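(* Let $\mathcal{G}$ be a triangular category over an algebraically closed field $\mathbf{k}$, with a fixed admissible order. Let $\lambda\in\Lambda$ be a weight. (a) $P_\lambda$ is semistandard; moreover, $[P_\lambda:\Delta_\lambda]=1$ and $[P_\lambda:\Delta_\mu]$ is non-zero only for $\mu\le\lambda$. (b) $P_\lambda$ is the projective cover of $\Delta_\lambda$ and of $L_\lambda$. (c) We have $\dim\mathrm{Hom}_{\mathcal{G}}(P_\lambda,M)=[M:L_\lambda]$ for any $\mathcal{G}$-module $M$. (d) The formal characters of the $P_\mu$'s, $\mu\in\Lambda$, are linearly independent. (e) We have $\widetilde{P}_\lambda\cong\bigoplus_{\mu\le\lambda}P_\mu^{\oplus a(\mu)}$, where $a(\mu)=m_\lambda(L_\mu)$ (in particular $a(\lambda)=1$). (f) Every $\mathcal{G}$-module is a quotient of a direct sum of $P_\mu$'s, and every finitely generated $\mathcal{G}$-module is a quotient of a finite direct sum of $P_\mu$'s. (g) Any finitely generated indecomposable projective $\mathcal{G}$-module is isomorphic to some $P_\mu$.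
   Context: Triangular categories. A subcategory is wide if it contains all objects. Write $|\mathcal{G}|$ for the set of isomorphism classes of objects of $\mathcal{G}$. Given a partial order $\le$ on $|\mathcal G|$, a wide subcategory is upwards (resp. downwards) if existence of a non-zero morphism $x\to y$ in it implies $x\le y$ (resp. $x\ge y$). A triangular category is a $\mathbf{k}$-linear category $\mathcal{G}$ together with a pair $(\mathcal{U},\mathcal{D})$ of wide subcategories such that: (T0) $\mathcal{G}$ is essentially small and all Hom spaces are finite dimensional; (T1) $\mathrm{End}_{\mathcal{U}}(x)=\mathrm{End}_{\mathcal{D}}(x)$ for all objects $x$, and this ring is semi-simple; (T2) there is a partial order $\le$ on $|\mathcal{G}|$ (called an admissible order) such that for every $x$ there are only finitely many $y\le x$, $\mathcal{U}$ is upwards, and $\mathcal{D}$ is downwards; (T3) for all $x,z\in\mathcal{G}$ the map $\bigoplus_{y\in|\mathcal{G}|}\mathrm{Hom}_{\mathcal{U}}(y,z)\otimes_{\mathrm{End}_{\mathcal{U}}(y)}\mathrm{Hom}_{\mathcal{D}}(x,y)\to\mathrm{Hom}_{\mathcal{G}}(x,z)$ induced by composition is an isomorphism. Put $\mathcal{M}=\mathcal{U}\cap\mathcal{D}$. Modules. For a $\mathbf{k}$-linear category $\mathcal{C}$, a $\mathcal{C}$-module is a $\mathbf{k}$-linear functor from $\mathcal{C}$ to $\mathbf{k}$-vector spaces. It is finitely generated if finitely many elements of various $M(x)$ are contained in no proper submodule, and pointwise finite if all $M(x)$ are finite dimensional. For a $\mathbf{k}$-linear functor $f$, $f^*$ denotes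 restriction of modules along $f$ and $f_!$ its left adjoint. Let $j\colon\mathcal{D}\to\mathcal{G}$ and $k\colon\mathcal{M}\to\mathcal{G}$ be the inclusions. Weights. $\Lambda$ is the set of isomorphism classes of simple $\mathcal{M}$-modules (weights). $S_\lambda$ is a representative of $\lambda$; it is non-zero on a unique class $\mathrm{supp}(\lambda)\in|\mathcal{G}|$. Put $\lambda<\mu$ if $\mathrm{supp}(\lambda)<\mathrm{supp}(\mu)$. $m_\lambda(M)\in\mathbf{N}\cup\{\infty\}$ is the multiplicity of $S_\lambda$ in the restriction of $M$ to $\mathcal{M}$. The formal character of a pointwise finite module $M$ is the formal sum $\Theta_M=\sum_\lambda m_\lambda(M)[\lambda]$ in the $\mathbf{Q}$-vector space of all formal sums $\sum_{\lambda\in\Lambda}a(\lambda)[\lambda]$, $a(\lambda)\in\mathbf{Q}$. $S_\lambda$ is regarded as a $\mathcal{D}$-module by letting all maps between non-isomorphic objects act by zero; the standard module is $\Delta_\lambda=j_!(S_\lambda)$, and $L_\lambda$ is its unique simple quotient. $[M:L_\lambda]\in\mathbf{N}\cup\{\infty\}$ is the supremum of the $n$ for which there is a chain of submodules $0\subseteq F_1\subsetneq G_1\subseteq\cdots\subseteq F_n\subsetneq G_n\subseteq M$ with all $G_i/F_i\cong L_\lambda$ (an infinite dimension is regarded as $\infty$ in (c)). Standard filtrations. A $\mathcal{G}$-module $M$ is semistandard if it has a finite filtration $0=F_0\subset\cdots\subset F_r=M$ with each $F_i/F_{i-1}$ ($1\le i\le r$) isomorphic to some $\Delta_{\mu(i)}$;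 the number of $i$ with $\mu(i)=\mu$ is independent of the filtration and is denoted $[M:\Delta_\mu]$. Projectives. $\widetilde{P}_\lambda=k_!(S_\lambda)$. It is a finitely generated projective semistandard module with $[\widetilde{P}_\lambda:\Delta_\lambda]=1$; it is a finite direct sum of indecomposable modules, unique up to isomorphism and permutation, each of which is semistandard. $P_\lambda$ is the unique (up to isomorphism) indecomposable summand of $\widetilde{P}_\lambda$ with $[P_\lambda:\Delta_\lambda]=1$.
   Formalization: It is additionally assumed that objects isomorphic in G are also isomorphic in M = U∩D; without this S_λ need not be a D-module under the stated rule, so Δ_λ would be undefined. The assumption is automatic when G is skeletal. *)

theory Defs
  imports
    "HOL-Computational_Algebra.Polynomial"
    "HOL-Library.Function_Algebras"
    "HOL-Library.Extended_Nat"
begin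

section \<open>Linear algebra\<close>

definition fin_dim :: "('k::field \<Rightarrow> 'v::ab_group_add \<Rightarrow> 'v) \<Rightarrow> 'v set \<Rightarrow> bool" where
  "fin_dim s V \<longleftrightarrow> (\<exists>B. finite B \<and> V \<subseteq> module.span s B)"

definition edim :: "('k::field \<Rightarrow> 'v::ab_group_add \<Rightarrow> 'v) \<Rightarrow> 'v set \<Rightarrow> enat" where
  "edim s V = (if fin_dim s V then enat (vector_space.dim s V) else \<infinity>)"

definition linear_map_on :: "('k::field \<Rightarrow> 'v::ab_group_add \<Rightarrow> 'v) \<Rightarrow> ('k \<Rightarrow> 'w::ab_group_add \<Rightarrow> 'w) \<Rightarrow>
    'v set \<Rightarrow> ('v \<Rightarrow> 'w) \<Rightarrow> bool" where
  "linear_map_on s t V f \<longleftrightarrow>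
     (\<forall>u\<in>V. \<forall>v\<in>V. f (u + v) = f u + f v) \<and> (\<forall>c. \<forall>v\<in>V. f (s c v) = t c (f v))"

definition fscale :: "'k::field \<Rightarrow> ('x \<Rightarrow> 'k) \<Rightarrow> 'x \<Rightarrow> 'k" where
  "fscale c f = (\<lambda>x. c * f x)"

text \<open>
  Balanced tensor products. Let \<open>A i\<close> and \<open>B i\<close> (\<open>i \<in> I\<close>) be vector spaces and let \<open>R\<close> be
  a set of pairs \<open>((i, a, b), (i', a', b'))\<close>. The term \<open>btensor sA sB I A B R\<close> is the quotient
  of the direct sum of the spaces \<open>A i \<otimes> B i\<close> (tensor products over the field) by the subspace
  spanned by the elements \<open>a \<otimes> b - a' \<otimes> b'\<close> for the pairs in \<open>R\<close>. In order to have it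
  as a subspace of a vector space type, we embed this quotient into its double dual: the dual is
  the space of families of bilinear forms on \<open>A i \<times> B i\<close> that respect \<open>R\<close>, and the class
  of \<open>a \<otimes> b\<close> is evaluation of such families at \<open>(a, b)\<close>. The universal property
  is lemma \<open>btensor_universal\<close> below.
\<close>

definition bilinear_family ::
  "('k::field \<Rightarrow> 'a::ab_group_add \<Rightarrow> 'a) \<Rightarrow> ('k \<Rightarrow> 'b::ab_group_add \<Rightarrow> 'b) \<Rightarrow>
   ('k \<Rightarrow> 'c::ab_group_add \<Rightarrow> 'c) \<Rightarrow> 'i set \<Rightarrow> ('i \<Rightarrow> 'a set) \<Rightarrow> ('i \<Rightarrow> 'b set) \<Rightarrow>
   (('i \<times> 'a \<times> 'b) \<times> ('i \<times> 'a \<times> 'b)) set \<Rightarrow> ('i \<Rightarrow> 'a \<Rightarrow> 'b \<Rightarrow> 'c) \<Rightarrow> bool" where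
  "bilinear_family sA sB sC I A B R \<beta> \<longleftrightarrow>
     (\<forall>i\<in>I. \<forall>b\<in>B i. linear_map_on sA sC (A i) (\<lambda>a. \<beta> i a b)) \<and>
     (\<forall>i\<in>I. \<forall>a\<in>A i. linear_map_on sB sC (B i) (\<beta> i a)) \<and>
     (\<forall>((i, a, b), (i', a', b')) \<in> R. \<beta> i a b = \<beta> i' a' b')"

definition pure_tensor ::
  "('k::field \<Rightarrow> 'a::ab_group_add \<Rightarrow> 'a) \<Rightarrow> ('k \<Rightarrow> 'b::ab_group_add \<Rightarrow> 'b) \<Rightarrow>
   'i set \<Rightarrow> ('i \<Rightarrow> 'a set) \<Rightarrow> ('i \<Rightarrow> 'b set) \<Rightarrow>
   (('i \<times> 'a \<times> 'b) \<times> ('i \<times> 'a \<times> 'b)) set \<Rightarrow> 'i \<Rightarrow> 'a \<Rightarrow> 'b \<Rightarrow> (('i \<Rightarrow> 'a \<Rightarrow> 'b \<Rightarrow> 'k) \<Rightarrow> 'k)" where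
  "pure_tensor sA sB I A B R i a b =
     (\<lambda>\<beta>. if bilinear_family sA sB (*) I A B R \<beta> then \<beta> i a b else 0)"

definition btensor ::
  "('k::field \<Rightarrow> 'a::ab_group_add \<Rightarrow> 'a) \<Rightarrow> ('k \<Rightarrow> 'b::ab_group_add \<Rightarrow> 'b) \<Rightarrow>
   'i set \<Rightarrow> ('i \<Rightarrow> 'a set) \<Rightarrow> ('i \<Rightarrow> 'b set) \<Rightarrow>
   (('i \<times> 'a \<times> 'b) \<times> ('i \<times> 'a \<times> 'b)) set \<Rightarrow> (('i \<Rightarrow> 'a \<Rightarrow> 'b \<Rightarrow> 'k) \<Rightarrow> 'k) set" where
  "btensor sA sB I A B R =
     module.span fscale {pure_tensor sA sB I A B R i a b | i a b. i \<in> I \<and> a \<in> A i \<and> b \<in> B i}"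

lemma vector_space_fscale: "vector_space fscale"
  by unfold_locales (auto simp: fscale_def fun_eq_iff algebra_simps)

lemma vector_space_mult: "vector_space ((*) :: 'k::field \<Rightarrow> 'k \<Rightarrow> 'k)"
  by unfold_locales (auto simp: algebra_simps)

lemma btensor_universal:
  fixes sC :: "'k::field \<Rightarrow> 'c::ab_group_add \<Rightarrow> 'c"
  assumes C: "vector_space sC" and h: "bilinear_family sA sB sC I A B R h"
  shows "\<exists>\<Phi>. linear_map_on fscale sC (btensor sA sB I A B R) \<Phi> \<and>
    (\<forall>i\<in>I. \<forall>a\<in>A i. \<forall>b\<in>B i. \<Phi> (pure_tensor sA sB I A B R i a b) = h i a b)"
proof -
  let ?b = "bilinear_family sA sB (*) I A B R"
  let ?l = "\<lambda>l. linear_map_on sC (*) UNIV l"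
  let ?P = "\<lambda>t w. \<forall>l. ?l l \<longrightarrow> t (\<lambda>i a b. l (h i a b)) = l w"
  interpret C: vector_space sC by (rule C)
  interpret F: vector_space "fscale :: 'k \<Rightarrow> (('i \<Rightarrow> 'a \<Rightarrow> 'b \<Rightarrow> 'k) \<Rightarrow> 'k) \<Rightarrow> _"
    by (rule vector_space_fscale)
  interpret CK: vector_space_pair sC "(*) :: 'k \<Rightarrow> 'k \<Rightarrow> 'k"
    by (intro vector_space_pair.intro C vector_space_mult)
  have sep: "v = w" if "\<And>l. ?l l \<Longrightarrow> l v = l w" for v w
  proof (rule ccontr)
    assume "v \<noteq> w"
    then have ind: "C.independent {v - w}" by simp
    obtain l where l: "Vector_Spaces.linear sC (*) l" "l (v - w) = (1::'k)"
      using CK.linear_independent_extend[OF ind, of "\<lambda>_. 1"] by auto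
    interpret l: Vector_Spaces.linear sC "(*)" l by (rule l(1))
    have "?l l" by (simp add: linear_map_on_def l.add l.scale)
    then have "l v = l w" by (rule that)
    with l(2) show False by (simp add: l.diff)
  qed
  have comp: "?b (\<lambda>i a b. l (h i a b))" if "?l l" for l
    using h that unfolding bilinear_family_def linear_map_on_def by (auto split: prod.splits)
  have pure: "?P (pure_tensor sA sB I A B R i a b) (h i a b)" for i a b
    by (auto simp: pure_tensor_def comp)
  have ex: "\<exists>w. ?P t w" if "t \<in> btensor sA sB I A B R" for t
    using that unfolding btensor_def
  proof (induction rule: F.span_induct_alt)
    case base
    have "l 0 = 0" if "?l l" for l
      using that C.scale_zero_left[of 0] unfolding linear_map_on_def
      by (metis UNIV_I mult_zero_left)
    then show ?case by (intro exI[of _ 0]) auto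
  next
    case (step c x y)
    obtain w where w: "?P y w" using step.IH by blast
    obtain i a b where x: "x = pure_tensor sA sB I A B R i a b" using step.hyps by blast
    have "?P (fscale c x + y) (sC c (h i a b) + w)"
      using w pure[of i a b] unfolding x by (auto simp: fscale_def linear_map_on_def)
    then show ?case by blast
  qed
  define \<Phi> where "\<Phi> t = (THE w. ?P t w)" for t
  have \<Phi>: "\<Phi> t = w" if "?P t w" for t w
    unfolding \<Phi>_def
  proof (rule the_equality)
    show "?P t w" by (rule that)
    show "v = w" if "?P t v" for v
      using that \<open>?P t w\<close> by (intro sep) metis
  qed
  have ex\<Phi>: "?P t (\<Phi> t)" if "t \<in> btensor sA sB I A B R" for t
    using ex[OF that] \<Phi> by metis
  have "linear_map_on fscale sC (btensor sA sB I A B R) \<Phi>"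
    unfolding linear_map_on_def
  proof (intro conjI ballI allI)
    fix u v assume "u \<in> btensor sA sB I A B R" "v \<in> btensor sA sB I A B R"
    then show "\<Phi> (u + v) = \<Phi> u + \<Phi> v"
      using ex\<Phi>[of u] ex\<Phi>[of v] by (intro \<Phi>) (auto simp: linear_map_on_def)
  next
    fix c v assume "v \<in> btensor sA sB I A B R"
    then show "\<Phi> (fscale c v) = sC c (\<Phi> v)"
      using ex\<Phi>[of v] by (intro \<Phi>) (auto simp: linear_map_on_def fscale_def)
  qed
  moreover have "\<Phi> (pure_tensor sA sB I A B R i a b) = h i a b" for i a b
    by (rule \<Phi>[OF pure])
  ultimately show ?thesis by blast
qed

section \<open>Linear categories and their modules\<close>

text \<open>
  The objects of a category are all elements of a type \<open>'o\<close>, so every category here is small.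
  The Hom spaces are subspaces of a single vector space type; they may overlap, which is why
  composition (\<open>cmp C x y z g f\<close> for \<open>f : x \<rightarrow> y\<close> and \<open>g : y \<rightarrow> z\<close>) refers to the objects.
\<close>

record ('o, 'm, 'k) lincat =
  cscale :: "'k \<Rightarrow> 'm \<Rightarrow> 'm"
  Hom :: "'o \<Rightarrow> 'o \<Rightarrow> 'm set"
  cmp :: "'o \<Rightarrow> 'o \<Rightarrow> 'o \<Rightarrow> 'm \<Rightarrow> 'm \<Rightarrow> 'm"
  ident :: "'o \<Rightarrow> 'm"

locale linear_category =
  fixes C :: "('o, 'm::ab_group_add, 'k::field) lincat"
  assumes vector_space: "vector_space (cscale C)"
    and subspace: "module.subspace (cscale C) (Hom C x y)"
    and comp_closed: "f \<in> Hom C x y \<Longrightarrow> g \<in> Hom C y z \<Longrightarrow> cmp C x y z g f \<in> Hom C x z"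
    and comp_linear_left: "f \<in> Hom C x y \<Longrightarrow>
      linear_map_on (cscale C) (cscale C) (Hom C y z) (\<lambda>g. cmp C x y z g f)"
    and comp_linear_right: "g \<in> Hom C y z \<Longrightarrow>
      linear_map_on (cscale C) (cscale C) (Hom C x y) (cmp C x y z g)"
    and comp_assoc: "f \<in> Hom C w x \<Longrightarrow> g \<in> Hom C x y \<Longrightarrow> h \<in> Hom C y z \<Longrightarrow>
      cmp C w x z (cmp C x y z h g) f = cmp C w y z h (cmp C w x y g f)"
    and ident_closed: "ident C x \<in> Hom C x x"
    and ident_left: "f \<in> Hom C x y \<Longrightarrow> cmp C x y y (ident C y) f = f"
    and ident_right: "f \<in> Hom C x y \<Longrightarrow> cmp C x x y f (ident C x) = f"

definition iso_obj :: "('o, 'm, 'k) lincat \<Rightarrow> 'o \<Rightarrow> 'o \<Rightarrow> bool" where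
  "iso_obj C x y \<longleftrightarrow> (\<exists>f \<in> Hom C x y. \<exists>g \<in> Hom C y x.
     cmp C x y x g f = ident C x \<and> cmp C y x y f g = ident C y)"

definition obj_class :: "('o, 'm, 'k) lincat \<Rightarrow> 'o \<Rightarrow> 'o set" where
  "obj_class C x = {y. iso_obj C x y}"

definition obj_classes :: "('o, 'm, 'k) lincat \<Rightarrow> 'o set set" where
  "obj_classes C = range (obj_class C)"

text \<open>Wide linear subcategories are given by their Hom spaces.\<close>

definition wide_subcategory ::
  "('o, 'm::ab_group_add, 'k::field) lincat \<Rightarrow> ('o \<Rightarrow> 'o \<Rightarrow> 'm set) \<Rightarrow> bool" where
  "wide_subcategory C H \<longleftrightarrow>
     (\<forall>x y. module.subspace (cscale C) (H x y) \<and> H x y \<subseteq> Hom C x y) \<and>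
     (\<forall>x. ident C x \<in> H x x) \<and>
     (\<forall>x y z. \<forall>f\<in>H x y. \<forall>g\<in>H y z. cmp C x y z g f \<in> H x z)"

definition subcat :: "('o, 'm, 'k) lincat \<Rightarrow> ('o \<Rightarrow> 'o \<Rightarrow> 'm set) \<Rightarrow> ('o, 'm, 'k) lincat" where
  "subcat C H = C\<lparr>Hom := H\<rparr>"

text \<open>
  A module \<open>M\<close> sends \<open>x\<close> to the subspace \<open>mob M x\<close> of a vector space type and
  \<open>f : x \<rightarrow> y\<close> to \<open>mact M x y f\<close>. Restriction of modules to a wide subcategory does not
  change the record, so \<open>M\<close> restricted to \<open>H\<close> is \<open>M\<close> viewed over \<open>subcat C H\<close>.
\<close>

record ('o, 'm, 'k, 'v) cmod =
  mscale :: "'k \<Rightarrow> 'v \<Rightarrow> 'v"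
  mob :: "'o \<Rightarrow> 'v set"
  mact :: "'o \<Rightarrow> 'o \<Rightarrow> 'm \<Rightarrow> 'v \<Rightarrow> 'v"

locale cat_module =
  fixes C :: "('o, 'm::ab_group_add, 'k::field) lincat"
    and M :: "('o, 'm, 'k, 'v::ab_group_add) cmod"
  assumes vector_space: "vector_space (mscale M)"
    and subspace: "module.subspace (mscale M) (mob M x)"
    and act_closed: "f \<in> Hom C x y \<Longrightarrow> v \<in> mob M x \<Longrightarrow> mact M x y f v \<in> mob M y"
    and act_linear: "f \<in> Hom C x y \<Longrightarrow>
      linear_map_on (mscale M) (mscale M) (mob M x) (mact M x y f)"
    and act_linear_left: "v \<in> mob M x \<Longrightarrow>
      linear_map_on (cscale C) (mscale M) (Hom C x y) (\<lambda>f. mact M x y f v)"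
    and act_ident: "v \<in> mob M x \<Longrightarrow> mact M x x (ident C x) v = v"
    and act_comp: "f \<in> Hom C x y \<Longrightarrow> g \<in> Hom C y z \<Longrightarrow> v \<in> mob M x \<Longrightarrow>
      mact M x z (cmp C x y z g f) v = mact M y z g (mact M x y f v)"

definition pointwise_finite :: "('o, 'm, 'k::field, 'v::ab_group_add) cmod \<Rightarrow> bool" where
  "pointwise_finite M \<longleftrightarrow> (\<forall>x. fin_dim (mscale M) (mob M x))"

definition submod ::
  "('o, 'm, 'k::field) lincat \<Rightarrow> ('o, 'm, 'k, 'v::ab_group_add) cmod \<Rightarrow> ('o \<Rightarrow> 'v set) \<Rightarrow> bool" where
  "submod C M N \<longleftrightarrow>
     (\<forall>x. module.subspace (mscale M) (N x) \<and> N x \<subseteq> mob M x) \<and>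
     (\<forall>x y. \<forall>f\<in>Hom C x y. \<forall>v\<in>N x. mact M x y f v \<in> N y)"

definition restr_mod :: "('o, 'm, 'k, 'v) cmod \<Rightarrow> ('o \<Rightarrow> 'v set) \<Rightarrow> ('o, 'm, 'k, 'v) cmod" where
  "restr_mod M N = M\<lparr>mob := N\<rparr>"

definition zero_sub :: "'o \<Rightarrow> 'v::zero set" where
  "zero_sub x = {0}"

definition fin_gen ::
  "('o, 'm, 'k::field) lincat \<Rightarrow> ('o, 'm, 'k, 'v::ab_group_add) cmod \<Rightarrow> bool" where
  "fin_gen C M \<longleftrightarrow> (\<exists>X. finite X \<and> (\<forall>(x, v)\<in>X. v \<in> mob M x) \<and>
     (\<forall>N. submod C M N \<and> (\<forall>(x, v)\<in>X. v \<in> N x) \<longrightarrow> N = mob M))"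

definition mod_hom ::
  "('o, 'm, 'k::field) lincat \<Rightarrow> ('o, 'm, 'k, 'v::ab_group_add) cmod \<Rightarrow>
   ('o, 'm, 'k, 'w::ab_group_add) cmod \<Rightarrow> ('o \<Rightarrow> 'v \<Rightarrow> 'w) \<Rightarrow> bool" where
  "mod_hom C M N \<phi> \<longleftrightarrow>
     (\<forall>x. \<phi> x ` mob M x \<subseteq> mob N x \<and> linear_map_on (mscale M) (mscale N) (mob M x) (\<phi> x)) \<and>
     (\<forall>x y. \<forall>f\<in>Hom C x y. \<forall>v\<in>mob M x. \<phi> y (mact M x y f v) = mact N x y f (\<phi> x v))"

text \<open>Homomorphisms are normalised to be zero outside the source, so they form a vector space.\<close>

definition hom_space ::
  "('o, 'm, 'k::field) lincat \<Rightarrow> ('o, 'm, 'k, 'v::ab_group_add) cmod \<Rightarrow>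
   ('o, 'm, 'k, 'w::ab_group_add) cmod \<Rightarrow> ('o \<Rightarrow> 'v \<Rightarrow> 'w) set" where
  "hom_space C M N = {\<phi>. mod_hom C M N \<phi> \<and> (\<forall>x v. v \<notin> mob M x \<longrightarrow> \<phi> x v = 0)}"

definition hom_dim ::
  "('o, 'm, 'k::field) lincat \<Rightarrow> ('o, 'm, 'k, 'v::ab_group_add) cmod \<Rightarrow>
   ('o, 'm, 'k, 'w::ab_group_add) cmod \<Rightarrow> enat" where
  "hom_dim C M N = edim (\<lambda>c \<phi> x v. mscale N c (\<phi> x v)) (hom_space C M N)"

definition isomorphic ::
  "('o, 'm, 'k::field) lincat \<Rightarrow> ('o, 'm, 'k, 'v::ab_group_add) cmod \<Rightarrow>
   ('o, 'm, 'k, 'w::ab_group_add) cmod \<Rightarrow> bool" where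
  "isomorphic C M N \<longleftrightarrow>
     (\<exists>\<phi>. mod_hom C M N \<phi> \<and> (\<forall>x. bij_betw (\<phi> x) (mob M x) (mob N x)))"

definition surj_hom ::
  "('o, 'm, 'k::field) lincat \<Rightarrow> ('o, 'm, 'k, 'v::ab_group_add) cmod \<Rightarrow>
   ('o, 'm, 'k, 'w::ab_group_add) cmod \<Rightarrow> ('o \<Rightarrow> 'v \<Rightarrow> 'w) \<Rightarrow> bool" where
  "surj_hom C M N \<phi> \<longleftrightarrow> mod_hom C M N \<phi> \<and> (\<forall>x. \<phi> x ` mob M x = mob N x)"

text \<open>\<open>is_quotient_of C M Q\<close>: \<open>Q\<close> is isomorphic to a quotient of \<open>M\<close>.\<close>

definition is_quotient_of ::
  "('o, 'm, 'k::field) lincat \<Rightarrow> ('o, 'm, 'k, 'v::ab_group_add) cmod \<Rightarrow>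
   ('o, 'm, 'k, 'w::ab_group_add) cmod \<Rightarrow> bool" where
  "is_quotient_of C M Q \<longleftrightarrow> (\<exists>\<pi>. surj_hom C M Q \<pi>)"

text \<open>
  \<open>subquot_iso C M F G Q\<close>: the subquotient \<open>G / F\<close> of \<open>M\<close> is isomorphic to \<open>Q\<close>, i.e.
  \<open>Q\<close> is the target of a surjection from \<open>G\<close> with kernel \<open>F\<close>.
\<close>

definition subquot_iso ::
  "('o, 'm, 'k::field) lincat \<Rightarrow> ('o, 'm, 'k, 'v::ab_group_add) cmod \<Rightarrow>
   ('o \<Rightarrow> 'v set) \<Rightarrow> ('o \<Rightarrow> 'v set) \<Rightarrow> ('o, 'm, 'k, 'w::ab_group_add) cmod \<Rightarrow> bool" where
  "subquot_iso C M F G Q \<longleftrightarrow>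
     (\<exists>\<pi>. surj_hom C (restr_mod M G) Q \<pi> \<and> (\<forall>x. F x = {v \<in> G x. \<pi> x v = 0}))"

definition simple_mod ::
  "('o, 'm::ab_group_add, 'k::field) lincat \<Rightarrow> ('o, 'm, 'k, 'v::ab_group_add) cmod \<Rightarrow> bool" where
  "simple_mod C M \<longleftrightarrow> cat_module C M \<and> mob M \<noteq> zero_sub \<and>
     (\<forall>N. submod C M N \<longrightarrow> N = zero_sub \<or> N = mob M)"

definition internal_sum ::
  "('o, 'm, 'k::field) lincat \<Rightarrow> ('o, 'm, 'k, 'v::ab_group_add) cmod \<Rightarrow>
   ('o \<Rightarrow> 'v set) \<Rightarrow> ('o \<Rightarrow> 'v set) \<Rightarrow> bool" where
  "internal_sum C M A B \<longleftrightarrow> submod C M A \<and> submod C M B \<and>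
     (\<forall>x. A x \<inter> B x = {0} \<and> {a + b | a b. a \<in> A x \<and> b \<in> B x} = mob M x)"

definition indecomposable ::
  "('o, 'm::ab_group_add, 'k::field) lincat \<Rightarrow> ('o, 'm, 'k, 'v::ab_group_add) cmod \<Rightarrow> bool" where
  "indecomposable C M \<longleftrightarrow> cat_module C M \<and> mob M \<noteq> zero_sub \<and>
     (\<forall>A B. internal_sum C M A B \<longrightarrow> A = zero_sub \<or> B = zero_sub)"

definition summand_of ::
  "('o, 'm, 'k::field) lincat \<Rightarrow> ('o, 'm, 'k, 'v::ab_group_add) cmod \<Rightarrow>
   ('o, 'm, 'k, 'w::ab_group_add) cmod \<Rightarrow> bool" where
  "summand_of C P M \<longleftrightarrow> (\<exists>A B. internal_sum C M A B \<and> isomorphic C P (restr_mod M A))"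

text \<open>
  In a direct sum over \<open>I\<close> the coordinates outside \<open>I\<close> are zero; the scalar multiplication on
  these coordinates is only a device to make the ambient type a vector space.
\<close>

definition dir_sum ::
  "'i set \<Rightarrow> ('i \<Rightarrow> ('o, 'm, 'k::field, 'v::ab_group_add) cmod) \<Rightarrow> ('o, 'm, 'k, 'i \<Rightarrow> 'v) cmod" where
  "dir_sum I N = \<lparr>
     mscale = (\<lambda>c h i. if i \<in> I then mscale (N i) c (h i) else (SOME s. vector_space s) c (h i)),
     mob = (\<lambda>x. {h. (\<forall>i\<in>I. h i \<in> mob (N i) x) \<and> (\<forall>i. i \<notin> I \<longrightarrow> h i = 0) \<and> finite {i. h i \<noteq> 0}}),
     mact = (\<lambda>x y f h i. if i \<in> I then mact (N i) x y f (h i) else 0)\<rparr>"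

text \<open>
  The lifting property is required for modules over the type \<open>'o \<times> 'v \<Rightarrow> 'm\<close> only. This type
  is large enough: it carries the free module on the elements of \<open>M\<close>, i.e. the direct sum over
  the pairs \<open>(x, v)\<close> with \<open>v \<in> mob M x\<close> of the representable modules \<open>Hom C x\<close>, and hence also
  an isomorphic copy of its quotient \<open>M\<close>. So \<open>M\<close> is a direct summand of this free module and the
  lifting property holds for modules over all types.
\<close>

definition projective ::
  "('o, 'm::ab_group_add, 'k::field) lincat \<Rightarrow> ('o, 'm, 'k, 'v::ab_group_add) cmod \<Rightarrow> bool" where
  "projective C M \<longleftrightarrow> cat_module C M \<and>
     (\<forall>(A :: ('o, 'm, 'k, 'o \<times> 'v \<Rightarrow> 'm) cmod) (B :: ('o, 'm, 'k, 'o \<times> 'v \<Rightarrow> 'm) cmod) \<pi> \<phi>.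
        cat_module C A \<and> cat_module C B \<and> surj_hom C A B \<pi> \<and> mod_hom C M B \<phi> \<longrightarrow>
        (\<exists>\<psi>. mod_hom C M A \<psi> \<and> (\<forall>x. \<forall>v\<in>mob M x. \<pi> x (\<psi> x v) = \<phi> x v)))"

definition projective_cover ::
  "('o, 'm::ab_group_add, 'k::field) lincat \<Rightarrow> ('o, 'm, 'k, 'v::ab_group_add) cmod \<Rightarrow>
   ('o, 'm, 'k, 'w::ab_group_add) cmod \<Rightarrow> bool" where
  "projective_cover C P M \<longleftrightarrow> projective C P \<and>
     (\<exists>\<pi>. surj_hom C P M \<pi> \<and>
        (\<forall>N. submod C P N \<and> (\<forall>x. \<pi> x ` N x = mob M x) \<longrightarrow> N = mob P))"

text \<open>The multiplicity \<open>[M : L]\<close> of a simple module \<open>L\<close> in a module \<open>M\<close>.\<close>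

definition multiplicity_mod ::
  "('o, 'm, 'k::field) lincat \<Rightarrow> ('o, 'm, 'k, 'v::ab_group_add) cmod \<Rightarrow>
   ('o, 'm, 'k, 'w::ab_group_add) cmod \<Rightarrow> enat" where
  "multiplicity_mod C M L = Sup {enat n | n. \<exists>F G.
     (\<forall>i<n. submod C M (F i) \<and> submod C M (G i) \<and> F i < G i \<and> subquot_iso C M (F i) (G i) L) \<and>
     (\<forall>i. Suc i < n \<longrightarrow> G i \<le> F (Suc i))}"

text \<open>
  The left adjoint of restriction along the inclusion of a wide subcategory \<open>H\<close>, computed as the
  coend \<open>z \<mapsto> \<Oplus>\<^sub>y Hom C y z \<otimes> S y\<close> modulo \<open>(g \<circ> c) \<otimes> s = g \<otimes> c s\<close> for \<open>c\<close> in \<open>H\<close>. The action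
  of \<open>h : z \<rightarrow> z'\<close> is \<open>g \<otimes> s \<mapsto> (h \<circ> g) \<otimes> s\<close>.
\<close>

definition ind_rel ::
  "('o, 'm, 'k) lincat \<Rightarrow> ('o \<Rightarrow> 'o \<Rightarrow> 'm set) \<Rightarrow> ('o, 'm, 'k, 'v) cmod \<Rightarrow> 'o \<Rightarrow>
   (('o \<times> 'm \<times> 'v) \<times> ('o \<times> 'm \<times> 'v)) set" where
  "ind_rel C H S z = {((y, cmp C y y' z g c, s), (y', g, mact S y y' c s)) | y y' g c s.
     c \<in> H y y' \<and> g \<in> Hom C y' z \<and> s \<in> mob S y}"

definition ind_tensor ::
  "('o, 'm::ab_group_add, 'k::field) lincat \<Rightarrow> ('o \<Rightarrow> 'o \<Rightarrow> 'm set) \<Rightarrow>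
   ('o, 'm, 'k, 'v::ab_group_add) cmod \<Rightarrow> 'o \<Rightarrow> 'o \<Rightarrow> 'm \<Rightarrow> 'v \<Rightarrow> (('o \<Rightarrow> 'm \<Rightarrow> 'v \<Rightarrow> 'k) \<Rightarrow> 'k)" where
  "ind_tensor C H S z =
     pure_tensor (cscale C) (mscale S) UNIV (\<lambda>y. Hom C y z) (mob S) (ind_rel C H S z)"

definition induced ::
  "('o, 'm::ab_group_add, 'k::field) lincat \<Rightarrow> ('o \<Rightarrow> 'o \<Rightarrow> 'm set) \<Rightarrow>
   ('o, 'm, 'k, 'v::ab_group_add) cmod \<Rightarrow>
   ('o, 'm, 'k, ('o \<Rightarrow> 'm \<Rightarrow> 'v \<Rightarrow> 'k) \<Rightarrow> 'k) cmod" where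
  "induced C H S = \<lparr>
     mscale = fscale,
     mob = (\<lambda>z. btensor (cscale C) (mscale S) UNIV (\<lambda>y. Hom C y z) (mob S) (ind_rel C H S z)),
     mact = (\<lambda>z z' h t \<beta>.
       if bilinear_family (cscale C) (mscale S) (*) UNIV (\<lambda>y. Hom C y z') (mob S) (ind_rel C H S z') \<beta>
       then t (\<lambda>y g s. \<beta> y (cmp C y z z' h g) s) else 0)\<rparr>"

lemma ind_bilinear_push:
  assumes C: "linear_category C" and H: "wide_subcategory C H" and h: "h \<in> Hom C z z'"
    and b: "bilinear_family (cscale C) (mscale S) sC UNIV (\<lambda>y. Hom C y z') (mob S) (ind_rel C H S z') \<beta>"
  shows "bilinear_family (cscale C) (mscale S) sC UNIV (\<lambda>y. Hom C y z) (mob S) (ind_rel C H S z)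
    (\<lambda>y g s. \<beta> y (cmp C y z z' h g) s)"
proof -
  interpret linear_category C by (rule C)
  have HH: "c \<in> H y y' \<Longrightarrow> c \<in> Hom C y y'" for c y y'
    using H by (auto simp: wide_subcategory_def)
  have rel: "\<beta> y (cmp C y y' z' g c) s = \<beta> y' g (mact S y y' c s)"
    if "c \<in> H y y'" "g \<in> Hom C y' z'" "s \<in> mob S y" for y y' g c s
    using b that unfolding bilinear_family_def ind_rel_def by fast
  have 1: "linear_map_on (cscale C) sC (Hom C y z) (\<lambda>g. \<beta> y (cmp C y z z' h g) s)"
    if "s \<in> mob S y" for y s
    using b that comp_linear_right[OF h, of y] comp_closed[OF _ h, of _ y]
    unfolding bilinear_family_def linear_map_on_def by simp
  have 2: "linear_map_on (mscale S) sC (mob S y) (\<beta> y (cmp C y z z' h g))"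
    if "g \<in> Hom C y z" for y g
    using b comp_closed[OF that h] unfolding bilinear_family_def by blast
  have 3: "\<beta> y (cmp C y z z' h (cmp C y y' z g c)) s = \<beta> y' (cmp C y' z z' h g) (mact S y y' c s)"
    if "c \<in> H y y'" "g \<in> Hom C y' z" "s \<in> mob S y" for y y' g c s
    using rel[OF that(1) comp_closed[OF that(2) h] that(3)] comp_assoc[OF HH[OF that(1)] that(2) h]
    by simp
  show ?thesis
    unfolding bilinear_family_def using 1 2 3 by (auto simp: ind_rel_def)
qed

text \<open>
  \<open>induced\<close> is left adjoint to restriction: the next lemmas give the unit and its universal property.
\<close>

lemma cat_module_induced:
  fixes C :: "('o, 'm::ab_group_add, 'k::field) lincat"
    and S :: "('o, 'm, 'k, 'v::ab_group_add) cmod"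
  assumes C: "linear_category C" and H: "wide_subcategory C H"
  shows "cat_module C (induced C H S)"
    and "h \<in> Hom C z z' \<Longrightarrow> g \<in> Hom C y z \<Longrightarrow> s \<in> mob S y \<Longrightarrow>
      mact (induced C H S) z z' h (ind_tensor C H S z y g s) =
      ind_tensor C H S z' y (cmp C y z z' h g) s"
proof -
  interpret linear_category C by (rule C)
  interpret CV: vector_space "cscale C" by (rule vector_space)
  interpret F: vector_space "fscale :: 'k \<Rightarrow> (('o \<Rightarrow> 'm \<Rightarrow> 'v \<Rightarrow> 'k) \<Rightarrow> 'k) \<Rightarrow> _"
    by (rule vector_space_fscale)
  let ?A = "mact (induced C H S)"
  let ?p = "ind_tensor C H S"
  let ?T = "mob (induced C H S)"
  have T: "?T z = F.span {?p z y g s | y g s. g \<in> Hom C y z \<and> s \<in> mob S y}" for z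
    by (simp add: induced_def btensor_def ind_tensor_def)
  have add: "?A z z' h (t + u) = ?A z z' h t + ?A z z' h u" for z z' h t u
    by (auto simp: induced_def fun_eq_iff)
  have scale: "?A z z' h (fscale c t) = fscale c (?A z z' h t)" for z z' h t c
    by (auto simp: induced_def fscale_def fun_eq_iff)
  have zero: "?A z z' h 0 = 0" for z z' h
    by (auto simp: induced_def fun_eq_iff)
  have pure: "?A z z' h (?p z y g s) = ?p z' y (cmp C y z z' h g) s"
    if "h \<in> Hom C z z'" for z z' h y g s
    using ind_bilinear_push[OF C H that, where S = S]
    by (auto simp: induced_def ind_tensor_def pure_tensor_def fun_eq_iff)
  then show "h \<in> Hom C z z' \<Longrightarrow> g \<in> Hom C y z \<Longrightarrow> s \<in> mob S y \<Longrightarrow>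
      ?A z z' h (?p z y g s) = ?p z' y (cmp C y z z' h g) s" by blast
  have pT: "?p z y g s \<in> ?T z" if "g \<in> Hom C y z" "s \<in> mob S y" for z y g s
    unfolding T by (rule F.span_base) (use that in blast)
  have p_left: "?p z y (g + g') s = ?p z y g s + ?p z y g' s"
    if "g \<in> Hom C y z" "g' \<in> Hom C y z" "s \<in> mob S y" for z y g g' s
    using that
    by (auto simp: ind_tensor_def pure_tensor_def fun_eq_iff bilinear_family_def linear_map_on_def)
  have p_left2: "?p z y (cscale C c g) s = fscale c (?p z y g s)"
    if "g \<in> Hom C y z" "s \<in> mob S y" for z y g s c
    using that
    by (auto simp: ind_tensor_def pure_tensor_def fun_eq_iff fscale_def bilinear_family_def linear_map_on_def)
  have sub: "F.subspace (?T z)" for z unfolding T by (rule F.subspace_span)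
  show "cat_module C (induced C H S)"
  proof (unfold_locales, goal_cases)
    case (5 x)
    then show ?case using sub by (simp add: induced_def)
  next
    case (6 f x y v)
    from 6(2) show ?case unfolding T[of x]
    proof (induction rule: F.span_induct_alt)
      case base show ?case using sub[of y] unfolding zero F.subspace_def by blast
    next
      case (step c t u)
      then obtain w g s where "t = ?p x w g s" "g \<in> Hom C w x" "s \<in> mob S w" by blast
      then have "?A x y f t \<in> ?T y" using pure[OF 6(1)] pT comp_closed 6(1) by simp
      then show ?case using step.IH sub[of y] unfolding add scale F.subspace_def by blast
    qed
  next
    case (7 f x y)
    then show ?case using add scale by (auto simp: linear_map_on_def induced_def)
  next
    case (8 v x y)
    have *: "?A x y (f + f') v = ?A x y f v + ?A x y f' v \<and> ?A x y (cscale C c f) v = fscale c (?A x y f v)"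
      if f: "f \<in> Hom C x y" "f' \<in> Hom C x y" for f f' c
    proof -
      have ff: "f + f' \<in> Hom C x y" "cscale C c f \<in> Hom C x y"
        using f subspace[of x y] by (auto simp: CV.subspace_def)
      from 8 show ?thesis unfolding T[of x]
      proof (induction rule: F.span_induct_alt)
        case base show ?case unfolding zero F.scale_zero_right by simp
      next
        case (step d t u)
        then obtain w g s where t: "t = ?p x w g s" "g \<in> Hom C w x" "s \<in> mob S w" by blast
        have "cmp C w x y (f + f') g = cmp C w x y f g + cmp C w x y f' g"
          "cmp C w x y (cscale C c f) g = cscale C c (cmp C w x y f g)"
          using comp_linear_left[OF t(2), of y] f by (auto simp: linear_map_on_def)
        then show ?case using step.IH t f ff
          by (simp only: add scale, simp add: pure p_left p_left2 comp_closed fscale_def algebra_simps)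
      qed
    qed
    show ?case using * by (auto simp: linear_map_on_def induced_def)
  next
    case (9 v x)
    then show ?case unfolding T[of x]
    proof (induction rule: F.span_induct_alt)
      case base show ?case unfolding zero by simp
    next
      case (step d t u)
      then obtain w g s where t: "t = ?p x w g s" "g \<in> Hom C w x" "s \<in> mob S w" by blast
      then show ?case using step.IH by (simp only: add scale, simp add: pure ident_closed ident_left)
    qed
  next
    case (10 f x y g z v)
    from 10(3) show ?case unfolding T[of x]
    proof (induction rule: F.span_induct_alt)
      case base show ?case unfolding zero by simp
    next
      case (step d t u)
      then obtain w h s where t: "t = ?p x w h s" "h \<in> Hom C w x" "s \<in> mob S w" by blast
      then show ?case using step.IH 10(1,2)
        by (simp only: add scale, simp add: pure comp_closed comp_assoc)
    qed
  qed (auto simp: induced_def F.vector_space_assms)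
qed

lemma induced_unit:
  fixes C :: "('o, 'm::ab_group_add, 'k::field) lincat"
    and S :: "('o, 'm, 'k, 'v::ab_group_add) cmod"
  assumes C: "linear_category C" and H: "wide_subcategory C H"
  shows "mod_hom (subcat C H) S (induced C H S) (\<lambda>y. ind_tensor C H S y y (ident C y))"
proof -
  interpret linear_category C by (rule C)
  interpret F: vector_space "fscale :: 'k \<Rightarrow> (('o \<Rightarrow> 'm \<Rightarrow> 'v \<Rightarrow> 'k) \<Rightarrow> 'k) \<Rightarrow> _"
    by (rule vector_space_fscale)
  have HH: "c \<in> H y y' \<Longrightarrow> c \<in> Hom C y y'" for c y y'
    using H by (auto simp: wide_subcategory_def)
  have 1: "ind_tensor C H S x x (ident C x) v \<in> mob (induced C H S) x" if "v \<in> mob S x" for x v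
    unfolding induced_def btensor_def ind_tensor_def
    by simp (rule F.span_base, use that ident_closed in blast)
  have 2: "linear_map_on (mscale S) (mscale (induced C H S)) (mob S x) (ind_tensor C H S x x (ident C x))" for x
    using ident_closed[of x]
    by (auto simp: ind_tensor_def pure_tensor_def induced_def fun_eq_iff fscale_def bilinear_family_def linear_map_on_def)
  have 3: "ind_tensor C H S y y (ident C y) (mact S x y f v) =
      mact (induced C H S) x y f (ind_tensor C H S x x (ident C x) v)"
    if f: "f \<in> H x y" and v: "v \<in> mob S x" for x y f v
  proof -
    have r: "((x, cmp C x y y (ident C y) f, v), (y, ident C y, mact S x y f v)) \<in> ind_rel C H S y"
      using that ident_closed by (auto simp: ind_rel_def)
    have "ind_tensor C H S y y (ident C y) (mact S x y f v) = ind_tensor C H S y x (cmp C x y y (ident C y) f) v"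
      using r by (force simp: ind_tensor_def pure_tensor_def fun_eq_iff bilinear_family_def)
    also have "\<dots> = ind_tensor C H S y x (cmp C x x y f (ident C x)) v"
      using HH[OF f] by (simp add: ident_left ident_right)
    also have "\<dots> = mact (induced C H S) x y f (ind_tensor C H S x x (ident C x) v)"
      using cat_module_induced(2)[OF C H HH[OF f] ident_closed v] by simp
    finally show ?thesis .
  qed
  show ?thesis unfolding mod_hom_def subcat_def using 1 2 3 by auto
qed

lemma induced_adjoint:
  fixes C :: "('o, 'm::ab_group_add, 'k::field) lincat"
    and S :: "('o, 'm, 'k, 'v::ab_group_add) cmod"
    and N :: "('o, 'm, 'k, 'w::ab_group_add) cmod"
  assumes C: "linear_category C" and H: "wide_subcategory C H"
    and S: "cat_module (subcat C H) S" and N: "cat_module C N"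
    and \<phi>: "mod_hom (subcat C H) S N \<phi>"
  shows "\<exists>!\<psi>. \<psi> \<in> hom_space C (induced C H S) N \<and>
    (\<forall>y. \<forall>s\<in>mob S y. \<psi> y (ind_tensor C H S y y (ident C y) s) = \<phi> y s)"
proof -
  interpret linear_category C by (rule C)
  interpret N: cat_module C N by (rule N)
  interpret NV: vector_space "mscale N" by (rule N.vector_space)
  interpret I: cat_module C "induced C H S" by (rule cat_module_induced(1)[OF C H])
  interpret F: vector_space "fscale :: 'k \<Rightarrow> (('o \<Rightarrow> 'm \<Rightarrow> 'v \<Rightarrow> 'k) \<Rightarrow> 'k) \<Rightarrow> _"
    by (rule vector_space_fscale)
  let ?p = "ind_tensor C H S"
  let ?T = "mob (induced C H S)"
  have HH: "c \<in> H y y' \<Longrightarrow> c \<in> Hom C y y'" for c y y'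
    using H by (auto simp: wide_subcategory_def)
  have T: "?T z = F.span {?p z y g s | y g s. g \<in> Hom C y z \<and> s \<in> mob S y}" for z
    by (simp add: induced_def btensor_def ind_tensor_def)
  have sc: "mscale (induced C H S) = fscale" by (simp add: induced_def)
  have pT: "?p z y g s \<in> ?T z" if "g \<in> Hom C y z" "s \<in> mob S y" for z y g s
    unfolding T by (rule F.span_base) (use that in blast)
  have \<phi>N: "\<phi> y s \<in> mob N y" if "s \<in> mob S y" for y s
    using \<phi> that by (auto simp: mod_hom_def)
  have bil: "bilinear_family (cscale C) (mscale S) (mscale N) UNIV (\<lambda>y. Hom C y z) (mob S)
      (ind_rel C H S z) (\<lambda>y g s. mact N y z g (\<phi> y s))" for z
  proof -
    have 1: "linear_map_on (cscale C) (mscale N) (Hom C y z) (\<lambda>g. mact N y z g (\<phi> y s))"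
      if "s \<in> mob S y" for y s
      by (rule N.act_linear_left[OF \<phi>N[OF that]])
    have 2: "linear_map_on (mscale S) (mscale N) (mob S y) (\<lambda>s. mact N y z g (\<phi> y s))"
      if "g \<in> Hom C y z" for y g
      using N.act_linear[OF that] \<phi> \<phi>N unfolding linear_map_on_def mod_hom_def by simp
    have 3: "mact N y z (cmp C y y' z g c) (\<phi> y s) = mact N y' z g (\<phi> y' (mact S y y' c s))"
      if "c \<in> H y y'" "g \<in> Hom C y' z" "s \<in> mob S y" for y y' g c s
    proof -
      have "\<phi> y' (mact S y y' c s) = mact N y y' c (\<phi> y s)"
        using \<phi> that by (simp add: mod_hom_def subcat_def)
      then show ?thesis using N.act_comp[OF HH[OF that(1)] that(2) \<phi>N[OF that(3)]] by simp
    qed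
    show ?thesis unfolding bilinear_family_def using 1 2 3 by (auto simp: ind_rel_def)
  qed
  have "\<exists>\<Phi>. linear_map_on fscale (mscale N) (?T z) \<Phi> \<and>
      (\<forall>y. \<forall>g\<in>Hom C y z. \<forall>s\<in>mob S y. \<Phi> (?p z y g s) = mact N y z g (\<phi> y s))" for z
    using btensor_universal[OF N.vector_space bil[of z]]
    by (simp add: induced_def ind_tensor_def)
  then obtain \<Phi> where \<Phi>: "linear_map_on fscale (mscale N) (?T z) (\<Phi> z)"
    and \<Phi>p: "g \<in> Hom C y z \<Longrightarrow> s \<in> mob S y \<Longrightarrow> \<Phi> z (?p z y g s) = mact N y z g (\<phi> y s)" for z y g s
    by metis
  define \<psi> where "\<psi> z t = (if t \<in> ?T z then \<Phi> z t else 0)" for z t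
  have subT: "F.subspace (?T z)" for z unfolding T by (rule F.subspace_span)
  have Tcl: "fscale c t + u \<in> ?T z" "fscale c t \<in> ?T z" "0 \<in> ?T z" if "t \<in> ?T z" "u \<in> ?T z" for c t u z
    using subT[of z] that by (auto simp: F.subspace_def)
  have lstep: "f (fscale c t + u) = mscale N c (f t) + f u"
    if "linear_map_on fscale (mscale N) (?T z) f" "t \<in> ?T z" "u \<in> ?T z" for f z c t u
    using that Tcl unfolding linear_map_on_def by metis
  have z0: "f 0 = 0" if "linear_map_on fscale (mscale N) (?T z) f" for f z
  proof -
    have "0 \<in> ?T z" using subT[of z] by (simp add: F.subspace_def)
    then have "f (fscale 0 0) = mscale N 0 (f 0)" using that unfolding linear_map_on_def by blast
    then show ?thesis by simp
  qed
  have \<psi>lin: "linear_map_on fscale (mscale N) (?T z) (\<psi> z)" for z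
    using \<Phi>[of z] subT[of z] unfolding linear_map_on_def \<psi>_def F.subspace_def by simp
  have eq: "\<forall>t\<in>?T z. f t = f' t"
    if f: "linear_map_on fscale (mscale N) (?T z) f" "linear_map_on fscale (mscale N) (?T z) f'"
      and p: "\<And>y g s. g \<in> Hom C y z \<Longrightarrow> s \<in> mob S y \<Longrightarrow> f (?p z y g s) = f' (?p z y g s)"
    for z f f'
  proof
    fix t assume "t \<in> ?T z"
    then have "t \<in> ?T z \<and> f t = f' t" unfolding T[of z]
    proof (induction rule: F.span_induct_alt)
      case base show ?case by (intro conjI F.span_zero) (simp only: z0[OF f(1)] z0[OF f(2)])
    next
      case (step c t u)
      then obtain y g s where t: "t = ?p z y g s" "g \<in> Hom C y z" "s \<in> mob S y" by blast
      have tu: "t \<in> ?T z" "u \<in> ?T z"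
        using pT[OF t(2,3)] step.IH unfolding t(1) T[of z] by blast+
      have "f (fscale c t + u) = f' (fscale c t + u)"
        using p[OF t(2,3)] step.IH by (simp only: lstep[OF f(1) tu] lstep[OF f(2) tu]) (simp add: t(1))
      then show ?case using Tcl(1)[OF tu] unfolding T[of z] by blast
    qed
    then show "f t = f' t" by blast
  qed
  have \<psi>N: "\<psi> z t \<in> mob N z" if "t \<in> ?T z" for z t
  proof -
    have "t \<in> ?T z \<and> \<psi> z t \<in> mob N z" using that unfolding T[of z]
    proof (induction rule: F.span_induct_alt)
      case base show ?case using N.subspace[of z]
        by (intro conjI F.span_zero) (simp only: z0[OF \<psi>lin[of z]] NV.subspace_def)
    next
      case (step c t u)
      then obtain y g s where t: "t = ?p z y g s" "g \<in> Hom C y z" "s \<in> mob S y" by blast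
      have tu: "t \<in> ?T z" "u \<in> ?T z"
        using pT[OF t(2,3)] step.IH unfolding t(1) T[of z] by blast+
      have "\<psi> z t \<in> mob N z" using t tu(1) \<Phi>p N.act_closed \<phi>N by (simp add: \<psi>_def)
      then have "\<psi> z (fscale c t + u) \<in> mob N z"
        using lstep[OF \<psi>lin tu] step.IH N.subspace[of z] by (simp add: NV.subspace_def)
      then show ?case using Tcl(1)[OF tu] unfolding T[of z] by blast
    qed
    then show ?thesis by blast
  qed
  have nat: "\<psi> z' (mact (induced C H S) z z' h t) = mact N z z' h (\<psi> z t)"
    if h: "h \<in> Hom C z z'" and t: "t \<in> ?T z" for z z' h t
  proof -
    have "\<forall>t\<in>?T z. \<psi> z' (mact (induced C H S) z z' h t) = mact N z z' h (\<psi> z t)"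
    proof (rule eq)
      show "linear_map_on fscale (mscale N) (?T z) (\<lambda>t. \<psi> z' (mact (induced C H S) z z' h t))"
        using \<psi>lin[of z'] I.act_linear[OF h] I.act_closed[OF h] unfolding linear_map_on_def sc by simp
      show "linear_map_on fscale (mscale N) (?T z) (\<lambda>t. mact N z z' h (\<psi> z t))"
        using \<psi>lin[of z] N.act_linear[OF h] \<psi>N[of _ z] unfolding linear_map_on_def by simp
      fix y g s assume gs: "g \<in> Hom C y z" "s \<in> mob S y"
      then show "\<psi> z' (mact (induced C H S) z z' h (?p z y g s)) = mact N z z' h (\<psi> z (?p z y g s))"
        using cat_module_induced(2)[OF C H h gs] pT[OF gs] pT[OF comp_closed[OF gs(1) h] gs(2)]
          \<Phi>p[OF gs] \<Phi>p[OF comp_closed[OF gs(1) h] gs(2)] N.act_comp[OF gs(1) h \<phi>N[OF gs(2)]]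
        by (simp add: \<psi>_def)
    qed
    with t show ?thesis by blast
  qed
  have \<psi>1: "\<psi> \<in> hom_space C (induced C H S) N"
    using \<psi>N nat \<psi>lin by (auto simp: hom_space_def mod_hom_def sc) (simp add: \<psi>_def)
  have \<psi>2: "\<psi> y (?p y y (ident C y) s) = \<phi> y s" if "s \<in> mob S y" for y s
    using that pT[OF ident_closed that] \<Phi>p[OF ident_closed that] N.act_ident[OF \<phi>N[OF that]]
    by (simp add: \<psi>_def)
  show ?thesis
  proof (rule ex1I[of _ \<psi>])
    show "\<psi> \<in> hom_space C (induced C H S) N \<and> (\<forall>y. \<forall>s\<in>mob S y. \<psi> y (?p y y (ident C y) s) = \<phi> y s)"
      using \<psi>1 \<psi>2 by blast
    fix \<chi> assume \<chi>: "\<chi> \<in> hom_space C (induced C H S) N \<and>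
      (\<forall>y. \<forall>s\<in>mob S y. \<chi> y (?p y y (ident C y) s) = \<phi> y s)"
    have "\<forall>t\<in>?T z. \<chi> z t = \<psi> z t" for z
    proof (rule eq)
      show "linear_map_on fscale (mscale N) (?T z) (\<chi> z)"
        using \<chi> by (simp add: hom_space_def mod_hom_def sc)
      show "linear_map_on fscale (mscale N) (?T z) (\<psi> z)" by (rule \<psi>lin)
      fix y g s assume gs: "g \<in> Hom C y z" "s \<in> mob S y"
      have "?p z y g s = mact (induced C H S) y z g (?p y y (ident C y) s)"
        using cat_module_induced(2)[OF C H gs(1) ident_closed gs(2)] gs(1) by (simp add: ident_right)
      then have "\<chi> z (?p z y g s) = mact N y z g (\<phi> y s)"
        using \<chi> gs pT[OF ident_closed gs(2)] by (simp add: hom_space_def mod_hom_def)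
      also have "\<dots> = \<psi> z (?p z y g s)" using \<Phi>p[OF gs] pT[OF gs] by (simp add: \<psi>_def)
      finally show "\<chi> z (?p z y g s) = \<psi> z (?p z y g s)" .
    qed
    then show "\<chi> = \<psi>"
      using \<chi> by (auto simp: fun_eq_iff hom_space_def \<psi>_def)
  qed
qed

section \<open>Triangular categories\<close>

definition left_ideal :: "('o, 'm::ab_group_add, 'k) lincat \<Rightarrow> 'o \<Rightarrow> 'm set \<Rightarrow> bool" where
  "left_ideal C x I \<longleftrightarrow> I \<subseteq> Hom C x x \<and> 0 \<in> I \<and> (\<forall>a\<in>I. \<forall>b\<in>I. a + b \<in> I \<and> - a \<in> I) \<and>
     (\<forall>e\<in>Hom C x x. \<forall>a\<in>I. cmp C x x x e a \<in> I)"

text \<open>A ring is semi-simple if every left ideal is a direct summand.\<close>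

definition semisimple_End :: "('o, 'm::ab_group_add, 'k) lincat \<Rightarrow> 'o \<Rightarrow> bool" where
  "semisimple_End C x \<longleftrightarrow> (\<forall>I. left_ideal C x I \<longrightarrow>
     (\<exists>J. left_ideal C x J \<and> I \<inter> J = {0} \<and> {a + b | a b. a \<in> I \<and> b \<in> J} = Hom C x x))"

definition transversal :: "('o, 'm, 'k) lincat \<Rightarrow> 'o set \<Rightarrow> bool" where
  "transversal C R \<longleftrightarrow> (\<forall>X\<in>obj_classes C. \<exists>!y. y \<in> R \<inter> X)"

text \<open>
  \<open>\<Oplus>\<^sub>y U(y,z) \<otimes> D(x,y)\<close>, where \<open>y\<close> ranges over \<open>R\<close> and the tensor product is over \<open>End\<^sub>U(y)\<close>.
\<close>

definition tri_rel ::
  "('o, 'm, 'k) lincat \<Rightarrow> ('o \<Rightarrow> 'o \<Rightarrow> 'm set) \<Rightarrow> ('o \<Rightarrow> 'o \<Rightarrow> 'm set) \<Rightarrow> 'o set \<Rightarrow> 'o \<Rightarrow> 'o \<Rightarrow>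
   (('o \<times> 'm \<times> 'm) \<times> ('o \<times> 'm \<times> 'm)) set" where
  "tri_rel C U D R x z = {((y, cmp C y y z g e, f), (y, g, cmp C x y y e f)) | y g e f.
     y \<in> R \<and> g \<in> U y z \<and> e \<in> U y y \<and> f \<in> D x y}"

definition triangular_iso ::
  "('o, 'm::ab_group_add, 'k::field) lincat \<Rightarrow> ('o \<Rightarrow> 'o \<Rightarrow> 'm set) \<Rightarrow> ('o \<Rightarrow> 'o \<Rightarrow> 'm set) \<Rightarrow>
   'o set \<Rightarrow> 'o \<Rightarrow> 'o \<Rightarrow> bool" where
  "triangular_iso C U D R x z \<longleftrightarrow>
     (let T = btensor (cscale C) (cscale C) R (\<lambda>y. U y z) (\<lambda>y. D x y) (tri_rel C U D R x z);
          t = pure_tensor (cscale C) (cscale C) R (\<lambda>y. U y z) (\<lambda>y. D x y) (tri_rel C U D R x z)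
      in \<exists>\<Phi>. linear_map_on fscale (cscale C) T \<Phi> \<and>
           (\<forall>y\<in>R. \<forall>g\<in>U y z. \<forall>f\<in>D x y. \<Phi> (t y g f) = cmp C x y z g f) \<and>
           bij_betw \<Phi> T (Hom C x z))"

definition admissible_order ::
  "('o, 'm::ab_group_add, 'k) lincat \<Rightarrow> ('o \<Rightarrow> 'o \<Rightarrow> 'm set) \<Rightarrow> ('o \<Rightarrow> 'o \<Rightarrow> 'm set) \<Rightarrow>
   ('o set \<times> 'o set) set \<Rightarrow> bool" where
  "admissible_order C U D r \<longleftrightarrow> partial_order_on (obj_classes C) r \<and>
     (\<forall>X\<in>obj_classes C. finite {Y. (Y, X) \<in> r}) \<and>
     (\<forall>x y. \<forall>f\<in>U x y. f \<noteq> 0 \<longrightarrow> (obj_class C x, obj_class C y) \<in> r) \<and>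
     (\<forall>x y. \<forall>f\<in>D x y. f \<noteq> 0 \<longrightarrow> (obj_class C y, obj_class C x) \<in> r)"

definition mid :: "('o \<Rightarrow> 'o \<Rightarrow> 'm set) \<Rightarrow> ('o \<Rightarrow> 'o \<Rightarrow> 'm set) \<Rightarrow> 'o \<Rightarrow> 'o \<Rightarrow> 'm set" where
  "mid U D x y = U x y \<inter> D x y"

text \<open>
  The index set \<open>|G|\<close> of (T3) is realised by a system of representatives, and (T3) is required for
  every such system. The axiom \<open>iso_mid\<close> makes explicit the convention that \<open>|G|\<close> is also the set
  of isomorphism classes of \<open>U \<inter> D\<close>; it holds automatically if \<open>G\<close> is skeletal. It does not follow
  from (T0)--(T3): if an isomorphism \<open>u : y' \<rightarrow> y\<close> spans \<open>U(y',y)\<close>, then \<open>D(y',y)\<close> may be spanned by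
  \<open>g \<circ> u\<close>, where \<open>g\<close> is an automorphism of \<open>y\<close> such that \<open>g - 1\<close> is non-zero and factors through
  lower objects. In that case \<open>(U \<inter> D)(y',y) = 0\<close>, and the extension by zero
  of a simple \<open>(U \<inter> D)\<close>-module to \<open>D\<close> is not defined.
\<close>

locale triangular_category = linear_category G
  for G :: "('o, 'm::ab_group_add, 'k::field) lincat" +
  fixes U D :: "'o \<Rightarrow> 'o \<Rightarrow> 'm set"
  assumes wide_U: "wide_subcategory G U"
    and wide_D: "wide_subcategory G D"
    and T0: "fin_dim (cscale G) (Hom G x y)"
    and T1_eq: "U x x = D x x"
    and T1_semisimple: "semisimple_End (subcat G U) x"
    and T2: "\<exists>r. admissible_order G U D r"
    and T3: "transversal G R \<Longrightarrow> triangular_iso G U D R x z"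
    and iso_mid: "iso_obj G x y \<Longrightarrow> iso_obj (subcat G (mid U D)) x y"

text \<open>
  Weights are isomorphism classes of simple modules over \<open>U \<inter> D\<close>. A simple module is a quotient of
  some representable module, so it is isomorphic to one whose spaces are subspaces of the type \<open>'m\<close>
  of morphisms.
\<close>

type_synonym ('o, 'm, 'k) weight = "('o, 'm, 'k, 'm) cmod set"

definition weights ::
  "('o, 'm::ab_group_add, 'k::field) lincat \<Rightarrow> ('o \<Rightarrow> 'o \<Rightarrow> 'm set) \<Rightarrow> ('o \<Rightarrow> 'o \<Rightarrow> 'm set) \<Rightarrow>
   ('o, 'm, 'k) weight set" where
  "weights G U D = {{T. simple_mod (subcat G (mid U D)) T \<and> isomorphic (subcat G (mid U D)) S T} | S.
     simple_mod (subcat G (mid U D)) (S :: ('o, 'm, 'k, 'm) cmod)}"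

definition wsupp :: "('o, 'm::zero, 'k) weight \<Rightarrow> 'o set" where
  "wsupp \<kappa> = {x. \<exists>S\<in>\<kappa>. mob S x \<noteq> {0}}"

definition weight_less :: "('o set \<times> 'o set) set \<Rightarrow> ('o, 'm::zero, 'k) weight \<Rightarrow> ('o, 'm, 'k) weight \<Rightarrow> bool" where
  "weight_less r \<kappa> \<mu> \<longleftrightarrow> (wsupp \<kappa>, wsupp \<mu>) \<in> r \<and> wsupp \<kappa> \<noteq> wsupp \<mu>"

text \<open>Distinct weights with the same support are incomparable.\<close>

definition weight_le :: "('o set \<times> 'o set) set \<Rightarrow> ('o, 'm::zero, 'k) weight \<Rightarrow> ('o, 'm, 'k) weight \<Rightarrow> bool" where
  "weight_le r \<kappa> \<mu> \<longleftrightarrow> \<kappa> = \<mu> \<or> weight_less r \<kappa> \<mu>"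

text \<open>In the following, \<open>S\<close> is a choice of representatives of the weights.\<close>

definition weight_mult ::
  "('o, 'm, 'k::field) lincat \<Rightarrow> ('o \<Rightarrow> 'o \<Rightarrow> 'm set) \<Rightarrow> ('o \<Rightarrow> 'o \<Rightarrow> 'm set) \<Rightarrow>
   (('o, 'm::ab_group_add, 'k) weight \<Rightarrow> ('o, 'm, 'k, 'm) cmod) \<Rightarrow>
   ('o, 'm, 'k) weight \<Rightarrow> ('o, 'm, 'k, 'v::ab_group_add) cmod \<Rightarrow> enat" where
  "weight_mult G U D S \<kappa> M = multiplicity_mod (subcat G (mid U D)) M (S \<kappa>)"

text \<open>Meaningful for pointwise finite modules only, as \<open>weight_mult\<close> may be infinite otherwise.\<close>

definition formal_character ::
  "('o, 'm, 'k::field) lincat \<Rightarrow> ('o \<Rightarrow> 'o \<Rightarrow> 'm set) \<Rightarrow> ('o \<Rightarrow> 'o \<Rightarrow> 'm set) \<Rightarrow>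
   (('o, 'm::ab_group_add, 'k) weight \<Rightarrow> ('o, 'm, 'k, 'm) cmod) \<Rightarrow>
   ('o, 'm, 'k, 'v::ab_group_add) cmod \<Rightarrow> ('o, 'm, 'k) weight \<Rightarrow> rat" where
  "formal_character G U D S M =
     (\<lambda>\<kappa>. if \<kappa> \<in> weights G U D then of_nat (the_enat (weight_mult G U D S \<kappa> M)) else 0)"

definition extend_by_zero ::
  "('o, 'm, 'k) lincat \<Rightarrow> ('o, 'm, 'k, 'v::zero) cmod \<Rightarrow> ('o, 'm, 'k, 'v) cmod" where
  "extend_by_zero G S = S\<lparr>mact := (\<lambda>x y f v. if iso_obj G x y then mact S x y f v else 0)\<rparr>"

definition standard ::
  "('o, 'm::ab_group_add, 'k::field) lincat \<Rightarrow> ('o \<Rightarrow> 'o \<Rightarrow> 'm set) \<Rightarrow>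
   ('o, 'm, 'k, 'v::ab_group_add) cmod \<Rightarrow> ('o, 'm, 'k, ('o \<Rightarrow> 'm \<Rightarrow> 'v \<Rightarrow> 'k) \<Rightarrow> 'k) cmod" where
  "standard G D S = induced G D (extend_by_zero G S)"

definition big_projective ::
  "('o, 'm::ab_group_add, 'k::field) lincat \<Rightarrow> ('o \<Rightarrow> 'o \<Rightarrow> 'm set) \<Rightarrow> ('o \<Rightarrow> 'o \<Rightarrow> 'm set) \<Rightarrow>
   ('o, 'm, 'k, 'v::ab_group_add) cmod \<Rightarrow> ('o, 'm, 'k, ('o \<Rightarrow> 'm \<Rightarrow> 'v \<Rightarrow> 'k) \<Rightarrow> 'k) cmod" where
  "big_projective G U D S = induced G (mid U D) S"

definition standard_filtration ::
  "('o, 'm::ab_group_add, 'k::field) lincat \<Rightarrow> ('o \<Rightarrow> 'o \<Rightarrow> 'm set) \<Rightarrow> ('o \<Rightarrow> 'o \<Rightarrow> 'm set) \<Rightarrow>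
   (('o, 'm, 'k) weight \<Rightarrow> ('o, 'm, 'k, 'm) cmod) \<Rightarrow>
   ('o, 'm, 'k, 'v::ab_group_add) cmod \<Rightarrow> nat \<Rightarrow> (nat \<Rightarrow> 'o \<Rightarrow> 'v set) \<Rightarrow>
   (nat \<Rightarrow> ('o, 'm, 'k) weight) \<Rightarrow> bool" where
  "standard_filtration G U D S M n F \<mu> \<longleftrightarrow>
     F 0 = zero_sub \<and> F n = mob M \<and> (\<forall>i\<le>n. submod G M (F i)) \<and>
     (\<forall>i<n. F i \<le> F (Suc i) \<and> \<mu> i \<in> weights G U D \<and>
        subquot_iso G M (F i) (F (Suc i)) (standard G D (S (\<mu> i))))"

definition semistandard ::
  "('o, 'm::ab_group_add, 'k::field) lincat \<Rightarrow> ('o \<Rightarrow> 'o \<Rightarrow> 'm set) \<Rightarrow> ('o \<Rightarrow> 'o \<Rightarrow> 'm set) \<Rightarrow>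
   (('o, 'm, 'k) weight \<Rightarrow> ('o, 'm, 'k, 'm) cmod) \<Rightarrow>
   ('o, 'm, 'k, 'v::ab_group_add) cmod \<Rightarrow> bool" where
  "semistandard G U D S M \<longleftrightarrow>
     cat_module G M \<and> (\<exists>n F \<mu>. standard_filtration G U D S M n F \<mu>)"

text \<open>The number does not depend on the filtration of a semistandard module.\<close>

definition standard_mult ::
  "('o, 'm::ab_group_add, 'k::field) lincat \<Rightarrow> ('o \<Rightarrow> 'o \<Rightarrow> 'm set) \<Rightarrow> ('o \<Rightarrow> 'o \<Rightarrow> 'm set) \<Rightarrow>
   (('o, 'm, 'k) weight \<Rightarrow> ('o, 'm, 'k, 'm) cmod) \<Rightarrow>
   ('o, 'm, 'k, 'v::ab_group_add) cmod \<Rightarrow> ('o, 'm, 'k) weight \<Rightarrow> nat" where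
  "standard_mult G U D S M \<nu> =
     (THE k. \<exists>n F \<mu>. standard_filtration G U D S M n F \<mu> \<and> k = card {i. i < n \<and> \<mu> i = \<nu>})"

text \<open>\<open>L\<close> is a simple quotient of the standard module of \<open>\<kappa>\<close>; it is unique up to isomorphism.\<close>

definition is_simple_of_weight ::
  "('o, 'm::ab_group_add, 'k::field) lincat \<Rightarrow> ('o \<Rightarrow> 'o \<Rightarrow> 'm set) \<Rightarrow> ('o \<Rightarrow> 'o \<Rightarrow> 'm set) \<Rightarrow>
   (('o, 'm, 'k) weight \<Rightarrow> ('o, 'm, 'k, 'm) cmod) \<Rightarrow>
   ('o, 'm, 'k) weight \<Rightarrow> ('o, 'm, 'k, 'v::ab_group_add) cmod \<Rightarrow> bool" where
  "is_simple_of_weight G U D S \<kappa> L \<longleftrightarrow>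
     simple_mod G L \<and> is_quotient_of G (standard G D (S \<kappa>)) L"

text \<open>
  \<open>P\<close> is an indecomposable summand of \<open>big_projective G U D (S \<kappa>)\<close> in which the standard
  module of \<open>\<kappa>\<close> occurs once; it is unique up to isomorphism.
\<close>

definition is_projective_of_weight ::
  "('o, 'm::ab_group_add, 'k::field) lincat \<Rightarrow> ('o \<Rightarrow> 'o \<Rightarrow> 'm set) \<Rightarrow> ('o \<Rightarrow> 'o \<Rightarrow> 'm set) \<Rightarrow>
   (('o, 'm, 'k) weight \<Rightarrow> ('o, 'm, 'k, 'm) cmod) \<Rightarrow>
   ('o, 'm, 'k) weight \<Rightarrow> ('o, 'm, 'k, 'v::ab_group_add) cmod \<Rightarrow> bool" where
  "is_projective_of_weight G U D S \<kappa> P \<longleftrightarrow>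
     indecomposable G P \<and> summand_of G P (big_projective G U D (S \<kappa>)) \<and>
     standard_mult G U D S P \<kappa> = 1"

end

theory Submission
  imports Defs
begin

text \<open>
  Write \<open>M = U \<inter> D\<close>. Over \<open>U\<close> the module \<open>\<Delta>\<^sub>\<mu>\<close> is the one induced from \<open>S\<^sub>\<mu>\<close>, and homomorphisms over \<open>U\<close> from
  a summand \<open>N\<close> of the induced projective module \<open>k\<^sub>!(S\<^sub>\<kappa>)\<close> to \<open>S\<^sub>\<mu>\<close> lift along \<open>\<Delta>\<^sub>\<mu> \<rightarrow> S\<^sub>\<mu>\<close>. Hence the map
  \<open>\<Delta>\<^sub>\<mu> \<rightarrow> N\<close> given by a vector of minimal support is split over \<open>U\<close>, so it is injective and the lifting property
  passes to its cokernel. Splitting off such submodules yields a standard filtration; it is finite because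
  the dimension of \<open>N\<close> on the finitely many classes below \<open>\<kappa>\<close> drops at each step. The multiplicities can be
  read off the formal characters, since those of the standard modules are unitriangular.

  By Fitting's lemma every proper submodule of \<open>P\<^sub>\<kappa>\<close> is contained in the kernel of \<open>P\<^sub>\<kappa> \<rightarrow> L\<^sub>\<kappa>\<close>, so \<open>P\<^sub>\<kappa>\<close> is a
  projective cover, and Schur's lemma over an algebraically closed field turns \<open>dim Hom(P\<^sub>\<kappa>, -)\<close> into the
  multiplicity of \<open>L\<^sub>\<kappa>\<close>. To decompose \<open>k\<^sub>!(S\<^sub>\<kappa>)\<close>, lift a basis of \<open>Hom\<^sub>M(S\<^sub>\<kappa>, L\<^sub>\<mu>) = Hom(k\<^sub>!(S\<^sub>\<kappa>), L\<^sub>\<mu>)\<close> to maps into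
  \<open>P\<^sub>\<mu>\<close>; the resulting map to the direct sum of the \<open>P\<^sub>\<mu>\<close> induces an isomorphism on homomorphisms to every
  simple module, so it is surjective, hence split, with zero kernel.
\<close>

section \<open>Linear algebra\<close>

text \<open>The engine is (T3) read as a statement about modules: restricted to \<open>U\<close>,
  the representable module \<open>rep G x\<close> is induced from \<open>D x\<close>, viewed over
  \<open>H = mid U D\<close>. A \<open>U\<close>-homomorphism out of it is therefore an
  \<open>H\<close>-homomorphism out of \<open>D x\<close>. Simple \<open>H\<close>-modules are
  projective, because endomorphism rings are semi-simple and non-zero morphisms of \<open>H\<close>
  only join isomorphic objects; so a surjection onto such a module splits over \<open>H\<close>, and
  this is where the lifting along \<open>\<Delta> \<mu> \<rightarrow> S0 \<mu>\<close> comes from.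

  Three obstacles shape the rest. HOL cannot quantify over the value types of modules, so lifting is
  stated for one pair of modules at a time and quotients are rebuilt inside a given type. Modules
  are only pointwise finite, so Fitting's lemma stabilises object by object, and the termination of
  the filtration is measured on finitely many objects. Multiplicities are suprema of lengths of
  chains; they are replaced by dimensions of Hom spaces out of the projective modules
  \<open>S \<nu>\<close> over \<open>H\<close>, which add up along filtrations.\<close>

lemma linear_map_on_extend:
  fixes f :: "'v::ab_group_add \<Rightarrow> 'w::ab_group_add" and s :: "'k::field \<Rightarrow> _"
  assumes s: "vector_space s" and t: "vector_space t" and V: "module.subspace s V"
    and f: "linear_map_on s t V f"
  shows "\<exists>g. Vector_Spaces.linear s t g \<and> (\<forall>v\<in>V. g v = f v)"
proof -
  interpret s: vector_space s by (rule s)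
  interpret t: vector_space t by (rule t)
  interpret p: vector_space_pair s t ..
  obtain B where B: "B \<subseteq> V" "s.independent B" "V \<subseteq> s.span B"
    using s.maximal_independent_subset[of V] by blast
  obtain g where g: "Vector_Spaces.linear s t g" "\<forall>x\<in>B. g x = f x"
    using p.linear_independent_extend[OF B(2), of f] by auto
  interpret g: Vector_Spaces.linear s t g by (rule g(1))
  have z: "f 0 = 0" using f s.subspace_0[OF V] unfolding linear_map_on_def
    by (metis s.scale_zero_left t.scale_zero_left)
  \<comment> \<open>Additivity of \<open>f\<close> is only known on \<open>V\<close>, so membership
    in \<open>V\<close> is carried through the induction.\<close>
  have "v \<in> V \<and> g v = f v" if "v \<in> s.span B" for v
    using that
  proof (induction rule: s.span_induct_alt)
    case base
    then show ?case using z s.subspace_0[OF V] by simp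
  next
    case (step c x y)
    then have "s c x \<in> V" "y \<in> V" "x \<in> V" using B(1) V by (auto simp: s.subspace_def)
    then have "f (s c x + y) = t c (f x) + f y" "s c x + y \<in> V"
      using f V unfolding linear_map_on_def s.subspace_def by simp_all
    then show ?case using step g(2) by (simp add: g.add g.scale)
  qed
  then show ?thesis using B(3) g(1) by blast
qed

lemma linear_map_on_props:
  fixes f :: "'v::ab_group_add \<Rightarrow> 'w::ab_group_add" and s :: "'k::field \<Rightarrow> _"
  assumes s: "vector_space s" and t: "vector_space t" and V: "module.subspace s V"
    and f: "linear_map_on s t V f"
  shows linear_map_on_0: "f 0 = 0"
    and linear_map_on_neg: "v \<in> V \<Longrightarrow> f (- v) = - f v"
    and linear_map_on_diff: "v \<in> V \<Longrightarrow> w \<in> V \<Longrightarrow> f (v - w) = f v - f w"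
    and linear_map_on_sum: "(\<And>i. i \<in> I \<Longrightarrow> h i \<in> V) \<Longrightarrow> f (\<Sum>i\<in>I. h i) = (\<Sum>i\<in>I. f (h i))"
proof -
  interpret s: vector_space s by (rule s)
  interpret t: vector_space t by (rule t)
  obtain g where g: "Vector_Spaces.linear s t g" "\<And>v. v \<in> V \<Longrightarrow> g v = f v"
    using linear_map_on_extend[OF assms] by blast
  interpret g: Vector_Spaces.linear s t g by (rule g(1))
  show "f 0 = 0" using g(2)[of 0] s.subspace_0[OF V] by simp
  show "v \<in> V \<Longrightarrow> f (- v) = - f v" using g(2)[of v] g(2)[of "- v"] s.subspace_neg[OF V] by (simp add: g.neg)
  show "v \<in> V \<Longrightarrow> w \<in> V \<Longrightarrow> f (v - w) = f v - f w"
    using g(2)[of v] g(2)[of w] g(2)[of "v - w"] s.subspace_diff[OF V] by (simp add: g.diff)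
  show "(\<And>i. i \<in> I \<Longrightarrow> h i \<in> V) \<Longrightarrow> f (\<Sum>i\<in>I. h i) = (\<Sum>i\<in>I. f (h i))"
    using g(2) s.subspace_sum[OF V, of I h] by (metis (mono_tags, lifting) g.sum sum.cong)
qed

lemma linear_map_on_subset: "linear_map_on s t V f \<Longrightarrow> W \<subseteq> V \<Longrightarrow> linear_map_on s t W f"
  by (simp add: linear_map_on_def subset_iff)

lemma linear_map_on_compose:
  "linear_map_on s t V f \<Longrightarrow> linear_map_on t u W g \<Longrightarrow> f ` V \<subseteq> W \<Longrightarrow> linear_map_on s u V (\<lambda>v. g (f v))"
  by (auto simp: linear_map_on_def image_subset_iff)

lemma subspace_image_on:
  assumes s: "vector_space s" and t: "vector_space t" and V: "module.subspace s V"
    and f: "linear_map_on s t V f"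
  shows "module.subspace t (f ` V)"
proof -
  interpret s: vector_space s by (rule s)
  interpret t: vector_space t by (rule t)
  show ?thesis unfolding t.subspace_def
  proof (intro conjI ballI allI)
    show "0 \<in> f ` V" using linear_map_on_0[OF s t V f] s.subspace_0[OF V] by force
    fix x assume x: "x \<in> f ` V"
    show "t c x \<in> f ` V" for c
      using x f s.subspace_scale[OF V] unfolding linear_map_on_def by (auto simp: image_iff) metis
    fix y assume "y \<in> f ` V"
    with x show "x + y \<in> f ` V"
      using f s.subspace_add[OF V] unfolding linear_map_on_def by (auto simp: image_iff) metis
  qed
qed

text \<open>Extend a basis of \<open>N\<close> and let \<open>p\<close> kill it and fix the added
  vectors. The image of \<open>p\<close> is a complement of \<open>N\<close>, so quotients can later
  be realised inside the value type of the module.\<close>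

lemma linear_complement_projection:
  assumes s: "vector_space (s :: 'k::field \<Rightarrow> 'v::ab_group_add \<Rightarrow> 'v)" and N: "module.subspace s N"
  shows "\<exists>p. Vector_Spaces.linear s s p \<and> (\<forall>v. p v = 0 \<longleftrightarrow> v \<in> N) \<and> (\<forall>v. v - p v \<in> N)"
proof -
  interpret s: vector_space s by (rule s)
  interpret p: vector_space_pair s s ..
  obtain B where B: "B \<subseteq> N" "s.independent B" "N \<subseteq> s.span B"
    using s.maximal_independent_subset[of N] by blast
  have NB: "s.span B = N" using s.span_minimal[OF B(1) N] B(3) by blast
  define E where "E = s.extend_basis B"
  have E: "B \<subseteq> E" "s.independent E" "s.span E = UNIV"
    using s.extend_basis_superset[OF B(2)] s.independent_extend_basis[OF B(2)]
      s.span_extend_basis[OF B(2)] by (auto simp: E_def)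
  obtain p where p: "Vector_Spaces.linear s s p" "\<forall>x\<in>E. p x = (if x \<in> B then 0 else x)"
    using p.linear_independent_extend[OF E(2), of "\<lambda>x. if x \<in> B then 0 else x"] by auto
  interpret p': Vector_Spaces.linear s s p by (rule p(1))
  have 1: "v - p v \<in> N" for v
  proof -
    have "v \<in> s.span E" by (simp add: E)
    then show ?thesis
    proof (induction rule: s.span_induct_alt)
      case base show ?case using s.subspace_0[OF N] by simp
    next
      case (step c x y)
      have x: "x - p x \<in> N" using p(2) step.hyps s.subspace_0[OF N] B(1) by auto
      have "s c x + y - p (s c x + y) = s c (x - p x) + (y - p y)"
        by (simp add: p'.add p'.scale s.scale_right_diff_distrib)
      then show ?case using s.subspace_add[OF N s.subspace_scale[OF N x] step.IH] by metis
    qed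
  qed
  have 2: "p v = 0" if "v \<in> N" for v
    using that unfolding NB[symmetric]
  proof (induction rule: s.span_induct_alt)
    case base show ?case by simp
  next
    case (step c x y)
    then show ?case using p(2) E(1) by (auto simp: p'.add p'.scale)
  qed
  show ?thesis using 1 2 p(1) by (metis diff_zero)
qed

lemma fin_dim_subset: "fin_dim s V \<Longrightarrow> W \<subseteq> V \<Longrightarrow> fin_dim s W"
  by (auto simp: fin_dim_def)

lemma fin_dim_basis:
  assumes s: "vector_space s" and V: "fin_dim s V"
  obtains B where "finite B" "B \<subseteq> V" "\<not> module.dependent s B" "V \<subseteq> module.span s B"
    "card B = vector_space.dim s V"
proof -
  interpret s: vector_space s by (rule s)
  obtain B where B: "B \<subseteq> V" "s.independent B" "V \<subseteq> s.span B" "card B = s.dim V"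
    using s.basis_exists[of V] by blast
  obtain C where C: "finite C" "V \<subseteq> s.span C" using V by (auto simp: fin_dim_def)
  have "finite B" using s.independent_span_bound[OF C(1) B(2)] B(1) C(2) by blast
  with B that show thesis by blast
qed

lemma fin_dim_independent_le:
  assumes s: "vector_space s" and V: "fin_dim s V" and B: "B \<subseteq> V" "\<not> module.dependent s B"
  shows "finite B" "card B \<le> vector_space.dim s V"
proof -
  interpret s: vector_space s by (rule s)
  obtain C where C: "finite C" "C \<subseteq> V" "s.independent C" "V \<subseteq> s.span C" "card C = s.dim V"
    by (rule fin_dim_basis[OF s V])
  show "finite B" "card B \<le> vector_space.dim s V"
    using s.independent_span_bound[OF C(1) B(2)] B(1) C(4,5) by auto
qed

lemma fin_dim_dim_mono:
  assumes s: "vector_space s" and V: "fin_dim s V" and W: "W \<subseteq> V"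
  shows "vector_space.dim s W \<le> vector_space.dim s V"
proof -
  obtain B where B: "finite B" "B \<subseteq> W" "\<not> module.dependent s B" "W \<subseteq> module.span s B"
    "card B = vector_space.dim s W"
    by (rule fin_dim_basis[OF s fin_dim_subset[OF V W]])
  have "B \<subseteq> V" using B W by blast
  then show ?thesis using fin_dim_independent_le(2)[OF s V _ B(3)] B(5) by simp
qed

lemma fin_dim_subspace_eq:
  assumes s: "vector_space s" and V: "fin_dim s V" and W: "W \<subseteq> V" "module.subspace s W"
    and d: "vector_space.dim s V \<le> vector_space.dim s W"
  shows "W = V"
proof (rule ccontr)
  interpret s: vector_space s by (rule s)
  assume "W \<noteq> V"
  then obtain v where v: "v \<in> V" "v \<notin> W" using W by blast
  obtain B where B: "finite B" "B \<subseteq> W" "s.independent B" "W \<subseteq> s.span B" "card B = s.dim W"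
    by (rule fin_dim_basis[OF s fin_dim_subset[OF V W(1)]])
  have "s.span B \<subseteq> W" by (rule s.span_minimal[OF B(2) W(2)])
  then have vB: "v \<notin> s.span B" using v by blast
  then have "s.independent (insert v B)" using B(3) by (simp add: s.independent_insert)
  moreover have "insert v B \<subseteq> V" using v(1) B(2) W(1) by blast
  ultimately have "card (insert v B) \<le> s.dim V" using fin_dim_independent_le(2)[OF s V] by simp
  moreover have "v \<notin> B" using vB s.span_base by blast
  ultimately show False using B(1,5) d by simp
qed

lemma fin_dim_dim_less:
  assumes s: "vector_space s" and V: "fin_dim s V" and W: "W \<subset> V" "module.subspace s W"
  shows "vector_space.dim s W < vector_space.dim s V"
  using fin_dim_subspace_eq[OF s V _ W(2)] W(1) by force

lemma fin_dim_rank_nullity: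
  fixes f :: "'v::ab_group_add \<Rightarrow> 'w::ab_group_add" and s :: "'k::field \<Rightarrow> _"
  assumes s: "vector_space s" and t: "vector_space t" and V: "module.subspace s V"
    and f: "linear_map_on s t V f" and fd: "fin_dim s V"
  shows fin_dim_image: "fin_dim t (f ` V)"
    and dim_kernel_image: "vector_space.dim s V = vector_space.dim s {v\<in>V. f v = 0} + vector_space.dim t (f ` V)"
proof -
  interpret s: vector_space s by (rule s)
  interpret t: vector_space t by (rule t)
  interpret p: vector_space_pair s t ..
  obtain g where g: "Vector_Spaces.linear s t g" "\<And>v. v \<in> V \<Longrightarrow> g v = f v"
    using linear_map_on_extend[OF s t V f] by blast
  interpret g: Vector_Spaces.linear s t g by (rule g(1))
  have fg: "f ` V = g ` V" using g(2) by auto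
  let ?K = "{v\<in>V. f v = 0}"
  have K: "?K = {v\<in>V. g v = 0}" using g(2) by auto
  have KV: "?K \<subseteq> V" by blast
  obtain B where B: "finite B" "B \<subseteq> ?K" "s.independent B" "?K \<subseteq> s.span B" "card B = s.dim ?K"
    by (rule fin_dim_basis[OF s fin_dim_subset[OF fd KV]])
  obtain E where E: "B \<subseteq> E" "E \<subseteq> V" "s.independent E" "V \<subseteq> s.span E"
    using s.maximal_independent_subset_extend[of B V] B by blast
  have EV: "s.span E = V" using s.span_minimal[OF E(2) V] E(4) by blast
  have finE: "finite E" using fin_dim_independent_le[OF s fd E(2,3)] by blast
  have cE: "card E = s.dim V" using s.dim_unique[OF E(2,4,3)] by simp
  show "fin_dim t (f ` V)"
    unfolding fin_dim_def
    using finE EV g.span_image[of E] fg by (intro exI[of _ "g ` E"]) simp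
  let ?F = "E - B"
  have inj: "inj_on g (s.span ?F)"
  proof -
    have "x = 0" if x: "x \<in> s.span ?F" "g x = 0" for x
    proof -
      have "x \<in> V" using x s.span_mono[of ?F E] EV by blast
      then have "x \<in> s.span B" using x(2) K B(4) by blast
      \<comment> \<open>The linear map that kills \<open>B\<close> and fixes the rest of
        \<open>E\<close> is both zero and the identity on this intersection.\<close>
      moreover have "s.span B \<inter> s.span ?F \<subseteq> {0}"
      proof
        interpret ss: vector_space_pair s s ..
        obtain p where p: "Vector_Spaces.linear s s p" "\<forall>x\<in>E. p x = (if x \<in> B then 0 else x)"
          using ss.linear_independent_extend[OF E(3), of "\<lambda>x. if x \<in> B then 0 else x"] by auto
        interpret p: Vector_Spaces.linear s s p by (rule p(1))
        fix y assume y: "y \<in> s.span B \<inter> s.span ?F"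
        have "p y = 0"
          by (rule p.eq_0_on_span[of B]) (use p(2) E(1) y in auto)
        moreover have "p y = y"
          by (rule ss.linear_eq_on[OF p(1) s.linear_ident, of _ ?F]) (use p(2) E(1) y in auto)
        ultimately show "y \<in> {0}" by simp
      qed
      ultimately show ?thesis using x by blast
    qed
    then show ?thesis
      using g.inj_on_iff_eq_0[of "s.span ?F"] by auto
  qed
  have indF: "s.independent ?F" using E(3) s.independent_mono by blast
  have ind: "t.independent (g ` ?F)"
    using p.linear_independent_injective_image[OF g(1) indF] inj by blast
  have "g ` V \<subseteq> t.span (g ` ?F)"
  proof -
    have "g x \<in> t.span (g ` ?F)" if "x \<in> E" for x
    proof (cases "x \<in> B")
      case True
      then show ?thesis using B(2) K t.span_zero by auto
    next
      case False
      then show ?thesis using that by (intro t.span_base imageI) simp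
    qed
    then have "t.span (g ` E) \<subseteq> t.span (g ` ?F)"
      by (intro t.span_minimal) auto
    then show ?thesis using EV g.span_image by auto
  qed
  moreover have "g ` ?F \<subseteq> g ` V" using E by blast
  moreover have "card (g ` ?F) = card ?F"
    using inj s.span_superset by (intro card_image) (meson inj_on_subset)
  ultimately have "t.dim (g ` V) = card ?F" by (intro t.dim_unique[OF _ _ ind])
  moreover have "card ?F = card E - card B" using B E by (simp add: card_Diff_subset)
  moreover have "card B \<le> card E" using E finE by (simp add: card_mono)
  ultimately show "s.dim V = s.dim ?K + t.dim (f ` V)" using B cE fg by simp
qed

text \<open>Reduces comparisons of possibly infinite dimensions to finite independent sets; an
  infinite-dimensional space contains such sets of every size.\<close>

lemma edim_ge_iff:
  assumes s: "vector_space s" and V: "module.subspace s V"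
  shows "enat n \<le> edim s V \<longleftrightarrow> (\<exists>B. finite B \<and> B \<subseteq> V \<and> \<not> module.dependent s B \<and> card B = n)"
proof -
  interpret s: vector_space s by (rule s)
  show ?thesis
  proof (cases "fin_dim s V")
    case True
    obtain B where B: "finite B" "B \<subseteq> V" "s.independent B" "V \<subseteq> s.span B" "card B = s.dim V"
      by (rule fin_dim_basis[OF s True])
    have "\<exists>C. finite C \<and> C \<subseteq> V \<and> s.independent C \<and> card C = n" if n: "n \<le> s.dim V"
    proof -
      obtain C where C: "C \<subseteq> B" "card C = n" "finite C"
        by (rule obtain_subset_with_card_n[of n B]) (use n B(5) in simp_all)
      then show ?thesis using B(2,3) s.independent_mono[OF B(3) C(1)] by blast
    qed
    then show ?thesis using True fin_dim_independent_le[OF s True] by (auto simp: edim_def)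
  next
    case False
    obtain B where B: "B \<subseteq> V" "s.independent B" "V \<subseteq> s.span B"
      using s.maximal_independent_subset[of V] by blast
    have "infinite B" using False B by (auto simp: fin_dim_def)
    then obtain C where C: "finite C" "card C = n" "C \<subseteq> B" using infinite_arbitrarily_large by blast
    then have "\<exists>C. finite C \<and> C \<subseteq> V \<and> s.independent C \<and> card C = n"
      using B(1) s.independent_mono[OF B(2) C(3)] by blast
    then show ?thesis using False by (simp add: edim_def)
  qed
qed

text \<open>A non-zero polynomial \<open>p\<close> with \<open>p(g) v = 0\<close> exists because the
  iterates of \<open>v\<close> stay in a finite-dimensional space. Splitting off a root
  \<open>c\<close> writes \<open>p = (X - c) q\<close>: either \<open>q(g) v\<close> is an
  eigenvector for \<open>c\<close>, or \<open>q\<close> is an annihilating polynomial of smaller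
  degree.\<close>

lemma linear_eigenvector:
  fixes s :: "'k::alg_closed_field \<Rightarrow> 'v::ab_group_add \<Rightarrow> 'v"
  assumes s: "vector_space s" and V: "module.subspace s V" and fd: "fin_dim s V"
    and f: "linear_map_on s s V f" "f ` V \<subseteq> V" and v: "v \<in> V" "v \<noteq> 0"
  shows "\<exists>c. \<exists>w\<in>V. w \<noteq> 0 \<and> f w = s c w"
proof -
  interpret s: vector_space s by (rule s)
  obtain g where g: "Vector_Spaces.linear s s g" "\<And>v. v \<in> V \<Longrightarrow> g v = f v"
    using linear_map_on_extend[OF s s V f(1)] by blast
  interpret g: Vector_Spaces.linear s s g by (rule g(1))
  \<comment> \<open>Horner evaluation of the polynomial \<open>p\<close> at the endomorphism
    \<open>g\<close>, applied to \<open>w\<close>.\<close>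
  define pev where "pev p w = fold_coeffs (\<lambda>a x. s a w + g x) p 0" for p w
  have pev_0 [simp]: "pev 0 w = 0" for w by (simp add: pev_def)
  have pev_pCons [simp]: "pev (pCons a p) w = s a w + g (pev p w)" for a p w
    by (cases "p = 0 \<and> a = 0") (auto simp: pev_def)
  have pev_add: "pev (p + q) w = pev p w + pev q w" for p q w
    by (induction p q rule: poly_induct2) (auto simp: g.add s.scale_left_distrib algebra_simps)
  have pev_smult: "pev (smult c p) w = s c (pev p w)" for c p w
    by (induction p) (auto simp: g.scale s.scale_right_distrib)
  have pev_V: "pev p w \<in> V" if "w \<in> V" for p w
  proof (induction p)
    case 0 show ?case using s.subspace_0[OF V] by simp
  next
    case (pCons a p)
    then show ?case using that f(2) g(2) s.subspace_add[OF V] s.subspace_scale[OF V] by auto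
  qed
  have root: "\<exists>c. \<exists>w\<in>V. w \<noteq> 0 \<and> f w = s c w" if "p \<noteq> 0" "pev p v = 0" for p
    using that
  proof (induction "degree p" arbitrary: p rule: less_induct)
    case less
    have "degree p \<noteq> 0"
    proof
      assume "degree p = 0"
      then obtain a where "p = [:a:]" using degree_eq_zeroE by blast
      then show False using less.prems v by simp
    qed
    then obtain c where "poly p c = 0" using alg_closed_imp_poly_has_root[of p] by auto
    then obtain q where q: "p = [:- c, 1:] * q" by (auto simp: poly_eq_0_iff_dvd)
    then have q0: "q \<noteq> 0" using less.prems by auto
    then have dq: "degree q < degree p" unfolding q by (subst degree_mult_eq) auto
    show ?case
    proof (cases "pev q v = 0")
      case True
      then show ?thesis using less.hyps[OF dq q0] by blast
    next
      case False
      have "p = smult (- c) q + pCons 0 q" unfolding q by simp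
      then have "pev p v = - s c (pev q v) + g (pev q v)" by (simp only: pev_add pev_smult) simp
      then have "g (pev q v) = s c (pev q v)" using less.prems by simp
      then show ?thesis using False pev_V[OF v(1), of q] g(2) by metis
    qed
  qed
  \<comment> \<open>One vector more than the dimension, which forces a relation among the
    iterates.\<close>
  define N where "N = Suc (s.dim V)"
  define h where "h i = (g ^^ i) v" for i
  have hV: "h i \<in> V" for i unfolding h_def by (induction i) (use v f(2) g(2) in auto)
  have sumpev: "pev p v = (\<Sum>i\<le>n. s (coeff p i) (h i))" if "degree p \<le> n" for p n
    using that
  proof (induction p arbitrary: n)
    case 0 then show ?case by simp
  next
    case (pCons a p)
    show ?case
    proof (cases n)
      case 0
      then have "p = 0" using pCons.prems by (cases "p = 0") auto
      then show ?thesis using 0 by (simp add: h_def)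
    next
      case (Suc m)
      then have "degree p \<le> m" using pCons.prems by (cases "p = 0") auto
      then have "pev p v = (\<Sum>i\<le>m. s (coeff p i) (h i))" by (rule pCons.IH)
      then show ?thesis unfolding Suc
        by (subst sum.atMost_Suc_shift) (simp add: g.sum g.scale h_def)
    qed
  qed
  \<comment> \<open>Linear dependence is a notion for sets, so repeated iterates are treated apart:
    \<open>h i = h j\<close> gives the annihilating polynomial \<open>X^j - X^i\<close>.\<close>
  show ?thesis
  proof (cases "inj_on h {..<N}")
    case True
    have "s.dependent (h ` {..<N})"
    proof (rule ccontr)
      assume "s.independent (h ` {..<N})"
      then have "card (h ` {..<N}) \<le> s.dim V" using hV by (intro fin_dim_independent_le(2)[OF s fd]) auto
      then show False using True by (simp add: card_image N_def)
    qed
    then obtain u where u: "(\<Sum>x\<in>h ` {..<N}. s (u x) x) = 0" "\<exists>x\<in>h ` {..<N}. u x \<noteq> 0"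
      using s.dependent_finite[of "h ` {..<N}"] by auto
    define p where "p = (\<Sum>i<N. monom (u (h i)) i)"
    have cp: "coeff p i = (if i < N then u (h i) else 0)" for i
      by (simp add: p_def coeff_sum)
    have "p \<noteq> 0" using u(2) cp by (metis coeff_0 imageE lessThan_iff)
    moreover have "pev p v = 0"
    proof -
      have "degree p \<le> N" by (rule degree_le) (simp add: cp)
      then have "pev p v = (\<Sum>i\<le>N. s (coeff p i) (h i))" by (rule sumpev)
      also have "\<dots> = (\<Sum>i<N. s (u (h i)) (h i))"
        by (rule sum.mono_neutral_cong_right) (auto simp: cp)
      also have "\<dots> = 0" using u(1) True by (simp add: sum.reindex)
      finally show ?thesis .
    qed
    ultimately show ?thesis by (rule root)
  next
    case False
    then obtain i j where ij: "i < j" "h i = h j" unfolding inj_on_def by (metis linorder_neqE_nat)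
    define p where "p = monom (1::'k) j - monom 1 i"
    have cp: "coeff p l = (if l = j then 1 else 0) - (if l = i then 1 else 0)" for l
      by (simp add: p_def)
    have "coeff p j = 1" using ij by (simp add: cp)
    then have "p \<noteq> 0" by auto
    moreover have "pev p v = 0"
    proof -
      have "degree p \<le> j" by (rule degree_le) (use ij in \<open>simp add: cp\<close>)
      then have "pev p v = (\<Sum>l\<le>j. s (coeff p l) (h l))" by (rule sumpev)
      also have "\<dots> = (\<Sum>l\<in>{i,j}. s (coeff p l) (h l))"
        by (rule sum.mono_neutral_right) (use ij in \<open>auto simp: cp\<close>)
      also have "\<dots> = 0" using ij by (simp add: cp)
      finally show ?thesis .
    qed
    ultimately show ?thesis by (rule root)
  qed
qed

section \<open>Modules over linear categories\<close>

context cat_module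
begin

sublocale mv: vector_space "mscale M" by (rule vector_space)

lemma mob_0: "0 \<in> mob M x" using mv.subspace_0[OF subspace] .
lemma mob_add: "v \<in> mob M x \<Longrightarrow> w \<in> mob M x \<Longrightarrow> v + w \<in> mob M x" using mv.subspace_add[OF subspace] .
lemma mob_diff: "v \<in> mob M x \<Longrightarrow> w \<in> mob M x \<Longrightarrow> v - w \<in> mob M x" using mv.subspace_diff[OF subspace] .
lemma mob_neg: "v \<in> mob M x \<Longrightarrow> - v \<in> mob M x" using mv.subspace_neg[OF subspace] .
lemma mob_scale: "v \<in> mob M x \<Longrightarrow> mscale M c v \<in> mob M x" using mv.subspace_scale[OF subspace] .
lemma mob_sum: "(\<And>i. i \<in> I \<Longrightarrow> h i \<in> mob M x) \<Longrightarrow> (\<Sum>i\<in>I. h i) \<in> mob M x"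
  using mv.subspace_sum[OF subspace] .

lemma
  assumes f: "f \<in> Hom C x y"
  shows act_0: "mact M x y f 0 = 0"
    and act_add: "v \<in> mob M x \<Longrightarrow> w \<in> mob M x \<Longrightarrow> mact M x y f (v + w) = mact M x y f v + mact M x y f w"
    and act_diff: "v \<in> mob M x \<Longrightarrow> w \<in> mob M x \<Longrightarrow> mact M x y f (v - w) = mact M x y f v - mact M x y f w"
    and act_scale: "v \<in> mob M x \<Longrightarrow> mact M x y f (mscale M c v) = mscale M c (mact M x y f v)"
    and act_sum: "(\<And>i. i \<in> I \<Longrightarrow> h i \<in> mob M x) \<Longrightarrow> mact M x y f (\<Sum>i\<in>I. h i) = (\<Sum>i\<in>I. mact M x y f (h i))"
proof -
  note p = linear_map_on_props[OF vector_space vector_space subspace act_linear[OF f]]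
  show "mact M x y f 0 = 0" by (rule p)
  show "v \<in> mob M x \<Longrightarrow> w \<in> mob M x \<Longrightarrow> mact M x y f (v + w) = mact M x y f v + mact M x y f w"
    "v \<in> mob M x \<Longrightarrow> mact M x y f (mscale M c v) = mscale M c (mact M x y f v)"
    using act_linear[OF f] by (simp_all add: linear_map_on_def)
  show "v \<in> mob M x \<Longrightarrow> w \<in> mob M x \<Longrightarrow> mact M x y f (v - w) = mact M x y f v - mact M x y f w"
    by (rule p)
  show "(\<And>i. i \<in> I \<Longrightarrow> h i \<in> mob M x) \<Longrightarrow> mact M x y f (\<Sum>i\<in>I. h i) = (\<Sum>i\<in>I. mact M x y f (h i))"
    by (rule p)
qed

end

section \<open>Submodules, homomorphisms and quotients\<close>

lemma restr_mod_sel [simp]: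
  "mscale (restr_mod M N) = mscale M" "mob (restr_mod M N) = N" "mact (restr_mod M N) = mact M"
  by (simp_all add: restr_mod_def)

lemma subcat_sel [simp]:
  "cscale (subcat C H) = cscale C" "Hom (subcat C H) = H" "cmp (subcat C H) = cmp C" "ident (subcat C H) = ident C"
  by (simp_all add: subcat_def)

lemma submodD:
  assumes M: "cat_module C M" and N: "submod C M N"
  shows submod_subspace: "module.subspace (mscale M) (N x)"
    and submod_le: "v \<in> N x \<Longrightarrow> v \<in> mob M x"
    and submod_act: "f \<in> Hom C x y \<Longrightarrow> v \<in> N x \<Longrightarrow> mact M x y f v \<in> N y"
    and submod_0: "0 \<in> N x"
    and submod_add: "v \<in> N x \<Longrightarrow> w \<in> N x \<Longrightarrow> v + w \<in> N x"
    and submod_diff: "v \<in> N x \<Longrightarrow> w \<in> N x \<Longrightarrow> v - w \<in> N x"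
    and submod_neg: "v \<in> N x \<Longrightarrow> - v \<in> N x"
    and submod_scale: "v \<in> N x \<Longrightarrow> mscale M c v \<in> N x"
    and submod_sum: "(\<And>i. i \<in> I \<Longrightarrow> h i \<in> N x) \<Longrightarrow> (\<Sum>i\<in>I. h i) \<in> N x"
proof -
  interpret cat_module C M by (rule M)
  show s: "module.subspace (mscale M) (N x)" and "v \<in> N x \<Longrightarrow> v \<in> mob M x"
    and "f \<in> Hom C x y \<Longrightarrow> v \<in> N x \<Longrightarrow> mact M x y f v \<in> N y"
    using N by (auto simp: submod_def)
  show "0 \<in> N x" "v \<in> N x \<Longrightarrow> w \<in> N x \<Longrightarrow> v + w \<in> N x" "v \<in> N x \<Longrightarrow> w \<in> N x \<Longrightarrow> v - w \<in> N x"
    "v \<in> N x \<Longrightarrow> - v \<in> N x" "v \<in> N x \<Longrightarrow> mscale M c v \<in> N x"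
    using mv.subspace_0[OF s] mv.subspace_add[OF s] mv.subspace_diff[OF s] mv.subspace_neg[OF s]
      mv.subspace_scale[OF s] by auto
  show "(\<And>i. i \<in> I \<Longrightarrow> h i \<in> N x) \<Longrightarrow> (\<Sum>i\<in>I. h i) \<in> N x"
    by (rule mv.subspace_sum[OF s])
qed

lemma submodI:
  assumes M: "cat_module C M" and "\<And>x v. v \<in> N x \<Longrightarrow> v \<in> mob M x" "\<And>x. 0 \<in> N x"
    and "\<And>x v w. v \<in> N x \<Longrightarrow> w \<in> N x \<Longrightarrow> v + w \<in> N x" "\<And>x c v. v \<in> N x \<Longrightarrow> mscale M c v \<in> N x"
    and "\<And>x y f v. f \<in> Hom C x y \<Longrightarrow> v \<in> N x \<Longrightarrow> mact M x y f v \<in> N y"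
  shows "submod C M N"
proof -
  interpret cat_module C M by (rule M)
  show ?thesis unfolding submod_def mv.subspace_def using assms by (simp add: subset_iff)
qed

lemma cat_module_restr:
  assumes M: "cat_module C M" and N: "submod C M N"
  shows "cat_module C (restr_mod M N)"
proof -
  interpret cat_module C M by (rule M)
  note le = submod_le[OF M N]
  have sub: "N x \<subseteq> mob M x" for x using le by blast
  show ?thesis
    by (rule cat_module.intro)
      (use vector_space submod_subspace[OF M N] submod_act[OF M N] linear_map_on_subset[OF act_linear sub]
        act_linear_left act_ident act_comp le in simp_all)
qed

lemma submod_mob: "cat_module C M \<Longrightarrow> submod C M (mob M)"
  using cat_module.subspace cat_module.act_closed by (fastforce simp: submod_def)

lemma submod_zero: assumes M: "cat_module C M" shows "submod C M zero_sub"
proof -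
  interpret cat_module C M by (rule M)
  show ?thesis by (rule submodI[OF M]) (auto simp: zero_sub_def mob_0 act_0)
qed

lemma submod_restr_eq [simp]: "restr_mod M (mob M) = M" by (simp add: restr_mod_def)

lemma cat_module_subcat:
  assumes M: "cat_module C M" and H: "wide_subcategory C H" and C: "linear_category C"
  shows "cat_module (subcat C H) M"
proof -
  interpret cat_module C M by (rule M)
  have HH: "c \<in> H y y' \<Longrightarrow> c \<in> Hom C y y'" and sub: "H y y' \<subseteq> Hom C y y'" for c y y'
    using H by (auto simp: wide_subcategory_def)
  show ?thesis
    by (rule cat_module.intro)
      (use vector_space subspace act_closed act_linear linear_map_on_subset[OF act_linear_left sub]
        act_ident act_comp HH in simp_all)
qed

lemma linear_category_subcat:
  assumes C: "linear_category C" and H: "wide_subcategory C H"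
  shows "linear_category (subcat C H)"
proof -
  interpret linear_category C by (rule C)
  have HH: "c \<in> H y y' \<Longrightarrow> c \<in> Hom C y y'" and sub: "H y y' \<subseteq> Hom C y y'" for c y y'
    using H by (auto simp: wide_subcategory_def)
  show ?thesis
    by (rule linear_category.intro)
      (use H vector_space linear_map_on_subset[OF comp_linear_left sub]
        linear_map_on_subset[OF comp_linear_right sub] HH comp_assoc ident_left ident_right in
        \<open>simp_all add: wide_subcategory_def\<close>)
qed

lemma submod_subcat: "submod C M N \<Longrightarrow> wide_subcategory C H \<Longrightarrow> submod (subcat C H) M N"
  unfolding submod_def wide_subcategory_def by (simp add: subset_iff)

lemma mod_hom_subcat: "mod_hom C M N \<phi> \<Longrightarrow> wide_subcategory C H \<Longrightarrow> mod_hom (subcat C H) M N \<phi>"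
  unfolding mod_hom_def wide_subcategory_def by (simp add: subset_iff)

lemma mod_homD:
  assumes M: "cat_module C M" and N: "cat_module C N" and \<phi>: "mod_hom C M N \<phi>"
  shows mod_hom_closed: "v \<in> mob M x \<Longrightarrow> \<phi> x v \<in> mob N x"
    and mod_hom_linear: "linear_map_on (mscale M) (mscale N) (mob M x) (\<phi> x)"
    and mod_hom_act: "f \<in> Hom C x y \<Longrightarrow> v \<in> mob M x \<Longrightarrow> \<phi> y (mact M x y f v) = mact N x y f (\<phi> x v)"
    and mod_hom_add: "v \<in> mob M x \<Longrightarrow> w \<in> mob M x \<Longrightarrow> \<phi> x (v + w) = \<phi> x v + \<phi> x w"
    and mod_hom_scale: "v \<in> mob M x \<Longrightarrow> \<phi> x (mscale M c v) = mscale N c (\<phi> x v)"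
    and mod_hom_0: "\<phi> x 0 = 0"
    and mod_hom_diff: "v \<in> mob M x \<Longrightarrow> w \<in> mob M x \<Longrightarrow> \<phi> x (v - w) = \<phi> x v - \<phi> x w"
    and mod_hom_neg: "v \<in> mob M x \<Longrightarrow> \<phi> x (- v) = - \<phi> x v"
    and mod_hom_sum: "(\<And>i. i \<in> I \<Longrightarrow> h i \<in> mob M x) \<Longrightarrow> \<phi> x (\<Sum>i\<in>I. h i) = (\<Sum>i\<in>I. \<phi> x (h i))"
proof -
  show l: "linear_map_on (mscale M) (mscale N) (mob M x) (\<phi> x)" using \<phi> by (simp add: mod_hom_def)
  note p = linear_map_on_props[OF cat_module.vector_space[OF M] cat_module.vector_space[OF N]
      cat_module.subspace[OF M] l]
  show "v \<in> mob M x \<Longrightarrow> \<phi> x v \<in> mob N x"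
    "f \<in> Hom C x y \<Longrightarrow> v \<in> mob M x \<Longrightarrow> \<phi> y (mact M x y f v) = mact N x y f (\<phi> x v)"
    "v \<in> mob M x \<Longrightarrow> w \<in> mob M x \<Longrightarrow> \<phi> x (v + w) = \<phi> x v + \<phi> x w"
    "v \<in> mob M x \<Longrightarrow> \<phi> x (mscale M c v) = mscale N c (\<phi> x v)"
    using \<phi> by (simp_all add: mod_hom_def linear_map_on_def image_subset_iff)
  show "\<phi> x 0 = 0"
    "v \<in> mob M x \<Longrightarrow> w \<in> mob M x \<Longrightarrow> \<phi> x (v - w) = \<phi> x v - \<phi> x w"
    "v \<in> mob M x \<Longrightarrow> \<phi> x (- v) = - \<phi> x v"
    using p(1-3) by blast+
  show "(\<And>i. i \<in> I \<Longrightarrow> h i \<in> mob M x) \<Longrightarrow> \<phi> x (\<Sum>i\<in>I. h i) = (\<Sum>i\<in>I. \<phi> x (h i))"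
    by (rule p(4))
qed

lemma mod_homI:
  assumes "\<And>x v. v \<in> mob M x \<Longrightarrow> \<phi> x v \<in> mob N x"
    and "\<And>x v w. v \<in> mob M x \<Longrightarrow> w \<in> mob M x \<Longrightarrow> \<phi> x (v + w) = \<phi> x v + \<phi> x w"
    and "\<And>x c v. v \<in> mob M x \<Longrightarrow> \<phi> x (mscale M c v) = mscale N c (\<phi> x v)"
    and "\<And>x y f v. f \<in> Hom C x y \<Longrightarrow> v \<in> mob M x \<Longrightarrow> \<phi> y (mact M x y f v) = mact N x y f (\<phi> x v)"
  shows "mod_hom C M N \<phi>"
  using assms by (auto simp: mod_hom_def linear_map_on_def)

lemma mod_hom_comp:
  assumes "mod_hom C M N \<phi>" "mod_hom C N L \<psi>"
  shows "mod_hom C M L (\<lambda>x v. \<psi> x (\<phi> x v))"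
  using assms unfolding mod_hom_def linear_map_on_def by (simp add: image_subset_iff)

lemma mod_hom_id: "cat_module C M \<Longrightarrow> mod_hom C M M (\<lambda>x v. v)"
  by (rule mod_homI) auto

lemma mod_hom_incl: "submod C M N \<Longrightarrow> mod_hom C (restr_mod M N) M (\<lambda>x v. v)"
  by (rule mod_homI) (auto simp: submod_def)

lemma mod_hom_restr_target: "mod_hom C M (restr_mod N A) \<phi> \<longleftrightarrow>
    (\<forall>x. \<phi> x ` mob M x \<subseteq> A x) \<and> mod_hom C M N \<phi>" if "\<And>x. A x \<subseteq> mob N x"
  using that unfolding mod_hom_def restr_mod_sel by (meson subset_trans)

lemma mod_hom_restr_source:
  assumes "cat_module C M" "submod C M A" "mod_hom C M N \<phi>"
  shows "mod_hom C (restr_mod M A) N \<phi>"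
  using mod_hom_comp[OF mod_hom_incl[OF assms(2)] assms(3)] .

lemma mod_hom_zero:
  assumes N: "cat_module C N"
  shows "mod_hom C M N (\<lambda>x v. 0)"
proof -
  interpret N: cat_module C N by (rule N)
  show ?thesis by (rule mod_homI) (simp_all add: N.mob_0 N.act_0)
qed

lemma mod_hom_plus:
  assumes N: "cat_module C N" and M: "cat_module C M" and f: "mod_hom C M N \<phi>" and g: "mod_hom C M N \<psi>"
  shows "mod_hom C M N (\<lambda>x v. \<phi> x v + \<psi> x v)"
proof -
  interpret N: cat_module C N by (rule N)
  show ?thesis
    by (rule mod_homI)
      (simp_all add: mod_homD[OF M N f] mod_homD[OF M N g] N.mob_add N.act_add N.mv.scale_right_distrib)
qed

lemma mod_hom_smult:
  assumes N: "cat_module C N" and M: "cat_module C M" and f: "mod_hom C M N \<phi>"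
  shows "mod_hom C M N (\<lambda>x v. mscale N c (\<phi> x v))"
proof -
  interpret N: cat_module C N by (rule N)
  show ?thesis
    by (rule mod_homI)
      (simp_all add: mod_homD[OF M N f] N.mob_scale N.act_scale N.mv.scale_right_distrib N.mv.scale_left_commute)
qed

lemma mod_hom_minus:
  assumes N: "cat_module C N" and M: "cat_module C M" and f: "mod_hom C M N \<phi>" and g: "mod_hom C M N \<psi>"
  shows "mod_hom C M N (\<lambda>x v. \<phi> x v - \<psi> x v)"
proof -
  interpret N: cat_module C N by (rule N)
  show ?thesis
    by (rule mod_homI)
      (simp_all add: mod_homD[OF M N f] mod_homD[OF M N g] N.mob_diff N.act_diff N.mv.scale_right_diff_distrib)
qed

lemma mod_hom_setsum:
  assumes N: "cat_module C N" and M: "cat_module C M" and f: "\<And>i. i \<in> I \<Longrightarrow> mod_hom C M N (\<phi> i)"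
  shows "mod_hom C M N (\<lambda>x v. \<Sum>i\<in>I. \<phi> i x v)"
  using f
proof (induction I rule: infinite_finite_induct)
  case (insert i I)
  then show ?case using mod_hom_plus[OF N M, of "\<phi> i"] by simp
qed (use mod_hom_zero[OF N] in simp_all)

lemma mod_hom_cong:
  assumes M: "cat_module C M" and "\<And>x v. v \<in> mob M x \<Longrightarrow> \<phi> x v = \<psi> x v"
  shows "mod_hom C M N \<phi> \<longleftrightarrow> mod_hom C M N \<psi>"
proof -
  interpret M: cat_module C M by (rule M)
  show ?thesis using assms(2) M.mob_add M.mob_scale M.act_closed
    unfolding mod_hom_def linear_map_on_def by (simp add: image_subset_iff)
qed

lemma submod_preimage:
  assumes M: "cat_module C M" and N: "cat_module C N" and f: "mod_hom C M N \<phi>" and B: "submod C N B"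
  shows "submod C M (\<lambda>x. {v \<in> mob M x. \<phi> x v \<in> B x})"
proof -
  interpret M: cat_module C M by (rule M)
  show ?thesis
    by (rule submodI[OF M])
      (simp_all add: mod_homD[OF M N f] M.mob_0 M.mob_add M.mob_scale M.act_closed submodD[OF N B])
qed

lemma submod_kernel:
  assumes M: "cat_module C M" and N: "cat_module C N" and f: "mod_hom C M N \<phi>"
  shows "submod C M (\<lambda>x. {v \<in> mob M x. \<phi> x v = 0})"
  using submod_preimage[OF M N f submod_zero[OF N]] by (simp add: zero_sub_def)

lemma submod_image:
  assumes M: "cat_module C M" and N: "cat_module C N" and f: "mod_hom C M N \<phi>" and A: "submod C M A"
  shows "submod C N (\<lambda>x. \<phi> x ` A x)"
proof -
  interpret N: cat_module C N by (rule N)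
  interpret M: cat_module C M by (rule M)
  note a = submodD[OF M A]
  show ?thesis
  proof (rule submodI[OF N])
    show "v \<in> \<phi> x ` A x \<Longrightarrow> v \<in> mob N x" for x v using a(2) mod_hom_closed[OF M N f] by blast
    show "0 \<in> \<phi> x ` A x" for x using a(4) mod_hom_0[OF M N f] by (metis imageI)
    show "v \<in> \<phi> x ` A x \<Longrightarrow> w \<in> \<phi> x ` A x \<Longrightarrow> v + w \<in> \<phi> x ` A x" for x v w
      by (auto simp: mod_hom_add[OF M N f a(2) a(2), symmetric] intro!: imageI a(5))
    show "v \<in> \<phi> x ` A x \<Longrightarrow> mscale N c v \<in> \<phi> x ` A x" for x v c
      by (auto simp: mod_hom_scale[OF M N f a(2), symmetric] intro!: imageI a(8))
    show "h \<in> Hom C x y \<Longrightarrow> v \<in> \<phi> x ` A x \<Longrightarrow> mact N x y h v \<in> \<phi> y ` A y" for x y h v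
      by (auto simp: mod_hom_act[OF M N f _ a(2), symmetric] intro!: imageI a(3))
  qed
qed

definition sub_sum :: "('o \<Rightarrow> 'v::plus set) \<Rightarrow> ('o \<Rightarrow> 'v set) \<Rightarrow> 'o \<Rightarrow> 'v set" where
  "sub_sum A B x = {a + b | a b. a \<in> A x \<and> b \<in> B x}"

lemma sub_sumI: "a \<in> A x \<Longrightarrow> b \<in> B x \<Longrightarrow> a + b \<in> sub_sum A B x"
  by (auto simp: sub_sum_def)

lemma submod_sub_sum:
  assumes M: "cat_module C M" and A: "submod C M A" and B: "submod C M B"
  shows "submod C M (sub_sum A B)" "A \<le> sub_sum A B" "B \<le> sub_sum A B"
proof -
  interpret M: cat_module C M by (rule M)
  note a = submodD[OF M A] and b = submodD[OF M B]
  have s: "a + b + (a' + b') \<in> sub_sum A B x" if "a \<in> A x" "b \<in> B x" "a' \<in> A x" "b' \<in> B x" for a b a' b' x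
    using sub_sumI[of "a + a'" A x "b + b'" B] a(5)[OF that(1,3)] b(5)[OF that(2,4)]
    by (simp add: algebra_simps)
  show "submod C M (sub_sum A B)"
  proof (rule submodI[OF M])
    show "v \<in> mob M x" if "v \<in> sub_sum A B x" for v x
      using that by (auto simp: sub_sum_def a(2) b(2) M.mob_add)
    show "0 \<in> sub_sum A B x" for x using sub_sumI[of 0 A x 0 B] a(4) b(4) by simp
    show "v + w \<in> sub_sum A B x" if vw: "v \<in> sub_sum A B x" "w \<in> sub_sum A B x" for v w x
    proof -
      obtain p q p' q' where "v = p + q" "p \<in> A x" "q \<in> B x" "w = p' + q'" "p' \<in> A x" "q' \<in> B x"
        using vw unfolding sub_sum_def by blast
      then show ?thesis using s by simp
    qed
    show "mscale M c v \<in> sub_sum A B x" if v: "v \<in> sub_sum A B x" for v c x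
    proof -
      obtain p q where "v = p + q" "p \<in> A x" "q \<in> B x" using v by (auto simp: sub_sum_def)
      then show ?thesis using sub_sumI[of _ A x _ B, OF a(8) b(8)] by (simp add: M.mv.scale_right_distrib)
    qed
    show "mact M x y f v \<in> sub_sum A B y" if f: "f \<in> Hom C x y" and v: "v \<in> sub_sum A B x" for v f x y
    proof -
      obtain p q where "v = p + q" "p \<in> A x" "q \<in> B x" using v by (auto simp: sub_sum_def)
      then show ?thesis using f sub_sumI[of _ A y _ B, OF a(3) b(3)] by (simp add: M.act_add a(2) b(2))
    qed
  qed
  show "A \<le> sub_sum A B"
    using sub_sumI[of _ A _ 0 B] b(4) by (auto simp: le_fun_def)
  show "B \<le> sub_sum A B"
    using sub_sumI[of 0 A _ _ B] a(4) by (auto simp: le_fun_def)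
qed

text \<open>The quotient lives on the images of linear projections \<open>p x\<close> with kernel
  \<open>N x\<close>, every action being followed by the projection. It keeps the value type of
  \<open>M\<close>; this matters in \<open>projective_lift_prop\<close>, where the quotient has to
  live on the type over which projectivity is tested.\<close>

lemma quotient_exists:
  fixes M :: "('o, 'm::ab_group_add, 'k::field, 'v::ab_group_add) cmod"
  assumes M: "cat_module C M" and N: "submod C M N"
  shows "\<exists>(Q :: ('o, 'm, 'k, 'v) cmod) \<pi>. cat_module C Q \<and> surj_hom C M Q \<pi> \<and>
    (\<forall>x. \<forall>v\<in>mob M x. \<pi> x v = 0 \<longleftrightarrow> v \<in> N x)"
proof -
  interpret M: cat_module C M by (rule M)
  note n = submodD[OF M N]
  obtain p where p: "Vector_Spaces.linear (mscale M) (mscale M) (p x)" "p x v = 0 \<longleftrightarrow> v \<in> N x" "v - p x v \<in> N x" for x v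
    using linear_complement_projection[OF M.vector_space n(1)] by metis
  have pl: "p x (v + w) = p x v + p x w" "p x (mscale M c v) = mscale M c (p x v)" "p x (v - w) = p x v - p x w" for x v w c
  proof -
    interpret p: Vector_Spaces.linear "mscale M" "mscale M" "p x" by (rule p(1))
    show "p x (v + w) = p x v + p x w" "p x (mscale M c v) = mscale M c (p x v)" "p x (v - w) = p x v - p x w"
      by (simp_all add: p.add p.scale p.diff)
  qed
  have pM: "p x v \<in> mob M x" if "v \<in> mob M x" for x v
    using M.mob_diff[OF that n(2)[OF p(3)[where v=v and x=x]]] by simp
  have key: "p y (mact M x y f (p x v)) = p y (mact M x y f v)" if "f \<in> Hom C x y" "v \<in> mob M x" for x y f v
  proof -
    have "p y (mact M x y f (v - p x v)) = 0" using that n(3) p(2,3) by blast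
    then show ?thesis using that by (simp add: M.act_diff pM pl)
  qed
  define Q where "Q = M\<lparr>mob := (\<lambda>x. p x ` mob M x), mact := (\<lambda>x y f v. p y (mact M x y f v))\<rparr>"
  have Qs [simp]: "mscale Q = mscale M" "mob Q = (\<lambda>x. p x ` mob M x)" "mact Q = (\<lambda>x y f v. p y (mact M x y f v))"
    by (simp_all add: Q_def)
  have idem: "p x (p x v) = p x v" for x v using p(2)[of x "v - p x v"] p(3)[of v x] pl(3)[of x v "p x v"] p(2)[of x "v - p x v"] by simp
  have "cat_module C Q"
  proof (rule cat_module.intro)
    show "vector_space (mscale Q)" using M.vector_space by simp
    show "module.subspace (mscale Q) (mob Q x)" for x
      using subspace_image_on[OF M.vector_space M.vector_space M.subspace[of x], where f = "p x"] pl by (simp add: linear_map_on_def)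
    show "linear_map_on (mscale Q) (mscale Q) (mob Q x) (mact Q x y f)" if "f \<in> Hom C x y" for x y f
      using that pM by (auto simp: linear_map_on_def M.act_add M.act_scale pl)
    show "linear_map_on (cscale C) (mscale Q) (Hom C x y) (\<lambda>f. mact Q x y f v)" if "v \<in> mob Q x" for x y v
      using M.act_linear_left[of v x y] that pM by (auto simp: linear_map_on_def pl)
    show "mact Q x x (ident C x) v = v" if "v \<in> mob Q x" for x v
      using that pM by (auto simp: M.act_ident idem)
    show "mact Q x z (cmp C x y z g f) v = mact Q y z g (mact Q x y f v)"
      if "f \<in> Hom C x y" "g \<in> Hom C y z" "v \<in> mob Q x" for x y z f g v
    proof -
      have "v \<in> mob M x" using that(3) pM by auto
      then show ?thesis using that(1,2) by (simp add: M.act_comp M.act_closed key[OF that(2) M.act_closed])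
    qed
  qed (use pM M.act_closed in auto)
  moreover have "surj_hom C M Q p"
    unfolding surj_hom_def mod_hom_def using key by (auto simp: linear_map_on_def pl)
  ultimately show ?thesis using p(2) by (intro exI[of _ Q] exI[of _ p]) simp
qed

lemma hom_factor:
  assumes M: "cat_module C M" and Q: "cat_module C Q" and X: "cat_module C X"
    and \<pi>: "surj_hom C M Q \<pi>" and \<phi>: "mod_hom C M X \<phi>"
    and k: "\<And>x v. v \<in> mob M x \<Longrightarrow> \<pi> x v = 0 \<Longrightarrow> \<phi> x v = 0"
  shows "\<exists>\<chi>. mod_hom C Q X \<chi> \<and> (\<forall>x. \<forall>v\<in>mob M x. \<chi> x (\<pi> x v) = \<phi> x v)"
proof -
  interpret M: cat_module C M by (rule M)
  interpret X: cat_module C X by (rule X)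
  have \<pi>': "mod_hom C M Q \<pi>" and s: "\<pi> x ` mob M x = mob Q x" for x using \<pi> by (auto simp: surj_hom_def)
  define \<chi> where "\<chi> x q = \<phi> x (SOME v. v \<in> mob M x \<and> \<pi> x v = q)" for x q
  have \<chi>: "\<chi> x (\<pi> x v) = \<phi> x v" if v: "v \<in> mob M x" for x v
  proof -
    define w where "w = (SOME w. w \<in> mob M x \<and> \<pi> x w = \<pi> x v)"
    have w: "w \<in> mob M x" "\<pi> x w = \<pi> x v"
      using someI[of "\<lambda>w. w \<in> mob M x \<and> \<pi> x w = \<pi> x v" v] v unfolding w_def by auto
    have "\<phi> x (w - v) = 0"
      using w v by (intro k) (simp_all add: M.mob_diff mod_hom_diff[OF M Q \<pi>'])
    then show ?thesis using w v by (simp add: \<chi>_def w_def[symmetric] mod_hom_diff[OF M X \<phi>])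
  qed
  have ex: "\<exists>v\<in>mob M x. q = \<pi> x v" if "q \<in> mob Q x" for q x using s that by blast
  have "mod_hom C Q X \<chi>"
  proof (rule mod_homI)
    fix x q assume "q \<in> mob Q x"
    then obtain v where v: "v \<in> mob M x" "q = \<pi> x v" using ex by blast
    show "\<chi> x q \<in> mob X x" using v \<chi> mod_hom_closed[OF M X \<phi>] by simp
    show "\<chi> x (mscale Q c q) = mscale X c (\<chi> x q)" for c
      using v \<chi> mod_hom_scale[OF M X \<phi>] mod_hom_scale[OF M Q \<pi>'] M.mob_scale by metis
    show "\<chi> y (mact Q x y f q) = mact X x y f (\<chi> x q)" if "f \<in> Hom C x y" for f y
      using that v \<chi> mod_hom_act[OF M X \<phi>] mod_hom_act[OF M Q \<pi>'] M.act_closed by metis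
    fix r assume "r \<in> mob Q x"
    then obtain w where w: "w \<in> mob M x" "r = \<pi> x w" using ex by blast
    show "\<chi> x (q + r) = \<chi> x q + \<chi> x r"
      using v w \<chi> mod_hom_add[OF M X \<phi>] mod_hom_add[OF M Q \<pi>'] M.mob_add by metis
  qed
  then show ?thesis using \<chi> by blast
qed

lemma mod_hom_inverse:
  assumes M: "cat_module C M" and N: "cat_module C N" and \<phi>: "mod_hom C M N \<phi>"
    and b: "\<And>x. bij_betw (\<phi> x) (mob M x) (mob N x)"
  shows "\<exists>\<psi>. mod_hom C N M \<psi> \<and> (\<forall>x. bij_betw (\<psi> x) (mob N x) (mob M x)) \<and>
    (\<forall>x. \<forall>v\<in>mob M x. \<psi> x (\<phi> x v) = v) \<and> (\<forall>x. \<forall>w\<in>mob N x. \<phi> x (\<psi> x w) = w)"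
proof -
  have inj: "inj_on (\<phi> x) (mob M x)" and im: "\<phi> x ` mob M x = mob N x" for x
    using b by (auto simp: bij_betw_def)
  have "surj_hom C M N \<phi>" using \<phi> im by (simp add: surj_hom_def)
  moreover have "v = 0" if "v \<in> mob M x" "\<phi> x v = 0" for x v
    using inj_onD[OF inj[of x], of v 0] that mod_hom_0[OF M N \<phi>, of x] cat_module.mob_0[OF M, of x] by simp
  ultimately obtain \<psi> where \<psi>: "mod_hom C N M \<psi>" "\<And>x v. v \<in> mob M x \<Longrightarrow> \<psi> x (\<phi> x v) = v"
    using hom_factor[OF M N M _ mod_hom_id[OF M], of \<phi>] by blast
  have 2: "\<phi> x (\<psi> x w) = w" if "w \<in> mob N x" for x w using that im[of x] \<psi>(2) by force
  have "bij_betw (\<psi> x) (mob N x) (mob M x)" for x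
    by (rule bij_betw_byWitness[where f' = "\<phi> x"])
      (use 2 \<psi>(2) mod_hom_closed[OF M N \<phi>] mod_hom_closed[OF N M \<psi>(1)] in auto)
  with \<psi> 2 show ?thesis by blast
qed

lemma isomorphic_sym:
  assumes M: "cat_module C M" and N: "cat_module C N" and "isomorphic C M N"
  shows "isomorphic C N M"
proof -
  obtain \<phi> where \<phi>: "mod_hom C M N \<phi>" "\<And>x. bij_betw (\<phi> x) (mob M x) (mob N x)"
    using assms(3) by (auto simp: isomorphic_def)
  show ?thesis using mod_hom_inverse[OF M N \<phi>] unfolding isomorphic_def by blast
qed

lemma isomorphic_refl: "cat_module C M \<Longrightarrow> isomorphic C M M"
  unfolding isomorphic_def using mod_hom_id by (intro exI[of _ "\<lambda>x v. v"]) (auto simp: bij_betw_def)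

lemma isomorphic_trans:
  assumes "isomorphic C M N" "isomorphic C N L"
  shows "isomorphic C M L"
proof -
  obtain \<phi> \<psi> where \<phi>: "mod_hom C M N \<phi>" "\<And>x. bij_betw (\<phi> x) (mob M x) (mob N x)"
    and \<psi>: "mod_hom C N L \<psi>" "\<And>x. bij_betw (\<psi> x) (mob N x) (mob L x)"
    using assms by (auto simp: isomorphic_def)
  show ?thesis unfolding isomorphic_def
    using mod_hom_comp[OF \<phi>(1) \<psi>(1)] bij_betw_trans[OF \<phi>(2) \<psi>(2)] by (auto simp: comp_def)
qed

lemma mod_hom_inj_iff:
  assumes M: "cat_module C M" and N: "cat_module C N" and \<phi>: "mod_hom C M N \<phi>"
  shows "inj_on (\<phi> x) (mob M x) \<longleftrightarrow> (\<forall>v\<in>mob M x. \<phi> x v = 0 \<longrightarrow> v = 0)"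
proof
  interpret M: cat_module C M by (rule M)
  show "\<forall>v\<in>mob M x. \<phi> x v = 0 \<longrightarrow> v = 0" if "inj_on (\<phi> x) (mob M x)"
    using inj_onD[OF that, of _ 0] mod_hom_0[OF M N \<phi>, of x] M.mob_0[of x] by simp
  assume *: "\<forall>v\<in>mob M x. \<phi> x v = 0 \<longrightarrow> v = 0"
  show "inj_on (\<phi> x) (mob M x)"
  proof (rule inj_onI)
    fix v w assume vw: "v \<in> mob M x" "w \<in> mob M x" "\<phi> x v = \<phi> x w"
    then have "\<phi> x (v - w) = 0" using mod_hom_diff[OF M N \<phi>] by simp
    then show "v = w" using * vw M.mob_diff by force
  qed
qed

section \<open>Simple modules and Schur's lemma\<close>

lemma simple_modD:
  assumes "simple_mod C M"
  shows simple_cat_module: "cat_module C M" and simple_nonzero: "mob M \<noteq> zero_sub"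
    and simple_submod: "submod C M N \<Longrightarrow> N = zero_sub \<or> N = mob M"
  using assms by (auto simp: simple_mod_def)

lemma simple_hom_inj:
  assumes M: "simple_mod C M" and N: "cat_module C N" and \<phi>: "mod_hom C M N \<phi>"
    and nz: "v \<in> mob M x" "\<phi> x v \<noteq> 0"
  shows "w \<in> mob M y \<Longrightarrow> \<phi> y w = 0 \<Longrightarrow> w = 0"
proof -
  have "(\<lambda>x. {v \<in> mob M x. \<phi> x v = 0}) = zero_sub"
    using simple_submod[OF M submod_kernel[OF simple_cat_module[OF M] N \<phi>]] nz
    by (metis (mono_tags, lifting) mem_Collect_eq)
  then show "w \<in> mob M y \<Longrightarrow> \<phi> y w = 0 \<Longrightarrow> w = 0" by (auto simp: fun_eq_iff zero_sub_def)
qed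

lemma simple_hom_surj:
  assumes N: "simple_mod C N" and M: "cat_module C M" and \<phi>: "mod_hom C M N \<phi>"
    and nz: "v \<in> mob M x" "\<phi> x v \<noteq> 0"
  shows "surj_hom C M N \<phi>"
proof -
  have "(\<lambda>x. \<phi> x ` mob M x) \<noteq> zero_sub" using nz by (auto simp: fun_eq_iff zero_sub_def)
  then have "(\<lambda>x. \<phi> x ` mob M x) = mob N"
    using simple_submod[OF N submod_image[OF M simple_cat_module[OF N] \<phi> submod_mob[OF M]]] by blast
  then show ?thesis using \<phi> by (auto simp: surj_hom_def fun_eq_iff)
qed

lemma simple_hom_iso:
  assumes M: "simple_mod C M" and N: "simple_mod C N" and \<phi>: "mod_hom C M N \<phi>"
    and nz: "v \<in> mob M x" "\<phi> x v \<noteq> 0"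
  shows "bij_betw (\<phi> y) (mob M y) (mob N y)"
  using simple_hom_surj[OF N simple_cat_module[OF M] \<phi> nz] simple_hom_inj[OF M simple_cat_module[OF N] \<phi> nz]
    mod_hom_inj_iff[OF simple_cat_module[OF M] simple_cat_module[OF N] \<phi>]
  by (auto simp: bij_betw_def surj_hom_def)

lemma mob_nonzero_iff: "cat_module C M \<Longrightarrow> mob M \<noteq> zero_sub \<longleftrightarrow> (\<exists>x. \<exists>v\<in>mob M x. v \<noteq> 0)"
  using cat_module.mob_0 by (fastforce simp: fun_eq_iff zero_sub_def)

lemma simple_mod_iso:
  assumes M: "simple_mod C M" and N: "cat_module C N" and "isomorphic C M N"
  shows "simple_mod C N"
proof -
  note Mc = simple_cat_module[OF M]
  obtain \<phi> where \<phi>: "mod_hom C M N \<phi>" "\<And>x. bij_betw (\<phi> x) (mob M x) (mob N x)"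
    using assms(3) by (auto simp: isomorphic_def)
  obtain \<psi> where \<psi>: "mod_hom C N M \<psi>" "\<And>x. bij_betw (\<psi> x) (mob N x) (mob M x)"
    "\<And>x v. v \<in> mob M x \<Longrightarrow> \<psi> x (\<phi> x v) = v" "\<And>x w. w \<in> mob N x \<Longrightarrow> \<phi> x (\<psi> x w) = w"
    using mod_hom_inverse[OF Mc N \<phi>] by blast
  obtain x v where v: "v \<in> mob M x" "v \<noteq> 0" using simple_nonzero[OF M] mob_nonzero_iff[OF Mc] by blast
  have "\<phi> x v \<noteq> 0" using v \<psi>(3)[OF v(1)] mod_hom_0[OF N Mc \<psi>(1)] by metis
  then have nz: "mob N \<noteq> zero_sub" using mob_nonzero_iff[OF N] mod_hom_closed[OF Mc N \<phi>(1) v(1)] by blast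
  have "A = zero_sub \<or> A = mob N" if A: "submod C N A" for A
  proof -
    have i: "(\<lambda>x. \<psi> x ` A x) = zero_sub \<or> (\<lambda>x. \<psi> x ` A x) = mob M"
      using simple_submod[OF M submod_image[OF N Mc \<psi>(1) A]] .
    have "A x = \<phi> x ` \<psi> x ` A x" for x
      using \<psi>(4) submod_le[OF N A] by force
    then show ?thesis using i \<phi>(2) mod_hom_0[OF Mc N \<phi>(1)]
      by (auto simp: fun_eq_iff zero_sub_def bij_betw_def)
  qed
  then show ?thesis using N nz by (auto simp: simple_mod_def)
qed

text \<open>An eigenvector at a single object is enough: the kernel of \<open>\<phi> - c\<close> is
  then a non-zero submodule of a simple module, hence everything.\<close>

lemma simple_endo_scalar:
  fixes M :: "('o, 'm::ab_group_add, 'k::alg_closed_field, 'v::ab_group_add) cmod"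
  assumes M: "simple_mod C M" and fd: "pointwise_finite M" and \<phi>: "mod_hom C M M \<phi>"
  shows "\<exists>c. \<forall>x. \<forall>v\<in>mob M x. \<phi> x v = mscale M c v"
proof -
  note Mc = simple_cat_module[OF M]
  interpret M: cat_module C M by (rule Mc)
  obtain x v where v: "v \<in> mob M x" "v \<noteq> 0" using simple_nonzero[OF M] mob_nonzero_iff[OF Mc] by blast
  have fdx: "fin_dim (mscale M) (mob M x)" and im: "\<phi> x ` mob M x \<subseteq> mob M x"
    using fd mod_hom_closed[OF Mc Mc \<phi>] by (auto simp: pointwise_finite_def)
  obtain c w where w: "w \<in> mob M x" "w \<noteq> 0" "\<phi> x w = mscale M c w"
    using linear_eigenvector[OF M.vector_space M.subspace fdx mod_hom_linear[OF Mc Mc \<phi>] im v] by auto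
  let ?h = "\<lambda>x v. \<phi> x v - mscale M c v"
  have h: "mod_hom C M M ?h"
    using mod_hom_minus[OF Mc Mc \<phi> mod_hom_smult[OF Mc Mc mod_hom_id[OF Mc]]] .
  have "?h y u = 0" if "u \<in> mob M y" for y u
    using simple_hom_inj[OF M Mc h that, of w x] w by force
  then show ?thesis by auto
qed

section \<open>Lifting properties and direct sums\<close>

definition rep :: "('o, 'm, 'k) lincat \<Rightarrow> 'o \<Rightarrow> ('o, 'm, 'k, 'm) cmod" where
  "rep C x = \<lparr>mscale = cscale C, mob = Hom C x, mact = cmp C x\<rparr>"

lemma rep_sel [simp]: "mscale (rep C x) = cscale C" "mob (rep C x) = Hom C x" "mact (rep C x) = cmp C x"
  by (simp_all add: rep_def)

lemma cat_module_rep: assumes C: "linear_category C" shows "cat_module C (rep C x)"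
proof -
  interpret linear_category C by (rule C)
  show ?thesis
    by (rule cat_module.intro)
      (use vector_space subspace comp_closed comp_linear_left comp_linear_right comp_assoc ident_left in simp_all)
qed

lemma yoneda_hom:
  assumes C: "linear_category C" and M: "cat_module C M" and v: "v \<in> mob M x"
  shows "mod_hom C (rep C x) M (\<lambda>y f. mact M x y f v)"
proof -
  interpret linear_category C by (rule C)
  interpret M: cat_module C M by (rule M)
  show ?thesis
    by (rule mod_homI)
      (use v M.act_closed M.act_linear_left[OF v] M.act_comp in \<open>simp_all add: linear_map_on_def\<close>)
qed

text \<open>Projectivity with respect to one given pair of modules. HOL cannot quantify over value
  types, so each instance is obtained at its own types; the relative form also expresses lifting
  along the maps from \<open>\<Delta> \<nu>\<close> to \<open>S0 \<nu>\<close> over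
  \<open>U\<close>.\<close>

definition lift_prop ::
  "('o, 'm, 'k::field) lincat \<Rightarrow> ('o, 'm, 'k, 'u::ab_group_add) cmod \<Rightarrow>
   ('o, 'm, 'k, 'v::ab_group_add) cmod \<Rightarrow> ('o, 'm, 'k, 'w::ab_group_add) cmod \<Rightarrow> bool" where
  "lift_prop C P A B \<longleftrightarrow> (\<forall>\<pi> \<phi>. surj_hom C A B \<pi> \<and> mod_hom C P B \<phi> \<longrightarrow>
     (\<exists>\<psi>. mod_hom C P A \<psi> \<and> (\<forall>x. \<forall>v\<in>mob P x. \<pi> x (\<psi> x v) = \<phi> x v)))"

lemma lift_propD:
  assumes "lift_prop C P A B" "surj_hom C A B \<pi>" "mod_hom C P B \<phi>"
  shows "\<exists>\<psi>. mod_hom C P A \<psi> \<and> (\<forall>x. \<forall>v\<in>mob P x. \<pi> x (\<psi> x v) = \<phi> x v)"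
  using assms unfolding lift_prop_def by blast

lemma projective_iff_lift_prop:
  "projective C (P :: ('o, 'm::ab_group_add, 'k::field, 'v::ab_group_add) cmod) \<longleftrightarrow> cat_module C P \<and>
    (\<forall>(A :: ('o, 'm, 'k, 'o \<times> 'v \<Rightarrow> 'm) cmod) (B :: ('o, 'm, 'k, 'o \<times> 'v \<Rightarrow> 'm) cmod).
      cat_module C A \<longrightarrow> cat_module C B \<longrightarrow> lift_prop C P A B)"
  unfolding projective_def lift_prop_def by blast

lemma lift_prop_retract:
  assumes Q: "lift_prop C Q A B" and i: "mod_hom C P Q \<iota>" and p: "mod_hom C Q P \<rho>"
    and r: "\<And>x v. v \<in> mob P x \<Longrightarrow> \<rho> x (\<iota> x v) = v"
  shows "lift_prop C P A B"
  unfolding lift_prop_def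
proof (intro allI impI, elim conjE)
  fix \<pi> \<phi> assume \<pi>: "surj_hom C A B \<pi>" and \<phi>: "mod_hom C P B \<phi>"
  obtain \<psi> where \<psi>: "mod_hom C Q A \<psi>" "\<And>x v. v \<in> mob Q x \<Longrightarrow> \<pi> x (\<psi> x v) = \<phi> x (\<rho> x v)"
    using lift_propD[OF Q \<pi> mod_hom_comp[OF p \<phi>]] by blast
  have "\<iota> x v \<in> mob Q x" if "v \<in> mob P x" for x v
    using i that by (auto simp: mod_hom_def)
  then show "\<exists>\<psi>. mod_hom C P A \<psi> \<and> (\<forall>x. \<forall>v\<in>mob P x. \<pi> x (\<psi> x v) = \<phi> x v)"
    using mod_hom_comp[OF i \<psi>(1)] \<psi>(2) r by (intro exI[of _ "\<lambda>x v. \<psi> x (\<iota> x v)"]) auto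
qed

text \<open>By Yoneda a map out of \<open>rep C x\<close> is given by the image of the identity, so
  it suffices to lift that one element.\<close>

lemma lift_prop_rep:
  fixes A :: "('o, 'm::ab_group_add, 'k::field, 'v::ab_group_add) cmod"
  assumes C: "linear_category C" and A: "cat_module C A" and B: "cat_module C B"
  shows "lift_prop C (rep C x) A B"
  unfolding lift_prop_def
proof (intro allI impI, elim conjE)
  interpret linear_category C by (rule C)
  interpret A: cat_module C A by (rule A)
  fix \<pi> \<phi> assume \<pi>: "surj_hom C A B \<pi>" and \<phi>: "mod_hom C (rep C x) B \<phi>"
  have \<pi>': "mod_hom C A B \<pi>" and s: "\<pi> x ` mob A x = mob B x" using \<pi> by (auto simp: surj_hom_def)
  have "\<phi> x (ident C x) \<in> mob B x" using mod_hom_closed[OF cat_module_rep[OF C] B \<phi>, of "ident C x" x] ident_closed by simp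
  then obtain a where a: "a \<in> mob A x" "\<pi> x a = \<phi> x (ident C x)" using s by force
  have "\<pi> y (mact A x y f a) = \<phi> y f" if "f \<in> Hom C x y" for y f
    using mod_hom_act[OF A B \<pi>' that a(1)] mod_hom_act[OF cat_module_rep[OF C] B \<phi> that, of "ident C x"]
      ident_closed ident_right[OF that] a(2) by simp
  then show "\<exists>\<psi>. mod_hom C (rep C x) A \<psi> \<and> (\<forall>y. \<forall>v\<in>mob (rep C x) y. \<pi> y (\<psi> y v) = \<phi> y v)"
    using yoneda_hom[OF C A a(1)] by (intro exI[of _ "\<lambda>y f. mact A x y f a"]) auto
qed

section \<open>Direct sums\<close>

lemma dir_sum_sel:
  "i \<in> I \<Longrightarrow> mscale (dir_sum I N) c h i = mscale (N i) c (h i)"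
  "h \<in> mob (dir_sum I N) x \<longleftrightarrow> (\<forall>i\<in>I. h i \<in> mob (N i) x) \<and> (\<forall>i. i \<notin> I \<longrightarrow> h i = 0) \<and> finite {i. h i \<noteq> 0}"
  "mact (dir_sum I N) x y f h = (\<lambda>i. if i \<in> I then mact (N i) x y f (h i) else 0)"
  by (simp_all add: dir_sum_def)

text \<open>Outside \<open>I\<close> the scalar multiplication is
  \<open>SOME s. vector_space s\<close>, which is known to fix 0 once some vector space structure on
  the value type exists. The same assumption, named \<open>ex\<close>, accompanies the later lemmas
  on direct sums.\<close>

lemma dir_sum_scale_out:
  fixes N :: "'i \<Rightarrow> ('o, 'm, 'k::field, 'v::ab_group_add) cmod"
  assumes "\<exists>s :: 'k \<Rightarrow> 'v \<Rightarrow> 'v. vector_space s" and "h i = 0"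
    and N: "i \<in> I \<Longrightarrow> vector_space (mscale (N i))"
  shows "mscale (dir_sum I N) c h i = 0"
proof -
  have *: "s c 0 = 0" if "vector_space s" for s :: "'k \<Rightarrow> 'v \<Rightarrow> 'v"
  proof -
    interpret vector_space s by fact
    show ?thesis by simp
  qed
  show ?thesis using assms(2) *[OF someI_ex[OF assms(1)]] *[OF N] by (simp add: dir_sum_def)
qed

lemma cat_module_dir_sum:
  fixes N :: "'i \<Rightarrow> ('o, 'm::ab_group_add, 'k::field, 'v::ab_group_add) cmod"
  assumes ex: "\<exists>s :: 'k \<Rightarrow> 'v \<Rightarrow> 'v. vector_space s" and N: "\<And>i. i \<in> I \<Longrightarrow> cat_module C (N i)"
  shows "cat_module C (dir_sum I N)"
proof -
  let ?S = "dir_sum I N"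
  let ?s = "\<lambda>i. if i \<in> I then mscale (N i) else (SOME s. vector_space s)"
  have sc: "mscale ?S c h i = ?s i c (h i)" for c h i by (simp add: dir_sum_def)
  have vs: "vector_space (?s i)" for i using someI_ex[OF ex] cat_module.vector_space[OF N] by auto
  note va = vector_space.vector_space_assms[OF vs]
  have vec: "vector_space (mscale ?S)"
    by unfold_locales (rule ext, simp only: sc plus_fun_apply va)+
  note VN = cat_module.vector_space[OF N]
  have out: "mscale ?S c h i = 0" if "h i = 0" for c h i
    by (intro dir_sum_scale_out ex that VN)
  interpret V: vector_space "mscale ?S" by (rule vec)
  have fin: "finite {i. (h + h') i \<noteq> 0}" if "finite {i. h i \<noteq> (0::'v)}" "finite {i. h' i \<noteq> 0}" for h h'
    by (rule finite_subset[OF _ finite_UnI[OF that]]) auto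
  have fin2: "finite {i. mscale ?S c h i \<noteq> 0}" if "finite {i. h i \<noteq> 0}" for h c
    by (rule finite_subset[OF _ that]) (use out in auto)
  have fin3: "finite {i. (if i \<in> I then mact (N i) x y f (h i) else 0) \<noteq> 0}"
    if "finite {i. h i \<noteq> 0}" "f \<in> Hom C x y" for h x y f
    by (rule finite_subset[OF _ that(1)]) (use cat_module.act_0[OF N that(2)] in auto)
  have sub: "V.subspace (mob ?S x)" for x
    unfolding V.subspace_def
  proof (intro conjI ballI allI)
    show "0 \<in> mob ?S x" using cat_module.mob_0[OF N] by (simp add: dir_sum_sel)
    fix h h' assume h: "h \<in> mob ?S x" and h': "h' \<in> mob ?S x"
    show "h + h' \<in> mob ?S x" using h h' fin cat_module.mob_add[OF N] by (auto simp: dir_sum_sel)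
  next
    fix c h assume h: "h \<in> mob ?S x"
    then show "mscale ?S c h \<in> mob ?S x"
      using fin2 out cat_module.mob_scale[OF N] by (simp add: dir_sum_sel)
  qed
  show ?thesis
  proof (rule cat_module.intro)
    show "mact ?S x y f h \<in> mob ?S y" if "f \<in> Hom C x y" "h \<in> mob ?S x" for x y f h
      using that fin3 cat_module.act_closed[OF N] by (simp add: dir_sum_sel)
    show "linear_map_on (mscale ?S) (mscale ?S) (mob ?S x) (mact ?S x y f)" if f: "f \<in> Hom C x y" for x y f
      unfolding linear_map_on_def
      by (auto simp: dir_sum_sel fun_eq_iff cat_module.act_add[OF N f] cat_module.act_scale[OF N f] out)
    show "linear_map_on (cscale C) (mscale ?S) (Hom C x y) (\<lambda>f. mact ?S x y f h)" if "h \<in> mob ?S x" for x y h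
      using that cat_module.act_linear_left[OF N] unfolding linear_map_on_def
      by (auto simp: dir_sum_sel fun_eq_iff out)
    show "mact ?S x x (ident C x) h = h" if "h \<in> mob ?S x" for x h
      using that cat_module.act_ident[OF N] by (auto simp: dir_sum_sel fun_eq_iff)
    show "mact ?S x z (cmp C x y z g f) h = mact ?S y z g (mact ?S x y f h)"
      if "f \<in> Hom C x y" "g \<in> Hom C y z" "h \<in> mob ?S x" for x y z f g h
      using that cat_module.act_comp[OF N] by (auto simp: dir_sum_sel fun_eq_iff)
  qed (use vec sub in auto)
qed

definition sgl :: "'i \<Rightarrow> 'v \<Rightarrow> 'i \<Rightarrow> 'v::zero" where
  "sgl i v = (\<lambda>j. if j = i then v else 0)"

lemma sgl_simps [simp]: "sgl i v i = v" "j \<noteq> i \<Longrightarrow> sgl i v j = 0"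
  by (simp_all add: sgl_def)

context
  fixes C :: "('o, 'm::ab_group_add, 'k::field) lincat"
    and N :: "'i \<Rightarrow> ('o, 'm, 'k, 'v::ab_group_add) cmod" and I :: "'i set"
  assumes ex: "\<exists>s :: 'k \<Rightarrow> 'v \<Rightarrow> 'v. vector_space s" and N: "\<And>i. i \<in> I \<Longrightarrow> cat_module C (N i)"
begin

lemma dir_sum_inj: assumes i: "i \<in> I" shows "mod_hom C (N i) (dir_sum I N) (\<lambda>x. sgl i)"
proof -
  interpret N: cat_module C "N i" by (rule N[OF i])
  have out: "mscale (dir_sum I N) c h j = 0" if "h j = 0" for c h j
    by (intro dir_sum_scale_out ex that cat_module.vector_space[OF N])
  have fin: "finite {j. sgl i v j \<noteq> (0::'v)}" for v
    by (rule finite_subset[of _ "{i}"]) (auto simp: sgl_def)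
  show ?thesis
  proof (rule mod_homI)
    show "sgl i v \<in> mob (dir_sum I N) x" if "v \<in> mob (N i) x" for x v
      using that i fin cat_module.mob_0[OF N] by (auto simp: dir_sum_sel sgl_def)
    show "sgl i (v + w) = sgl i v + sgl i w" for v w :: 'v by (auto simp: sgl_def fun_eq_iff)
    show "sgl i (mscale (N i) c v) = mscale (dir_sum I N) c (sgl i v)" for c v
      using i out by (auto simp: sgl_def fun_eq_iff dir_sum_sel)
    show "sgl i (mact (N i) x y f v) = mact (dir_sum I N) x y f (sgl i v)" if "f \<in> Hom C x y" for x y f v
      using i cat_module.act_0[OF N that] by (auto simp: sgl_def fun_eq_iff dir_sum_sel)
  qed
qed

lemma dir_sum_decompose:
  assumes h: "h \<in> mob (dir_sum I N) x"
  shows "h = (\<Sum>i | h i \<noteq> 0. sgl i (h i))"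
proof
  fix j
  have fin: "finite {i. h i \<noteq> 0}" using h by (simp add: dir_sum_sel)
  have "(\<Sum>i\<in>T. sgl i (h i)) j = (\<Sum>i\<in>T. sgl i (h i) j)" for T
    by (induction T rule: infinite_finite_induct) auto
  then have "(\<Sum>i | h i \<noteq> 0. sgl i (h i)) j = (\<Sum>i | h i \<noteq> 0. sgl i (h i) j)" .
  also have "\<dots> = (\<Sum>i | h i \<noteq> 0. if i = j then h j else 0)" by (rule sum.cong) (auto simp: sgl_def)
  also have "\<dots> = h j" using fin by (auto simp: sum.delta)
  finally show "h j = (\<Sum>i | h i \<noteq> 0. sgl i (h i)) j" by simp
qed

lemma dir_sum_out:
  fixes X :: "('o, 'm, 'k, 'w::ab_group_add) cmod"
  assumes X: "cat_module C X" and \<phi>: "\<And>i. i \<in> I \<Longrightarrow> mod_hom C (N i) X (\<phi> i)"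
  shows "\<exists>\<psi>. mod_hom C (dir_sum I N) X \<psi> \<and> (\<forall>i\<in>I. \<forall>x. \<forall>v\<in>mob (N i) x. \<psi> x (sgl i v) = \<phi> i x v)"
proof -
  interpret X: cat_module C X by (rule X)
  let ?S = "dir_sum I N"
  define \<psi> where "\<psi> x h = (\<Sum>i | h i \<noteq> 0. \<phi> i x (h i))" for x h
  have SI: "i \<in> I" if "h \<in> mob ?S x" "h i \<noteq> 0" for h x i using that by (auto simp: dir_sum_sel)
  have z: "\<phi> i x 0 = 0" if "i \<in> I" for i x using mod_hom_0[OF N[OF that] X \<phi>[OF that]] .
  \<comment> \<open>Sums over the supports of different elements are compared over a common finite
    index set; the added terms vanish.\<close>
  have eq: "\<psi> x h = (\<Sum>i\<in>T. \<phi> i x (h i))" if "h \<in> mob ?S x" "finite T" "T \<subseteq> I" "{i. h i \<noteq> 0} \<subseteq> T" for x h T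
    unfolding \<psi>_def using that z by (intro sum.mono_neutral_left) auto
  have in_N: "h i \<in> mob (N i) x" if "h \<in> mob ?S x" "i \<in> I" for h x i using that by (simp add: dir_sum_sel)
  interpret S: cat_module C ?S by (rule cat_module_dir_sum[OF ex N])
  have "mod_hom C ?S X \<psi>"
  proof (rule mod_homI)
    show "\<psi> x h \<in> mob X x" if h: "h \<in> mob ?S x" for x h
      unfolding \<psi>_def using SI[OF h] in_N[OF h] mod_hom_closed[OF N X \<phi>] by (intro X.mob_sum) simp
    show "\<psi> x (h + h') = \<psi> x h + \<psi> x h'" if h: "h \<in> mob ?S x" "h' \<in> mob ?S x" for x h h'
    proof -
      let ?T = "{i. h i \<noteq> 0} \<union> {i. h' i \<noteq> 0}"
      have T: "finite ?T" "?T \<subseteq> I" using h by (auto simp: dir_sum_sel)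
      have "\<psi> x (h + h') = (\<Sum>i\<in>?T. \<phi> i x ((h + h') i))"
        by (rule eq[OF S.mob_add[OF h] T]) auto
      also have "\<dots> = (\<Sum>i\<in>?T. \<phi> i x (h i) + \<phi> i x (h' i))"
      proof (rule sum.cong[OF refl])
        fix i assume "i \<in> ?T"
        then have i: "i \<in> I" using T by blast
        show "\<phi> i x ((h + h') i) = \<phi> i x (h i) + \<phi> i x (h' i)"
          using mod_hom_add[OF N[OF i] X \<phi>[OF i] in_N[OF h(1) i] in_N[OF h(2) i]] by simp
      qed
      also have "\<dots> = \<psi> x h + \<psi> x h'"
        using eq[OF h(1) T] eq[OF h(2) T] by (simp add: sum.distrib)
      finally show ?thesis .
    qed
    show "\<psi> x (mscale ?S c h) = mscale X c (\<psi> x h)" if h: "h \<in> mob ?S x" for x c h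
    proof -
      let ?T = "{i. h i \<noteq> 0}"
      have T: "finite ?T" "?T \<subseteq> I" using h by (auto simp: dir_sum_sel)
      have "\<psi> x (mscale ?S c h) = (\<Sum>i\<in>?T. \<phi> i x (mscale ?S c h i))"
        by (rule eq[OF S.mob_scale[OF h] T]) (auto intro: dir_sum_scale_out[OF ex] cat_module.vector_space[OF N])
      also have "\<dots> = (\<Sum>i\<in>?T. mscale X c (\<phi> i x (h i)))"
      proof (rule sum.cong[OF refl])
        fix i assume "i \<in> ?T"
        then have i: "i \<in> I" using T by blast
        show "\<phi> i x (mscale ?S c h i) = mscale X c (\<phi> i x (h i))"
          using mod_hom_scale[OF N[OF i] X \<phi>[OF i] in_N[OF h i]] i by (simp add: dir_sum_sel)
      qed
      finally show ?thesis by (simp add: \<psi>_def X.mv.scale_sum_right)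
    qed
    show "\<psi> y (mact ?S x y f h) = mact X x y f (\<psi> x h)" if f: "f \<in> Hom C x y" and h: "h \<in> mob ?S x" for x y f h
    proof -
      let ?T = "{i. h i \<noteq> 0}"
      have T: "finite ?T" "?T \<subseteq> I" using h by (auto simp: dir_sum_sel)
      have "\<psi> y (mact ?S x y f h) = (\<Sum>i\<in>?T. \<phi> i y (mact ?S x y f h i))"
        using cat_module.act_0[OF N f]
        by (intro eq[OF S.act_closed[OF f h] T]) (auto simp: dir_sum_sel)
      also have "\<dots> = (\<Sum>i\<in>?T. mact X x y f (\<phi> i x (h i)))"
      proof (rule sum.cong[OF refl])
        fix i assume "i \<in> ?T"
        then have i: "i \<in> I" using T by blast
        show "\<phi> i y (mact ?S x y f h i) = mact X x y f (\<phi> i x (h i))"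
          using mod_hom_act[OF N[OF i] X \<phi>[OF i] f in_N[OF h i]] i by (simp add: dir_sum_sel)
      qed
      also have "\<dots> = mact X x y f (\<psi> x h)"
        unfolding \<psi>_def using T in_N[OF h] mod_hom_closed[OF N X \<phi>] by (intro X.act_sum[OF f, symmetric]) blast
      finally show ?thesis .
    qed
  qed
  moreover have "\<psi> x (sgl i v) = \<phi> i x v" if i: "i \<in> I" and v: "v \<in> mob (N i) x" for i x v
  proof -
    have "\<psi> x (sgl i v) = (\<Sum>j\<in>{i}. \<phi> j x (sgl i v j))"
      using mod_hom_closed[OF N[OF i] S.cat_module_axioms dir_sum_inj[OF i] v] i
      by (intro eq) (auto simp: sgl_def)
    then show ?thesis by simp
  qed
  ultimately show ?thesis by blast
qed

lemma dir_sum_hom_ext: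
  fixes X :: "('o, 'm, 'k, 'w::ab_group_add) cmod"
  assumes X: "cat_module C X" and \<phi>: "mod_hom C (dir_sum I N) X \<phi>" and \<psi>: "mod_hom C (dir_sum I N) X \<psi>"
    and e: "\<And>i x v. i \<in> I \<Longrightarrow> v \<in> mob (N i) x \<Longrightarrow> \<phi> x (sgl i v) = \<psi> x (sgl i v)"
    and h: "h \<in> mob (dir_sum I N) x"
  shows "\<phi> x h = \<psi> x h"
proof -
  note S = cat_module_dir_sum[OF ex N]
  have i: "i \<in> I" "h i \<in> mob (N i) x" if "h i \<noteq> 0" for i using that h by (auto simp: dir_sum_sel)
  have m: "sgl i (h i) \<in> mob (dir_sum I N) x" if "i \<in> {i. h i \<noteq> 0}" for i
    using mod_hom_closed[OF N S dir_sum_inj] i that by blast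
  have "\<phi> x (\<Sum>i | h i \<noteq> 0. sgl i (h i)) = (\<Sum>i | h i \<noteq> 0. \<phi> x (sgl i (h i)))"
    by (rule mod_hom_sum[OF S X \<phi> m])
  also have "\<dots> = (\<Sum>i | h i \<noteq> 0. \<psi> x (sgl i (h i)))"
    by (rule sum.cong[OF refl]) (use e i in blast)
  also have "\<dots> = \<psi> x (\<Sum>i | h i \<noteq> 0. sgl i (h i))"
    by (rule mod_hom_sum[OF S X \<psi> m, symmetric])
  finally show ?thesis using dir_sum_decompose[OF h] by simp
qed

lemma dir_sum_in:
  fixes X :: "('o, 'm, 'k, 'w::ab_group_add) cmod"
  assumes fin: "finite I" and X: "cat_module C X" and \<psi>: "\<And>i. i \<in> I \<Longrightarrow> mod_hom C X (N i) (\<psi> i)"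
  shows "mod_hom C X (dir_sum I N) (\<lambda>x v i. if i \<in> I then \<psi> i x v else 0)"
proof -
  have out: "mscale (dir_sum I N) c h j = 0" if "h j = 0" for c h j
    by (intro dir_sum_scale_out ex that cat_module.vector_space[OF N])
  show ?thesis
  proof (rule mod_homI)
    show "(\<lambda>i. if i \<in> I then \<psi> i x v else 0) \<in> mob (dir_sum I N) x" if "v \<in> mob X x" for x v
      using that mod_hom_closed[OF X N \<psi>] by (auto simp: dir_sum_sel intro: finite_subset[OF _ fin])
  qed (auto simp: fun_eq_iff mod_hom_add[OF X N \<psi>] mod_hom_scale[OF X N \<psi>] mod_hom_act[OF X N \<psi>] dir_sum_sel out)
qed

lemma lift_prop_dir_sum:
  fixes A :: "('o, 'm, 'k, 'w::ab_group_add) cmod" and B :: "('o, 'm, 'k, 'u::ab_group_add) cmod"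
  assumes A: "cat_module C A" and B: "cat_module C B"
    and l: "\<And>i. i \<in> I \<Longrightarrow> lift_prop C (N i) A B"
  shows "lift_prop C (dir_sum I N) A B"
  unfolding lift_prop_def
proof (intro allI impI, elim conjE)
  note S = cat_module_dir_sum[OF ex N]
  fix \<pi> \<phi> assume \<pi>: "surj_hom C A B \<pi>" and \<phi>: "mod_hom C (dir_sum I N) B \<phi>"
  have \<pi>': "mod_hom C A B \<pi>" using \<pi> by (simp add: surj_hom_def)
  have "\<exists>\<psi>. mod_hom C (N i) A \<psi> \<and> (\<forall>x. \<forall>v\<in>mob (N i) x. \<pi> x (\<psi> x v) = \<phi> x (sgl i v))" if "i \<in> I" for i
    using l[OF that] \<pi> mod_hom_comp[OF dir_sum_inj[OF that] \<phi>] unfolding lift_prop_def by blast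
  then obtain \<psi> where \<psi>: "\<And>i. i \<in> I \<Longrightarrow> mod_hom C (N i) A (\<psi> i)"
    "\<And>i x v. i \<in> I \<Longrightarrow> v \<in> mob (N i) x \<Longrightarrow> \<pi> x (\<psi> i x v) = \<phi> x (sgl i v)"
    by metis
  obtain \<chi> where \<chi>: "mod_hom C (dir_sum I N) A \<chi>"
    "\<And>i x v. i \<in> I \<Longrightarrow> v \<in> mob (N i) x \<Longrightarrow> \<chi> x (sgl i v) = \<psi> i x v"
    using dir_sum_out[OF A \<psi>(1)] by blast
  have "\<pi> x (\<chi> x h) = \<phi> x h" if "h \<in> mob (dir_sum I N) x" for x h
    by (rule dir_sum_hom_ext[OF B mod_hom_comp[OF \<chi>(1) \<pi>'] \<phi> _ that]) (simp add: \<chi>(2) \<psi>(2))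
  then show "\<exists>\<psi>. mod_hom C (dir_sum I N) A \<psi> \<and> (\<forall>x. \<forall>v\<in>mob (dir_sum I N) x. \<pi> x (\<psi> x v) = \<phi> x v)"
    using \<chi>(1) by blast
qed

end

text \<open>
  A module satisfying \<^const>\<open>projective\<close> is a retract of the free module on its elements, so it has
  the lifting property for modules over arbitrary types.
\<close>

lemma projective_lift_prop:
  fixes M :: "('o, 'm::ab_group_add, 'k::field, 'v::ab_group_add) cmod"
    and A :: "('o, 'm, 'k, 'w::ab_group_add) cmod" and B :: "('o, 'm, 'k, 'u::ab_group_add) cmod"
  assumes C: "linear_category C" and M: "projective C M" and A: "cat_module C A" and B: "cat_module C B"
  shows "lift_prop C M A B"
proof -
  interpret linear_category C by (rule C)
  have Mc: "cat_module C M" using M by (simp add: projective_def)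
  interpret M: cat_module C M by (rule Mc)
  define I where "I = {(x, v). v \<in> mob M x}"
  define N where "N = (\<lambda>(x :: 'o, v :: 'v). rep C x)"
  define F where "F = dir_sum I N"
  have ex: "\<exists>s :: 'k \<Rightarrow> 'm \<Rightarrow> 'm. vector_space s" using vector_space by blast
  have N: "cat_module C (N i)" for i by (cases i) (simp add: N_def cat_module_rep[OF C])
  have F: "cat_module C F" unfolding F_def by (rule cat_module_dir_sum[OF ex N])
  have y: "mod_hom C (N i) M (\<lambda>y f. mact M (fst i) y f (snd i))" if "i \<in> I" for i
    using that yoneda_hom[OF C Mc] by (auto simp: N_def I_def split: prod.splits)
  obtain p where "mod_hom C (dir_sum I N) M p"
    and p2: "\<And>i y f. i \<in> I \<Longrightarrow> f \<in> mob (N i) y \<Longrightarrow> p y (sgl i f) = mact M (fst i) y f (snd i)"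
    using dir_sum_out[where I = I and N = N, OF ex N Mc y] by blast
  then have p1: "mod_hom C F M p" by (simp add: F_def)
  note p = p1 p2
  have "v \<in> p x ` mob F x" if v: "v \<in> mob M x" for x v
  proof -
    have i: "(x, v) \<in> I" using v by (simp add: I_def)
    have "ident C x \<in> mob (N (x, v)) x" by (simp add: N_def ident_closed)
    then have "sgl (x, v) (ident C x) \<in> mob F x" "p x (sgl (x, v) (ident C x)) = v"
      using p(2)[OF i] M.act_ident[OF v] mod_hom_closed[OF N F dir_sum_inj[where I = I and N = N, OF ex N i, folded F_def]] by auto
    then show ?thesis by force
  qed
  then have ps: "surj_hom C F M p" using p(1) mod_hom_closed[OF F Mc p(1)] by (auto simp: surj_hom_def)
  \<comment> \<open>\<open>Q\<close> is a copy of \<open>M\<close> on the value type of the free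
    module \<open>F\<close>, the type at which projectivity of \<open>M\<close> is assumed. The maps
    \<open>\<chi>\<close> and \<open>\<phi>\<close> below identify \<open>Q\<close> with
    \<open>M\<close>.\<close>
  obtain Q :: "('o, 'm, 'k, 'o \<times> 'v \<Rightarrow> 'm) cmod" and q where Q: "cat_module C Q" "surj_hom C F Q q"
    "\<And>x v. v \<in> mob F x \<Longrightarrow> q x v = 0 \<longleftrightarrow> v \<in> {v \<in> mob F x. p x v = 0}"
    using quotient_exists[OF F submod_kernel[OF F Mc p(1)]] by blast
  have kq: "p x v = 0" if "v \<in> mob F x" "q x v = 0" for x v using Q(3)[OF that(1)] that by simp
  have kp: "q x v = 0" if "v \<in> mob F x" "p x v = 0" for x v using Q(3)[OF that(1)] that by simp
  have q: "mod_hom C F Q q" using Q(2) by (simp add: surj_hom_def)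
  obtain \<chi> where \<chi>: "mod_hom C Q M \<chi>" "\<And>x v. v \<in> mob F x \<Longrightarrow> \<chi> x (q x v) = p x v"
    using hom_factor[OF F Q(1) Mc Q(2) p(1) kq] by blast
  obtain \<phi> where \<phi>: "mod_hom C M Q \<phi>" "\<And>x v. v \<in> mob F x \<Longrightarrow> \<phi> x (p x v) = q x v"
    using hom_factor[OF F Mc Q(1) ps q kp] by blast
  have "lift_prop C M F Q" using M F Q(1) by (simp add: projective_iff_lift_prop)
  then obtain \<psi> where \<psi>: "mod_hom C M F \<psi>" "\<And>x v. v \<in> mob M x \<Longrightarrow> q x (\<psi> x v) = \<phi> x v"
    using lift_propD[OF _ Q(2) \<phi>(1)] by blast
  have "p x (\<psi> x v) = v" if v: "v \<in> mob M x" for x v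
  proof -
    obtain w where w: "w \<in> mob F x" "v = p x w" using ps v by (auto simp: surj_hom_def)
    have "p x (\<psi> x v) = \<chi> x (q x (\<psi> x v))" using \<chi>(2) mod_hom_closed[OF Mc F \<psi>(1) v] by simp
    also have "\<dots> = \<chi> x (q x w)" using \<psi>(2)[OF v] \<phi>(2)[OF w(1)] w(2) by simp
    finally show ?thesis using \<chi>(2) w by simp
  qed
  moreover have "lift_prop C F A B"
    unfolding F_def using lift_prop_rep[OF C A B] by (intro lift_prop_dir_sum[OF ex N A B]) (auto simp: N_def)
  ultimately show ?thesis using lift_prop_retract[OF _ \<psi>(1) p(1)] by blast
qed

section \<open>Multiplicities and covers\<close>

abbreviation hscale :: "('o, 'm, 'k, 'v) cmod \<Rightarrow> 'k \<Rightarrow> ('o \<Rightarrow> 'u \<Rightarrow> 'v) \<Rightarrow> 'o \<Rightarrow> 'u \<Rightarrow> 'v" where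
  "hscale M \<equiv> \<lambda>c \<phi> x v. mscale M c (\<phi> x v)"

lemma vector_space_hscale:
  assumes "cat_module C M"
  shows "vector_space (hscale M :: 'k::field \<Rightarrow> ('o \<Rightarrow> 'u \<Rightarrow> 'v::ab_group_add) \<Rightarrow> _)"
proof -
  interpret cat_module C M by (rule assms)
  show ?thesis
    by unfold_locales (auto simp: fun_eq_iff mv.scale_right_distrib mv.scale_left_distrib)
qed

lemma hom_space_mod_hom: "\<phi> \<in> hom_space C P M \<Longrightarrow> mod_hom C P M \<phi>"
  by (simp add: hom_space_def)

definition hom_norm :: "('o, 'm, 'k, 'u) cmod \<Rightarrow> ('o \<Rightarrow> 'u \<Rightarrow> 'v::zero) \<Rightarrow> 'o \<Rightarrow> 'u \<Rightarrow> 'v" where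
  "hom_norm P \<phi> x v = (if v \<in> mob P x then \<phi> x v else 0)"

lemma hom_norm_hom_space:
  assumes P: "cat_module C P" and \<phi>: "mod_hom C P M \<phi>"
  shows "hom_norm P \<phi> \<in> hom_space C P M"
  using mod_hom_cong[OF P, of \<phi> "hom_norm P \<phi>" M] \<phi> by (simp add: hom_space_def hom_norm_def)

lemma subspace_hom_sub:
  fixes M :: "('o, 'm::ab_group_add, 'k::field, 'v::ab_group_add) cmod"
  assumes P: "cat_module C P" and M: "cat_module C M" and A: "submod C M A"
  shows "module.subspace (hscale M) {\<phi> \<in> hom_space C P M. \<forall>x. \<forall>v\<in>mob P x. \<phi> x v \<in> A x}"
proof -
  interpret M: cat_module C M by (rule M)
  interpret H: vector_space "hscale M :: 'k \<Rightarrow> ('o \<Rightarrow> 'u::ab_group_add \<Rightarrow> 'v) \<Rightarrow> _" by (rule vector_space_hscale[OF M])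
  note a = submodD[OF M A]
  show ?thesis unfolding H.subspace_def
    using mod_hom_zero[OF M, of P] mod_hom_plus[OF M P] mod_hom_smult[OF M P] a(4,5,8)
    by (auto simp: hom_space_def zero_fun_def plus_fun_def)
qed

lemma subspace_hom_space:
  fixes M :: "('o, 'm::ab_group_add, 'k::field, 'v::ab_group_add) cmod"
  assumes P: "cat_module C P" and M: "cat_module C M"
  shows "module.subspace (hscale M) (hom_space C P M)"
proof -
  have "{\<phi> \<in> hom_space C P M. \<forall>x. \<forall>v\<in>mob P x. \<phi> x v \<in> mob M x} = hom_space C P M"
    using mod_hom_closed[OF P M] by (auto simp: hom_space_def)
  then show ?thesis using subspace_hom_sub[OF P M submod_mob[OF M]] by simp
qed

text \<open>The chains counted by \<open>multiplicity_mod\<close>, confined between two submodules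
  \<open>A\<close> and \<open>B\<close> so that they can be concatenated.\<close>

definition mult_chain ::
  "('o, 'm, 'k::field) lincat \<Rightarrow> ('o, 'm, 'k, 'v::ab_group_add) cmod \<Rightarrow>
   ('o, 'm, 'k, 'w::ab_group_add) cmod \<Rightarrow> nat \<Rightarrow> ('o \<Rightarrow> 'v set) \<Rightarrow> ('o \<Rightarrow> 'v set) \<Rightarrow> bool" where
  "mult_chain C M L n A B \<longleftrightarrow> (\<exists>F G.
     (\<forall>i<n. submod C M (F i) \<and> submod C M (G i) \<and> F i < G i \<and> subquot_iso C M (F i) (G i) L \<and>
        A \<le> F i \<and> G i \<le> B) \<and>
     (\<forall>i. Suc i < n \<longrightarrow> G i \<le> F (Suc i)))"

lemma mult_chain_0: "mult_chain C M L 0 A B"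
  by (simp add: mult_chain_def)

lemma mult_chain_mono:
  assumes "mult_chain C M L n A B" "m \<le> n"
  shows "mult_chain C M L m A B"
proof -
  obtain F G where "\<forall>i<n. submod C M (F i) \<and> submod C M (G i) \<and> F i < G i \<and>
      subquot_iso C M (F i) (G i) L \<and> A \<le> F i \<and> G i \<le> B" "\<forall>i. Suc i < n \<longrightarrow> G i \<le> F (Suc i)"
    using assms(1) unfolding mult_chain_def by blast
  then show ?thesis using assms(2) unfolding mult_chain_def by (intro exI[of _ F] exI[of _ G]) simp
qed

lemma mult_chain_append:
  assumes "mult_chain C M L m A B" "mult_chain C M L n B D" "A \<le> B" "B \<le> D"
  shows "mult_chain C M L (m + n) A D"
proof -
  obtain F1 G1 where 1: "\<And>i. i < m \<Longrightarrow> submod C M (F1 i) \<and> submod C M (G1 i) \<and> F1 i < G1 i \<and>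
      subquot_iso C M (F1 i) (G1 i) L \<and> A \<le> F1 i \<and> G1 i \<le> B" "\<And>i. Suc i < m \<Longrightarrow> G1 i \<le> F1 (Suc i)"
    using assms(1) unfolding mult_chain_def by blast
  obtain F2 G2 where 2: "\<And>i. i < n \<Longrightarrow> submod C M (F2 i) \<and> submod C M (G2 i) \<and> F2 i < G2 i \<and>
      subquot_iso C M (F2 i) (G2 i) L \<and> B \<le> F2 i \<and> G2 i \<le> D" "\<And>i. Suc i < n \<Longrightarrow> G2 i \<le> F2 (Suc i)"
    using assms(2) unfolding mult_chain_def by blast
  let ?F = "\<lambda>i. if i < m then F1 i else F2 (i - m)" and ?G = "\<lambda>i. if i < m then G1 i else G2 (i - m)"
  have "submod C M (?F i) \<and> submod C M (?G i) \<and> ?F i < ?G i \<and> subquot_iso C M (?F i) (?G i) L \<and>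
      A \<le> ?F i \<and> ?G i \<le> D" if i: "i < m + n" for i
  proof (cases "i < m")
    case True
    then show ?thesis using 1(1)[OF True] order_trans[OF _ assms(4)] by simp
  next
    case False
    then have "i - m < n" using i by simp
    then show ?thesis using 2(1) False order_trans[OF assms(3)] by simp
  qed
  moreover have "?G i \<le> ?F (Suc i)" if i: "Suc i < m + n" for i
  proof -
    consider "Suc i < m" | "Suc i = m" | "m \<le> i" by linarith
    then show ?thesis
    proof cases
      case 1
      then show ?thesis using \<open>\<And>i. Suc i < m \<Longrightarrow> G1 i \<le> F1 (Suc i)\<close> by simp
    next
      case c: 2
      then have "G1 i \<le> B" "B \<le> F2 0" using 1(1)[of i] 2(1)[of 0] i by auto
      then show ?thesis using c by auto
    next
      case 3
      then show ?thesis using 2(2)[of "i - m"] i by (simp add: Suc_diff_le)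
    qed
  qed
  ultimately show ?thesis unfolding mult_chain_def by (intro exI[of _ ?F] exI[of _ ?G]) simp
qed

lemma enat_le_multiplicity_mod:
  "mult_chain C M L n A B \<Longrightarrow> enat n \<le> multiplicity_mod C M L"
  unfolding multiplicity_mod_def mult_chain_def by (rule Sup_upper) blast

lemma enat_le_ext:
  assumes "\<And>n. enat n \<le> a \<Longrightarrow> enat n \<le> b"
  shows "a \<le> b"
proof (cases b)
  case (enat m)
  have "\<not> enat (Suc m) \<le> a" using assms[of "Suc m"] enat by auto
  then show ?thesis using enat by (cases a) auto
qed simp

section \<open>Homomorphisms out of a cover of a simple module count multiplicities\<close>

context
  fixes C :: "('o, 'm::ab_group_add, 'k::field) lincat"
    and P :: "('o, 'm, 'k, 'p::ab_group_add) cmod"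
    and L :: "('o, 'm, 'k, 'l::ab_group_add) cmod"
    and M :: "('o, 'm, 'k, 'v::ab_group_add) cmod"
    and \<pi> :: "'o \<Rightarrow> 'p \<Rightarrow> 'l"
  assumes P: "cat_module C P" and M: "cat_module C M" and L: "simple_mod C L"
    and \<pi>: "surj_hom C P L \<pi>"
    and cover: "\<And>N x v. submod C P N \<Longrightarrow> N \<noteq> mob P \<Longrightarrow> v \<in> N x \<Longrightarrow> \<pi> x v = 0"
    and scal: "\<And>\<chi>. mod_hom C P L \<chi> \<Longrightarrow> \<exists>c. \<forall>x. \<forall>v\<in>mob P x. \<chi> x v = mscale L c (\<pi> x v)"
begin

text \<open>For \<open>\<phi>\<close> in \<open>WS B\<close> but not in \<open>WS A\<close>, put
  \<open>I = A + \<phi>(P)\<close> and \<open>J = A + \<phi>(ker \<pi>)\<close>. The preimage of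
  \<open>A\<close> under \<open>\<phi>\<close> is a proper submodule, hence inside
  \<open>ker \<pi>\<close>, and so \<open>I / J\<close> is \<open>L\<close>. Since
  \<open>Hom(P, L)\<close> is spanned by \<open>\<pi>\<close>, passing from \<open>J\<close> to
  \<open>I\<close> enlarges the space of maps in \<open>W\<close> by at most one dimension, and the
  induction applies to the intervals from \<open>A\<close> to \<open>J\<close> and from
  \<open>I\<close> to \<open>B\<close>.\<close>

lemma hom_dim_chain:
  assumes W: "module.subspace (hscale M) W" "fin_dim (hscale M) W" "W \<subseteq> hom_space C P M"
    and A: "submod C M A" and B: "submod C M B" and AB: "A \<le> B"
  defines "WS \<equiv> \<lambda>A. W \<inter> {\<phi> \<in> hom_space C P M. \<forall>x. \<forall>v\<in>mob P x. \<phi> x v \<in> A x}"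
  shows "mult_chain C M L (vector_space.dim (hscale M) (WS B) - vector_space.dim (hscale M) (WS A)) A B"
proof -
  have Lc: "cat_module C L" using L by (rule simple_cat_module)
  interpret P: cat_module C P by (rule P)
  interpret M: cat_module C M by (rule M)
  interpret L: cat_module C L by (rule Lc)
  interpret H: vector_space "hscale M :: 'k \<Rightarrow> ('o \<Rightarrow> 'p \<Rightarrow> 'v) \<Rightarrow> _" by (rule vector_space_hscale[OF M])
  have \<pi>': "mod_hom C P L \<pi>" and \<pi>s: "\<pi> x ` mob P x = mob L x" for x using \<pi> by (auto simp: surj_hom_def)
  have subW: "H.subspace (WS A)" if "submod C M A" for A
    unfolding WS_def by (rule H.subspace_inter[OF W(1) subspace_hom_sub[OF P M that]])
  have fdW: "fin_dim (hscale M) (WS A)" for A by (rule fin_dim_subset[OF W(2)]) (simp add: WS_def)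
  have monoW: "WS A \<subseteq> WS B" if "A \<le> B" for A B using that by (auto simp: WS_def le_fun_def)
  obtain x0 l0 where l0: "l0 \<in> mob L x0" "l0 \<noteq> 0" using simple_nonzero[OF L] mob_nonzero_iff[OF Lc] by blast
  obtain p0 where p0: "p0 \<in> mob P x0" "\<pi> x0 p0 = l0" using l0(1) unfolding \<pi>s[of x0, symmetric] by blast
  show ?thesis using A B AB
  proof (induction "H.dim (WS B) - H.dim (WS A)" arbitrary: A B rule: less_induct)
    case less
    note A = less.prems(1) and B = less.prems(2) and AB = less.prems(3)
    show ?case
    proof (cases "WS B \<subseteq> WS A")
      case True
      then have "H.dim (WS B) - H.dim (WS A) = 0" using fin_dim_dim_mono[OF H.vector_space_axioms fdW True] by simp
      then show ?thesis using mult_chain_0 by simp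
    next
      case False
      then obtain \<phi> where \<phi>B: "\<phi> \<in> WS B" and \<phi>A: "\<phi> \<notin> WS A" by blast
      then have \<phi>: "mod_hom C P M \<phi>" by (auto simp: WS_def hom_space_def)
      define K where "K x = {v \<in> mob P x. \<pi> x v = 0}" for x
      have K: "submod C P K" unfolding K_def[abs_def] by (rule submod_kernel[OF P Lc \<pi>'])
      define I where "I = sub_sum A (\<lambda>x. \<phi> x ` mob P x)"
      define J where "J = sub_sum A (\<lambda>x. \<phi> x ` K x)"
      note Isub = submod_sub_sum[OF M A submod_image[OF P M \<phi> submod_mob[OF P]], folded I_def]
      note Jsub = submod_sub_sum[OF M A submod_image[OF P M \<phi> K], folded J_def]
      have JI: "J \<le> I" by (auto simp: le_fun_def I_def J_def sub_sum_def K_def)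
      have IB: "I \<le> B"
      proof (intro le_funI subsetI)
        fix x v assume "v \<in> I x"
        then obtain a p where v: "v = a + \<phi> x p" "a \<in> A x" "p \<in> mob P x" by (auto simp: I_def sub_sum_def)
        have "a \<in> B x" "\<phi> x p \<in> B x" using le_funD[OF AB, of x] v(2,3) \<phi>B by (auto simp: WS_def)
        then show "v \<in> B x" unfolding v(1) by (rule submod_add[OF M B])
      qed
      have ker: "\<pi> x p = 0" if "p \<in> mob P x" "\<phi> x p \<in> A x" for x p
      proof (rule cover[OF submod_preimage[OF P M \<phi> A]])
        show "(\<lambda>x. {v \<in> mob P x. \<phi> x v \<in> A x}) \<noteq> mob P"
          using \<phi>A \<phi>B by (auto simp: WS_def fun_eq_iff set_eq_iff)
        show "p \<in> {v \<in> mob P x. \<phi> x v \<in> A x}" using that by simp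
      qed
      \<comment> \<open>Induces the isomorphism from \<open>I / J\<close> to \<open>L\<close>: the
        element \<open>a + \<phi> x p\<close> goes to \<open>\<pi> x p\<close>, independently of the
        choice of \<open>p\<close> by \<open>ker\<close>.\<close>
      define \<rho> where "\<rho> x v = \<pi> x (SOME p. p \<in> mob P x \<and> v - \<phi> x p \<in> A x)" for x v
      have \<rho>: "\<rho> x v = \<pi> x p" if p: "p \<in> mob P x" "v - \<phi> x p \<in> A x" for x v p
      proof -
        define q where "q = (SOME p. p \<in> mob P x \<and> v - \<phi> x p \<in> A x)"
        have q: "q \<in> mob P x" "v - \<phi> x q \<in> A x"
          using someI[of "\<lambda>p. p \<in> mob P x \<and> v - \<phi> x p \<in> A x" p] p unfolding q_def by auto
        have "(v - \<phi> x p) - (v - \<phi> x q) \<in> A x" using submod_diff[OF M A p(2) q(2)] .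
        then have "\<phi> x (q - p) \<in> A x" using p(1) q(1) by (simp add: mod_hom_diff[OF P M \<phi>])
        then have "\<pi> x (q - p) = 0" using ker[OF P.mob_diff[OF q(1) p(1)]] by blast
        then show ?thesis using p(1) q(1) by (simp add: \<rho>_def q_def[symmetric] mod_hom_diff[OF P Lc \<pi>'])
      qed
      have exA: "\<exists>p\<in>mob P x. v - \<phi> x p \<in> A x" if v: "v \<in> I x" for x v
      proof -
        obtain a p where ap: "v = a + \<phi> x p" "a \<in> A x" "p \<in> mob P x" using v by (auto simp: I_def sub_sum_def)
        then have "v - \<phi> x p \<in> A x" by simp
        then show ?thesis using ap(3) by blast
      qed
      have \<rho>hom: "mod_hom C (restr_mod M I) L \<rho>"
      proof (rule mod_homI, unfold restr_mod_sel)
        fix x v assume v: "v \<in> I x"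
        then obtain p where p: "p \<in> mob P x" "v - \<phi> x p \<in> A x" using exA by blast
        show "\<rho> x v \<in> mob L x" using \<rho>[OF p] mod_hom_closed[OF P Lc \<pi>' p(1)] by simp
        show "\<rho> x (mscale M c v) = mscale L c (\<rho> x v)" for c
        proof -
          have "mscale M c v - \<phi> x (mscale P c p) \<in> A x"
            using submod_scale[OF M A p(2), of c] p(1)
            by (simp add: M.mv.scale_right_diff_distrib mod_hom_scale[OF P M \<phi>])
          then show ?thesis using \<rho>[OF P.mob_scale[OF p(1)]] \<rho>[OF p] mod_hom_scale[OF P Lc \<pi>' p(1)] by simp
        qed
        show "\<rho> y (mact M x y f v) = mact L x y f (\<rho> x v)" if f: "f \<in> Hom C x y" for f y
        proof -
          have vM: "v \<in> mob M x" using submod_le[OF M Isub(1) v] .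
          have "mact M x y f v - \<phi> y (mact P x y f p) \<in> A y"
            using submod_act[OF M A f p(2)] p(1) vM
            by (simp add: M.act_diff[OF f] mod_hom_act[OF P M \<phi> f] mod_hom_closed[OF P M \<phi>])
          then show ?thesis using \<rho>[OF P.act_closed[OF f p(1)]] \<rho>[OF p] mod_hom_act[OF P Lc \<pi>' f p(1)] by simp
        qed
        fix w assume w: "w \<in> I x"
        then obtain q where q: "q \<in> mob P x" "w - \<phi> x q \<in> A x" using exA by blast
        have "v + w - \<phi> x (p + q) \<in> A x"
          using submod_add[OF M A p(2) q(2)] p(1) q(1) by (simp add: mod_hom_add[OF P M \<phi>] algebra_simps)
        then show "\<rho> x (v + w) = \<rho> x v + \<rho> x w"
          using \<rho>[OF P.mob_add[OF p(1) q(1)]] \<rho>[OF p] \<rho>[OF q] mod_hom_add[OF P Lc \<pi>' p(1) q(1)] by simp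
      qed
      have \<phi>I: "\<phi> x p \<in> I x" "\<rho> x (\<phi> x p) = \<pi> x p" if "p \<in> mob P x" for x p
        using that Isub(3) submod_0[OF M A] \<rho>[of p x "\<phi> x p"] by (auto simp: le_fun_def)
      have \<rho>surj: "surj_hom C (restr_mod M I) L \<rho>"
      proof -
        have "mob L x \<subseteq> \<rho> x ` I x" for x
          using \<phi>I[of _ x] \<pi>s[of x] by (force simp: image_iff)
        moreover have "\<rho> x ` I x \<subseteq> mob L x" for x using \<rho>hom by (simp add: mod_hom_def)
        ultimately have "\<rho> x ` I x = mob L x" for x by (rule subset_antisym[rotated])
        then show ?thesis using \<rho>hom by (simp add: surj_hom_def)
      qed
      have \<rho>J: "v \<in> J x \<longleftrightarrow> \<rho> x v = 0" if v: "v \<in> I x" for x v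
      proof
        assume "v \<in> J x"
        then obtain a p where "v = a + \<phi> x p" "a \<in> A x" "p \<in> mob P x" "\<pi> x p = 0"
          by (auto simp: J_def sub_sum_def K_def)
        then show "\<rho> x v = 0" using \<rho>[of p x v] by simp
      next
        assume *: "\<rho> x v = 0"
        obtain p where p: "p \<in> mob P x" "v - \<phi> x p \<in> A x" using exA[OF v] by blast
        then have "\<phi> x p \<in> \<phi> x ` K x" using \<rho>[OF p] * by (auto simp: K_def)
        then show "v \<in> J x" using sub_sumI[of "v - \<phi> x p" A x "\<phi> x p"] p by (simp add: J_def)
      qed
      have sq: "subquot_iso C M J I L"
        unfolding subquot_iso_def using \<rho>surj \<rho>J JI by (intro exI[of _ \<rho>]) (auto simp: le_fun_def)
      have p0J: "\<phi> x0 p0 \<notin> J x0" using \<rho>J[OF \<phi>I(1)[OF p0(1)]] \<phi>I(2)[OF p0(1)] p0(2) l0 by simp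
      have "J \<noteq> I" using p0J \<phi>I(1)[OF p0(1)] by auto
      then have c1: "mult_chain C M L 1 J I"
        unfolding mult_chain_def using sq JI Isub Jsub by (intro exI[of _ "\<lambda>_. J"] exI[of _ "\<lambda>_. I"]) auto
      have \<phi>WI: "\<phi> \<in> WS I" using \<phi>B \<phi>I by (auto simp: WS_def)
      have \<phi>WJ: "\<phi> \<notin> WS J" using p0J p0 by (auto simp: WS_def)
      have d1: "H.dim (WS J) < H.dim (WS I)"
        using fin_dim_dim_less[OF H.vector_space_axioms fdW _ subW[OF Jsub(1)]] monoW[OF JI] \<phi>WI \<phi>WJ by blast
      have d2: "H.dim (WS I) \<le> H.dim (WS B)"
        using fin_dim_dim_mono[OF H.vector_space_axioms fdW monoW[OF IB]] .
      have d3: "H.dim (WS A) \<le> H.dim (WS J)"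
        using fin_dim_dim_mono[OF H.vector_space_axioms fdW monoW[OF Jsub(2)]] .
      \<comment> \<open>Composites \<open>\<rho> \<circ> \<psi>\<close> are multiples of
        \<open>\<pi>\<close>, so evaluating them at the single vector \<open>p0\<close>, where
        \<open>\<pi>\<close> does not vanish, is a map of rank at most one; its kernel is
        \<open>WS J\<close>.\<close>
      have d4: "H.dim (WS I) \<le> H.dim (WS J) + 1"
      proof -
        let ?ev = "\<lambda>\<psi>. \<rho> x0 (\<psi> x0 p0)"
        have WI: "mod_hom C P (restr_mod M I) \<psi>" if "\<psi> \<in> WS I" for \<psi>
          using that by (auto simp: WS_def hom_space_def mod_hom_def)
        have WIc: "\<exists>c. \<forall>x. \<forall>v\<in>mob P x. \<rho> x (\<psi> x v) = mscale L c (\<pi> x v)" if "\<psi> \<in> WS I" for \<psi>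
          using scal[OF mod_hom_comp[OF WI[OF that] \<rho>hom]] .
        have Ic: "cat_module C (restr_mod M I)" by (rule cat_module_restr[OF M Isub(1)])
        have ev: "linear_map_on (hscale M) (mscale L) (WS I) ?ev"
          unfolding linear_map_on_def using p0(1)
          by (auto simp: WS_def mod_hom_add[OF Ic Lc \<rho>hom, simplified] mod_hom_scale[OF Ic Lc \<rho>hom, simplified])
        have k: "{\<psi> \<in> WS I. ?ev \<psi> = 0} = WS J"
        proof
          show "{\<psi> \<in> WS I. ?ev \<psi> = 0} \<subseteq> WS J"
          proof
            fix \<psi> assume "\<psi> \<in> {\<psi> \<in> WS I. ?ev \<psi> = 0}"
            then have \<psi>: "\<psi> \<in> WS I" "?ev \<psi> = 0" by auto
            obtain c where c: "\<And>x v. v \<in> mob P x \<Longrightarrow> \<rho> x (\<psi> x v) = mscale L c (\<pi> x v)"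
              using WIc[OF \<psi>(1)] by blast
            then have "c = 0" using \<psi>(2) p0 l0 by simp
            then have "\<psi> x v \<in> J x" if "v \<in> mob P x" for x v
              using \<rho>J c[OF that] \<psi>(1) that by (auto simp: WS_def)
            then show "\<psi> \<in> WS J" using \<psi>(1) by (auto simp: WS_def)
          qed
          show "WS J \<subseteq> {\<psi> \<in> WS I. ?ev \<psi> = 0}"
          proof
            fix \<psi> assume \<psi>: "\<psi> \<in> WS J"
            then have "\<psi> \<in> WS I" "\<psi> x0 p0 \<in> J x0" using monoW[OF JI] p0 by (auto simp: WS_def)
            then show "\<psi> \<in> {\<psi> \<in> WS I. ?ev \<psi> = 0}" using \<rho>J JI by (auto simp: le_fun_def)
          qed
        qed
        have "?ev ` WS I \<subseteq> L.mv.span {l0}"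
        proof (rule image_subsetI)
          fix \<psi> assume "\<psi> \<in> WS I"
          then obtain c where "\<rho> x0 (\<psi> x0 p0) = mscale L c l0" using WIc p0 by blast
          then show "?ev \<psi> \<in> L.mv.span {l0}" by (simp add: L.mv.span_base L.mv.span_scale)
        qed
        then have "L.mv.dim (?ev ` WS I) \<le> card {l0}" by (intro L.mv.dim_le_card) auto
        then show ?thesis
          using dim_kernel_image[OF H.vector_space_axioms L.vector_space subW[OF Isub(1)] ev fdW] k by simp
      qed
      have dA: "H.dim (WS A) < H.dim (WS I)" using d1 d3 by linarith
      have "mult_chain C M L (H.dim (WS J) - H.dim (WS A)) A J"
        by (rule less.hyps[OF _ A Jsub(1,2)]) (use d1 d2 d3 in linarith)
      moreover have "mult_chain C M L (H.dim (WS B) - H.dim (WS I)) I B"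
        by (rule less.hyps[OF _ Isub(1) B IB]) (use d2 dA in linarith)
      ultimately have "mult_chain C M L ((H.dim (WS J) - H.dim (WS A)) + (1 + (H.dim (WS B) - H.dim (WS I)))) A B"
        using mult_chain_append[OF _ mult_chain_append[OF c1 _ JI IB] Jsub(2)] JI IB by (meson order_trans)
      then show ?thesis by (rule mult_chain_mono) (use d1 d2 d3 d4 in linarith)
    qed
  qed
qed

text \<open>Used twice: over \<open>G\<close> for \<open>P \<mu>\<close> covering
  \<open>L \<mu>\<close>, and over \<open>U \<inter> D\<close> for a simple module covering itself.
  One inequality is \<open>hom_dim_chain\<close> for the span of finitely many independent maps. For
  the other, each subquotient \<open>G i / F i\<close> of a chain admits a lift of
  \<open>\<pi>\<close> into \<open>G i\<close> that does not land in \<open>F i\<close>, so the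
  dimensions grow along the chain.\<close>

lemma hom_dim_eq_multiplicity:
  assumes lift: "\<And>B \<rho>. submod C M B \<Longrightarrow> surj_hom C (restr_mod M B) L \<rho> \<Longrightarrow>
      \<exists>\<psi>. mod_hom C P (restr_mod M B) \<psi> \<and> (\<forall>x. \<forall>v\<in>mob P x. \<rho> x (\<psi> x v) = \<pi> x v)"
  shows "hom_dim C P M = multiplicity_mod C M L"
proof (rule antisym)
  have Lc: "cat_module C L" using L by (rule simple_cat_module)
  interpret M: cat_module C M by (rule M)
  interpret H: vector_space "hscale M :: 'k \<Rightarrow> ('o \<Rightarrow> 'p \<Rightarrow> 'v) \<Rightarrow> _" by (rule vector_space_hscale[OF M])
  let ?HS = "\<lambda>A. {\<phi> \<in> hom_space C P M. \<forall>x. \<forall>v\<in>mob P x. \<phi> x v \<in> A x}"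
  note sH = subspace_hom_space[OF P M]
  show "hom_dim C P M \<le> multiplicity_mod C M L"
  proof (rule enat_le_ext)
    fix n assume "enat n \<le> hom_dim C P M"
    then obtain B where B: "finite B" "B \<subseteq> hom_space C P M" "H.independent B" "card B = n"
      unfolding hom_dim_def edim_ge_iff[OF H.vector_space_axioms sH] by blast
    let ?W = "H.span B"
    have W: "H.subspace ?W" "fin_dim (hscale M) ?W" "?W \<subseteq> hom_space C P M"
      using B H.span_minimal[OF B(2) sH] by (auto simp: fin_dim_def)
    have 1: "?W \<inter> ?HS zero_sub \<subseteq> {0}"
      by (clarsimp simp: zero_sub_def hom_space_def fun_eq_iff) metis
    have 2: "?W \<inter> ?HS (mob M) = ?W"
      using W(3) mod_hom_closed[OF P M] by (auto simp: hom_space_def)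
    have "H.dim (?W \<inter> ?HS zero_sub) \<le> 0"
      using H.dim_le_card[of "?W \<inter> ?HS zero_sub" "{}"] 1 by simp
    moreover have "H.dim ?W = n" using H.dim_span_eq_card_independent[OF B(3)] B(4) by simp
    moreover have "zero_sub \<le> mob M" using M.mob_0 by (auto simp: le_fun_def zero_sub_def)
    ultimately have "mult_chain C M L n zero_sub (mob M)"
      using hom_dim_chain[OF W submod_zero[OF M] submod_mob[OF M]] 2 by simp
    then show "enat n \<le> multiplicity_mod C M L" by (rule enat_le_multiplicity_mod)
  qed
  obtain x0 l0 where l0: "l0 \<in> mob L x0" "l0 \<noteq> 0" using simple_nonzero[OF L] mob_nonzero_iff[OF Lc] by blast
  obtain p0 where p0: "p0 \<in> mob P x0" "\<pi> x0 p0 = l0" using l0(1) \<pi> by (force simp: surj_hom_def)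
  show "multiplicity_mod C M L \<le> hom_dim C P M"
    unfolding multiplicity_mod_def
  proof (rule Sup_least, clarify)
    fix n F G
    assume *: "\<forall>i<n. submod C M (F i) \<and> submod C M (G i) \<and> F i < G i \<and> subquot_iso C M (F i) (G i) L"
      and s: "\<forall>i. Suc i < n \<longrightarrow> G i \<le> F (Suc i)"
    show "enat n \<le> hom_dim C P M"
    proof (cases "fin_dim (hscale M) (hom_space C P M)")
      case False
      then show ?thesis by (simp add: hom_dim_def edim_def)
    next
      case True
      have fd: "fin_dim (hscale M) (?HS A)" for A by (rule fin_dim_subset[OF True]) auto
      have less: "H.dim (?HS (F i)) < H.dim (?HS (G i))" if i: "i < n" for i
      proof -
        have sub: "submod C M (F i)" "submod C M (G i)" "F i < G i" "subquot_iso C M (F i) (G i) L" using * i by auto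
        obtain \<rho> where \<rho>: "surj_hom C (restr_mod M (G i)) L \<rho>" "\<And>x. F i x = {v \<in> G i x. \<rho> x v = 0}"
          using sub(4) by (auto simp: subquot_iso_def)
        obtain \<psi> where \<psi>: "mod_hom C P (restr_mod M (G i)) \<psi>" "\<And>x v. v \<in> mob P x \<Longrightarrow> \<rho> x (\<psi> x v) = \<pi> x v"
          using lift[OF sub(2) \<rho>(1)] by blast
        have \<psi>M: "mod_hom C P M \<psi>" using mod_hom_comp[OF \<psi>(1) mod_hom_incl[OF sub(2)]] .
        have "hom_norm P \<psi> \<in> ?HS (G i)"
          using hom_norm_hom_space[OF P \<psi>M] \<psi>(1) by (auto simp: hom_norm_def mod_hom_def)
        moreover have "\<psi> x0 p0 \<notin> F i x0" using \<psi>(2)[OF p0(1)] p0(2) l0 \<rho>(2) by auto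
        then have "hom_norm P \<psi> \<notin> ?HS (F i)" using p0 by (auto simp: hom_norm_def)
        moreover have "?HS (F i) \<subseteq> ?HS (G i)" using sub(3) by (auto simp: less_fun_def le_fun_def)
        ultimately show ?thesis
          by (intro fin_dim_dim_less[OF H.vector_space_axioms fd _ subspace_hom_sub[OF P M sub(1)]]) blast
      qed
      have "i + 1 \<le> H.dim (?HS (G i))" if "i < n" for i
        using that
      proof (induction i)
        case 0 then show ?case using less[of 0] by simp
      next
        case (Suc i)
        have "G i \<le> F (Suc i)" using s Suc.prems by blast
        then have "?HS (G i) \<subseteq> ?HS (F (Suc i))" by (auto simp: le_fun_def)
        from fin_dim_dim_mono[OF H.vector_space_axioms fd this] less[of "Suc i"] Suc
        show ?case by simp
      qed
      from this[of "n - 1"] have "n = 0 \<or> n \<le> H.dim (?HS (G (n - 1)))" by (cases n) auto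
      moreover have "H.dim (?HS (G (n - 1))) \<le> H.dim (hom_space C P M)"
        by (rule fin_dim_dim_mono[OF H.vector_space_axioms True]) auto
      ultimately show ?thesis using True by (auto simp: hom_dim_def edim_def)
    qed
  qed
qed

end

text \<open>The usual decomposition into eventual kernel and eventual image. The power at which they
  stabilise depends on the object, since \<open>P\<close> is only pointwise finite, so the two
  summands are the union of all kernels and the intersection of all images, and nilpotency holds
  object by object.\<close>

lemma fitting:
  assumes P: "indecomposable C P" and fd: "pointwise_finite P" and \<psi>: "mod_hom C P P \<psi>"
  shows "(\<forall>x. bij_betw (\<psi> x) (mob P x) (mob P x)) \<or> (\<forall>x. \<exists>n. \<forall>v\<in>mob P x. (\<psi> x ^^ n) v = 0)"
proof -
  have Pc: "cat_module C P" using P by (simp add: indecomposable_def)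
  interpret P: cat_module C P by (rule Pc)
  have pw: "mod_hom C P P (\<lambda>x. \<psi> x ^^ n)" for n
  proof (induction n)
    case 0 show ?case using mod_hom_id[OF Pc] by simp
  next
    case (Suc n)
    show ?case using mod_hom_comp[OF Suc \<psi>] by (simp add: comp_def)
  qed
  define K where "K n x = {v \<in> mob P x. (\<psi> x ^^ n) v = 0}" for n x
  define R where "R n x = (\<psi> x ^^ n) ` mob P x" for n x
  have K: "submod C P (K n)" for n unfolding K_def[abs_def] by (rule submod_kernel[OF Pc Pc pw])
  have R: "submod C P (R n)" for n unfolding R_def[abs_def] by (rule submod_image[OF Pc Pc pw submod_mob[OF Pc]])
  have K1: "K n x \<subseteq> K (Suc n) x" for n x using mod_hom_0[OF Pc Pc \<psi>] by (auto simp: K_def)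
  have R1: "R (Suc n) x \<subseteq> R n x" for n x
    unfolding R_def funpow_Suc_right using mod_hom_closed[OF Pc Pc \<psi>] by auto
  have Kmono: "K m x \<subseteq> K n x" if "m \<le> n" for m n x using lift_Suc_mono_le[of "\<lambda>n. K n x", OF K1 that] .
  have Rmono: "R n x \<subseteq> R m x" if "m \<le> n" for m n x using lift_Suc_antimono_le[of "\<lambda>n. R n x", OF R1 that] .
  have fdx: "fin_dim (mscale P) (mob P x)" for x using fd by (simp add: pointwise_finite_def)
  have KP: "K n x \<subseteq> mob P x" and RP: "R n x \<subseteq> mob P x" for n x using submod_le[OF Pc K] submod_le[OF Pc R] by auto
  have stab: "\<exists>n. \<forall>m\<ge>n. K m x = K n x \<and> R m x = R n x" for x
  proof -
    \<comment> \<open>Drops with every growth of a kernel and every shrinking of an image, so a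
      stage of minimal value is one at which both have stabilised.\<close>
    define d where "d n = P.mv.dim (mob P x) - P.mv.dim (K n x) + P.mv.dim (R n x)" for n
    define n where "n = (ARG_MIN d n. True)"
    have n: "d n \<le> d m" for m unfolding n_def by (rule arg_min_nat_le) simp
    have "K m x = K n x \<and> R m x = R n x" if "n \<le> m" for m
    proof -
      note fm = fin_dim_dim_mono[OF P.vector_space]
      have a: "P.mv.dim (K n x) \<le> P.mv.dim (K m x)" using fm[OF fin_dim_subset[OF fdx KP] Kmono[OF that]] .
      have b: "P.mv.dim (R m x) \<le> P.mv.dim (R n x)" using fm[OF fin_dim_subset[OF fdx RP] Rmono[OF that]] .
      have c: "P.mv.dim (K m x) \<le> P.mv.dim (mob P x)" using fm[OF fdx KP] .
      have e: "P.mv.dim (K m x) \<le> P.mv.dim (K n x)" "P.mv.dim (R n x) \<le> P.mv.dim (R m x)"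
        using n[of m] a b c unfolding d_def by linarith+
      have "K n x = K m x"
        by (rule fin_dim_subspace_eq[OF P.vector_space fin_dim_subset[OF fdx KP] Kmono[OF that] submod_subspace[OF Pc K] e(1)])
      moreover have "R m x = R n x"
        by (rule fin_dim_subspace_eq[OF P.vector_space fin_dim_subset[OF fdx RP] Rmono[OF that] submod_subspace[OF Pc R] e(2)])
      ultimately show ?thesis by simp
    qed
    then show ?thesis by blast
  qed
  obtain N where N: "\<And>x m. m \<ge> N x \<Longrightarrow> K m x = K (N x) x \<and> R m x = R (N x) x" using stab by metis
  define A where "A x = (\<Union>n. K n x)" for x
  define B where "B x = (\<Inter>n. R n x)" for x
  have KN: "K n x \<subseteq> K (N x) x" for n x
    using Kmono[of n "max n (N x)" x] N[of x "max n (N x)"] by simp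
  have RN: "R (N x) x \<subseteq> R n x" for n x
    using Rmono[of n "max n (N x)" x] N[of x "max n (N x)"] by simp
  have AN: "A x = K (N x) x" for x using KN unfolding A_def by blast
  have BN: "B x = R (N x) x" for x using RN unfolding B_def by blast
  have "submod C P A"
  proof (rule submodI[OF Pc])
    show "v \<in> A x \<Longrightarrow> v \<in> mob P x" for v x using KP by (auto simp: A_def)
    show "0 \<in> A x" for x using submod_0[OF Pc K] by (auto simp: A_def)
    show "v \<in> A x \<Longrightarrow> w \<in> A x \<Longrightarrow> v + w \<in> A x" for v w x unfolding AN by (rule submod_add[OF Pc K])
    show "v \<in> A x \<Longrightarrow> mscale P c v \<in> A x" for v c x unfolding AN by (rule submod_scale[OF Pc K])
    show "f \<in> Hom C x y \<Longrightarrow> v \<in> A x \<Longrightarrow> mact P x y f v \<in> A y" for f x y v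
      by (auto simp: A_def intro: submod_act[OF Pc K])
  qed
  moreover have "submod C P B"
  proof (rule submodI[OF Pc])
    show "v \<in> B x \<Longrightarrow> v \<in> mob P x" for v x using RP by (auto simp: B_def)
    show "0 \<in> B x" for x using submod_0[OF Pc R] by (auto simp: B_def)
    show "v \<in> B x \<Longrightarrow> w \<in> B x \<Longrightarrow> v + w \<in> B x" for v w x unfolding BN by (rule submod_add[OF Pc R])
    show "v \<in> B x \<Longrightarrow> mscale P c v \<in> B x" for v c x unfolding BN by (rule submod_scale[OF Pc R])
    show "f \<in> Hom C x y \<Longrightarrow> v \<in> B x \<Longrightarrow> mact P x y f v \<in> B y" for f x y v
      by (auto simp: B_def intro: submod_act[OF Pc R])
  qed
  moreover have "A x \<inter> B x = {0}" for x
  proof -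
    have "v = 0" if v: "v \<in> A x" "v \<in> B x" for v
    proof -
      obtain w where w: "w \<in> mob P x" "v = (\<psi> x ^^ N x) w" using v(2) by (auto simp: BN R_def)
      have "(\<psi> x ^^ N x) v = 0" using v(1) by (auto simp: AN K_def)
      then have "(\<psi> x ^^ (N x + N x)) w = 0" using w by (simp add: funpow_add)
      then have "w \<in> K (N x + N x) x" using w by (simp add: K_def)
      then have "w \<in> K (N x) x" using N[of x "N x + N x"] by simp
      then show ?thesis using w by (simp add: K_def)
    qed
    then show ?thesis using submod_0[OF Pc \<open>submod C P A\<close>] submod_0[OF Pc \<open>submod C P B\<close>] by blast
  qed
  moreover have "{a + b | a b. a \<in> A x \<and> b \<in> B x} = mob P x" for x
  proof
    show "{a + b | a b. a \<in> A x \<and> b \<in> B x} \<subseteq> mob P x"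
      using submod_le[OF Pc \<open>submod C P A\<close>] submod_le[OF Pc \<open>submod C P B\<close>] P.mob_add by blast
    show "mob P x \<subseteq> {a + b | a b. a \<in> A x \<and> b \<in> B x}"
    proof
      fix v assume v: "v \<in> mob P x"
      then have "(\<psi> x ^^ N x) v \<in> R (N x + N x) x" using N[of x "N x + N x"] by (auto simp: R_def)
      then obtain w where w: "w \<in> mob P x" "(\<psi> x ^^ N x) v = (\<psi> x ^^ (N x + N x)) w" by (auto simp: R_def)
      let ?u = "(\<psi> x ^^ N x) w"
      have u: "?u \<in> B x" using w by (auto simp: BN R_def)
      have uP: "?u \<in> mob P x" using mod_hom_closed[OF Pc Pc pw w(1)] .
      have "(\<psi> x ^^ N x) (v - ?u) = 0"
        using mod_hom_diff[OF Pc Pc pw v uP] w(2) by (simp add: funpow_add)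
      then have "v - ?u \<in> A x" using P.mob_diff[OF v uP] by (simp add: AN K_def)
      then show "v \<in> {a + b | a b. a \<in> A x \<and> b \<in> B x}" using u by force
    qed
  qed
  ultimately have isum: "internal_sum C P A B" by (simp add: internal_sum_def)
  then have AB: "A = zero_sub \<or> B = zero_sub" using P by (simp add: indecomposable_def)
  show ?thesis
  proof (cases "A = zero_sub")
    case True
    have "bij_betw (\<psi> x) (mob P x) (mob P x)" for x
    proof -
      have "K n x \<subseteq> {0}" for n using True unfolding A_def by (auto simp: fun_eq_iff zero_sub_def)
      then have "v = 0" if "v \<in> mob P x" "\<psi> x v = 0" for v using that by (force simp: K_def dest: spec[of _ 1])
      then have inj: "inj_on (\<psi> x) (mob P x)" using mod_hom_inj_iff[OF Pc Pc \<psi>] by blast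
      have "B x = mob P x" using isum True unfolding internal_sum_def zero_sub_def by force
      then have "mob P x \<subseteq> R 1 x" unfolding B_def by blast
      then have "\<psi> x ` mob P x = mob P x" using RP[of 1 x] by (auto simp: R_def)
      with inj show ?thesis by (simp add: bij_betw_def)
    qed
    then show ?thesis by blast
  next
    case False
    then have "B = zero_sub" using AB by blast
    then have "R (N x) x = {0}" for x using BN[of x] by (simp add: zero_sub_def)
    then have "\<forall>v\<in>mob P x. (\<psi> x ^^ N x) v = 0" for x unfolding R_def by blast
    then show ?thesis by blast
  qed
qed

text \<open>If \<open>\<pi>\<close> does not vanish on \<open>N\<close>, it lifts to an endomorphism
  \<open>\<psi>\<close> of \<open>P\<close> with values in \<open>N\<close> and
  \<open>\<pi> \<circ> \<psi> = \<pi>\<close>. Such a \<open>\<psi>\<close> is not nilpotent, so by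
  Fitting's lemma it is bijective and \<open>N\<close> is all of \<open>P\<close>.\<close>

lemma indecomposable_cover:
  assumes P: "indecomposable C P" and fd: "pointwise_finite P"
    and L: "simple_mod C L" and \<pi>: "surj_hom C P L \<pi>"
    and lift: "\<And>N. submod C P N \<Longrightarrow> lift_prop C P (restr_mod P N) L"
    and N: "submod C P N" "N \<noteq> mob P" "v \<in> N x"
  shows "\<pi> x v = 0"
proof (rule ccontr)
  assume nz: "\<pi> x v \<noteq> 0"
  have Pc: "cat_module C P" using P by (simp add: indecomposable_def)
  note Lc = simple_cat_module[OF L]
  have \<pi>': "mod_hom C P L \<pi>" using \<pi> by (simp add: surj_hom_def)
  have "surj_hom C (restr_mod P N) L \<pi>"
    by (rule simple_hom_surj[OF L cat_module_restr[OF Pc N(1)] mod_hom_restr_source[OF Pc N(1) \<pi>'] _ nz])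
      (use N in simp)
  then obtain \<psi> where \<psi>: "mod_hom C P (restr_mod P N) \<psi>" "\<And>x v. v \<in> mob P x \<Longrightarrow> \<pi> x (\<psi> x v) = \<pi> x v"
    using lift_propD[OF lift[OF N(1)] _ \<pi>'] by blast
  have \<psi>P: "mod_hom C P P \<psi>" using mod_hom_comp[OF \<psi>(1) mod_hom_incl[OF N(1)]] .
  have \<psi>N: "\<psi> y ` mob P y \<subseteq> N y" for y using \<psi>(1) by (auto simp: mod_hom_def)
  from fitting[OF P fd \<psi>P] show False
  proof
    assume "\<forall>x. bij_betw (\<psi> x) (mob P x) (mob P x)"
    then have "mob P y \<subseteq> N y" for y using \<psi>N[of y] by (simp add: bij_betw_def)
    then have "N = mob P" using submod_le[OF Pc N(1)] by (intro ext) blast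
    then show False using N(2) by blast
  next
    assume "\<forall>x. \<exists>n. \<forall>v\<in>mob P x. (\<psi> x ^^ n) v = 0"
    then obtain n where n: "\<And>w. w \<in> mob P x \<Longrightarrow> (\<psi> x ^^ n) w = 0" by blast
    have v: "v \<in> mob P x" using submod_le[OF Pc N(1,3)] .
    have "(\<psi> x ^^ k) v \<in> mob P x \<and> \<pi> x ((\<psi> x ^^ k) v) = \<pi> x v" for k
      by (induction k) (use v \<psi>(2) mod_hom_closed[OF Pc Pc \<psi>P] in auto)
    from this[of n] show False using n[OF v] nz mod_hom_0[OF Pc Lc \<pi>'] by simp
  qed
qed

text \<open>A maximal proper submodule above \<open>N\<close> exists by Zorn's lemma: the union of a
  chain of proper submodules is proper, because a finite generating set inside it would already lie
  in one member.\<close>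

lemma fin_gen_simple_quotient:
  fixes M :: "('o, 'm::ab_group_add, 'k::field, 'v::ab_group_add) cmod"
  assumes M: "cat_module C M" and fg: "fin_gen C M" and N: "submod C M N" "N \<noteq> mob M"
  shows "\<exists>(Q :: ('o, 'm, 'k, 'v) cmod) \<pi>. simple_mod C Q \<and> surj_hom C M Q \<pi> \<and> (\<forall>x. \<forall>v\<in>N x. \<pi> x v = 0)"
proof -
  interpret M: cat_module C M by (rule M)
  obtain X where X: "finite X" "\<And>x v. (x, v) \<in> X \<Longrightarrow> v \<in> mob M x"
    "\<And>A. submod C M A \<Longrightarrow> (\<And>x v. (x, v) \<in> X \<Longrightarrow> v \<in> A x) \<Longrightarrow> A = mob M"
    using fg unfolding fin_gen_def by (metis (no_types, lifting) case_prodD case_prodI2)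
  \<comment> \<open>Zorn's lemma is applied to sets ordered by inclusion, so a family of subspaces
    is coded as its set of pairs.\<close>
  define \<A> where "\<A> = {Sigma UNIV A | A. submod C M A \<and> N \<le> A \<and> A \<noteq> mob M}"
  have "\<exists>m\<in>\<A>. \<forall>X\<in>\<A>. m \<subseteq> X \<longrightarrow> X = m"
  proof (rule subset_Zorn_nonempty)
    show "\<A> \<noteq> {}" using N by (auto simp: \<A>_def)
    fix \<C> assume ne: "\<C> \<noteq> {}" and ch: "subset.chain \<A> \<C>"
    have sub: "\<C> \<subseteq> \<A>" and tot: "\<And>S T. S \<in> \<C> \<Longrightarrow> T \<in> \<C> \<Longrightarrow> S \<subseteq> T \<or> T \<subseteq> S"
      using ch by (auto simp: subset.chain_def)
    define A where "A x = {v. (x, v) \<in> \<Union>\<C>}" for x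
    have UA: "\<Union>\<C> = Sigma UNIV A" by (auto simp: A_def)
    have mem: "\<exists>B. submod C M B \<and> N \<le> B \<and> B \<noteq> mob M \<and> S = Sigma UNIV B" if "S \<in> \<C>" for S
      using sub that by (auto simp: \<A>_def)
    have A1: "\<exists>B. submod C M B \<and> v \<in> B x \<and> Sigma UNIV B \<in> \<C>" if "v \<in> A x" for x v
    proof -
      obtain S where "S \<in> \<C>" "(x, v) \<in> S" using \<open>v \<in> A x\<close> by (auto simp: A_def)
      then show ?thesis using mem[of S] by auto
    qed
    have BA: "B x \<subseteq> A x" if "Sigma UNIV B \<in> \<C>" for B x
      using that by (auto simp: A_def intro!: bexI[of _ "Sigma UNIV B"])
    obtain S0 where "S0 \<in> \<C>" using ne by blast
    then obtain B0 where B0: "submod C M B0" "N \<le> B0" "Sigma UNIV B0 \<in> \<C>" using mem by metis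
    have fin: "\<exists>B. submod C M B \<and> B \<noteq> mob M \<and> Sigma UNIV B \<in> \<C> \<and> Y \<subseteq> Sigma UNIV B"
      if Y: "finite Y" "Y \<subseteq> \<Union>\<C>" for Y
    proof -
      obtain S where "S \<in> \<C>" "Y \<subseteq> S"
        by (rule finite_subset_Union_chain[OF Y ne ch])
      then show ?thesis using mem by metis
    qed
    have "submod C M A"
    proof (rule submodI[OF M])
      show "v \<in> mob M x" if "v \<in> A x" for v x using A1[OF that] submod_le[OF M] by blast
      show "0 \<in> A x" for x using submod_0[OF M B0(1), of x] BA[OF B0(3), of x] by blast
      show "mscale M c v \<in> A x" if "v \<in> A x" for v c x using A1[OF that] submod_scale[OF M] BA by blast
      show "mact M x y f v \<in> A y" if "f \<in> Hom C x y" "v \<in> A x" for f x y v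
        using A1[OF that(2)] submod_act[OF M _ that(1)] BA by blast
      show "v + w \<in> A x" if "v \<in> A x" "w \<in> A x" for v w x
      proof -
        have "finite {(x, v), (x, w)}" "{(x, v), (x, w)} \<subseteq> \<Union>\<C>" using that by (auto simp: A_def)
        from fin[OF this] obtain B where "submod C M B" "Sigma UNIV B \<in> \<C>" "v \<in> B x" "w \<in> B x" by auto
        then show ?thesis using submod_add[OF M] BA by blast
      qed
    qed
    moreover have "N \<le> A" using B0(2) BA[OF B0(3)] by (auto simp: le_fun_def)
    moreover have "A \<noteq> mob M"
    proof
      assume "A = mob M"
      then have "X \<subseteq> \<Union>\<C>" using X(2) UA by auto
      from fin[OF X(1) this] obtain B where B: "submod C M B" "B \<noteq> mob M" "X \<subseteq> Sigma UNIV B" by blast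
      then have "B = mob M" by (intro X(3)) auto
      with B show False by blast
    qed
    ultimately show "\<Union>\<C> \<in> \<A>" unfolding UA \<A>_def by blast
  qed
  then obtain m where m: "m \<in> \<A>" "\<And>X. X \<in> \<A> \<Longrightarrow> m \<subseteq> X \<Longrightarrow> X = m" by blast
  from m(1) obtain A where A: "submod C M A" "N \<le> A" "A \<noteq> mob M" and mA: "m = Sigma UNIV A"
    by (auto simp: \<A>_def)
  have max: "Sigma UNIV B = Sigma UNIV A"
    if "submod C M B" "N \<le> B" "B \<noteq> mob M" "Sigma UNIV A \<subseteq> Sigma UNIV B" for B
  proof -
    have "Sigma UNIV B \<in> \<A>" using that by (auto simp: \<A>_def)
    then show ?thesis using m(2)[of "Sigma UNIV B"] that(4) mA by simp
  qed
  obtain Q :: "('o, 'm, 'k, 'v) cmod" and \<pi> where Q: "cat_module C Q" "surj_hom C M Q \<pi>"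
    and k: "\<And>x v. v \<in> mob M x \<Longrightarrow> \<pi> x v = 0 \<longleftrightarrow> v \<in> A x"
    using quotient_exists[OF M A(1)] by blast
  have \<pi>: "mod_hom C M Q \<pi>" and s: "\<And>x. \<pi> x ` mob M x = mob Q x" using Q(2) by (auto simp: surj_hom_def)
  have "simple_mod C Q" unfolding simple_mod_def
  proof (intro conjI allI impI)
    show "cat_module C Q" by (rule Q)
    obtain x v where v: "v \<in> mob M x" "v \<notin> A x" using A(3) submod_le[OF M A(1)] by blast
    then have "\<pi> x v \<in> mob Q x" "\<pi> x v \<noteq> 0" using k s[of x] by auto
    then show "mob Q \<noteq> zero_sub" using mob_nonzero_iff[OF Q(1)] by blast
    fix B assume B: "submod C Q B"
    let ?B = "\<lambda>x. {v \<in> mob M x. \<pi> x v \<in> B x}"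
    have B': "submod C M ?B" by (rule submod_preimage[OF M Q(1) \<pi> B])
    have AB: "A x \<subseteq> ?B x" for x
    proof
      fix v assume v: "v \<in> A x"
      then have "\<pi> x v = 0" using k[OF submod_le[OF M A(1) v]] by simp
      then show "v \<in> ?B x" using submod_le[OF M A(1) v] submod_0[OF Q(1) B, of x] by simp
    qed
    have BQ: "B x = \<pi> x ` ?B x" for x using s[of x] submod_le[OF Q(1) B, of _ x] by force
    show "B = zero_sub \<or> B = mob Q"
    proof (cases "?B = mob M")
      case True
      then have "B x = mob Q x" for x using BQ[of x] s[of x] by (metis (mono_tags, lifting))
      then show ?thesis by blast
    next
      case False
      have "Sigma UNIV ?B = Sigma UNIV A"
        by (rule max[OF B' _ False]) (use AB A(2) in \<open>auto simp: le_fun_def\<close>)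
      then have "?B x = A x" for x by (auto simp: set_eq_iff)
      then have "B x = {0}" for x
        using BQ[of x] k submod_le[OF M A(1)] submod_0[OF Q(1) B, of x] by (auto simp: image_iff)
      then show ?thesis by (auto simp: zero_sub_def fun_eq_iff)
    qed
  qed
  moreover have "\<pi> x v = 0" if "v \<in> N x" for x v
    using that subsetD[OF le_funD[OF A(2)]] k submod_le[OF M A(1)] by blast
  ultimately show ?thesis using Q(2) by blast
qed

lemma fin_gen_quotient:
  assumes M: "cat_module C M" and Q: "cat_module C Q" and fg: "fin_gen C M" and \<pi>: "surj_hom C M Q \<pi>"
  shows "fin_gen C Q"
proof -
  obtain X where X: "finite X" "\<And>x v. (x, v) \<in> X \<Longrightarrow> v \<in> mob M x"
    "\<And>A. submod C M A \<Longrightarrow> (\<And>x v. (x, v) \<in> X \<Longrightarrow> v \<in> A x) \<Longrightarrow> A = mob M"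
    using fg unfolding fin_gen_def by (metis (no_types, lifting) case_prodD case_prodI2)
  have \<pi>': "mod_hom C M Q \<pi>" and s: "\<And>x. \<pi> x ` mob M x = mob Q x" using \<pi> by (auto simp: surj_hom_def)
  show ?thesis unfolding fin_gen_def
  proof (intro exI[of _ "(\<lambda>(x, v). (x, \<pi> x v)) ` X"] conjI allI impI, goal_cases)
    case 1 show ?case using X(1) by simp
  next
    case 2 show ?case using X(2) mod_hom_closed[OF M Q \<pi>'] by auto
  next
    case (3 N)
    then have N: "submod C Q N" by blast
    have "(\<lambda>x. {v \<in> mob M x. \<pi> x v \<in> N x}) = mob M"
      by (rule X(3)[OF submod_preimage[OF M Q \<pi>' N]]) (use 3 X(2) in auto)
    then have "\<pi> x v \<in> N x" if "v \<in> mob M x" for x v using that by (auto simp: fun_eq_iff set_eq_iff)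
    then have "mob Q x \<subseteq> N x" for x unfolding s[of x, symmetric] by (rule image_subsetI)
    then show ?case using submod_le[OF Q N] by (intro ext) blast
  qed
qed

lemma fin_gen_rep: assumes C: "linear_category C" shows "fin_gen C (rep C x)"
proof -
  interpret linear_category C by (rule C)
  show ?thesis unfolding fin_gen_def
  proof (intro exI[of _ "{(x, ident C x)}"] conjI allI impI, goal_cases)
    case (3 N)
    then have N: "submod C (rep C x) N" and i: "ident C x \<in> N x" by auto
    have "f \<in> N y" if "f \<in> Hom C x y" for f y
      using submod_act[OF cat_module_rep[OF C] N that i] ident_right[OF that] by simp
    then show ?case using submod_le[OF cat_module_rep[OF C] N] by (intro ext) auto
  qed (auto simp: ident_closed)
qed

section \<open>Weights\<close>

text \<open>The trace of the family \<open>F\<close> in \<open>M\<close>: the sum of the images of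
  all homomorphisms from its members.\<close>

definition trace_sub ::
  "('o, 'm, 'k::field) lincat \<Rightarrow> ('i \<Rightarrow> ('o, 'm, 'k, 'u::ab_group_add) cmod) \<Rightarrow> 'i set \<Rightarrow>
   ('o, 'm, 'k, 'v::ab_group_add) cmod \<Rightarrow> 'o \<Rightarrow> 'v set" where
  "trace_sub C F W M x = module.span (mscale M) {\<phi> x s | w \<phi> s. w \<in> W \<and> mod_hom C (F w) M \<phi> \<and> s \<in> mob (F w) x}"

lemma trace_sub_image:
  assumes M: "cat_module C M" and "w \<in> W" "mod_hom C (F w) M \<phi>" "s \<in> mob (F w) x"
  shows "\<phi> x s \<in> trace_sub C F W M x"
proof -
  interpret M: cat_module C M by (rule M)
  show ?thesis unfolding trace_sub_def using assms(2-) by (intro M.mv.span_base) blast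
qed

lemma submod_trace_sub:
  assumes M: "cat_module C M" and F: "\<And>w. w \<in> W \<Longrightarrow> cat_module C (F w)"
  shows "submod C M (trace_sub C F W M)"
proof -
  interpret M: cat_module C M by (rule M)
  let ?X = "\<lambda>x. {\<phi> x s | w \<phi> s. w \<in> W \<and> mod_hom C (F w) M \<phi> \<and> s \<in> mob (F w) x}"
  have XM: "?X x \<subseteq> mob M x" for x using mod_hom_closed[OF F M] by blast
  have sub: "M.mv.subspace (trace_sub C F W M x)" for x unfolding trace_sub_def by (rule M.mv.subspace_span)
  have le: "trace_sub C F W M x \<subseteq> mob M x" for x
    unfolding trace_sub_def by (rule M.mv.span_minimal[OF XM M.subspace])
  have "mact M x y f v \<in> trace_sub C F W M y" if f: "f \<in> Hom C x y" and v: "v \<in> trace_sub C F W M x" for x y f v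
  proof -
    have "v \<in> mob M x \<and> mact M x y f v \<in> trace_sub C F W M y"
      using v unfolding trace_sub_def[of C F W M x]
    proof (induction rule: M.mv.span_induct_alt)
      case base
      then show ?case using M.act_0[OF f] M.mob_0 M.mv.subspace_0[OF sub] by simp
    next
      case (step c a b)
      then obtain w \<phi> s where a: "a = \<phi> x s" and w: "w \<in> W" "mod_hom C (F w) M \<phi>" "s \<in> mob (F w) x" by blast
      have aM: "a \<in> mob M x" using step.hyps XM by blast
      have "mact M x y f a = \<phi> y (mact (F w) x y f s)"
        using mod_hom_act[OF F[OF w(1)] M w(2) f w(3)] a by simp
      also have "\<dots> \<in> trace_sub C F W M y"
        by (rule trace_sub_image[where w = w and W = W and F = F,
              OF M w(1,2) cat_module.act_closed[OF F[OF w(1)] f w(3)]])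
      finally show ?case
        using step.IH aM M.mv.subspace_add[OF sub M.mv.subspace_scale[OF sub]]
        by (simp add: M.act_add[OF f] M.act_scale[OF f] M.mob_add M.mob_scale)
    qed
    then show ?thesis by blast
  qed
  then show ?thesis using sub le by (simp add: submod_def)
qed

text \<open>Scalars are absorbed into the homomorphisms, so plain finite sums of images
  suffice.\<close>

lemma trace_sub_sum:
  assumes M: "cat_module C M" and F: "\<And>w. w \<in> W \<Longrightarrow> cat_module C (F w)"
    and v: "v \<in> trace_sub C F W M x"
  shows "\<exists>(n::nat) w \<phi> s. (\<forall>j<n. w j \<in> W \<and> mod_hom C (F (w j)) M (\<phi> j) \<and> s j \<in> mob (F (w j)) x) \<and>
    v = (\<Sum>j<n. \<phi> j x (s j))"
proof -
  interpret M: cat_module C M by (rule M)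
  show ?thesis using v unfolding trace_sub_def
  proof (induction rule: M.mv.span_induct_alt)
    case base show ?case by (intro exI[of _ 0]) simp
  next
    case (step c a b)
    obtain n w \<phi> s where IH: "\<forall>j<n. w j \<in> W \<and> mod_hom C (F (w j)) M (\<phi> j) \<and> s j \<in> mob (F (w j)) x"
      "b = (\<Sum>j<n::nat. \<phi> j x (s j))" using step.IH by blast
    obtain w' \<phi>' s' where a: "a = \<phi>' x s'" "w' \<in> W" "mod_hom C (F w') M \<phi>'" "s' \<in> mob (F w') x"
      using step.hyps by blast
    let ?w = "\<lambda>j. if j < n then w j else w'"
    let ?\<phi> = "\<lambda>j. if j < n then \<phi> j else (\<lambda>x v. mscale M c (\<phi>' x v))"
    let ?s = "\<lambda>j. if j < n then s j else s'"
    show ?case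
      by (intro exI[of _ "Suc n"] exI[of _ ?w] exI[of _ ?\<phi>] exI[of _ ?s])
        (use IH a mod_hom_smult[OF M F[OF a(2)] a(3)] in \<open>auto simp: less_Suc_eq add.commute\<close>)
  qed
qed

text \<open>A proper trace would be killed by a map onto some simple \<open>Q\<close>; but a
  non-zero map from a member of the family to \<open>Q\<close> lifts to \<open>M\<close>, and the
  lift has its image in the trace.\<close>

lemma trace_sub_full:
  fixes M :: "('o, 'm::ab_group_add, 'k::field, 'v::ab_group_add) cmod"
  assumes M: "cat_module C M" and fg: "fin_gen C M" and F: "\<And>w. w \<in> W \<Longrightarrow> cat_module C (F w)"
    and nz: "\<And>Q :: ('o, 'm, 'k, 'v) cmod. simple_mod C Q \<Longrightarrow>
      \<exists>w\<in>W. \<exists>\<phi> x. \<exists>s\<in>mob (F w) x. lift_prop C (F w) M Q \<and> mod_hom C (F w) Q \<phi> \<and> \<phi> x s \<noteq> 0"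
  shows "trace_sub C F W M = mob M"
proof (rule ccontr)
  assume "trace_sub C F W M \<noteq> mob M"
  then obtain Q :: "('o, 'm, 'k, 'v) cmod" and \<pi> where Q: "simple_mod C Q" "surj_hom C M Q \<pi>"
    and k: "\<And>x v. v \<in> trace_sub C F W M x \<Longrightarrow> \<pi> x v = 0"
    using fin_gen_simple_quotient[OF M fg submod_trace_sub[where W = W and F = F, OF M F]] by blast
  obtain w \<phi> x s where w: "w \<in> W" "s \<in> mob (F w) x" "lift_prop C (F w) M Q" "mod_hom C (F w) Q \<phi>" "\<phi> x s \<noteq> 0"
    using nz[OF Q(1)] by blast
  obtain \<psi> where \<psi>: "mod_hom C (F w) M \<psi>" "\<forall>x. \<forall>v\<in>mob (F w) x. \<pi> x (\<psi> x v) = \<phi> x v"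
    using lift_propD[OF w(3) Q(2) w(4)] by blast
  show False using k[OF trace_sub_image[where w = w and W = W and F = F, OF M w(1) \<psi>(1) w(2)]] \<psi>(2) w(2,5) by simp
qed

section \<open>Isomorphism of objects\<close>

lemma iso_obj_refl: "linear_category C \<Longrightarrow> iso_obj C x x"
  unfolding iso_obj_def
  by (intro bexI[of _ "ident C x"] conjI linear_category.ident_closed
      linear_category.ident_left[OF _ linear_category.ident_closed])

lemma iso_obj_sym: "iso_obj C x y \<Longrightarrow> iso_obj C y x"
  unfolding iso_obj_def by blast

lemma iso_obj_trans:
  assumes C: "linear_category C" and "iso_obj C x y" "iso_obj C y z"
  shows "iso_obj C x z"
proof -
  interpret linear_category C by (rule C)
  obtain f g where f: "f \<in> Hom C x y" "g \<in> Hom C y x" "cmp C x y x g f = ident C x" "cmp C y x y f g = ident C y"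
    using assms(2) by (auto simp: iso_obj_def)
  obtain f' g' where f': "f' \<in> Hom C y z" "g' \<in> Hom C z y" "cmp C y z y g' f' = ident C y" "cmp C z y z f' g' = ident C z"
    using assms(3) by (auto simp: iso_obj_def)
  have "cmp C x z x (cmp C z y x g g') (cmp C x y z f' f) = ident C x"
    using f f' comp_assoc[OF f(1) f'(1) comp_closed[OF f'(2) f(2)]] comp_assoc[OF f'(1,2) f(2)]
    by (simp add: ident_right)
  moreover have "cmp C z x z (cmp C x y z f' f) (cmp C z y x g g') = ident C z"
    using f f' comp_assoc[OF f'(2) f(2) comp_closed[OF f(1) f'(1)]] comp_assoc[OF f(2,1) f'(1)]
    by (simp add: ident_right)
  ultimately show ?thesis
    unfolding iso_obj_def using comp_closed f f' by blast
qed

lemma obj_class_eq_iff: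
  assumes C: "linear_category C"
  shows "obj_class C x = obj_class C y \<longleftrightarrow> iso_obj C x y"
proof
  show "iso_obj C x y" if "obj_class C x = obj_class C y"
    using that iso_obj_refl[OF C, of y] by (auto simp: obj_class_def)
  assume xy: "iso_obj C x y"
  have "iso_obj C x z \<longleftrightarrow> iso_obj C y z" for z
    using iso_obj_trans[OF C xy, of z] iso_obj_trans[OF C iso_obj_sym[OF xy], of z] by blast
  then show "obj_class C x = obj_class C y" by (simp add: obj_class_def)
qed

section \<open>Simple modules over the common subcategory of \<open>U\<close> and
  \<open>D\<close>\<close>

locale tri = triangular_category G U D
  for G :: "('o, 'm::ab_group_add, 'k::alg_closed_field) lincat" and U D :: "'o \<Rightarrow> 'o \<Rightarrow> 'm set" +
  fixes r :: "('o set \<times> 'o set) set"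
    and S :: "('o, 'm, 'k) weight \<Rightarrow> ('o, 'm, 'k, 'm) cmod"
  assumes adm: "admissible_order G U D r"
    and S_in: "\<mu> \<in> weights G U D \<Longrightarrow> S \<mu> \<in> \<mu>"
begin

sublocale gv: vector_space "cscale G" by (rule vector_space)

abbreviation "H \<equiv> mid U D"
abbreviation "K \<equiv> subcat G (mid U D)"
abbreviation "\<Lambda> \<equiv> weights G U D"

definition le :: "'o \<Rightarrow> 'o \<Rightarrow> bool" where
  "le x y \<longleftrightarrow> (obj_class G x, obj_class G y) \<in> r"

lemma linG: "linear_category G" by (rule linear_category_axioms)

lemma wide_H: "wide_subcategory G H"
  using wide_U wide_D gv.subspace_inter unfolding wide_subcategory_def mid_def by blast

lemma linK: "linear_category K" by (rule linear_category_subcat[OF linG wide_H])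

lemma U_Hom: "f \<in> U x y \<Longrightarrow> f \<in> Hom G x y" and D_Hom: "f \<in> D x y \<Longrightarrow> f \<in> Hom G x y"
  and H_U: "f \<in> H x y \<Longrightarrow> f \<in> U x y" and H_D: "f \<in> H x y \<Longrightarrow> f \<in> D x y"
  and H_Hom: "f \<in> H x y \<Longrightarrow> f \<in> Hom G x y"
  and U_comp: "f \<in> U x y \<Longrightarrow> g \<in> U y z \<Longrightarrow> cmp G x y z g f \<in> U x z"
  and D_comp: "f \<in> D x y \<Longrightarrow> g \<in> D y z \<Longrightarrow> cmp G x y z g f \<in> D x z"
  and H_comp: "f \<in> H x y \<Longrightarrow> g \<in> H y z \<Longrightarrow> cmp G x y z g f \<in> H x z"
  and U_sub: "gv.subspace (U x y)" and D_sub: "gv.subspace (D x y)" and H_sub: "gv.subspace (H x y)"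
  and H_ident: "ident G x \<in> H x x"
  using wide_U wide_D wide_H by (auto simp: wide_subcategory_def mid_def subset_iff)

lemma H_self: "H x x = U x x" using T1_eq by (simp add: mid_def)

lemma comp_0: "f \<in> Hom G x y \<Longrightarrow> cmp G x y z 0 f = 0" "g \<in> Hom G y z \<Longrightarrow> cmp G x y z g 0 = 0"
  using linear_map_on_0[OF vector_space vector_space subspace comp_linear_left]
    linear_map_on_0[OF vector_space vector_space subspace comp_linear_right] by auto

lemma comp_add:
  "f \<in> Hom G x y \<Longrightarrow> g \<in> Hom G y z \<Longrightarrow> g' \<in> Hom G y z \<Longrightarrow> cmp G x y z (g + g') f = cmp G x y z g f + cmp G x y z g' f"
  "g \<in> Hom G y z \<Longrightarrow> f \<in> Hom G x y \<Longrightarrow> f' \<in> Hom G x y \<Longrightarrow> cmp G x y z g (f + f') = cmp G x y z g f + cmp G x y z g f'"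
  using comp_linear_left[of f x y z] comp_linear_right[of g y z x] by (simp_all add: linear_map_on_def)

lemma comp_scale:
  "f \<in> Hom G x y \<Longrightarrow> g \<in> Hom G y z \<Longrightarrow> cmp G x y z (cscale G c g) f = cscale G c (cmp G x y z g f)"
  "g \<in> Hom G y z \<Longrightarrow> f \<in> Hom G x y \<Longrightarrow> cmp G x y z g (cscale G c f) = cscale G c (cmp G x y z g f)"
  using comp_linear_left[of f x y z] comp_linear_right[of g y z x] by (simp_all add: linear_map_on_def)

lemma iso_refl: "iso_obj G x x" by (rule iso_obj_refl[OF linG])
lemmas iso_sym = iso_obj_sym[of G]
lemmas iso_trans = iso_obj_trans[OF linG]

lemma po: "partial_order_on (obj_classes G) r" using adm by (simp add: admissible_order_def)

lemma cls_in: "obj_class G x \<in> obj_classes G" by (simp add: obj_classes_def)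

lemma le_refl: "le x x"
  using po cls_in unfolding le_def partial_order_on_def preorder_on_def refl_on_def by blast

lemma le_trans: "le x y \<Longrightarrow> le y z \<Longrightarrow> le x z"
  using po unfolding le_def partial_order_on_def preorder_on_def trans_on_def using cls_in by blast

lemma le_antisym: "le x y \<Longrightarrow> le y x \<Longrightarrow> iso_obj G x y"
  using po unfolding le_def partial_order_on_def antisym_on_def obj_class_eq_iff[OF linG, symmetric] using cls_in by blast

lemma iso_le: "iso_obj G x y \<Longrightarrow> le x y"
  using le_refl[of x] by (simp add: le_def obj_class_eq_iff[OF linG, symmetric])

lemma U_le: "f \<in> U x y \<Longrightarrow> f \<noteq> 0 \<Longrightarrow> le x y" and D_le: "f \<in> D x y \<Longrightarrow> f \<noteq> 0 \<Longrightarrow> le y x"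
  using adm unfolding admissible_order_def le_def by blast+

text \<open>Such an \<open>f\<close> goes both up and down in the order. Modules over
  \<open>H\<close> therefore decompose according to isomorphism classes of objects.\<close>

lemma H_iso: "f \<in> H x y \<Longrightarrow> f \<noteq> 0 \<Longrightarrow> iso_obj G x y"
  using U_le D_le le_antisym H_U H_D by blast

lemma iso_H:
  assumes "iso_obj G x y"
  obtains m m' where "m \<in> H x y" "m' \<in> H y x" "cmp G x y x m' m = ident G x" "cmp G y x y m m' = ident G y"
  using iso_mid[OF assms] unfolding iso_obj_def by auto

text \<open>Composing with an isomorphism of \<open>H\<close> back to \<open>x\<close> turns
  \<open>u\<close> into an endomorphism, where \<open>U\<close> and \<open>D\<close> agree. That
  such an isomorphism exists is the content of \<open>iso_mid\<close>.\<close>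

lemma U_iso_H: assumes "iso_obj G x y" "u \<in> U x y" shows "u \<in> H x y"
proof -
  obtain m m' where m: "m \<in> H x y" "m' \<in> H y x" "cmp G y x y m m' = ident G y" by (rule iso_H[OF assms(1)])
  have "cmp G x y x m' u \<in> H x x" using U_comp[OF assms(2) H_U[OF m(2)]] by (simp add: H_self)
  then have "cmp G x x y m (cmp G x y x m' u) \<in> H x y" using H_comp m(1) by blast
  moreover have "cmp G x x y m (cmp G x y x m' u) = u"
    using comp_assoc[OF U_Hom[OF assms(2)] H_Hom[OF m(2)] H_Hom[OF m(1)]] m(3) ident_left[OF U_Hom[OF assms(2)]] by simp
  ultimately show ?thesis by simp
qed

lemma D_iso_H: assumes "iso_obj G x y" "u \<in> D x y" shows "u \<in> H x y"
proof -
  obtain m m' where m: "m \<in> H x y" "m' \<in> H y x" "cmp G y x y m m' = ident G y" by (rule iso_H[OF assms(1)])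
  have "cmp G x y x m' u \<in> H x x" using D_comp[OF assms(2) H_D[OF m(2)]] by (simp add: H_self T1_eq)
  then have "cmp G x x y m (cmp G x y x m' u) \<in> H x y" using H_comp m(1) by blast
  moreover have "cmp G x x y m (cmp G x y x m' u) = u"
    using comp_assoc[OF D_Hom[OF assms(2)] H_Hom[OF m(2)] H_Hom[OF m(1)]] m(3) ident_left[OF D_Hom[OF assms(2)]] by simp
  ultimately show ?thesis by simp
qed

text \<open>The kernel of \<open>p\<close> at \<open>x\<close> is a left ideal \<open>I\<close> of a
  semi-simple ring. Write the identity as \<open>a + b\<close> along \<open>I\<close> and a
  complement \<open>J\<close>; right multiplication by \<open>b\<close> kills the kernel of
  \<open>p\<close> at every object and induces the section.\<close>

lemma K_cyclic_retract:
  fixes N :: "('o, 'm, 'k, 'v::ab_group_add) cmod"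
  assumes N: "cat_module K N" and p: "surj_hom K (rep K x) N p"
  shows "\<exists>s. mod_hom K N (rep K x) s \<and> (\<forall>y. \<forall>v\<in>mob N y. p y (s y v) = v)"
proof -
  note R = cat_module_rep[OF linK, of x]
  have p': "mod_hom K (rep K x) N p" and ps: "p y ` H x y = mob N y" for y using p by (auto simp: surj_hom_def)
  define I where "I = {c \<in> H x x. p x c = 0}"
  have pact: "p z (cmp G x y z f c) = mact N y z f (p y c)" if "f \<in> H y z" "c \<in> H x y" for f y z c
    using mod_hom_act[OF R N p', of f y z c] that by simp
  have li: "left_ideal (subcat G U) x I"
    unfolding left_ideal_def subcat_sel H_self[symmetric] I_def
    using gv.subspace_0[OF H_sub] gv.subspace_add[OF H_sub] gv.subspace_neg[OF H_sub]
      mod_homD[OF R N p', simplified] pact H_comp cat_module.act_0[OF N] by auto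
  then obtain J where J: "left_ideal (subcat G U) x J" "I \<inter> J = {0}" "{a + b | a b. a \<in> I \<and> b \<in> J} = H x x"
    using T1_semisimple[of x] unfolding semisimple_End_def by (auto simp: H_self)
  have Jc: "cmp G x x x e b \<in> J" "b \<in> H x x" if "b \<in> J" "e \<in> H x x" for b e
    using J(1) that by (auto simp: left_ideal_def H_self)
  obtain a b where ab: "ident G x = a + b" "a \<in> I" "b \<in> J" using J(3) H_ident[of x] by blast
  have aH: "a \<in> H x x" using ab(2) by (simp add: I_def)
  have bH: "b \<in> H x x" using Jc(2)[OF ab(3) H_ident] .
  have rb: "mod_hom K (rep K x) (rep K x) (\<lambda>y f. cmp G x x y f b)"
    using yoneda_hom[OF linK R, of b x] bH by simp
  \<comment> \<open>A non-zero \<open>c\<close> can be moved by an isomorphism to some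
    \<open>c'\<close> in \<open>I\<close>; then \<open>c' b = c' - c' a\<close> lies in
    \<open>I\<close> and in \<open>J\<close>.\<close>
  have kill: "cmp G x x y c b = 0" if c: "c \<in> H x y" "p y c = 0" for y c
  proof (cases "c = 0")
    case True
    then show ?thesis using comp_0(1)[OF H_Hom[OF bH]] by simp
  next
    case False
    obtain m m' where m: "m \<in> H x y" "m' \<in> H y x" "cmp G y x y m m' = ident G y"
      by (rule iso_H[OF H_iso[OF c(1) False]])
    define c' where "c' = cmp G x y x m' c"
    have c': "c' \<in> I" using pact[OF m(2) c(1)] c cat_module.act_0[OF N, of m' y x] m(2) H_comp[OF c(1) m(2)]
      by (simp add: I_def c'_def)
    then have c'H: "c' \<in> H x x" by (simp add: I_def)
    have "cmp G x x x c' a \<in> I" using li ab(2) c'H by (simp add: left_ideal_def H_self)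
    moreover have "c' = cmp G x x x c' a + cmp G x x x c' b"
      using comp_add(2)[OF H_Hom[OF c'H] H_Hom[OF aH] H_Hom[OF bH]] ab(1) ident_right[OF H_Hom[OF c'H]] by simp
    ultimately have "cmp G x x x c' b \<in> I"
      using c' li unfolding left_ideal_def by (metis add_diff_cancel_left' diff_conv_add_uminus)
    then have z: "cmp G x x x c' b = 0" using Jc(1)[OF ab(3) c'H] J(2) by blast
    have "c = cmp G x x y m c'"
      using comp_assoc[OF H_Hom[OF c(1)] H_Hom[OF m(2)] H_Hom[OF m(1)]] m(3) ident_left[OF H_Hom[OF c(1)]]
      by (simp add: c'_def)
    then have "cmp G x x y c b = cmp G x x y m (cmp G x x x c' b)"
      using comp_assoc[OF H_Hom[OF bH] H_Hom[OF c'H] H_Hom[OF m(1)]] by simp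
    then show ?thesis using z comp_0(2)[OF H_Hom[OF m(1)]] by simp
  qed
  obtain s where s: "mod_hom K N (rep K x) s" "\<forall>y. \<forall>c\<in>H x y. s y (p y c) = cmp G x x y c b"
    using hom_factor[OF R N R p rb] kill by auto
  have "p y (s y v) = v" if v: "v \<in> mob N y" for y v
  proof -
    obtain c where c: "c \<in> H x y" "v = p y c" using v unfolding ps[of y, symmetric] by blast
    have pb: "p x b = p x (ident G x)"
      using mod_hom_add[OF R N p', of a x b] aH bH ab by (simp add: I_def)
    have "p y (s y v) = mact N x y c (p x b)" using s(2) c pact[OF c(1) bH] by simp
    also have "\<dots> = p y (cmp G x x y c (ident G x))" using pb pact[OF c(1) H_ident] by simp
    finally show ?thesis using c ident_right[OF H_Hom[OF c(1)]] by simp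
  qed
  then show ?thesis using s(1) by blast
qed

lemma S_simple: assumes "\<mu> \<in> \<Lambda>" shows "simple_mod K (S \<mu>)"
  using S_in[OF assms] assms by (auto simp: weights_def)

lemmas S_cat = simple_cat_module[OF S_simple]

lemma weight_mem_iff:
  assumes \<mu>: "\<mu> \<in> \<Lambda>"
  shows "T \<in> \<mu> \<longleftrightarrow> simple_mod K T \<and> isomorphic K (S \<mu>) T"
proof -
  obtain T0 :: "('o, 'm, 'k, 'm) cmod" where T0: "simple_mod K T0" and e: "\<mu> = {T. simple_mod K T \<and> isomorphic K T0 T}"
    using \<mu> by (auto simp: weights_def)
  have i: "isomorphic K T0 (S \<mu>)" using S_in[OF \<mu>] e by blast
  have i': "isomorphic K (S \<mu>) T0" by (rule isomorphic_sym[OF simple_cat_module[OF T0] S_cat[OF \<mu>] i])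
  show ?thesis using e isomorphic_trans[OF i] isomorphic_trans[OF i'] by blast
qed

lemma weight_eqI:
  assumes \<mu>: "\<mu> \<in> \<Lambda>" and \<nu>: "\<nu> \<in> \<Lambda>" and "isomorphic K (S \<mu>) (S \<nu>)"
  shows "\<mu> = \<nu>"
proof -
  have "isomorphic K (S \<nu>) (S \<mu>)" by (rule isomorphic_sym[OF S_cat[OF \<mu>] S_cat[OF \<nu>] assms(3)])
  then show ?thesis using weight_mem_iff[OF \<mu>] weight_mem_iff[OF \<nu>] isomorphic_trans assms(3) by blast
qed

text \<open>Weights are classes of modules with values in \<open>'m\<close>, whereas
  \<open>N\<close> has an arbitrary value type. A non-zero vector presents \<open>N\<close> as a
  quotient of \<open>rep K x\<close>, and that quotient can be rebuilt on \<open>'m\<close>.\<close>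

lemma simple_K_weight:
  fixes N :: "('o, 'm, 'k, 'v::ab_group_add) cmod"
  assumes N: "simple_mod K N"
  shows "\<exists>\<mu>\<in>\<Lambda>. isomorphic K (S \<mu>) N"
proof -
  note Nc = simple_cat_module[OF N]
  obtain x v where v: "v \<in> mob N x" "v \<noteq> 0" using simple_nonzero[OF N] mob_nonzero_iff[OF Nc] by blast
  let ?p = "\<lambda>y f. mact N x y f v"
  note R = cat_module_rep[OF linK, of x]
  have p: "mod_hom K (rep K x) N ?p" by (rule yoneda_hom[OF linK Nc v(1)])
  have "?p x (ident G x) = v" using cat_module.act_ident[OF Nc v(1)] by simp
  then have ps: "surj_hom K (rep K x) N ?p"
    using simple_hom_surj[OF N R p, of "ident G x" x] H_ident v(2) by simp
  obtain Q :: "('o, 'm, 'k, 'm) cmod" and q where Q: "cat_module K Q" "surj_hom K (rep K x) Q q"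
    and k: "\<And>y f. f \<in> H x y \<Longrightarrow> q y f = 0 \<longleftrightarrow> ?p y f = 0"
    using quotient_exists[OF R submod_kernel[OF R Nc p]] by auto
  have q: "mod_hom K (rep K x) Q q" and qs: "q y ` H x y = mob Q y" for y using Q(2) by (auto simp: surj_hom_def)
  obtain \<chi> where \<chi>: "mod_hom K N Q \<chi>" "\<forall>y. \<forall>f\<in>H x y. \<chi> y (?p y f) = q y f"
    using hom_factor[OF R Nc Q(1) ps q] k by auto
  have "bij_betw (\<chi> y) (mob N y) (mob Q y)" for y
  proof -
    have im: "?p y ` H x y = mob N y" using ps by (simp add: surj_hom_def)
    have "\<chi> y ` mob N y = mob Q y" unfolding im[symmetric] qs[of y, symmetric] image_image using \<chi>(2) by auto
    moreover have "w = 0" if w: "w \<in> mob N y" "\<chi> y w = 0" for w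
    proof -
      obtain f where "f \<in> H x y" "w = ?p y f" using w(1) unfolding im[symmetric] by blast
      then show ?thesis using w(2) \<chi>(2) k by simp
    qed
    then have "inj_on (\<chi> y) (mob N y)" using mod_hom_inj_iff[OF Nc Q(1) \<chi>(1)] by blast
    ultimately show ?thesis by (simp add: bij_betw_def)
  qed
  then have NQ: "isomorphic K N Q" using \<chi>(1) by (auto simp: isomorphic_def)
  have Qs: "simple_mod K Q" by (rule simple_mod_iso[OF N Q(1) NQ])
  define \<mu> where "\<mu> = {T :: ('o, 'm, 'k, 'm) cmod. simple_mod K T \<and> isomorphic K Q T}"
  have \<mu>: "\<mu> \<in> \<Lambda>" using Qs by (auto simp: \<mu>_def weights_def)
  have "Q \<in> \<mu>" using Qs isomorphic_refl[OF Q(1)] by (simp add: \<mu>_def)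
  then have "isomorphic K (S \<mu>) Q" using weight_mem_iff[OF \<mu>] by blast
  then show ?thesis using \<mu> isomorphic_trans isomorphic_sym[OF Nc Q(1) NQ] by blast
qed

lemma S_retract:
  assumes \<mu>: "\<mu> \<in> \<Lambda>" and v: "v \<in> mob (S \<mu>) x" "v \<noteq> 0"
  shows "surj_hom K (rep K x) (S \<mu>) (\<lambda>y f. mact (S \<mu>) x y f v)"
    and "\<exists>s. mod_hom K (S \<mu>) (rep K x) s \<and> (\<forall>y. \<forall>w\<in>mob (S \<mu>) y. mact (S \<mu>) x y (s y w) v = w)"
proof -
  let ?p = "\<lambda>y f. mact (S \<mu>) x y f v"
  note R = cat_module_rep[OF linK, of x]
  have p: "mod_hom K (rep K x) (S \<mu>) ?p" by (rule yoneda_hom[OF linK S_cat[OF \<mu>] v(1)])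
  have "?p x (ident G x) = v" using cat_module.act_ident[OF S_cat[OF \<mu>] v(1)] by simp
  then show ps: "surj_hom K (rep K x) (S \<mu>) ?p"
    using simple_hom_surj[OF S_simple[OF \<mu>] R p, of "ident G x" x] H_ident v(2) by simp
  show "\<exists>s. mod_hom K (S \<mu>) (rep K x) s \<and> (\<forall>y. \<forall>w\<in>mob (S \<mu>) y. mact (S \<mu>) x y (s y w) v = w)"
    using K_cyclic_retract[OF S_cat[OF \<mu>] ps] .
qed

lemma S_nonzero: assumes "\<mu> \<in> \<Lambda>" shows "\<exists>x. \<exists>v\<in>mob (S \<mu>) x. v \<noteq> 0"
  using simple_nonzero[OF S_simple[OF assms]] mob_nonzero_iff[OF S_cat[OF assms]] by blast

text \<open>By semi-simplicity a simple module over \<open>K\<close> is a retract of a representable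
  one, hence projective.\<close>

lemma S_lift:
  fixes A :: "('o, 'm, 'k, 'v::ab_group_add) cmod" and B :: "('o, 'm, 'k, 'w::ab_group_add) cmod"
  assumes \<mu>: "\<mu> \<in> \<Lambda>" and A: "cat_module K A" and B: "cat_module K B"
  shows "lift_prop K (S \<mu>) A B"
proof -
  obtain x v where v: "v \<in> mob (S \<mu>) x" "v \<noteq> 0" using S_nonzero[OF \<mu>] by blast
  obtain s where s: "mod_hom K (S \<mu>) (rep K x) s" "\<forall>y. \<forall>w\<in>mob (S \<mu>) y. mact (S \<mu>) x y (s y w) v = w"
    using S_retract(2)[OF \<mu> v] by blast
  show ?thesis
    by (rule lift_prop_retract[OF lift_prop_rep[OF linK A B] s(1) yoneda_hom[OF linK S_cat[OF \<mu>] v(1)]])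
      (use s(2) in blast)
qed

lemma H_fin: "fin_dim (cscale G) (H x y)"
  by (rule fin_dim_subset[OF T0]) (use H_Hom in blast)

lemma S_fin: assumes \<mu>: "\<mu> \<in> \<Lambda>" shows "pointwise_finite (S \<mu>)"
  unfolding pointwise_finite_def
proof
  fix y
  obtain x v where v: "v \<in> mob (S \<mu>) x" "v \<noteq> 0" using S_nonzero[OF \<mu>] by blast
  let ?p = "\<lambda>f. mact (S \<mu>) x y f v"
  have "?p ` H x y = mob (S \<mu>) y" using S_retract(1)[OF \<mu> v] by (simp add: surj_hom_def)
  moreover have "linear_map_on (cscale G) (mscale (S \<mu>)) (H x y) ?p"
    using cat_module.act_linear_left[OF S_cat[OF \<mu>] v(1), of y] by simp
  ultimately show "fin_dim (mscale (S \<mu>)) (mob (S \<mu>) y)"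
    using fin_dim_image[OF vector_space cat_module.vector_space[OF S_cat[OF \<mu>]] H_sub _ H_fin] by metis
qed

lemma S_iso_nonzero:
  assumes \<mu>: "\<mu> \<in> \<Lambda>" and v: "v \<in> mob (S \<mu>) x" "v \<noteq> 0"
  shows "(\<exists>w\<in>mob (S \<mu>) y. w \<noteq> 0) \<longleftrightarrow> iso_obj G x y"
proof
  note S = S_cat[OF \<mu>]
  show "iso_obj G x y" if ex: "\<exists>w\<in>mob (S \<mu>) y. w \<noteq> 0"
  proof -
    obtain w where w: "w \<in> mob (S \<mu>) y" "w \<noteq> 0" using ex by blast
    have "(\<lambda>f. mact (S \<mu>) x y f v) ` H x y = mob (S \<mu>) y" using S_retract(1)[OF \<mu> v] by (simp add: surj_hom_def)
    then have "w \<in> (\<lambda>f. mact (S \<mu>) x y f v) ` H x y" using w(1) by simp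
    then obtain f where f: "f \<in> H x y" "mact (S \<mu>) x y f v = w" by blast
    have "f \<noteq> 0"
      using f(2) w(2) linear_map_on_0[OF vector_space cat_module.vector_space[OF S] H_sub
          cat_module.act_linear_left[OF S v(1), of y, simplified]] by auto
    then show ?thesis using H_iso f(1) by blast
  qed
  assume "iso_obj G x y"
  then obtain m m' where m: "m \<in> H x y" "m' \<in> H y x" "cmp G x y x m' m = ident G x" by (rule iso_H)
  have "mact (S \<mu>) y x m' (mact (S \<mu>) x y m v) = v"
    using cat_module.act_comp[OF S, of m x y m' x v] cat_module.act_ident[OF S v(1)] m v by simp
  then have "mact (S \<mu>) x y m v \<noteq> 0" using cat_module.act_0[OF S, of m' y x] m(2) v(2) by auto
  then show "\<exists>w\<in>mob (S \<mu>) y. w \<noteq> 0" using cat_module.act_closed[OF S, of m x y v] m(1) v(1) by auto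
qed

lemma wsupp_iff:
  assumes \<mu>: "\<mu> \<in> \<Lambda>"
  shows "x \<in> wsupp \<mu> \<longleftrightarrow> (\<exists>v\<in>mob (S \<mu>) x. v \<noteq> 0)"
proof -
  have "mob T x \<noteq> {0} \<longleftrightarrow> mob (S \<mu>) x \<noteq> {0}" if "T \<in> \<mu>" for T
  proof -
    have T: "simple_mod K T" "isomorphic K (S \<mu>) T" using that weight_mem_iff[OF \<mu>] by auto
    obtain \<phi> where \<phi>: "mod_hom K (S \<mu>) T \<phi>" "\<And>x. bij_betw (\<phi> x) (mob (S \<mu>) x) (mob T x)"
      using T(2) by (auto simp: isomorphic_def)
    have z: "\<phi> x 0 = 0" by (rule mod_hom_0[OF S_cat[OF \<mu>] simple_cat_module[OF T(1)] \<phi>(1)])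
    have im: "\<phi> x ` mob (S \<mu>) x = mob T x" and inj: "inj_on (\<phi> x) (mob (S \<mu>) x)"
      using \<phi>(2)[of x] by (auto simp: bij_betw_def)
    have S0: "0 \<in> mob (S \<mu>) x" using cat_module.mob_0[OF S_cat[OF \<mu>]] .
    show ?thesis
    proof
      show "mob T x \<noteq> {0} \<Longrightarrow> mob (S \<mu>) x \<noteq> {0}" using im z by auto
      assume "mob (S \<mu>) x \<noteq> {0}"
      then obtain v where v: "v \<in> mob (S \<mu>) x" "v \<noteq> 0" using S0 by blast
      then have "\<phi> x v \<noteq> 0" using inj_onD[OF inj, of v 0] z S0 by auto
      then show "mob T x \<noteq> {0}" using im v(1) by auto
    qed
  qed
  moreover have "x \<in> wsupp \<mu> \<longleftrightarrow> (\<exists>T\<in>\<mu>. mob T x \<noteq> {0})" by (simp add: wsupp_def)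
  ultimately have "x \<in> wsupp \<mu> \<longleftrightarrow> mob (S \<mu>) x \<noteq> {0}" using S_in[OF \<mu>] by blast
  then show ?thesis using cat_module.mob_0[OF S_cat[OF \<mu>], of x] by blast
qed

lemma wsupp_class: assumes \<mu>: "\<mu> \<in> \<Lambda>" and x: "x \<in> wsupp \<mu>" shows "wsupp \<mu> = obj_class G x"
proof -
  obtain v where v: "v \<in> mob (S \<mu>) x" "v \<noteq> 0" using x wsupp_iff[OF \<mu>] by blast
  show ?thesis using wsupp_iff[OF \<mu>] S_iso_nonzero[OF \<mu> v] by (auto simp: obj_class_def)
qed

lemma wsupp_ex: assumes \<mu>: "\<mu> \<in> \<Lambda>" shows "\<exists>x. x \<in> wsupp \<mu>"
  using S_nonzero[OF \<mu>] wsupp_iff[OF \<mu>] by blast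

lemma S_zero: "\<mu> \<in> \<Lambda> \<Longrightarrow> x \<notin> wsupp \<mu> \<Longrightarrow> v \<in> mob (S \<mu>) x \<Longrightarrow> v = 0"
  using wsupp_iff by blast

lemma schur_zero:
  assumes \<mu>: "\<mu> \<in> \<Lambda>" and \<nu>: "\<nu> \<in> \<Lambda>" and \<phi>: "mod_hom K (S \<mu>) (S \<nu>) \<phi>" and nz: "v \<in> mob (S \<mu>) x" "\<phi> x v \<noteq> 0"
  shows "\<mu> = \<nu>"
  using simple_hom_iso[OF S_simple[OF \<mu>] S_simple[OF \<nu>] \<phi> nz] \<phi> weight_eqI[OF \<mu> \<nu>]
  unfolding isomorphic_def by blast

text \<open>The module \<open>S \<mu>\<close> covers itself by the identity and has only scalar
  endomorphisms, so the general comparison of multiplicities with Hom spaces applies over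
  \<open>K\<close>.\<close>

lemma weight_mult_eq:
  fixes N :: "('o, 'm, 'k, 'v::ab_group_add) cmod"
  assumes \<mu>: "\<mu> \<in> \<Lambda>" and N: "cat_module K N"
  shows "weight_mult G U D S \<mu> N = hom_dim K (S \<mu>) N"
  unfolding weight_mult_def
proof (rule hom_dim_eq_multiplicity[symmetric, where \<pi> = "\<lambda>x v. v"])
  note Sc = S_cat[OF \<mu>]
  show "surj_hom K (S \<mu>) (S \<mu>) (\<lambda>x v. v)" using mod_hom_id[OF Sc] by (simp add: surj_hom_def)
  show "v = 0" if "submod K (S \<mu>) A" "A \<noteq> mob (S \<mu>)" "v \<in> A x" for A x v
    using simple_submod[OF S_simple[OF \<mu>] that(1)] that by (auto simp: zero_sub_def)
  show "\<exists>c. \<forall>x. \<forall>v\<in>mob (S \<mu>) x. \<chi> x v = mscale (S \<mu>) c v" if "mod_hom K (S \<mu>) (S \<mu>) \<chi>" for \<chi>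
    by (rule simple_endo_scalar[OF S_simple[OF \<mu>] S_fin[OF \<mu>] that])
  show "\<exists>\<psi>. mod_hom K (S \<mu>) (restr_mod N B) \<psi> \<and> (\<forall>x. \<forall>v\<in>mob (S \<mu>) x. \<rho> x (\<psi> x v) = v)"
    if "submod K N B" "surj_hom K (restr_mod N B) (S \<mu>) \<rho>" for B \<rho>
    by (rule lift_propD[OF S_lift[OF \<mu> cat_module_restr[OF N that(1)] Sc] that(2) mod_hom_id[OF Sc]])
qed (use S_cat[OF \<mu>] N S_simple[OF \<mu>] in auto)

text \<open>\<open>N\<close> need not be finitely generated, but its part on the isomorphism class
  of \<open>x\<close> is generated by the finite-dimensional space at \<open>x\<close>, so this part
  has a simple quotient. It is also a direct summand over \<open>K\<close>, and a surjection onto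
  \<open>S \<mu>\<close> splits.\<close>

lemma K_split:
  fixes N :: "('o, 'm, 'k, 'v::ab_group_add) cmod"
  assumes N: "cat_module K N" and fd: "fin_dim (mscale N) (mob N x)" and nz: "v0 \<in> mob N x" "v0 \<noteq> 0"
  shows "\<exists>\<mu>\<in>\<Lambda>. \<exists>q \<iota>. x \<in> wsupp \<mu> \<and> mod_hom K N (S \<mu>) q \<and> mod_hom K (S \<mu>) N \<iota> \<and>
    (\<forall>y. \<forall>v\<in>mob (S \<mu>) y. q y (\<iota> y v) = v)"
proof -
  interpret N: cat_module K N by (rule N)
  define A where "A y = (if iso_obj G x y then mob N y else {0})" for y
  have A: "submod K N A"
  proof (rule submodI[OF N])
    show "mact N y z f v \<in> A z" if "f \<in> Hom K y z" "v \<in> A y" for y z f v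
    proof (cases "f = 0")
      case True
      have "v \<in> mob N y" using that N.mob_0 by (auto simp: A_def split: if_splits)
      then show ?thesis using True linear_map_on_0[OF vector_space N.vector_space H_sub
            N.act_linear_left[of v y z, simplified]] N.mob_0 by (auto simp: A_def)
    next
      case False
      then have "iso_obj G y z" using that H_iso by simp
      then have "iso_obj G x y \<longleftrightarrow> iso_obj G x z" using iso_trans iso_sym by blast
      then show ?thesis using that N.act_closed[of f y z v] N.act_0[of f y z] by (auto simp: A_def split: if_splits)
    qed
  qed (auto simp: A_def N.mob_0 N.mob_add N.mob_scale split: if_splits)
  let ?A = "restr_mod N A"
  have Ac: "cat_module K ?A" by (rule cat_module_restr[OF N A])
  obtain B where B: "finite B" "B \<subseteq> mob N x" "mob N x \<subseteq> N.mv.span B"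
    using fin_dim_basis[OF N.vector_space fd] by metis
  have Ax: "A x = mob N x" using iso_refl by (simp add: A_def)
  have fg: "fin_gen K ?A"
    unfolding fin_gen_def
  proof (intro exI[of _ "Pair x ` B"] conjI allI impI, goal_cases)
    case 1 show ?case using B by simp
  next
    case 2 show ?case using B Ax by auto
  next
    case (3 T)
    then have T: "submod K ?A T" and BT: "B \<subseteq> T x" by auto
    note t = submodD[OF Ac T, simplified]
    have "mob N x \<subseteq> T x" using B(3) N.mv.span_minimal[OF BT t(1)] by blast
    moreover have "v \<in> T y" if v: "v \<in> A y" for y v
    proof (cases "iso_obj G x y")
      case True
      then obtain m m' where m: "m \<in> H x y" "m' \<in> H y x" "cmp G y x y m m' = ident G y" by (rule iso_H)
      have vN: "v \<in> mob N y" using v True by (simp add: A_def)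
      have "mact N y x m' v \<in> T x" using N.act_closed[of m' y x v] m vN \<open>mob N x \<subseteq> T x\<close> by auto
      then have "mact N x y m (mact N y x m' v) \<in> T y" using t(3) m(1) by simp
      then show ?thesis using N.act_comp[of m' y x m y v] m vN N.act_ident[OF vN] by simp
    next
      case False
      then show ?thesis using v t(4) by (simp add: A_def)
    qed
    ultimately show ?case using t(2) by (intro ext) auto
  qed
  have "zero_sub \<noteq> mob ?A" using nz Ax by (auto simp: fun_eq_iff zero_sub_def)
  then obtain Q :: "('o, 'm, 'k, 'v) cmod" and \<pi> where Q: "simple_mod K Q" "surj_hom K ?A Q \<pi>"
    using fin_gen_simple_quotient[OF Ac fg submod_zero[OF Ac]] by blast
  note Qc = simple_cat_module[OF Q(1)]
  obtain \<mu> where \<mu>: "\<mu> \<in> \<Lambda>" "isomorphic K (S \<mu>) Q" using simple_K_weight[OF Q(1)] by blast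
  obtain \<theta> where \<theta>: "mod_hom K Q (S \<mu>) \<theta>" "\<And>x. bij_betw (\<theta> x) (mob Q x) (mob (S \<mu>) x)"
    using isomorphic_sym[OF S_cat[OF \<mu>(1)] Qc \<mu>(2)] by (auto simp: isomorphic_def)
  note Sc = S_cat[OF \<mu>(1)]
  \<comment> \<open>Extension by zero off the class of \<open>x\<close>; it respects the action
    because non-zero morphisms of \<open>H\<close> do not leave a class.\<close>
  define q where "q y v = (if iso_obj G x y then \<theta> y (\<pi> y v) else 0)" for y v
  have \<pi>: "mod_hom K ?A Q \<pi>" using Q(2) by (simp add: surj_hom_def)
  note \<theta>\<pi> = mod_hom_comp[OF \<pi> \<theta>(1)]
  interpret S: cat_module K "S \<mu>" by (rule Sc)
  note h = mod_homD[OF Ac Sc \<theta>\<pi>, simplified]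
  have Aiso: "A y = mob N y" if "iso_obj G x y" for y using that by (simp add: A_def)
  have q: "mod_hom K N (S \<mu>) q"
  proof (rule mod_homI)
    show "q y v \<in> mob (S \<mu>) y" if "v \<in> mob N y" for y v
      using h(1)[of v y] that Aiso[of y] cat_module.mob_0[OF Sc] by (auto simp: q_def)
    show "q y (v + w) = q y v + q y w" if "v \<in> mob N y" "w \<in> mob N y" for y v w
      using h(4)[of v y w] that Aiso[of y] by (auto simp: q_def)
    show "q y (mscale N c v) = mscale (S \<mu>) c (q y v)" if "v \<in> mob N y" for y v c
      using h(5)[of v y c] that Aiso[of y] by (auto simp: q_def)
    show "q z (mact N y z f v) = mact (S \<mu>) y z f (q y v)" if f: "f \<in> Hom K y z" and v: "v \<in> mob N y" for y z f v
    proof (cases "f = 0")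
      case True
      have "mact N y z f v = 0" using True linear_map_on_0[OF vector_space N.vector_space H_sub
            N.act_linear_left[OF v, of z, simplified]] by simp
      moreover have "q y v \<in> mob (S \<mu>) y" using h(1)[of v y] v Aiso[of y] cat_module.mob_0[OF Sc] by (auto simp: q_def)
      then have "mact (S \<mu>) y z f (q y v) = 0" using True linear_map_on_0[OF vector_space cat_module.vector_space[OF Sc] H_sub
            cat_module.act_linear_left[OF Sc, of _ y z, simplified]] by simp
      ultimately show ?thesis using h(6)[of z] by (simp add: q_def)
    next
      case False
      then have "iso_obj G y z" using f H_iso by simp
      then have "iso_obj G x y \<longleftrightarrow> iso_obj G x z" using iso_trans iso_sym by blast
      then show ?thesis using h(3)[of f y z v] f v Aiso[of y] cat_module.act_0[OF Sc, of f y z] by (auto simp: q_def)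
    qed
  qed
  have Q0: "mob Q y = {0}" if "\<not> iso_obj G x y" for y
  proof -
    have "mob Q y = \<pi> y ` A y" using Q(2) by (simp add: surj_hom_def)
    then show ?thesis using that mod_hom_0[OF Ac Qc \<pi>, of y] by (simp add: A_def)
  qed
  have im: "q y ` mob N y = mob (S \<mu>) y" for y
  proof (cases "iso_obj G x y")
    case True
    have "\<pi> y ` A y = mob Q y" using Q(2) by (simp add: surj_hom_def)
    then have "\<pi> y ` mob N y = mob Q y" using Aiso[OF True] by simp
    moreover have "\<theta> y ` mob Q y = mob (S \<mu>) y" using \<theta>(2)[of y] by (simp add: bij_betw_def)
    ultimately show ?thesis using True image_image[of "\<theta> y" "\<pi> y" "mob N y"] by (simp add: q_def)
  next
    case False
    have "\<theta> y ` mob Q y = mob (S \<mu>) y" using \<theta>(2)[of y] by (simp add: bij_betw_def)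
    then have "mob (S \<mu>) y = {0}" using Q0[OF False] mod_hom_0[OF Qc Sc \<theta>(1)] by simp
    then show ?thesis using False N.mob_0[of y] by (auto simp: q_def)
  qed
  then have qs: "surj_hom K N (S \<mu>) q" using q by (simp add: surj_hom_def)
  obtain \<iota> where \<iota>: "mod_hom K (S \<mu>) N \<iota>" "\<forall>y. \<forall>v\<in>mob (S \<mu>) y. q y (\<iota> y v) = v"
    using lift_propD[OF S_lift[OF \<mu>(1) N Sc] qs mod_hom_id[OF Sc]] by blast
  have "x \<in> wsupp \<mu>"
  proof -
    obtain y w where w: "w \<in> mob (S \<mu>) y" "w \<noteq> 0" using S_nonzero[OF \<mu>(1)] by blast
    have "q y (\<iota> y w) \<noteq> 0" using \<iota>(2) w by simp
    then have "iso_obj G x y" by (simp add: q_def split: if_splits)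
    then have "iso_obj G y x" by (rule iso_sym)
    then show ?thesis using S_iso_nonzero[OF \<mu>(1) w] wsupp_iff[OF \<mu>(1)] by blast
  qed
  then show ?thesis using \<mu>(1) q \<iota> by blast
qed

text \<open>The identity of \<open>x\<close> is a finite sum of elements of images of modules
  \<open>S \<mu>\<close> in \<open>rep K x\<close>. On a weight supported at \<open>x\<close> but
  absent from that sum, this identity would act as zero by Schur's lemma.\<close>

lemma finite_weights_at: "finite {\<mu> \<in> \<Lambda>. x \<in> wsupp \<mu>}"
proof -
  note R = cat_module_rep[OF linK, of x]
  have "trace_sub K S \<Lambda> (rep K x) = mob (rep K x)"
  proof (rule trace_sub_full[OF R fin_gen_rep[OF linK] S_cat])
    fix Q :: "('o, 'm, 'k, 'm) cmod" assume Q: "simple_mod K Q"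
    obtain \<mu> \<phi> where \<mu>: "\<mu> \<in> \<Lambda>" "mod_hom K (S \<mu>) Q \<phi>" "\<And>x. bij_betw (\<phi> x) (mob (S \<mu>) x) (mob Q x)"
      using simple_K_weight[OF Q] by (auto simp: isomorphic_def)
    obtain y v where v: "v \<in> mob (S \<mu>) y" "v \<noteq> 0" using S_nonzero[OF \<mu>(1)] by blast
    have "\<phi> y v \<noteq> 0"
      using mod_hom_inj_iff[OF S_cat[OF \<mu>(1)] simple_cat_module[OF Q] \<mu>(2)] \<mu>(3)[of y] v by (auto simp: bij_betw_def)
    then show "\<exists>w\<in>\<Lambda>. \<exists>\<phi> y. \<exists>s\<in>mob (S w) y. lift_prop K (S w) (rep K x) Q \<and> mod_hom K (S w) Q \<phi> \<and> \<phi> y s \<noteq> 0"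
      using \<mu>(1,2) v(1) S_lift[OF \<mu>(1) R simple_cat_module[OF Q]] by blast
  qed
  then have "ident G x \<in> trace_sub K S \<Lambda> (rep K x) x" using H_ident by simp
  from trace_sub_sum[OF R S_cat this] obtain n :: nat and w \<phi> s where
    w: "\<And>j. j < n \<Longrightarrow> w j \<in> \<Lambda> \<and> mod_hom K (S (w j)) (rep K x) (\<phi> j) \<and> s j \<in> mob (S (w j)) x"
    and e: "ident G x = (\<Sum>j<n. \<phi> j x (s j))" by blast
  have "\<mu> \<in> w ` {..<n}" if \<mu>: "\<mu> \<in> \<Lambda>" and x: "x \<in> wsupp \<mu>" for \<mu>
  proof (rule ccontr)
    assume nm: "\<mu> \<notin> w ` {..<n}"
    note Sc = S_cat[OF \<mu>]
    obtain v where v: "v \<in> mob (S \<mu>) x" "v \<noteq> 0" using x wsupp_iff[OF \<mu>] by blast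
    have y: "mod_hom K (rep K x) (S \<mu>) (\<lambda>y f. mact (S \<mu>) x y f v)" by (rule yoneda_hom[OF linK Sc v(1)])
    have z: "mact (S \<mu>) x x (\<phi> j x (s j)) v = 0" if j: "j < n" for j
    proof (rule ccontr)
      assume "mact (S \<mu>) x x (\<phi> j x (s j)) v \<noteq> 0"
      then have "w j = \<mu>"
        using schur_zero[OF _ \<mu> mod_hom_comp[OF _ y], of "w j" "\<phi> j" "s j" x] w[OF j] by blast
      then show False using nm j by blast
    qed
    have m: "\<phi> j x (s j) \<in> mob (rep K x) x" if "j \<in> {..<n}" for j
      using w[of j] that mod_hom_closed[OF S_cat R] by auto
    have "v = mact (S \<mu>) x x (\<Sum>j<n. \<phi> j x (s j)) v" using cat_module.act_ident[OF Sc v(1)] e by simp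
    also have "\<dots> = (\<Sum>j<n. mact (S \<mu>) x x (\<phi> j x (s j)) v)" by (rule mod_hom_sum[OF R Sc y m])
    also have "\<dots> = 0" using z by simp
    finally show False using v(2) by simp
  qed
  then have "{\<mu> \<in> \<Lambda>. x \<in> wsupp \<mu>} \<subseteq> w ` {..<n}" by blast
  then show ?thesis by (rule finite_subset) simp
qed

end

section \<open>Standard modules\<close>

lemma induced_act:
  assumes C: "linear_category C" and H: "wide_subcategory C H" and g: "g \<in> Hom C y z" and s: "s \<in> mob S y"
  shows "mact (induced C H S) y z g (ind_tensor C H S y y (ident C y) s) = ind_tensor C H S z y g s"
  using cat_module_induced(2)[OF C H g linear_category.ident_closed[OF C] s] linear_category.ident_right[OF C g] by simp

lemma induced_mob:
  "mob (induced C H S) z = module.span fscale {ind_tensor C H S z y g s | y g s. g \<in> Hom C y z \<and> s \<in> mob S y}"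
  by (simp add: induced_def btensor_def ind_tensor_def)

lemma induced_mscale [simp]: "mscale (induced C H S) = fscale" by (simp add: induced_def)

lemma induced_tensor_closed:
  "g \<in> Hom C y z \<Longrightarrow> s \<in> mob S y \<Longrightarrow> ind_tensor C H S z y g s \<in> mob (induced C H S) z"
  unfolding induced_mob
  by (rule module.span_base[OF vector_space_fscale[unfolded module_iff_vector_space[symmetric]]]) blast

lemma induced_generated:
  assumes C: "linear_category C" and H: "wide_subcategory C H"
    and N: "submod C (induced C H S) N"
    and g: "\<And>y s. s \<in> mob S y \<Longrightarrow> ind_tensor C H S y y (ident C y) s \<in> N y"
  shows "N = mob (induced C H S)"
proof -
  note I = cat_module_induced(1)[OF C H, of S]
  interpret I: cat_module C "induced C H S" by (rule I)
  have "mob (induced C H S) z \<subseteq> N z" for z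
    unfolding induced_mob
  proof (rule I.mv.span_minimal[simplified])
    show "module.subspace fscale (N z)" using submod_subspace[OF I N] by simp
    show "{ind_tensor C H S z y g s |y g s. g \<in> Hom C y z \<and> s \<in> mob S y} \<subseteq> N z"
      using induced_act[OF C H] submod_act[OF I N _ g] by fastforce
  qed
  then show ?thesis using submod_le[OF I N] by (intro ext) blast
qed

lemma tensor_family_span:
  fixes sA :: "'k::field \<Rightarrow> 'a::ab_group_add \<Rightarrow> 'a" and sB :: "'k \<Rightarrow> 'b::ab_group_add \<Rightarrow> 'b"
    and I :: "'i set" and sC :: "'k \<Rightarrow> 'c::ab_group_add \<Rightarrow> 'c"
  assumes T: "\<tau> \<in> btensor sA sB I A B R" and \<Phi>: "linear_map_on fscale sC (btensor sA sB I A B R) \<Phi>"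
    and sC: "vector_space sC"
  shows "\<Phi> \<tau> \<in> module.span sC {\<Phi> (pure_tensor sA sB I A B R i a b) | i a b. i \<in> I \<and> a \<in> A i \<and> b \<in> B i}"
proof -
  interpret C: vector_space sC by (rule sC)
  interpret F: vector_space "fscale :: 'k \<Rightarrow> (('i \<Rightarrow> 'a \<Rightarrow> 'b \<Rightarrow> 'k) \<Rightarrow> 'k) \<Rightarrow> _" by (rule vector_space_fscale)
  obtain g where g: "Vector_Spaces.linear fscale sC g" "\<And>v. v \<in> btensor sA sB I A B R \<Longrightarrow> g v = \<Phi> v"
    using linear_map_on_extend[OF vector_space_fscale sC _ \<Phi>] F.subspace_span unfolding btensor_def by blast
  interpret g: Vector_Spaces.linear fscale sC g by (rule g(1))
  let ?X = "{pure_tensor sA sB I A B R i a b | i a b. i \<in> I \<and> a \<in> A i \<and> b \<in> B i}"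
  have X: "?X \<subseteq> btensor sA sB I A B R" unfolding btensor_def by (rule F.span_superset)
  have "g \<tau> \<in> C.span (g ` ?X)" using T g.span_image[of ?X] unfolding btensor_def by blast
  moreover have "g ` ?X \<subseteq> {\<Phi> (pure_tensor sA sB I A B R i a b) | i a b. i \<in> I \<and> a \<in> A i \<and> b \<in> B i}"
  proof (rule image_subsetI)
    fix v assume v: "v \<in> ?X"
    then have "g v = \<Phi> v" using g(2) X by blast
    then show "g v \<in> {\<Phi> (pure_tensor sA sB I A B R i a b) | i a b. i \<in> I \<and> a \<in> A i \<and> b \<in> B i}"
      using v by auto
  qed
  ultimately show ?thesis using g(2)[OF T] C.span_mono by (metis (no_types, lifting) subsetD)
qed

section \<open>Restriction to \<open>U\<close> and \<open>D\<close>, and (T3) as a property of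
  modules\<close>

context tri
begin

abbreviation "KU \<equiv> subcat G U"
abbreviation "KD \<equiv> subcat G D"

lemma linU: "linear_category KU" by (rule linear_category_subcat[OF linG wide_U])
lemma linD: "linear_category KD" by (rule linear_category_subcat[OF linG wide_D])

lemma wide_H_U: "wide_subcategory KU H" and wide_H_D: "wide_subcategory KD H"
  using wide_H by (auto simp: wide_subcategory_def mid_def)

lemma subcat_subcat [simp]: "subcat (subcat G E) E' = subcat G E'" by (simp add: subcat_def)

lemma U_to_K: "cat_module KU N \<Longrightarrow> cat_module K N" using cat_module_subcat[OF _ wide_H_U linU] by simp
lemma D_to_K: "cat_module KD N \<Longrightarrow> cat_module K N" using cat_module_subcat[OF _ wide_H_D linD] by simp
lemma G_to_K: "cat_module G N \<Longrightarrow> cat_module K N" by (rule cat_module_subcat[OF _ wide_H linG])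
lemma G_to_U: "cat_module G N \<Longrightarrow> cat_module KU N" by (rule cat_module_subcat[OF _ wide_U linG])
lemma G_to_D: "cat_module G N \<Longrightarrow> cat_module KD N" by (rule cat_module_subcat[OF _ wide_D linG])
lemma hom_U_to_K: "mod_hom KU M N \<phi> \<Longrightarrow> mod_hom K M N \<phi>" using mod_hom_subcat[OF _ wide_H_U] by simp
lemma hom_D_to_K: "mod_hom KD M N \<phi> \<Longrightarrow> mod_hom K M N \<phi>" using mod_hom_subcat[OF _ wide_H_D] by simp
lemma hom_G_to_K: "mod_hom G M N \<phi> \<Longrightarrow> mod_hom K M N \<phi>" by (rule mod_hom_subcat[OF _ wide_H])
lemma hom_G_to_U: "mod_hom G M N \<phi> \<Longrightarrow> mod_hom KU M N \<phi>" by (rule mod_hom_subcat[OF _ wide_U])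

lemma transversal_ex: "\<exists>R. transversal G R"
proof -
  define R where "R = (\<lambda>X. SOME y. y \<in> X) ` obj_classes G"
  have pick: "(SOME y. y \<in> X) \<in> X" if X: "X \<in> obj_classes G" for X
  proof -
    obtain x where "X = obj_class G x" using X by (auto simp: obj_classes_def)
    then have "x \<in> X" using iso_refl by (simp add: obj_class_def)
    then show ?thesis by (rule someI)
  qed
  have same: "X = Y" if X: "X \<in> obj_classes G" "Y \<in> obj_classes G" "y \<in> X" "y \<in> Y" for X Y y
  proof -
    obtain x x' where "X = obj_class G x" "Y = obj_class G x'" using X by (auto simp: obj_classes_def)
    then show ?thesis using X(3,4) iso_trans iso_sym obj_class_eq_iff[OF linG] unfolding obj_class_def
      by (metis mem_Collect_eq)
  qed
  have "\<exists>!y. y \<in> R \<inter> X" if X: "X \<in> obj_classes G" for X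
  proof (rule ex1I[of _ "SOME y. y \<in> X"])
    show "(SOME y. y \<in> X) \<in> R \<inter> X" using X pick by (auto simp: R_def)
    show "y = (SOME y. y \<in> X)" if y: "y \<in> R \<inter> X" for y
    proof -
      obtain Y where "Y \<in> obj_classes G" "y = (SOME y. y \<in> Y)" using y by (auto simp: R_def)
      then show ?thesis using same[of X Y y] X y pick[of Y] by auto
    qed
  qed
  then have "transversal G R" unfolding transversal_def by (intro ballI)
  then show ?thesis by blast
qed

lemma transversal_rep:
  assumes "transversal G R" shows "\<exists>y'\<in>R. iso_obj G y y'"
proof -
  have "\<exists>!y'. y' \<in> R \<inter> obj_class G y" using assms cls_in[of y] by (simp only: transversal_def)
  from ex1_implies_ex[OF this] show ?thesis by (auto simp: obj_class_def)
qed

lemma T3_iso: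
  assumes R: "transversal G R"
  shows "\<exists>\<Phi>. linear_map_on fscale (cscale G)
      (btensor (cscale G) (cscale G) R (\<lambda>y. U y z) (\<lambda>y. D x y) (tri_rel G U D R x z)) \<Phi> \<and>
    (\<forall>y\<in>R. \<forall>g\<in>U y z. \<forall>f\<in>D x y.
      \<Phi> (pure_tensor (cscale G) (cscale G) R (\<lambda>y. U y z) (\<lambda>y. D x y) (tri_rel G U D R x z) y g f) = cmp G x y z g f) \<and>
    bij_betw \<Phi> (btensor (cscale G) (cscale G) R (\<lambda>y. U y z) (\<lambda>y. D x y) (tri_rel G U D R x z)) (Hom G x z)"
  using T3[OF R, of x z] unfolding triangular_iso_def Let_def .

lemma tri_span_R:
  assumes R: "transversal G R" and h: "h \<in> Hom G x z"
  shows "h \<in> gv.span {cmp G x y z u d | y u d. y \<in> R \<and> u \<in> U y z \<and> d \<in> D x y}"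
proof -
  let ?T = "btensor (cscale G) (cscale G) R (\<lambda>y. U y z) (\<lambda>y. D x y) (tri_rel G U D R x z)"
  let ?t = "pure_tensor (cscale G) (cscale G) R (\<lambda>y. U y z) (\<lambda>y. D x y) (tri_rel G U D R x z)"
  obtain \<Phi> where \<Phi>: "linear_map_on fscale (cscale G) ?T \<Phi>"
    "\<forall>y\<in>R. \<forall>g\<in>U y z. \<forall>f\<in>D x y. \<Phi> (?t y g f) = cmp G x y z g f" "bij_betw \<Phi> ?T (Hom G x z)"
    using T3_iso[OF R, where x = x and z = z] by blast
  have "h \<in> \<Phi> ` ?T" using h \<Phi>(3) by (simp add: bij_betw_def)
  then obtain \<tau> where \<tau>: "\<tau> \<in> ?T" "h = \<Phi> \<tau>" by blast
  have "{\<Phi> (?t y g f) | y g f. y \<in> R \<and> g \<in> U y z \<and> f \<in> D x y} =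
      {cmp G x y z u d | y u d. y \<in> R \<and> u \<in> U y z \<and> d \<in> D x y}"
    using \<Phi>(2) by (auto, metis, metis)
  then show ?thesis using tensor_family_span[OF \<tau>(1) \<Phi>(1) vector_space] \<tau>(2) by simp
qed

text \<open>The surjectivity half of (T3) as an induction rule.\<close>

lemma tri_induct [consumes 2, case_names zero step]:
  assumes h: "h \<in> Hom G x z" and R: "transversal G R"
    and z: "P 0"
    and s: "\<And>c y u d h. y \<in> R \<Longrightarrow> u \<in> U y z \<Longrightarrow> d \<in> D x y \<Longrightarrow> h \<in> Hom G x z \<Longrightarrow> P h \<Longrightarrow>
      P (cscale G c (cmp G x y z u d) + h)"
  shows "P h"
proof -
  have "h \<in> Hom G x z \<and> P h"
    using tri_span_R[OF R h]
  proof (induction rule: gv.span_induct_alt)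
    case base
    then show ?case using z gv.subspace_0[OF subspace] by simp
  next
    case (step c a b)
    then obtain y u d where a: "a = cmp G x y z u d" "y \<in> R" "u \<in> U y z" "d \<in> D x y" by blast
    then have "a \<in> Hom G x z" using comp_closed U_Hom D_Hom by blast
    then show ?case using s[OF a(2-4)] step.IH a(1) gv.subspace_add[OF subspace gv.subspace_scale[OF subspace]] by blast
  qed
  then show ?thesis by blast
qed

lemma rep_G_U: "cat_module KU (rep G x)" by (rule G_to_U[OF cat_module_rep[OF linG]])

text \<open>Uniqueness half of the assertion that \<open>rep G x\<close>, restricted to
  \<open>U\<close>, is induced from \<open>D x\<close> over \<open>H\<close>.\<close>

lemma rep_U_unique:
  assumes B: "cat_module KU B" and \<phi>: "mod_hom KU (rep G x) B \<phi>" and \<psi>: "mod_hom KU (rep G x) B \<psi>"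
    and e: "\<And>y d. d \<in> D x y \<Longrightarrow> \<phi> y d = \<psi> y d" and h: "h \<in> Hom G x z"
  shows "\<phi> z h = \<psi> z h"
proof -
  obtain R where R: "transversal G R" using transversal_ex by blast
  note f = mod_homD[OF rep_G_U B \<phi>, simplified] and g = mod_homD[OF rep_G_U B \<psi>, simplified]
  show ?thesis using h R
  proof (induction rule: tri_induct)
    case zero
    show ?case using f(6) g(6) by simp
  next
    case (step c y u d h)
    have m: "cmp G x y z u d \<in> Hom G x z" using comp_closed U_Hom D_Hom step by blast
    have "\<phi> z (cmp G x y z u d) = \<psi> z (cmp G x y z u d)"
      using f(3)[OF step(2) D_Hom[OF step(3)]] g(3)[OF step(2) D_Hom[OF step(3)]] e[OF step(3)] by simp
    then show ?case using m step(4,5) f(4,5) g(4,5) gv.subspace_scale[OF subspace m] by simp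
  qed
qed

text \<open>Existence half of the same assertion. The rule sending a composite \<open>u d\<close> to
  \<open>u\<close> applied to \<open>\<theta> d\<close> is balanced over the endomorphism rings
  because \<open>\<theta>\<close> is \<open>H\<close>-linear, so it factors through the tensor
  product, which (T3) identifies with \<open>Hom G x z\<close>.\<close>

lemma T3_ext:
  fixes B :: "('o, 'm, 'k, 'v::ab_group_add) cmod"
  assumes B: "cat_module KU B" and \<theta>: "mod_hom K (rep KD x) B \<theta>"
  shows "\<exists>\<Theta>. mod_hom KU (rep G x) B \<Theta> \<and> (\<forall>y. \<forall>d\<in>D x y. \<Theta> y d = \<theta> y d)"
proof -
  interpret B: cat_module KU B by (rule B)
  have Dc: "cat_module K (rep KD x)" by (rule D_to_K[OF cat_module_rep[OF linD]])
  note t = mod_homD[OF Dc U_to_K[OF B] \<theta>, simplified]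
  obtain R where R: "transversal G R" using transversal_ex by blast
  let ?T = "\<lambda>z. btensor (cscale G) (cscale G) R (\<lambda>y. U y z) (\<lambda>y. D x y) (tri_rel G U D R x z)"
  let ?t = "\<lambda>z. pure_tensor (cscale G) (cscale G) R (\<lambda>y. U y z) (\<lambda>y. D x y) (tri_rel G U D R x z)"
  have "\<exists>\<Theta>. linear_map_on (cscale G) (mscale B) (Hom G x z) \<Theta> \<and>
      (\<forall>y\<in>R. \<forall>u\<in>U y z. \<forall>d\<in>D x y. \<Theta> (cmp G x y z u d) = mact B y z u (\<theta> y d))" for z
  proof -
    obtain \<Phi> where \<Phi>: "linear_map_on fscale (cscale G) (?T z) \<Phi>"
      "\<forall>y\<in>R. \<forall>g\<in>U y z. \<forall>f\<in>D x y. \<Phi> (?t z y g f) = cmp G x y z g f" "bij_betw \<Phi> (?T z) (Hom G x z)"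
      using T3_iso[OF R, where x = x and z = z] by blast
    have bil: "bilinear_family (cscale G) (cscale G) (mscale B) R (\<lambda>y. U y z) (\<lambda>y. D x y) (tri_rel G U D R x z)
        (\<lambda>y g f. mact B y z g (\<theta> y f))"
    proof -
      have 1: "linear_map_on (cscale G) (mscale B) (U y z) (\<lambda>a. mact B y z a (\<theta> y b))" if "b \<in> D x y" for y b
        using B.act_linear_left[of "\<theta> y b" y z] t(1)[OF that] by simp
      have 2: "linear_map_on (cscale G) (mscale B) (D x y) (\<lambda>f. mact B y z a (\<theta> y f))" if a: "a \<in> U y z" for y a
        using t(1,4,5) B.act_add[of a y z] B.act_scale[of a y z] a by (simp add: linear_map_on_def)
      have 3: "mact B y z (cmp G y y z g e) (\<theta> y f) = mact B y z g (\<theta> y (cmp G x y y e f))"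
        if p: "g \<in> U y z" "e \<in> U y y" "f \<in> D x y" for y g e f
        using B.act_comp[of e y y g z "\<theta> y f"] p t(1) t(3)[of e y y f] by (simp add: H_self)
      show ?thesis unfolding bilinear_family_def using 1 2 3 by (auto simp: tri_rel_def)
    qed
    obtain \<Psi> where \<Psi>: "linear_map_on fscale (mscale B) (?T z) \<Psi>"
      "\<forall>y\<in>R. \<forall>g\<in>U y z. \<forall>f\<in>D x y. \<Psi> (?t z y g f) = mact B y z g (\<theta> y f)"
      using btensor_universal[OF B.vector_space bil] by blast
    \<comment> \<open>Inverse of the isomorphism of (T3); the map sought is
      \<open>\<Psi> \<circ> i\<close>.\<close>
    define i where "i = inv_into (?T z) \<Phi>"
    have iT: "i h \<in> ?T z" "\<Phi> (i h) = h" if "h \<in> Hom G x z" for h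
    proof -
      have "h \<in> \<Phi> ` ?T z" using that \<Phi>(3) by (simp add: bij_betw_def)
      then show "i h \<in> ?T z" "\<Phi> (i h) = h" unfolding i_def by (rule inv_into_into, rule f_inv_into_f)
    qed
    have i\<Phi>: "i (\<Phi> \<tau>) = \<tau>" if "\<tau> \<in> ?T z" for \<tau>
      using that \<Phi>(3) unfolding i_def bij_betw_def by (auto intro: inv_into_f_f)
    interpret F: vector_space "fscale :: 'k \<Rightarrow> (('o \<Rightarrow> 'm \<Rightarrow> 'm \<Rightarrow> 'k) \<Rightarrow> 'k) \<Rightarrow> _" by (rule vector_space_fscale)
    have Tsub: "F.subspace (?T z)" unfolding btensor_def by (rule F.subspace_span)
    have ilin: "linear_map_on (cscale G) fscale (Hom G x z) i"
      unfolding linear_map_on_def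
    proof (intro conjI ballI allI)
      fix u v assume uv: "u \<in> Hom G x z" "v \<in> Hom G x z"
      have "\<Phi> (i u + i v) = u + v" using \<Phi>(1) iT[OF uv(1)] iT[OF uv(2)] by (simp add: linear_map_on_def)
      then show "i (u + v) = i u + i v" using i\<Phi> F.subspace_add[OF Tsub iT(1)[OF uv(1)] iT(1)[OF uv(2)]] by metis
    next
      fix c v assume v: "v \<in> Hom G x z"
      have "\<Phi> (fscale c (i v)) = cscale G c v" using \<Phi>(1) iT[OF v] by (simp add: linear_map_on_def)
      then show "i (cscale G c v) = fscale c (i v)" using i\<Phi> F.subspace_scale[OF Tsub iT(1)[OF v]] by metis
    qed
    have "linear_map_on (cscale G) (mscale B) (Hom G x z) (\<lambda>h. \<Psi> (i h))"
      by (rule linear_map_on_compose[OF ilin \<Psi>(1)]) (use iT in blast)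
    moreover have "\<Psi> (i (cmp G x y z u d)) = mact B y z u (\<theta> y d)" if "y \<in> R" "u \<in> U y z" "d \<in> D x y" for y u d
    proof -
      have "?t z y u d \<in> ?T z" unfolding btensor_def by (rule F.span_base) (use that in blast)
      then have "i (cmp G x y z u d) = ?t z y u d" using i\<Phi>[of "?t z y u d"] \<Phi>(2) that by simp
      then show ?thesis using \<Psi>(2) that by simp
    qed
    ultimately show ?thesis by (intro exI[of _ "\<lambda>h. \<Psi> (i h)"]) blast
  qed
  then obtain \<Theta> where lin: "\<And>z. linear_map_on (cscale G) (mscale B) (Hom G x z) (\<Theta> z)"
    and \<Theta>: "\<And>z y u d. y \<in> R \<Longrightarrow> u \<in> U y z \<Longrightarrow> d \<in> D x y \<Longrightarrow> \<Theta> z (cmp G x y z u d) = mact B y z u (\<theta> y d)"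
    by metis
  have add: "\<Theta> z (g + h) = \<Theta> z g + \<Theta> z h"
    if "g \<in> Hom G x z" "h \<in> Hom G x z" for z g h using lin[of z] that by (auto simp: linear_map_on_def)
  have scale: "\<Theta> z (cscale G c g) = mscale B c (\<Theta> z g)"
    if "g \<in> Hom G x z" for z g c using lin[of z] that by (auto simp: linear_map_on_def)
  have z0: "\<Theta> z 0 = 0" for z by (rule linear_map_on_0[OF vector_space B.vector_space subspace lin])
  have hom: "cscale G c (cmp G x y z u d) \<in> Hom G x z" "cmp G x y z u d \<in> Hom G x z" if "u \<in> U y z" "d \<in> D x y" for c y z u d
    using gv.subspace_scale[OF subspace] comp_closed[OF D_Hom[OF that(2)] U_Hom[OF that(1)]] by auto
  have cl: "\<Theta> z h \<in> mob B z" if "h \<in> Hom G x z" for z h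
    using that R
  proof (induction rule: tri_induct)
    case zero show ?case using z0 B.mob_0 by simp
  next
    case (step c y u d h)
    have "\<Theta> z (cmp G x y z u d) \<in> mob B z"
      using \<Theta>[OF step(1-3)] B.act_closed[of u y z "\<theta> y d"] t(1) step(2,3) by simp
    then show ?case using step(4,5) hom[OF step(2,3)] add scale B.mob_add B.mob_scale by simp
  qed
  have nat: "\<Theta> w (cmp G x z w v h) = mact B z w v (\<Theta> z h)" if v: "v \<in> U z w" and h: "h \<in> Hom G x z" for z w v h
    using h R
  proof (induction rule: tri_induct)
    case zero show ?case using z0 comp_0(2)[OF U_Hom[OF v]] B.act_0[of v z w] v by simp
  next
    case (step c y u d h)
    note hh = hom[OF step(2,3)]
    have a: "cmp G x z w v (cmp G x y z u d) = cmp G x y w (cmp G y z w v u) d"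
      using comp_assoc[OF D_Hom[OF step(3)] U_Hom[OF step(2)] U_Hom[OF v]] by simp
    have "\<Theta> w (cmp G x z w v (cmp G x y z u d)) = mact B z w v (\<Theta> z (cmp G x y z u d))"
      using \<Theta>[OF step(1) U_comp[OF step(2) v] step(3)] \<Theta>[OF step(1-3)] B.act_comp[of u y z v w "\<theta> y d"] t(1)[OF step(3)] v step(2)
      by (simp add: a)
    then show ?case
      using step(4,5) hh comp_add(2)[OF U_Hom[OF v]] comp_scale(2)[OF U_Hom[OF v]] add scale cl
        comp_closed[OF _ U_Hom[OF v]] gv.subspace_scale[OF subspace] B.act_add[of v z w] B.act_scale[of v z w] v
        B.mob_scale by simp
  qed
  have "mod_hom KU (rep G x) B \<Theta>"
    by (rule mod_homI) (use cl nat add scale in simp_all)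
  \<comment> \<open>The object \<open>y\<close> need not be one of the chosen representatives, so
    \<open>d\<close> is first carried to a representative by an isomorphism of
    \<open>H\<close>.\<close>
  moreover have "\<Theta> y d = \<theta> y d" if d: "d \<in> D x y" for y d
  proof -
    obtain y' where y': "y' \<in> R" "iso_obj G y y'" using transversal_rep[OF R] by blast
    obtain m m' where m: "m \<in> H y y'" "m' \<in> H y' y" "cmp G y y' y m' m = ident G y" by (rule iso_H[OF y'(2)])
    have md: "cmp G x y y' m d \<in> D x y'" using D_comp[OF d H_D[OF m(1)]] .
    have "d = cmp G x y' y m' (cmp G x y y' m d)"
      using comp_assoc[OF D_Hom[OF d] H_Hom[OF m(1)] H_Hom[OF m(2)]] m(3) ident_left[OF D_Hom[OF d]] by simp
    then have "\<Theta> y d = mact B y' y m' (\<theta> y' (cmp G x y y' m d))" using \<Theta>[OF y'(1) H_U[OF m(2)] md] by simp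
    also have "\<dots> = \<theta> y d"
      using t(3)[OF m(2) md] \<open>d = _\<close> by simp
    finally show ?thesis .
  qed
  ultimately show ?thesis by blast
qed

text \<open>The same record is a module over \<open>D\<close>, from which the standard module is
  induced, and over \<open>U\<close>, where it is a quotient of the standard module.\<close>

definition S0 where "S0 \<mu> = extend_by_zero G (S \<mu>)"

lemma S0_sel [simp]: "mscale (S0 \<mu>) = mscale (S \<mu>)" "mob (S0 \<mu>) = mob (S \<mu>)"
  "mact (S0 \<mu>) x y f v = (if iso_obj G x y then mact (S \<mu>) x y f v else 0)"
  by (simp_all add: S0_def extend_by_zero_def)

lemma S_act_zero: "\<mu> \<in> \<Lambda> \<Longrightarrow> v \<in> mob (S \<mu>) x \<Longrightarrow> mact (S \<mu>) x y 0 v = 0"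
  using linear_map_on_0[OF vector_space cat_module.vector_space[OF S_cat] H_sub
      cat_module.act_linear_left[OF S_cat, simplified]] .

text \<open>Shared by \<open>U\<close> and \<open>D\<close>. Extension by zero respects composition
  if a composite of non-zero morphisms with isomorphic ends passes only through an object of the
  same class; the order guarantees this for both subcategories.\<close>

lemma S0_cat:
  assumes \<mu>: "\<mu> \<in> \<Lambda>" and E: "wide_subcategory G E"
    and EH: "\<And>x y f. iso_obj G x y \<Longrightarrow> f \<in> E x y \<Longrightarrow> f \<in> H x y"
    and EE: "\<And>x y z f g. f \<in> E x y \<Longrightarrow> g \<in> E y z \<Longrightarrow> f \<noteq> 0 \<Longrightarrow> g \<noteq> 0 \<Longrightarrow> iso_obj G x z \<Longrightarrow> iso_obj G x y"
  shows "cat_module (subcat G E) (S0 \<mu>)"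
proof -
  interpret S: cat_module K "S \<mu>" by (rule S_cat[OF \<mu>])
  have Esub: "gv.subspace (E x y)" and EHom: "f \<in> E x y \<Longrightarrow> f \<in> Hom G x y" for x y f
    using E by (auto simp: wide_subcategory_def)
  show ?thesis
  proof (rule cat_module.intro)
    show "linear_map_on (cscale (subcat G E)) (mscale (S0 \<mu>)) (Hom (subcat G E) x y) (\<lambda>f. mact (S0 \<mu>) x y f v)"
      if "v \<in> mob (S0 \<mu>) x" for x y v
    proof (cases "iso_obj G x y")
      case True
      then have "E x y \<subseteq> H x y" using EH by blast
      then show ?thesis using S.act_linear_left[of v x y] that True linear_map_on_subset[of _ _ "H x y" _ "E x y"] by simp
    qed (simp add: linear_map_on_def)
    show "mact (S0 \<mu>) x z (cmp (subcat G E) x y z g f) v = mact (S0 \<mu>) y z g (mact (S0 \<mu>) x y f v)"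
      if f: "f \<in> Hom (subcat G E) x y" and g: "g \<in> Hom (subcat G E) y z" and v: "v \<in> mob (S0 \<mu>) x" for x y z f g v
    proof (cases "f = 0 \<or> g = 0")
      case True
      have "cmp G x y z g f = 0" using True comp_0 EHom f g by auto
      moreover have "mact (S \<mu>) x y f v \<in> mob (S \<mu>) y" if "iso_obj G x y"
        using S.act_closed[of f x y v] EH[OF that] f v by simp
      ultimately show ?thesis
        using True S_act_zero[OF \<mu>] v S.mob_0 S.act_0[of g y z] EH[of y z g] g by auto
    next
      case False
      then have nz: "f \<noteq> 0" "g \<noteq> 0" by auto
      show ?thesis
      proof (cases "iso_obj G x z")
        case True
        then have xy: "iso_obj G x y" using EE f g nz by simp
        then have yz: "iso_obj G y z" using True iso_trans iso_sym by blast
        show ?thesis using True xy yz S.act_comp[of f x y g z v] EH f g v by simp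
      next
        case xz: False
        then have "\<not> (iso_obj G x y \<and> iso_obj G y z)" using iso_trans by blast
        then show ?thesis using xz S.act_0[of g y z] EH[of y z g] g by auto
      qed
    qed
    show "mact (S0 \<mu>) x x (ident (subcat G E) x) v = v" if "v \<in> mob (S0 \<mu>) x" for x v
      using that S.act_ident iso_refl by simp
    show "mact (S0 \<mu>) x y f v \<in> mob (S0 \<mu>) y" if "f \<in> Hom (subcat G E) x y" "v \<in> mob (S0 \<mu>) x" for x y f v
      using that S.act_closed[of f x y v] EH[of x y f] S.mob_0 by simp
    show "linear_map_on (mscale (S0 \<mu>)) (mscale (S0 \<mu>)) (mob (S0 \<mu>) x) (mact (S0 \<mu>) x y f)"
      if "f \<in> Hom (subcat G E) x y" for x y f
      using that S.act_linear[of f x y] EH[of x y f] by (cases "iso_obj G x y") (simp_all add: linear_map_on_def)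
  qed (use S.vector_space S.subspace in simp_all)
qed

lemma S0_U: assumes \<mu>: "\<mu> \<in> \<Lambda>" shows "cat_module KU (S0 \<mu>)"
proof (rule S0_cat[OF \<mu> wide_U U_iso_H])
  fix x y z f g assume "f \<in> U x y" "g \<in> U y z" "f \<noteq> 0" "g \<noteq> 0" "iso_obj G x z"
  then have "le x y" "le y x" using U_le iso_le iso_sym le_trans by blast+
  then show "iso_obj G x y" by (rule le_antisym)
qed

lemma S0_D: assumes \<mu>: "\<mu> \<in> \<Lambda>" shows "cat_module KD (S0 \<mu>)"
proof (rule S0_cat[OF \<mu> wide_D D_iso_H])
  fix x y z f g assume "f \<in> D x y" "g \<in> D y z" "f \<noteq> 0" "g \<noteq> 0" "iso_obj G x z"
  then have "le x y" "le y x" using D_le iso_le iso_sym le_trans by blast+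
  then show "iso_obj G x y" by (rule le_antisym)
qed

lemma S_S0: assumes \<mu>: "\<mu> \<in> \<Lambda>" shows "mod_hom K (S \<mu>) (S0 \<mu>) (\<lambda>x v. v)" "mod_hom K (S0 \<mu>) (S \<mu>) (\<lambda>x v. v)"
proof -
  have e: "mact (S \<mu>) x y f v = mact (S0 \<mu>) x y f v" if "f \<in> H x y" "v \<in> mob (S \<mu>) x" for x y f v
    using that S_act_zero[OF \<mu>] H_iso[of f x y] by auto
  show "mod_hom K (S \<mu>) (S0 \<mu>) (\<lambda>x v. v)" by (rule mod_homI) (simp_all add: e del: S0_sel(3))
  show "mod_hom K (S0 \<mu>) (S \<mu>) (\<lambda>x v. v)" by (rule mod_homI) (simp_all add: e del: S0_sel(3))
qed

definition \<Delta> where "\<Delta> \<mu> = standard G D (S \<mu>)"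
text \<open>The unit of the induction adjunction; it embeds \<open>S \<mu>\<close> as the lowest
  layer of \<open>\<Delta> \<mu>\<close>.\<close>

definition \<eta> where "\<eta> \<mu> y = ind_tensor G D (S0 \<mu>) y y (ident G y)"

lemma \<Delta>_eq: "\<Delta> \<mu> = induced G D (S0 \<mu>)" by (simp add: \<Delta>_def standard_def S0_def)

lemma \<Delta>_cat: "cat_module G (\<Delta> \<mu>)" unfolding \<Delta>_eq by (rule cat_module_induced(1)[OF linG wide_D])

lemma \<eta>_hom: "mod_hom KD (S0 \<mu>) (\<Delta> \<mu>) (\<eta> \<mu>)"
  unfolding \<Delta>_eq \<eta>_def using induced_unit[OF linG wide_D] .

lemma \<Delta>_ext:
  fixes N :: "('o, 'm, 'k, 'v::ab_group_add) cmod"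
  assumes \<mu>: "\<mu> \<in> \<Lambda>" and N: "cat_module G N" and \<phi>: "mod_hom KD (S0 \<mu>) N \<phi>"
  shows "\<exists>\<psi>. mod_hom G (\<Delta> \<mu>) N \<psi> \<and> (\<forall>y. \<forall>s\<in>mob (S \<mu>) y. \<psi> y (\<eta> \<mu> y s) = \<phi> y s)"
  using ex1_implies_ex[OF induced_adjoint[OF linG wide_D S0_D[OF \<mu>] N \<phi>]]
  unfolding \<Delta>_eq \<eta>_def by (auto simp: hom_space_def)

lemma \<Delta>_gen: "submod G (\<Delta> \<mu>) N \<Longrightarrow> (\<And>y s. s \<in> mob (S \<mu>) y \<Longrightarrow> \<eta> \<mu> y s \<in> N y) \<Longrightarrow> N = mob (\<Delta> \<mu>)"
  unfolding \<Delta>_eq \<eta>_def by (rule induced_generated[OF linG wide_D]) auto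

text \<open>By (T3) a morphism is a combination of composites \<open>u d\<close>, and
  \<open>d\<close> maps the image of \<open>\<eta>\<close> into itself, so the action of
  \<open>U\<close> on this image already yields all of \<open>\<Delta> \<mu>\<close>.\<close>

lemma \<Delta>_U_gen:
  assumes \<mu>: "\<mu> \<in> \<Lambda>" and N: "submod KU (\<Delta> \<mu>) N" and g: "\<And>y s. s \<in> mob (S \<mu>) y \<Longrightarrow> \<eta> \<mu> y s \<in> N y"
  shows "N = mob (\<Delta> \<mu>)"
proof (rule \<Delta>_gen)
  interpret E: cat_module G "\<Delta> \<mu>" by (rule \<Delta>_cat)
  note EU = G_to_U[OF \<Delta>_cat[of \<mu>]]
  note n = submodD[OF EU N, simplified]
  obtain R where R: "transversal G R" using transversal_ex by blast
  have \<eta>c: "\<eta> \<mu> y s \<in> mob (\<Delta> \<mu>) y" if "s \<in> mob (S \<mu>) y" for y s using n(2)[OF g[OF that]] .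
  have "mact (\<Delta> \<mu>) y z h (\<eta> \<mu> y s) \<in> N z" if h: "h \<in> Hom G y z" and s: "s \<in> mob (S \<mu>) y" for y z h s
    using h R
  proof (induction rule: tri_induct)
    case zero
    show ?case unfolding linear_map_on_0[OF vector_space E.vector_space subspace E.act_linear_left[OF \<eta>c[OF s]]]
      by (rule n(4))
  next
    case (step c w u d h)
    have hh: "cmp G y w z u d \<in> Hom G y z" using comp_closed U_Hom D_Hom step(2,3) by blast
    have ds: "mact (S0 \<mu>) y w d s \<in> mob (S \<mu>) w" using cat_module.act_closed[OF S0_D[OF \<mu>], of d y w s] step(3) s by simp
    have "mact (\<Delta> \<mu>) y z (cmp G y w z u d) (\<eta> \<mu> y s) = mact (\<Delta> \<mu>) w z u (mact (\<Delta> \<mu>) y w d (\<eta> \<mu> y s))"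
      by (rule E.act_comp[OF D_Hom[OF step(3)] U_Hom[OF step(2)] \<eta>c[OF s]])
    also have "mact (\<Delta> \<mu>) y w d (\<eta> \<mu> y s) = \<eta> \<mu> w (mact (S0 \<mu>) y w d s)"
      using mod_hom_act[OF S0_D[OF \<mu>] G_to_D[OF \<Delta>_cat] \<eta>_hom, of d y w s] step(3) s by simp
    finally have "mact (\<Delta> \<mu>) y z (cmp G y w z u d) (\<eta> \<mu> y s) \<in> N z" using n(3)[OF step(2) g[OF ds]] by simp
    moreover have "mact (\<Delta> \<mu>) y z (cscale G c (cmp G y w z u d) + h) (\<eta> \<mu> y s) =
        mscale (\<Delta> \<mu>) c (mact (\<Delta> \<mu>) y z (cmp G y w z u d) (\<eta> \<mu> y s)) + mact (\<Delta> \<mu>) y z h (\<eta> \<mu> y s)"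
      using E.act_linear_left[OF \<eta>c[OF s], of z] hh gv.subspace_scale[OF subspace hh] step(4)
      unfolding linear_map_on_def by metis
    ultimately show ?case using n(5)[OF n(8) step(5)] by metis
  qed
  note ** = this
  have *: "ind_tensor G D (S0 \<mu>) z y h s \<in> N z" if "h \<in> Hom G y z" "s \<in> mob (S0 \<mu>) y" for y z h s
  proof -
    have "ind_tensor G D (S0 \<mu>) z y h s = mact (\<Delta> \<mu>) y z h (\<eta> \<mu> y s)"
      using induced_act[OF linG wide_D that] by (simp only: \<Delta>_eq \<eta>_def)
    moreover have "s \<in> mob (S \<mu>) y" using that(2) by simp
    ultimately show ?thesis using ** that(1) by simp
  qed
  have "mob (\<Delta> \<mu>) z \<subseteq> N z" for z
    unfolding \<Delta>_eq induced_mob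
    by (rule E.mv.span_minimal[unfolded \<Delta>_eq, simplified]) (use * n(1) in \<open>auto simp: \<Delta>_eq\<close>)
  then have "N = mob (\<Delta> \<mu>)" using n(2) by (intro ext) blast
  then show "submod G (\<Delta> \<mu>) N" using submod_mob[OF \<Delta>_cat] by simp
qed (rule g)

text \<open>The candidate \<open>N\<close> is the image of \<open>\<eta>\<close> on the support of
  \<open>\<mu>\<close>, all of \<open>\<Delta> \<mu>\<close> on the other classes above it, and zero
  elsewhere. As a \<open>U\<close>-submodule that contains the image of \<open>\<eta>\<close>, it is
  everything.\<close>

lemma \<Delta>_support:
  assumes \<mu>: "\<mu> \<in> \<Lambda>" and x: "x \<in> wsupp \<mu>"
  shows "v \<in> mob (\<Delta> \<mu>) z \<Longrightarrow> v \<noteq> 0 \<Longrightarrow> le x z"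
    and "v \<in> mob (\<Delta> \<mu>) z \<Longrightarrow> z \<in> wsupp \<mu> \<Longrightarrow> v \<in> \<eta> \<mu> z ` mob (S \<mu>) z"
proof -
  interpret E: cat_module G "\<Delta> \<mu>" by (rule \<Delta>_cat)
  note DD = S0_D[OF \<mu>]
  note h = mod_homD[OF DD G_to_D[OF \<Delta>_cat] \<eta>_hom, simplified]
  have sup: "z \<in> wsupp \<mu> \<longleftrightarrow> iso_obj G x z" for z using wsupp_class[OF \<mu> x] by (simp add: obj_class_def)
  define N where "N z = (if z \<in> wsupp \<mu> then \<eta> \<mu> z ` mob (S \<mu>) z else if le x z then mob (\<Delta> \<mu>) z else {0})" for z
  have im: "module.subspace (mscale (\<Delta> \<mu>)) (\<eta> \<mu> z ` mob (S \<mu>) z)" for z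
    using subspace_image_on[OF cat_module.vector_space[OF DD] E.vector_space cat_module.subspace[OF DD]
        mod_hom_linear[OF DD G_to_D[OF \<Delta>_cat] \<eta>_hom]] by simp
  have Nsub: "module.subspace (mscale (\<Delta> \<mu>)) (N z)" for z
    using im E.subspace by (simp add: N_def E.mv.subspace_single_0)
  have Nle: "N z \<subseteq> mob (\<Delta> \<mu>) z" for z using h(1) E.mob_0 by (auto simp: N_def)
  have N0: "0 \<in> N z" for z using E.mv.subspace_0[OF Nsub] .
  have act: "mact (\<Delta> \<mu>) z w u v \<in> N w" if u: "u \<in> U z w" and v: "v \<in> N z" for z w u v
  proof (cases "u = 0 \<or> v = 0")
    case True
    then have "mact (\<Delta> \<mu>) z w u v = 0"
      using E.act_0[OF U_Hom[OF u]] linear_map_on_0[OF vector_space E.vector_space subspace E.act_linear_left, of v z w] v Nle by auto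
    then show ?thesis using N0 by simp
  next
    case False
    have xz: "le x z" using v False sup iso_le by (auto simp: N_def split: if_splits)
    have zw: "le z w" using U_le[OF u] False by simp
    show ?thesis
    proof (cases "w \<in> wsupp \<mu>")
      case True
      then have "le w x" using sup iso_le iso_sym by blast
      then have "le z x" using zw le_trans by blast
      then have zs: "z \<in> wsupp \<mu>" using xz le_antisym sup by blast
      then have izw: "iso_obj G z w" using True sup iso_trans iso_sym by blast
      obtain s where s: "s \<in> mob (S \<mu>) z" "v = \<eta> \<mu> z s" using v zs by (auto simp: N_def)
      have uD: "u \<in> D z w" using H_D[OF U_iso_H[OF izw u]] .
      have "mact (\<Delta> \<mu>) z w u v = \<eta> \<mu> w (mact (S0 \<mu>) z w u s)"
        using h(3)[OF uD s(1)] s(2) by simp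
      moreover have "mact (S0 \<mu>) z w u s \<in> mob (S \<mu>) w" using cat_module.act_closed[OF DD, of u z w s] uD s(1) by simp
      ultimately show ?thesis using True unfolding N_def by auto
    next
      case w: False
      have "v \<in> mob (\<Delta> \<mu>) z" using v Nle by blast
      then show ?thesis using w le_trans[OF xz zw] E.act_closed[OF U_Hom[OF u]] by (simp add: N_def)
    qed
  qed
  have "submod KU (\<Delta> \<mu>) N" using Nsub Nle act by (simp add: submod_def)
  moreover have "\<eta> \<mu> y s \<in> N y" if s: "s \<in> mob (S \<mu>) y" for y s
  proof (cases "y \<in> wsupp \<mu>")
    case True then show ?thesis using s by (simp add: N_def)
  next
    case False
    then have "s = 0" using S_zero[OF \<mu> False s] by blast
    then show ?thesis using h(6)[of y] N0 by simp
  qed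
  ultimately have N: "N = mob (\<Delta> \<mu>)" by (rule \<Delta>_U_gen[OF \<mu>])
  show "le x z" if "v \<in> mob (\<Delta> \<mu>) z" "v \<noteq> 0"
    using that sup iso_le unfolding N[symmetric] by (auto simp: N_def split: if_splits)
  show "v \<in> \<eta> \<mu> z ` mob (S \<mu>) z" if "v \<in> mob (\<Delta> \<mu>) z" "z \<in> wsupp \<mu>"
    using that unfolding N[symmetric] by (simp add: N_def)
qed

text \<open>For fixed \<open>s\<close> the action of \<open>d\<close> in \<open>D y\<close> on
  \<open>s\<close> is \<open>H\<close>-linear in \<open>d\<close>, so it extends by (T3) to a
  \<open>U\<close>-homomorphism on \<open>rep G y\<close>. Uniqueness of such extensions makes the
  result linear in \<open>s\<close> and balanced over \<open>D\<close>, so it descends to the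
  induced module.\<close>

lemma \<Delta>_tau:
  assumes \<mu>: "\<mu> \<in> \<Lambda>"
  shows "\<exists>\<tau>. surj_hom KU (\<Delta> \<mu>) (S0 \<mu>) \<tau> \<and> (\<forall>y. \<forall>s\<in>mob (S \<mu>) y. \<tau> y (\<eta> \<mu> y s) = s)"
proof -
  note SU = S0_U[OF \<mu>] and SD = S0_D[OF \<mu>]
  interpret SU: cat_module KU "S0 \<mu>" by (rule SU)
  interpret SD: cat_module KD "S0 \<mu>" by (rule SD)
  have ex: "\<exists>\<Theta>. mod_hom KU (rep G w) (S0 \<mu>) \<Theta> \<and> (\<forall>y. \<forall>d\<in>D w y. \<Theta> y d = mact (S0 \<mu>) w y d s)"
    if "s \<in> mob (S0 \<mu>) w" for w s
    using T3_ext[OF SU hom_D_to_K[OF yoneda_hom[OF linD SD that]]] .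
  define \<Theta> where "\<Theta> w s = (SOME \<Theta>. mod_hom KU (rep G w) (S0 \<mu>) \<Theta> \<and>
    (\<forall>y. \<forall>d\<in>D w y. \<Theta> y d = mact (S0 \<mu>) w y d s))" for w s
  have \<Theta>: "mod_hom KU (rep G w) (S0 \<mu>) (\<Theta> w s)"
    and \<Theta>d: "\<And>y d. d \<in> D w y \<Longrightarrow> \<Theta> w s y d = mact (S0 \<mu>) w y d s" if "s \<in> mob (S0 \<mu>) w" for w s
    using someI_ex[OF ex[OF that]] unfolding \<Theta>_def[symmetric] by blast+
  have bil: "bilinear_family (cscale G) (mscale (S0 \<mu>)) (mscale (S0 \<mu>)) UNIV (\<lambda>y. Hom G y z) (mob (S0 \<mu>))
      (ind_rel G D (S0 \<mu>) z) (\<lambda>y g s. \<Theta> y s z g)" for z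
  proof -
    have 1: "linear_map_on (cscale G) (mscale (S0 \<mu>)) (Hom G y z) (\<lambda>a. \<Theta> y b z a)" if "b \<in> mob (S0 \<mu>) y" for y b
      using mod_hom_linear[OF rep_G_U SU \<Theta>[OF that], of z] by simp
    have 2: "linear_map_on (mscale (S0 \<mu>)) (mscale (S0 \<mu>)) (mob (S0 \<mu>) y) (\<lambda>s. \<Theta> y s z g)" if g: "g \<in> Hom G y z" for y g
      unfolding linear_map_on_def
    proof (intro conjI ballI allI)
      fix s s' assume s: "s \<in> mob (S0 \<mu>) y" "s' \<in> mob (S0 \<mu>) y"
      show "\<Theta> y (s + s') z g = \<Theta> y s z g + \<Theta> y s' z g"
      proof (rule rep_U_unique[OF SU \<Theta>[OF SU.mob_add[OF s]] mod_hom_plus[OF SU rep_G_U \<Theta>[OF s(1)] \<Theta>[OF s(2)]] _ g])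
        fix w d assume d: "d \<in> D y w"
        show "\<Theta> y (s + s') w d = \<Theta> y s w d + \<Theta> y s' w d"
          unfolding \<Theta>d[OF s(1) d] \<Theta>d[OF s(2) d] \<Theta>d[OF SU.mob_add[OF s] d]
          by (rule SD.act_add[OF _ s]) (use d in simp)
      qed
    next
      fix c s assume s: "s \<in> mob (S0 \<mu>) y"
      show "\<Theta> y (mscale (S0 \<mu>) c s) z g = mscale (S0 \<mu>) c (\<Theta> y s z g)"
      proof (rule rep_U_unique[OF SU \<Theta>[OF SU.mob_scale[OF s]] mod_hom_smult[OF SU rep_G_U \<Theta>[OF s]] _ g])
        fix w d assume d: "d \<in> D y w"
        show "\<Theta> y (mscale (S0 \<mu>) c s) w d = mscale (S0 \<mu>) c (\<Theta> y s w d)"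
          unfolding \<Theta>d[OF s d] \<Theta>d[OF SU.mob_scale[OF s] d]
          by (rule SD.act_scale[OF _ s]) (use d in simp)
      qed
    qed
    have 3: "\<Theta> y s z (cmp G y y' z g c) = \<Theta> y' (mact (S0 \<mu>) y y' c s) z g"
      if q: "c \<in> D y y'" "g \<in> Hom G y' z" "s \<in> mob (S0 \<mu>) y" for y y' g c s
    proof -
      have cs: "mact (S0 \<mu>) y y' c s \<in> mob (S0 \<mu>) y'" using SD.act_closed[of c y y' s] q by simp
      have yc: "mod_hom KU (rep G y') (rep G y) (\<lambda>w f. cmp G y y' w f c)"
        using hom_G_to_U[OF yoneda_hom[OF linG cat_module_rep[OF linG], of c y y']] D_Hom[OF q(1)] by simp
      show ?thesis
      proof (rule rep_U_unique[OF SU mod_hom_comp[OF yc \<Theta>[OF q(3)]] \<Theta>[OF cs] _ q(2)])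
        fix w d assume d: "d \<in> D y' w"
        show "\<Theta> y s w (cmp G y y' w d c) = \<Theta> y' (mact (S0 \<mu>) y y' c s) w d"
          using \<Theta>d[OF q(3) D_comp[OF q(1) d]] \<Theta>d[OF cs d] SD.act_comp[of c y y' d w s] q d by simp
      qed
    qed
    show ?thesis unfolding bilinear_family_def
    proof (intro conjI)
      show "\<forall>((i, a, b), i', a', b')\<in>ind_rel G D (S0 \<mu>) z. \<Theta> i b z a = \<Theta> i' b' z a'"
        using 3 unfolding ind_rel_def by (auto simp del: S0_sel)
    qed (use 1 2 in auto)
  qed
  have "\<exists>\<tau>. linear_map_on fscale (mscale (S0 \<mu>)) (mob (\<Delta> \<mu>) z) \<tau> \<and>
      (\<forall>y. \<forall>g\<in>Hom G y z. \<forall>s\<in>mob (S0 \<mu>) y. \<tau> (ind_tensor G D (S0 \<mu>) z y g s) = \<Theta> y s z g)" for z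
    using btensor_universal[OF SU.vector_space bil[of z]] by (simp add: \<Delta>_eq induced_def ind_tensor_def)
  then obtain \<tau> where lin: "\<And>z. linear_map_on fscale (mscale (S0 \<mu>)) (mob (\<Delta> \<mu>) z) (\<tau> z)"
    and \<tau>: "\<And>z y g s. g \<in> Hom G y z \<Longrightarrow> s \<in> mob (S0 \<mu>) y \<Longrightarrow> \<tau> z (ind_tensor G D (S0 \<mu>) z y g s) = \<Theta> y s z g"
    by metis
  interpret E: cat_module G "\<Delta> \<mu>" by (rule \<Delta>_cat)
  have Esc: "mscale (\<Delta> \<mu>) = fscale" by (simp add: \<Delta>_eq)
  have add: "\<tau> z (v + w) = \<tau> z v + \<tau> z w" and scale: "\<tau> z (mscale (\<Delta> \<mu>) c v) = mscale (S0 \<mu>) c (\<tau> z v)"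
    if "v \<in> mob (\<Delta> \<mu>) z" "w \<in> mob (\<Delta> \<mu>) z" for z v w c using lin[of z] that by (auto simp: linear_map_on_def Esc)
  have z0: "\<tau> z 0 = 0" for z
    by (rule linear_map_on_0[OF _ SU.vector_space _ lin]) (use E.vector_space E.subspace Esc in simp_all)
  \<comment> \<open>Span induction over pure tensors, with membership in
    \<open>\<Delta> \<mu>\<close> carried along because \<open>\<tau>\<close> is linear only
    there.\<close>
  have ind: "P v" if v: "v \<in> mob (\<Delta> \<mu>) z" and "P 0"
    and st: "\<And>c y g s w. g \<in> Hom G y z \<Longrightarrow> s \<in> mob (S0 \<mu>) y \<Longrightarrow> w \<in> mob (\<Delta> \<mu>) z \<Longrightarrow> P w \<Longrightarrow>
      P (mscale (\<Delta> \<mu>) c (ind_tensor G D (S0 \<mu>) z y g s) + w)" for P v z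
  proof -
    have "v \<in> mob (\<Delta> \<mu>) z \<and> P v" using v unfolding \<Delta>_eq induced_mob
    proof (induction rule: E.mv.span_induct_alt[unfolded Esc, consumes 1, case_names base step])
      case base then show ?case using \<open>P 0\<close> E.mv.span_zero[unfolded Esc] by blast
    next
      case (step c a b)
      then obtain y g s where a: "a = ind_tensor G D (S0 \<mu>) z y g s" "g \<in> Hom G y z" "s \<in> mob (S0 \<mu>) y" by blast
      have m: "a \<in> mob (\<Delta> \<mu>) z" "b \<in> mob (\<Delta> \<mu>) z"
        using induced_tensor_closed[OF a(2,3)] step.IH a(1) by (simp_all add: \<Delta>_eq induced_mob)
      have "mscale (\<Delta> \<mu>) c a + b \<in> mob (\<Delta> \<mu>) z" using E.mob_add[OF E.mob_scale[OF m(1)] m(2)] .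
      moreover have "P (mscale (\<Delta> \<mu>) c a + b)" using st[OF a(2,3) m(2)] step.IH a(1) by blast
      ultimately show ?case unfolding \<Delta>_eq induced_mob induced_mscale by (rule conjI)
    qed
    then show ?thesis by blast
  qed
  have tc: "ind_tensor G D (S0 \<mu>) z y g s \<in> mob (\<Delta> \<mu>) z" if "g \<in> Hom G y z" "s \<in> mob (S0 \<mu>) y" for z y g s
    using induced_tensor_closed[OF that] by (simp add: \<Delta>_eq)
  have cl: "\<tau> z v \<in> mob (S0 \<mu>) z" if "v \<in> mob (\<Delta> \<mu>) z" for z v
    using that
  proof (rule ind)
    show "\<tau> z 0 \<in> mob (S0 \<mu>) z" using z0 SU.mob_0 by simp
    fix c y g s w assume *: "g \<in> Hom G y z" "s \<in> mob (S0 \<mu>) y" "w \<in> mob (\<Delta> \<mu>) z" "\<tau> z w \<in> mob (S0 \<mu>) z"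
    have "\<Theta> y s z g \<in> mob (S0 \<mu>) z" using mod_hom_closed[OF rep_G_U SU \<Theta>[OF *(2)], of g z] *(1) by simp
    then show "\<tau> z (mscale (\<Delta> \<mu>) c (ind_tensor G D (S0 \<mu>) z y g s) + w) \<in> mob (S0 \<mu>) z"
      using add[OF E.mob_scale[OF tc[OF *(1,2)]] *(3)] scale[OF tc[OF *(1,2)] *(3)] \<tau>[OF *(1,2)] *(4) SU.mob_add SU.mob_scale by metis
  qed
  have nat: "\<tau> w (mact (\<Delta> \<mu>) z w u v) = mact (S0 \<mu>) z w u (\<tau> z v)" if u: "u \<in> U z w" and v: "v \<in> mob (\<Delta> \<mu>) z" for z w u v
    using v
  proof (rule ind)
    show "\<tau> w (mact (\<Delta> \<mu>) z w u 0) = mact (S0 \<mu>) z w u (\<tau> z 0)"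
      using E.act_0[OF U_Hom[OF u]] z0 SU.act_0[of u z w] u by simp
    fix c y g s v assume *: "g \<in> Hom G y z" "s \<in> mob (S0 \<mu>) y" "v \<in> mob (\<Delta> \<mu>) z"
      and IH: "\<tau> w (mact (\<Delta> \<mu>) z w u v) = mact (S0 \<mu>) z w u (\<tau> z v)"
    let ?p = "ind_tensor G D (S0 \<mu>) z y g s"
    have p: "?p \<in> mob (\<Delta> \<mu>) z" by (rule tc[OF *(1,2)])
    have uH: "u \<in> Hom G z w" by (rule U_Hom[OF u])
    have uU: "u \<in> Hom KU z w" using u by simp
    have "mact (\<Delta> \<mu>) z w u ?p = ind_tensor G D (S0 \<mu>) w y (cmp G y z w u g) s"
      unfolding \<Delta>_eq by (rule cat_module_induced(2)[OF linG wide_D uH *(1,2)])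
    then have "\<tau> w (mact (\<Delta> \<mu>) z w u ?p) = \<Theta> y s w (cmp G y z w u g)" using \<tau>[OF comp_closed[OF *(1) uH] *(2)] by simp
    also have "\<dots> = mact (S0 \<mu>) z w u (\<tau> z ?p)"
      using mod_hom_act[OF rep_G_U SU \<Theta>[OF *(2)], of u z w g] u *(1) \<tau>[OF *(1,2)] by (simp del: S0_sel)
    finally have e: "\<tau> w (mact (\<Delta> \<mu>) z w u ?p) = mact (S0 \<mu>) z w u (\<tau> z ?p)" .
    note ac = E.act_closed[OF uH]
    have "\<tau> w (mact (\<Delta> \<mu>) z w u (mscale (\<Delta> \<mu>) c ?p + v)) =
        mscale (S0 \<mu>) c (\<tau> w (mact (\<Delta> \<mu>) z w u ?p)) + \<tau> w (mact (\<Delta> \<mu>) z w u v)"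
      using E.act_add[OF uH E.mob_scale[OF p] *(3)] E.act_scale[OF uH p]
        add[OF E.mob_scale[OF ac[OF p]] ac[OF *(3)]] scale[OF ac[OF p] ac[OF *(3)]] by simp
    also have "\<dots> = mact (S0 \<mu>) z w u (mscale (S0 \<mu>) c (\<tau> z ?p) + \<tau> z v)"
      using e IH SU.act_add[OF uU SU.mob_scale[OF cl[OF p]] cl[OF *(3)]] SU.act_scale[OF uU cl[OF p]] by simp
    also have "mscale (S0 \<mu>) c (\<tau> z ?p) + \<tau> z v = \<tau> z (mscale (\<Delta> \<mu>) c ?p + v)"
      using add[OF E.mob_scale[OF p] *(3)] scale[OF p *(3)] by simp
    finally show "\<tau> w (mact (\<Delta> \<mu>) z w u (mscale (\<Delta> \<mu>) c ?p + v)) = mact (S0 \<mu>) z w u (\<tau> z (mscale (\<Delta> \<mu>) c ?p + v))" .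
  qed
  have th: "mod_hom KU (\<Delta> \<mu>) (S0 \<mu>) \<tau>"
    by (rule mod_homI) (use cl nat add scale in \<open>simp_all del: S0_sel\<close>)
  have \<tau>\<eta>: "\<tau> y (\<eta> \<mu> y s) = s" if s: "s \<in> mob (S \<mu>) y" for y s
  proof -
    have "\<tau> y (\<eta> \<mu> y s) = \<Theta> y s y (ident G y)" using \<tau>[OF ident_closed, of s y] s by (simp add: \<eta>_def)
    also have "\<dots> = s" using \<Theta>d[OF _ H_D[OF H_ident], of s y] SD.act_ident[of s y] s by simp
    finally show ?thesis .
  qed
  have "\<tau> y ` mob (\<Delta> \<mu>) y = mob (S0 \<mu>) y" for y
  proof
    show "\<tau> y ` mob (\<Delta> \<mu>) y \<subseteq> mob (S0 \<mu>) y" using cl by blast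
    show "mob (S0 \<mu>) y \<subseteq> \<tau> y ` mob (\<Delta> \<mu>) y"
    proof
      fix s assume s: "s \<in> mob (S0 \<mu>) y"
      have "\<eta> \<mu> y s \<in> mob (\<Delta> \<mu>) y" using tc[OF ident_closed s] by (simp add: \<eta>_def)
      then show "s \<in> \<tau> y ` mob (\<Delta> \<mu>) y" using \<tau>\<eta>[of s y] s by force
    qed
  qed
  then have "surj_hom KU (\<Delta> \<mu>) (S0 \<mu>) \<tau>" using th by (simp add: surj_hom_def)
  then show ?thesis using \<tau>\<eta> by blast
qed

text \<open>Over \<open>H\<close> the surjection \<open>\<pi>\<close> has a section on
  \<open>S \<mu>\<close>, as simple modules are projective there. Following \<open>\<phi>\<close> on
  \<open>D x\<close> by this section and extending by (T3) gives the lift, and it is enough to check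
  it on \<open>D x\<close>.\<close>

lemma rep_u_lift:
  fixes A :: "('o, 'm, 'k, 'v::ab_group_add) cmod"
  assumes \<mu>: "\<mu> \<in> \<Lambda>" and A: "cat_module KU A"
  shows "lift_prop KU (rep G x) A (S0 \<mu>)"
  unfolding lift_prop_def
proof (intro allI impI, elim conjE)
  fix \<pi> \<phi> assume \<pi>: "surj_hom KU A (S0 \<mu>) \<pi>" and \<phi>: "mod_hom KU (rep G x) (S0 \<mu>) \<phi>"
  have \<pi>': "mod_hom KU A (S0 \<mu>) \<pi>" using \<pi> by (simp add: surj_hom_def)
  have \<pi>K: "surj_hom K A (S0 \<mu>) \<pi>" using \<pi> hom_U_to_K by (auto simp: surj_hom_def)
  obtain \<sigma> where \<sigma>: "mod_hom K (S \<mu>) A \<sigma>" "\<forall>y. \<forall>s\<in>mob (S \<mu>) y. \<pi> y (\<sigma> y s) = s"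
    using lift_propD[OF S_lift[OF \<mu> U_to_K[OF A] U_to_K[OF S0_U[OF \<mu>]]] \<pi>K S_S0(1)[OF \<mu>]] by blast
  have incl: "mod_hom K (rep KD x) (rep G x) (\<lambda>y d. d)"
    by (rule mod_homI) (auto simp: D_Hom)
  have \<phi>K: "mod_hom K (rep KD x) (S \<mu>) \<phi>"
    using mod_hom_comp[OF mod_hom_comp[OF incl hom_U_to_K[OF \<phi>]] S_S0(2)[OF \<mu>]] .
  obtain \<Theta> where \<Theta>: "mod_hom KU (rep G x) A \<Theta>" "\<forall>y. \<forall>d\<in>D x y. \<Theta> y d = \<sigma> y (\<phi> y d)"
    using T3_ext[OF A mod_hom_comp[OF \<phi>K \<sigma>(1)]] by blast
  have "\<pi> z (\<Theta> z h) = \<phi> z h" if "h \<in> Hom G x z" for z h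
  proof (rule rep_U_unique[OF S0_U[OF \<mu>] mod_hom_comp[OF \<Theta>(1) \<pi>'] \<phi> _ that])
    fix y d assume d: "d \<in> D x y"
    have "\<phi> y d \<in> mob (S \<mu>) y" using mod_hom_closed[OF rep_G_U S0_U[OF \<mu>] \<phi>, of d y] D_Hom[OF d] by simp
    then show "\<pi> y (\<Theta> y d) = \<phi> y d" using \<Theta>(2) d \<sigma>(2) by simp
  qed
  then show "\<exists>\<psi>. mod_hom KU (rep G x) A \<psi> \<and> (\<forall>y. \<forall>v\<in>mob (rep G x) y. \<pi> y (\<psi> y v) = \<phi> y v)"
    using \<Theta>(1) by auto
qed

text \<open>\<open>K_split\<close> provides maps over \<open>H\<close> only; minimality of the class
  of \<open>x\<close> upgrades them. Downward morphisms leaving the class kill the image of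
  \<open>\<iota>\<close>, so \<open>\<iota>\<close> is \<open>D\<close>-linear and extends to
  \<open>\<Delta> \<mu>\<close>. Upward morphisms entering the class start where \<open>N\<close>
  vanishes, so \<open>q\<close> is \<open>U\<close>-linear.\<close>

lemma step_min:
  fixes N :: "('o, 'm, 'k, 'v::ab_group_add) cmod"
  assumes N: "cat_module G N" and fd: "fin_dim (mscale N) (mob N x)" and nz: "v0 \<in> mob N x" "v0 \<noteq> 0"
    and min: "\<And>y v. v \<in> mob N y \<Longrightarrow> v \<noteq> 0 \<Longrightarrow> le y x \<Longrightarrow> iso_obj G y x"
  shows "\<exists>\<mu>\<in>\<Lambda>. \<exists>q \<iota> \<psi>. x \<in> wsupp \<mu> \<and> mod_hom KU N (S0 \<mu>) q \<and> mod_hom G (\<Delta> \<mu>) N \<psi> \<and>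
    (\<forall>y. \<forall>s\<in>mob (S \<mu>) y. \<psi> y (\<eta> \<mu> y s) = \<iota> y s \<and> q y (\<iota> y s) = s)"
proof -
  interpret N: cat_module G N by (rule N)
  obtain \<mu> q \<iota> where \<mu>: "\<mu> \<in> \<Lambda>" "x \<in> wsupp \<mu>" and q: "mod_hom K N (S \<mu>) q"
    and \<iota>: "mod_hom K (S \<mu>) N \<iota>" and q\<iota>: "\<forall>y. \<forall>v\<in>mob (S \<mu>) y. q y (\<iota> y v) = v"
    using K_split[OF G_to_K[OF N] fd nz] by blast
  note Sc = S_cat[OF \<mu>(1)]
  interpret S: cat_module K "S \<mu>" by (rule Sc)
  note i = mod_homD[OF Sc G_to_K[OF N] \<iota>, simplified] and qh = mod_homD[OF G_to_K[OF N] Sc q, simplified]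
  have sup: "z \<in> wsupp \<mu> \<longleftrightarrow> iso_obj G x z" for z using wsupp_class[OF \<mu>] by (simp add: obj_class_def)
  have act0: "mact N y z 0 v = 0" if "v \<in> mob N y" for y z v
    using linear_map_on_0[OF vector_space N.vector_space subspace N.act_linear_left[OF that]] .
  have "mod_hom KD (S0 \<mu>) N \<iota>"
  proof (rule mod_homI)
    fix y z f s assume f: "f \<in> Hom KD y z" and s: "s \<in> mob (S0 \<mu>) y"
    show "\<iota> z (mact (S0 \<mu>) y z f s) = mact N y z f (\<iota> y s)"
    proof (cases "iso_obj G y z")
      case True
      then have "f \<in> H y z" using D_iso_H f by simp
      then show ?thesis using True i(3) s by simp
    next
      case False
      have "mact N y z f (\<iota> y s) = 0"
      proof (rule ccontr)
        assume nz: "mact N y z f (\<iota> y s) \<noteq> 0"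
        have ism: "\<iota> y s \<in> mob N y" using i(1) s by simp
        have fN: "f \<in> Hom G y z" using f D_Hom by simp
        have "f \<noteq> 0" using nz act0[OF ism] by auto
        then have zy: "le z y" using D_le f by simp
        have "s \<noteq> 0" using nz i(6)[of y] N.act_0[OF fN] by auto
        then have "y \<in> wsupp \<mu>" using S_zero[OF \<mu>(1)] s by auto
        then have yx: "iso_obj G y x" using sup iso_sym by blast
        then have "le z x" using zy iso_le le_trans by blast
        then have "iso_obj G z x" using min[OF N.act_closed[OF fN ism] nz] by blast
        then show False using False yx iso_trans iso_sym by blast
      qed
      then show ?thesis using False i(6) by simp
    qed
  qed (use i in simp_all)
  then obtain \<psi> where \<psi>: "mod_hom G (\<Delta> \<mu>) N \<psi>" "\<forall>y. \<forall>s\<in>mob (S \<mu>) y. \<psi> y (\<eta> \<mu> y s) = \<iota> y s"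
    using \<Delta>_ext[OF \<mu>(1) N] by blast
  have "mod_hom KU N (S0 \<mu>) q"
  proof (rule mod_homI)
    fix y z u v assume u: "u \<in> Hom KU y z" and v: "v \<in> mob N y"
    have uG: "u \<in> Hom G y z" using u U_Hom by simp
    show "q z (mact N y z u v) = mact (S0 \<mu>) y z u (q y v)"
    proof (cases "iso_obj G y z")
      case True
      then have "u \<in> H y z" using U_iso_H u by simp
      then show ?thesis using True qh(3) v by simp
    next
      case False
      have "q z (mact N y z u v) = 0"
      proof (rule ccontr)
        assume nz: "q z (mact N y z u v) \<noteq> 0"
        have "mact N y z u v \<noteq> 0" using nz qh(6)[of z] by auto
        then have "u \<noteq> 0" "v \<noteq> 0" using act0[OF v] N.act_0[OF uG] by auto
        then have yz: "le y z" using U_le u by simp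
        have "z \<in> wsupp \<mu>" using S_zero[OF \<mu>(1)] qh(1)[OF N.act_closed[OF uG v]] nz by blast
        then have zx: "iso_obj G z x" using sup iso_sym by blast
        then have "le y x" using yz iso_le le_trans by blast
        then have "iso_obj G y x" using min[OF v \<open>v \<noteq> 0\<close>] by blast
        then show False using False zx iso_trans iso_sym by blast
      qed
      then show ?thesis using False by simp
    qed
  qed (use qh in simp_all)
  then show ?thesis using \<mu> \<psi> q\<iota> by blast
qed

end

section \<open>The induced projective modules\<close>

lemma induced_hom_eq:
  assumes C: "linear_category C" and H: "wide_subcategory C H" and B: "cat_module C B"
    and \<phi>: "mod_hom C (induced C H S) B \<phi>" and \<psi>: "mod_hom C (induced C H S) B \<psi>"
    and e: "\<And>y s. s \<in> mob S y \<Longrightarrow> \<phi> y (ind_tensor C H S y y (ident C y) s) = \<psi> y (ind_tensor C H S y y (ident C y) s)"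
    and v: "v \<in> mob (induced C H S) z"
  shows "\<phi> z v = \<psi> z v"
proof -
  note I = cat_module_induced(1)[OF C H, of S]
  let ?N = "\<lambda>z. {v \<in> mob (induced C H S) z. \<phi> z v - \<psi> z v = 0}"
  have N: "submod C (induced C H S) ?N" by (rule submod_kernel[OF I B mod_hom_minus[OF B I \<phi> \<psi>]])
  have "?N = mob (induced C H S)"
  proof (rule induced_generated[OF C H N])
    fix y s assume s: "s \<in> mob S y"
    show "ind_tensor C H S y y (ident C y) s \<in> ?N y"
      using e[OF s] induced_tensor_closed[OF linear_category.ident_closed[OF C] s] by simp
  qed
  then have "?N z = mob (induced C H S) z" by (rule fun_cong)
  then have "v \<in> ?N z" using v by (simp only:)
  then show ?thesis by simp
qed

lemma internal_sum_projection:
  assumes M: "cat_module C M" and s: "internal_sum C M A B"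
  shows "\<exists>p. mod_hom C M (restr_mod M A) p \<and> (\<forall>x. \<forall>v\<in>A x. p x v = v)"
proof -
  interpret M: cat_module C M by (rule M)
  have A: "submod C M A" and B: "submod C M B" and AB: "\<And>x. A x \<inter> B x = {0}"
    and sum: "\<And>x. {a + b | a b. a \<in> A x \<and> b \<in> B x} = mob M x"
    using s by (auto simp: internal_sum_def)
  note a = submodD[OF M A] and b = submodD[OF M B]
  define p where "p x v = (THE u. u \<in> A x \<and> v - u \<in> B x)" for x v
  have p: "p x v = u" if "u \<in> A x" "v - u \<in> B x" for x u v
    unfolding p_def
  proof (rule the_equality)
    show "u \<in> A x \<and> v - u \<in> B x" using that by simp
    fix u' assume u': "u' \<in> A x \<and> v - u' \<in> B x"
    have "(v - u') - (v - u) \<in> B x" using u' that b(6) by blast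
    then have "u - u' \<in> A x \<inter> B x" using u' that a(6) by simp
    then show "u' = u" using AB by simp
  qed
  have ex: "\<exists>u\<in>A x. v - u \<in> B x" if v: "v \<in> mob M x" for x v
  proof -
    obtain a b where ab: "v = a + b" "a \<in> A x" "b \<in> B x" using v unfolding sum[of x, symmetric] by blast
    then have "v - a \<in> B x" by simp
    then show ?thesis using ab(2) by blast
  qed
  have "mod_hom C M (restr_mod M A) p"
  proof (rule mod_homI, unfold restr_mod_sel)
    fix x v assume v: "v \<in> mob M x"
    then obtain u where u: "u \<in> A x" "v - u \<in> B x" using ex by blast
    show "p x v \<in> A x" using p[OF u] u by simp
    show "p x (mscale M c v) = mscale M c (p x v)" for c
      using p[OF a(8)[OF u(1), of c]] b(8)[OF u(2), of c] p[OF u] by (simp add: M.mv.scale_right_diff_distrib)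
    show "p y (mact M x y f v) = mact M x y f (p x v)" if f: "f \<in> Hom C x y" for f y
      using p[OF a(3)[OF f u(1)]] b(3)[OF f u(2)] p[OF u] M.act_diff[OF f v a(2)[OF u(1)]] by simp
    fix w assume w: "w \<in> mob M x"
    then obtain t where t: "t \<in> A x" "w - t \<in> B x" using ex by blast
    have "v + w - (u + t) \<in> B x" using b(5)[OF u(2) t(2)] by (simp add: algebra_simps)
    then show "p x (v + w) = p x v + p x w" using p[OF a(5)[OF u(1) t(1)]] p[OF u] p[OF t] by simp
  qed
  moreover have "p x v = v" if "v \<in> A x" for x v using p[OF that] b(4) by simp
  ultimately show ?thesis by blast
qed

lemma summand_retract:
  assumes M: "cat_module C M" and P: "cat_module C P" and s: "summand_of C P M"
  shows "\<exists>i p. mod_hom C P M i \<and> mod_hom C M P p \<and> (\<forall>x. \<forall>v\<in>mob P x. p x (i x v) = v)"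
proof -
  obtain A B where AB: "internal_sum C M A B" "isomorphic C P (restr_mod M A)" using s by (auto simp: summand_of_def)
  have A: "submod C M A" using AB(1) by (simp add: internal_sum_def)
  obtain p where p: "mod_hom C M (restr_mod M A) p" "\<forall>x. \<forall>v\<in>A x. p x v = v"
    using internal_sum_projection[OF M AB(1)] by blast
  obtain \<phi> where \<phi>: "mod_hom C P (restr_mod M A) \<phi>" "\<And>x. bij_betw (\<phi> x) (mob P x) (mob (restr_mod M A) x)"
    using AB(2) by (auto simp: isomorphic_def)
  note Ac = cat_module_restr[OF M A]
  obtain \<psi> where \<psi>: "mod_hom C (restr_mod M A) P \<psi>" "\<forall>x. \<forall>v\<in>mob P x. \<psi> x (\<phi> x v) = v"
    using mod_hom_inverse[OF P Ac \<phi>] by blast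
  have "\<psi> x (p x (\<phi> x v)) = v" if "v \<in> mob P x" for x v
    using mod_hom_closed[OF P Ac \<phi>(1) that] p(2) \<psi>(2) that by simp
  then show ?thesis
    using mod_hom_comp[OF \<phi>(1) mod_hom_incl[OF A]] mod_hom_comp[OF p(1) \<psi>(1)] by blast
qed

lemma retract_surj:
  assumes P: "cat_module C P" and M: "cat_module C M" and "mod_hom C P M i" "mod_hom C M P p"
    and "\<And>x v. v \<in> mob P x \<Longrightarrow> p x (i x v) = v"
  shows "surj_hom C M P p"
proof -
  have "p x ` mob M x = mob P x" for x
  proof
    show "p x ` mob M x \<subseteq> mob P x" using assms(4) by (simp add: mod_hom_def)
    show "mob P x \<subseteq> p x ` mob M x"
    proof
      fix v assume v: "v \<in> mob P x"
      then show "v \<in> p x ` mob M x" using mod_hom_closed[OF P M assms(3) v] assms(5)[OF v] by force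
    qed
  qed
  then show ?thesis using assms(4) by (simp add: surj_hom_def)
qed

lemma pointwise_finite_quotient:
  assumes M: "cat_module C M" and Q: "cat_module C Q" and fd: "pointwise_finite M" and \<pi>: "surj_hom C M Q \<pi>"
  shows "pointwise_finite Q"
  unfolding pointwise_finite_def
proof
  fix x
  have \<pi>': "mod_hom C M Q \<pi>" and s: "\<pi> x ` mob M x = mob Q x" using \<pi> by (auto simp: surj_hom_def)
  show "fin_dim (mscale Q) (mob Q x)"
    using fin_dim_image[OF cat_module.vector_space[OF M] cat_module.vector_space[OF Q] cat_module.subspace[OF M]
        mod_hom_linear[OF M Q \<pi>']] fd s by (simp add: pointwise_finite_def) metis
qed

lemma surj_hom_comp:
  assumes "surj_hom C M N \<phi>" "surj_hom C N L \<psi>" shows "surj_hom C M L (\<lambda>x v. \<psi> x (\<phi> x v))"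
proof -
  have "(\<lambda>v. \<psi> x (\<phi> x v)) ` mob M x = mob L x" for x
    using assms image_image[of "\<psi> x" "\<phi> x" "mob M x"] by (simp add: surj_hom_def)
  then show ?thesis using assms mod_hom_comp[of C M N \<phi> L \<psi>] by (simp add: surj_hom_def)
qed

section \<open>The modules \<open>Pt \<mu>\<close> and lifting over \<open>U\<close>\<close>

context tri
begin

definition Pt where "Pt \<mu> = big_projective G U D (S \<mu>)"
definition \<zeta> where "\<zeta> \<mu> y = ind_tensor G H (S \<mu>) y y (ident G y)"

lemma Pt_eq: "Pt \<mu> = induced G H (S \<mu>)" by (simp add: Pt_def big_projective_def)

lemma Pt_cat: "cat_module G (Pt \<mu>)" unfolding Pt_eq by (rule cat_module_induced(1)[OF linG wide_H])

lemma \<zeta>_hom: "mod_hom K (S \<mu>) (Pt \<mu>) (\<zeta> \<mu>)"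
  unfolding Pt_eq \<zeta>_def using induced_unit[OF linG wide_H] .

lemma Pt_ext:
  fixes N :: "('o, 'm, 'k, 'v::ab_group_add) cmod"
  assumes \<mu>: "\<mu> \<in> \<Lambda>" and N: "cat_module G N" and \<phi>: "mod_hom K (S \<mu>) N \<phi>"
  shows "\<exists>\<psi>. mod_hom G (Pt \<mu>) N \<psi> \<and> (\<forall>y. \<forall>s\<in>mob (S \<mu>) y. \<psi> y (\<zeta> \<mu> y s) = \<phi> y s)"
  using ex1_implies_ex[OF induced_adjoint[OF linG wide_H S_cat[OF \<mu>] N \<phi>]]
  unfolding Pt_eq \<zeta>_def by (auto simp: hom_space_def)

lemma Pt_hom_eq:
  fixes N :: "('o, 'm, 'k, 'v::ab_group_add) cmod"
  assumes "cat_module G N" "mod_hom G (Pt \<mu>) N \<phi>" "mod_hom G (Pt \<mu>) N \<psi>"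
    and "\<And>y s. s \<in> mob (S \<mu>) y \<Longrightarrow> \<phi> y (\<zeta> \<mu> y s) = \<psi> y (\<zeta> \<mu> y s)" "v \<in> mob (Pt \<mu>) z"
  shows "\<phi> z v = \<psi> z v"
  using induced_hom_eq[OF linG wide_H assms(1)] assms(2-) unfolding Pt_eq \<zeta>_def by blast

lemma surj_hom_G_to_K: "surj_hom G A B \<pi> \<Longrightarrow> surj_hom K A B \<pi>"
  using hom_G_to_K by (auto simp: surj_hom_def)

lemma surj_hom_G_to_U: "surj_hom G A B \<pi> \<Longrightarrow> surj_hom KU A B \<pi>"
  using hom_G_to_U by (auto simp: surj_hom_def)

text \<open>Homomorphisms out of \<open>Pt \<mu>\<close> are homomorphisms over \<open>K\<close> out
  of \<open>S \<mu>\<close>, which is projective there.\<close>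

lemma Pt_lift:
  fixes A :: "('o, 'm, 'k, 'v::ab_group_add) cmod" and B :: "('o, 'm, 'k, 'w::ab_group_add) cmod"
  assumes \<mu>: "\<mu> \<in> \<Lambda>" and A: "cat_module G A" and B: "cat_module G B"
  shows "lift_prop G (Pt \<mu>) A B"
  unfolding lift_prop_def
proof (intro allI impI, elim conjE)
  fix \<pi> \<phi> assume \<pi>: "surj_hom G A B \<pi>" and \<phi>: "mod_hom G (Pt \<mu>) B \<phi>"
  have \<pi>': "mod_hom G A B \<pi>" using \<pi> by (simp add: surj_hom_def)
  obtain \<sigma> where \<sigma>: "mod_hom K (S \<mu>) A \<sigma>" "\<forall>y. \<forall>s\<in>mob (S \<mu>) y. \<pi> y (\<sigma> y s) = \<phi> y (\<zeta> \<mu> y s)"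
    using lift_propD[OF S_lift[OF \<mu> G_to_K[OF A] G_to_K[OF B]] surj_hom_G_to_K[OF \<pi>]
        mod_hom_comp[OF \<zeta>_hom hom_G_to_K[OF \<phi>]]] by blast
  obtain \<psi> where \<psi>: "mod_hom G (Pt \<mu>) A \<psi>" "\<forall>y. \<forall>s\<in>mob (S \<mu>) y. \<psi> y (\<zeta> \<mu> y s) = \<sigma> y s"
    using Pt_ext[OF \<mu> A \<sigma>(1)] by blast
  have "\<pi> z (\<psi> z v) = \<phi> z v" if "v \<in> mob (Pt \<mu>) z" for z v
    by (rule Pt_hom_eq[OF B mod_hom_comp[OF \<psi>(1) \<pi>'] \<phi> _ that]) (use \<psi>(2) \<sigma>(2) in simp)
  then show "\<exists>\<psi>. mod_hom G (Pt \<mu>) A \<psi> \<and> (\<forall>x. \<forall>v\<in>mob (Pt \<mu>) x. \<pi> x (\<psi> x v) = \<phi> x v)" using \<psi>(1) by blast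
qed

text \<open>Inducing a retraction of \<open>rep K x\<close> onto \<open>S \<mu>\<close> gives one of
  \<open>rep G x\<close> onto \<open>Pt \<mu>\<close>. Finiteness of \<open>Pt \<mu>\<close> and its
  lifting property over \<open>U\<close> are inherited from \<open>rep G x\<close>.\<close>

lemma Pt_rep:
  assumes \<mu>: "\<mu> \<in> \<Lambda>" and v: "v \<in> mob (S \<mu>) x" "v \<noteq> 0"
  shows "\<exists>i. mod_hom G (Pt \<mu>) (rep G x) i \<and>
      (\<forall>y. \<forall>u\<in>mob (Pt \<mu>) y. mact (Pt \<mu>) x y (i y u) (\<zeta> \<mu> x v) = u)"
    and "mod_hom G (rep G x) (Pt \<mu>) (\<lambda>y h. mact (Pt \<mu>) x y h (\<zeta> \<mu> x v))"
proof -
  note Sc = S_cat[OF \<mu>]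
  have \<zeta>v: "\<zeta> \<mu> x v \<in> mob (Pt \<mu>) x" by (rule mod_hom_closed[OF Sc G_to_K[OF Pt_cat] \<zeta>_hom v(1)])
  let ?p = "\<lambda>y h. mact (Pt \<mu>) x y h (\<zeta> \<mu> x v)"
  show p: "mod_hom G (rep G x) (Pt \<mu>) ?p" by (rule yoneda_hom[OF linG Pt_cat \<zeta>v])
  obtain s where s: "mod_hom K (S \<mu>) (rep K x) s" "\<forall>y. \<forall>w\<in>mob (S \<mu>) y. mact (S \<mu>) x y (s y w) v = w"
    using S_retract(2)[OF \<mu> v] by blast
  have incl: "mod_hom K (rep K x) (rep G x) (\<lambda>y d. d)"
    by (rule mod_homI) (auto simp: H_Hom)
  obtain i where i: "mod_hom G (Pt \<mu>) (rep G x) i" "\<forall>y. \<forall>w\<in>mob (S \<mu>) y. i y (\<zeta> \<mu> y w) = s y w"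
    using Pt_ext[OF \<mu> cat_module_rep[OF linG] mod_hom_comp[OF s(1) incl]] by blast
  have "?p y (i y u) = u" if "u \<in> mob (Pt \<mu>) y" for y u
  proof (rule Pt_hom_eq[OF Pt_cat mod_hom_comp[OF i(1) p] mod_hom_id[OF Pt_cat] _ that])
    fix y w assume w: "w \<in> mob (S \<mu>) y"
    have sw: "s y w \<in> H x y" using mod_hom_closed[OF Sc cat_module_rep[OF linK] s(1) w] by simp
    have "?p y (i y (\<zeta> \<mu> y w)) = \<zeta> \<mu> y (mact (S \<mu>) x y (s y w) v)"
      using i(2) w mod_hom_act[OF Sc G_to_K[OF Pt_cat] \<zeta>_hom, of "s y w" x y v] sw v(1) by simp
    then show "?p y (i y (\<zeta> \<mu> y w)) = \<zeta> \<mu> y w" using s(2) w by simp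
  qed
  then show "\<exists>i. mod_hom G (Pt \<mu>) (rep G x) i \<and> (\<forall>y. \<forall>u\<in>mob (Pt \<mu>) y. ?p y (i y u) = u)" using i(1) by blast
qed

lemma Pt_surj_rep:
  assumes \<mu>: "\<mu> \<in> \<Lambda>" and v: "v \<in> mob (S \<mu>) x" "v \<noteq> 0"
  shows "surj_hom G (rep G x) (Pt \<mu>) (\<lambda>y h. mact (Pt \<mu>) x y h (\<zeta> \<mu> x v))"
  using Pt_rep[OF \<mu> v] retract_surj[OF Pt_cat cat_module_rep[OF linG]] by blast

lemma Pt_fin: assumes \<mu>: "\<mu> \<in> \<Lambda>" shows "pointwise_finite (Pt \<mu>)" "fin_gen G (Pt \<mu>)"
proof -
  obtain x v where v: "v \<in> mob (S \<mu>) x" "v \<noteq> 0" using S_nonzero[OF \<mu>] by blast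
  have "pointwise_finite (rep G x)" using T0 by (simp add: pointwise_finite_def)
  then show "pointwise_finite (Pt \<mu>)"
    by (rule pointwise_finite_quotient[OF cat_module_rep[OF linG] Pt_cat _ Pt_surj_rep[OF \<mu> v]])
  show "fin_gen G (Pt \<mu>)"
    by (rule fin_gen_quotient[OF cat_module_rep[OF linG] Pt_cat fin_gen_rep[OF linG] Pt_surj_rep[OF \<mu> v]])
qed

text \<open>A weak form of projectivity over \<open>U\<close>. It survives passing to the cokernel
  of a map that splits only over \<open>U\<close>, which is what the construction of the filtration
  requires.\<close>

definition u_lift :: "('o, 'm, 'k, 'v::ab_group_add) cmod \<Rightarrow> bool" where
  "u_lift N \<longleftrightarrow> (\<forall>\<nu>\<in>\<Lambda>. lift_prop KU N (\<Delta> \<nu>) (S0 \<nu>))"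

lemma u_lift_retract:
  assumes "u_lift Q" "mod_hom KU N Q i" "mod_hom KU Q N p" "\<And>x v. v \<in> mob N x \<Longrightarrow> p x (i x v) = v"
  shows "u_lift N"
  using lift_prop_retract[OF _ assms(2-4)] assms(1) by (auto simp: u_lift_def)

lemma Pt_u_lift: assumes \<mu>: "\<mu> \<in> \<Lambda>" shows "u_lift (Pt \<mu>)"
proof -
  obtain x v where v: "v \<in> mob (S \<mu>) x" "v \<noteq> 0" using S_nonzero[OF \<mu>] by blast
  obtain i where i: "mod_hom G (Pt \<mu>) (rep G x) i" "\<forall>y. \<forall>u\<in>mob (Pt \<mu>) y. mact (Pt \<mu>) x y (i y u) (\<zeta> \<mu> x v) = u"
    using Pt_rep(1)[OF \<mu> v] by blast
  have "u_lift (rep G x)" unfolding u_lift_def using rep_u_lift G_to_U[OF \<Delta>_cat] by blast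
  then show ?thesis
    by (rule u_lift_retract[OF _ hom_G_to_U[OF i(1)] hom_G_to_U[OF Pt_rep(2)[OF \<mu> v]]]) (use i(2) in blast)
qed

text \<open>A rank that strictly increases along the order, by finiteness of the sets of smaller
  classes. It lets minimal and maximal elements be found by comparing natural numbers.\<close>

definition lc :: "'o set \<Rightarrow> nat" where "lc X = card {Y. (Y, X) \<in> r}"

lemma lc_less: assumes "le x y" "\<not> iso_obj G x y" shows "lc (obj_class G x) < lc (obj_class G y)"
  unfolding lc_def
proof (rule psubset_card_mono)
  show "finite {Y. (Y, obj_class G y) \<in> r}" using adm cls_in by (simp add: admissible_order_def)
  have tr: "trans r" and as: "antisym r" and rf: "\<forall>X\<in>obj_classes G. (X, X) \<in> r"
    using po by (auto simp: partial_order_on_def preorder_on_def refl_on_def)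
  have xy: "(obj_class G x, obj_class G y) \<in> r" using assms(1) by (simp add: le_def)
  have "{Y. (Y, obj_class G x) \<in> r} \<subseteq> {Y. (Y, obj_class G y) \<in> r}" using xy tr by (auto dest: transD)
  moreover have "(obj_class G y, obj_class G y) \<in> r" using rf cls_in by blast
  moreover have "(obj_class G y, obj_class G x) \<notin> r" using assms le_antisym by (auto simp: le_def)
  ultimately show "{Y. (Y, obj_class G x) \<in> r} \<subset> {Y. (Y, obj_class G y) \<in> r}" by blast
qed

lemma minimal_support:
  assumes "v0 \<in> mob N x0" "v0 \<noteq> 0"
  shows "\<exists>x. \<exists>v\<in>mob N x. v \<noteq> 0 \<and> (\<forall>y. \<forall>w\<in>mob N y. w \<noteq> 0 \<longrightarrow> le y x \<longrightarrow> iso_obj G y x)"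
proof -
  define P where "P x \<longleftrightarrow> (\<exists>v\<in>mob N x. v \<noteq> 0)" for x
  define x where "x = (ARG_MIN (\<lambda>x. lc (obj_class G x)) x. P x)"
  have "P x0" using assms by (auto simp: P_def)
  then have x: "P x" unfolding x_def by (rule arg_min_natI)
  have min: "lc (obj_class G x) \<le> lc (obj_class G y)" if "P y" for y
    unfolding x_def using that by (rule arg_min_nat_le)
  have "iso_obj G y x" if "P y" "le y x" for y
    using lc_less[OF that(2)] min[OF that(1)] by linarith
  then show ?thesis using x unfolding P_def by blast
qed

lemma weight_le_refl: "weight_le r \<mu> \<mu>" by (simp add: weight_le_def)

text \<open>\<open>N\<close> is generated by a single vector \<open>w\<close> at an object
  \<open>x\<close> of the support of \<open>\<kappa>\<close>. At a class \<open>y\<close> minimal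
  for \<open>N\<close>, a composite \<open>u d\<close> acts on \<open>w\<close> without vanishing
  only if it passes through the class of \<open>y\<close> itself. This forces \<open>y\<close> to
  lie below \<open>x\<close>, and if the classes agree, then \<open>N\<close> at \<open>y\<close> is
  the image of \<open>S \<kappa>\<close>. The splitting \<open>\<rho>\<close> is a lift of
  \<open>q\<close> along \<open>\<tau>\<close>.\<close>

lemma quotient_step:
  fixes N :: "('o, 'm, 'k, 'v::ab_group_add) cmod"
  assumes \<kappa>: "\<kappa> \<in> \<Lambda>" and N: "cat_module G N" and p0: "surj_hom G (Pt \<kappa>) N p0" and ul: "u_lift N"
    and nz: "mob N \<noteq> zero_sub"
  shows "\<exists>\<mu>\<in>\<Lambda>. weight_le r \<mu> \<kappa> \<and> (\<exists>\<psi> \<rho>. mod_hom G (\<Delta> \<mu>) N \<psi> \<and> mod_hom KU N (\<Delta> \<mu>) \<rho> \<and>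
    (\<forall>y. \<forall>v\<in>mob (\<Delta> \<mu>) y. \<rho> y (\<psi> y v) = v) \<and> (\<mu> = \<kappa> \<longrightarrow> surj_hom G (\<Delta> \<mu>) N \<psi>))"
proof -
  interpret N: cat_module G N by (rule N)
  have fdN: "fin_dim (mscale N) (mob N y)" for y
    using pointwise_finite_quotient[OF Pt_cat N Pt_fin(1)[OF \<kappa>] p0] by (simp add: pointwise_finite_def)
  obtain x v where v: "v \<in> mob (S \<kappa>) x" "v \<noteq> 0" using S_nonzero[OF \<kappa>] by blast
  have x: "x \<in> wsupp \<kappa>" using v wsupp_iff[OF \<kappa>] by blast
  note p0' = surj_hom_def[THEN iffD1, OF p0, THEN conjunct1]
  define \<zeta>' where "\<zeta>' y s = p0 y (\<zeta> \<kappa> y s)" for y s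
  have \<zeta>': "mod_hom K (S \<kappa>) N \<zeta>'" unfolding \<zeta>'_def by (rule mod_hom_comp[OF \<zeta>_hom hom_G_to_K[OF p0']])
  note z = mod_homD[OF S_cat[OF \<kappa>] G_to_K[OF N] \<zeta>', simplified]
  define w where "w = \<zeta>' x v"
  have wN: "w \<in> mob N x" using z(1) v by (simp add: w_def)
  have \<zeta>v: "\<zeta> \<kappa> x v \<in> mob (Pt \<kappa>) x" by (rule mod_hom_closed[OF S_cat[OF \<kappa>] G_to_K[OF Pt_cat] \<zeta>_hom v(1)])
  have gen: "\<exists>h\<in>Hom G x y. n = mact N x y h w" if n: "n \<in> mob N y" for y n
  proof -
    have "n \<in> (\<lambda>h. p0 y (mact (Pt \<kappa>) x y h (\<zeta> \<kappa> x v))) ` Hom G x y"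
      using surj_hom_comp[OF Pt_surj_rep[OF \<kappa> v] p0] n by (simp add: surj_hom_def)
    then obtain h where "h \<in> Hom G x y" "n = p0 y (mact (Pt \<kappa>) x y h (\<zeta> \<kappa> x v))" by blast
    then show ?thesis using mod_hom_act[OF Pt_cat N p0' _ \<zeta>v, of h y] by (auto simp: w_def \<zeta>'_def)
  qed
  have act_lin: "mact N x y (cscale G c f + h) w = mscale N c (mact N x y f w) + mact N x y h w" "mact N x y 0 w = 0"
    if "f \<in> Hom G x y" "h \<in> Hom G x y" for f h c y
    using N.act_linear_left[OF wN, of y] that gv.subspace_scale[OF subspace that(1)]
      linear_map_on_0[OF vector_space N.vector_space subspace N.act_linear_left[OF wN]]
    by (auto simp: linear_map_on_def)
  obtain R where R: "transversal G R" using transversal_ex by blast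
  obtain y v1 where v1: "v1 \<in> mob N y" "v1 \<noteq> 0"
    and min: "\<And>z v. v \<in> mob N z \<Longrightarrow> v \<noteq> 0 \<Longrightarrow> le z y \<Longrightarrow> iso_obj G z y"
  proof -
    obtain x0 u0 where "u0 \<in> mob N x0" "u0 \<noteq> 0" using nz mob_nonzero_iff[OF N] by blast
    from minimal_support[OF this] show ?thesis using that by blast
  qed
  \<comment> \<open>The intermediate object \<open>w'\<close> lies below \<open>y\<close> since
    \<open>u\<close> is upward, and \<open>N\<close> is non-zero there; minimality leaves only the
    class of \<open>y\<close>.\<close>
  have ud: "iso_obj G w' y" if "u \<in> U w' y" "d \<in> D x w'" "mact N x y (cmp G x w' y u d) w \<noteq> 0" for u w' d
  proof -
    have e: "mact N x y (cmp G x w' y u d) w = mact N w' y u (mact N x w' d w)"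
      using N.act_comp[OF D_Hom U_Hom wN] that(1,2) by simp
    have dN: "mact N x w' d w \<in> mob N w'" using N.act_closed[OF D_Hom[OF that(2)] wN] .
    have "mact N x w' d w \<noteq> 0" using that(3) e N.act_0[OF U_Hom[OF that(1)]] by auto
    moreover have "u \<noteq> 0"
      using that(3) e linear_map_on_0[OF vector_space N.vector_space subspace N.act_linear_left[OF dN, of y]] by auto
    ultimately show ?thesis using min[OF dN] U_le[OF that(1)] by blast
  qed
  \<comment> \<open>Composites that act without vanishing pass through the class of
    \<open>y\<close>, and their part \<open>d\<close> goes down from \<open>x\<close> to it.\<close>
  have leyx: "le y x"
  proof (rule ccontr)
    assume n: "\<not> le y x"
    have zero: "mact N x y h w = 0" if h: "h \<in> Hom G x y" for h
      using h R
    proof (induction rule: tri_induct)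
      case zero show ?case using act_lin(2)[OF h h] .
    next
      case (step c w' u d h')
      have hh: "cmp G x w' y u d \<in> Hom G x y" using comp_closed U_Hom D_Hom step(2,3) by blast
      have "mact N x y (cmp G x w' y u d) w = 0"
      proof (rule ccontr)
        assume nz: "mact N x y (cmp G x w' y u d) w \<noteq> 0"
        then have "iso_obj G w' y" using ud step(2,3) by blast
        moreover have "d \<noteq> 0" using nz act_lin(2)[OF h h] comp_0(2)[OF U_Hom[OF step(2)], of x] by auto
        then have "le w' x" using D_le step(3) by blast
        ultimately show False using n iso_le iso_sym le_trans by blast
      qed
      then show ?case using act_lin(1)[OF hh step(4)] step(5) by simp
    qed
    obtain h where "h \<in> Hom G x y" "v1 = mact N x y h w" using gen[OF v1(1)] by blast
    then show False using zero v1(2) by simp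
  qed
  have "\<exists>\<mu>\<in>\<Lambda>. \<exists>q \<iota> \<psi>. y \<in> wsupp \<mu> \<and> mod_hom KU N (S0 \<mu>) q \<and> mod_hom G (\<Delta> \<mu>) N \<psi> \<and>
    (\<forall>y. \<forall>s\<in>mob (S \<mu>) y. \<psi> y (\<eta> \<mu> y s) = \<iota> y s \<and> q y (\<iota> y s) = s)"
    by (rule step_min[OF N fdN v1 min])
  then obtain \<mu> q \<iota> \<psi> where \<mu>: "\<mu> \<in> \<Lambda>" "y \<in> wsupp \<mu>" and q: "mod_hom KU N (S0 \<mu>) q" and \<psi>: "mod_hom G (\<Delta> \<mu>) N \<psi>"
    and \<psi>\<iota>: "\<And>z s. s \<in> mob (S \<mu>) z \<Longrightarrow> \<psi> z (\<eta> \<mu> z s) = \<iota> z s" and q\<iota>: "\<And>z s. s \<in> mob (S \<mu>) z \<Longrightarrow> q z (\<iota> z s) = s"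
    by blast
  have sup\<mu>: "wsupp \<mu> = obj_class G y" and sup\<kappa>: "wsupp \<kappa> = obj_class G x" using wsupp_class \<mu> \<kappa> x by auto
  have qK: "mod_hom K N (S \<mu>) q" using mod_hom_comp[OF hom_U_to_K[OF q] S_S0(2)[OF \<mu>(1)]] .
  have \<iota>N: "\<iota> z s \<in> mob N z" if "s \<in> mob (S \<mu>) z" for z s
  proof -
    have "\<eta> \<mu> z s \<in> mob (\<Delta> \<mu>) z"
      using mod_hom_closed[OF S0_D[OF \<mu>(1)] G_to_D[OF \<Delta>_cat] \<eta>_hom, of s z] that by simp
    then show ?thesis using mod_hom_closed[OF \<Delta>_cat N \<psi>] \<psi>\<iota>[OF that] by metis
  qed
  \<comment> \<open>If the minimal class is that of \<open>x\<close>, strictly lower objects contribute nothing to \<open>N y\<close>.\<close>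
  have top: "mob N y \<subseteq> \<zeta>' y ` mob (S \<kappa>) y" if xy: "iso_obj G x y"
  proof
    note sub = subspace_image_on[OF cat_module.vector_space[OF S_cat[OF \<kappa>]] N.vector_space cat_module.subspace[OF S_cat[OF \<kappa>]] z(2), of y]
    fix n assume "n \<in> mob N y"
    then obtain h where h: "h \<in> Hom G x y" "n = mact N x y h w" using gen by blast
    have "mact N x y h w \<in> \<zeta>' y ` mob (S \<kappa>) y"
      using h(1) R
    proof (induction rule: tri_induct)
      case zero show ?case using act_lin(2)[OF h(1) h(1)] N.mv.subspace_0[OF sub] by simp
    next
      case (step c w' u d h')
      have hh: "cmp G x w' y u d \<in> Hom G x y" using comp_closed U_Hom D_Hom step(2,3) by blast
      have "mact N x y (cmp G x w' y u d) w \<in> \<zeta>' y ` mob (S \<kappa>) y"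
      proof (cases "mact N x y (cmp G x w' y u d) w = 0")
        case True then show ?thesis using N.mv.subspace_0[OF sub] by simp
      next
        case False
        have wy: "iso_obj G w' y" by (rule ud[OF step(2,3) False])
        then have "iso_obj G x w'" using xy iso_trans iso_sym by blast
        then have "cmp G x w' y u d \<in> H x y" using H_comp[OF D_iso_H[OF _ step(3)] U_iso_H[OF wy step(2)]] by blast
        then have "mact N x y (cmp G x w' y u d) w = \<zeta>' y (mact (S \<kappa>) x y (cmp G x w' y u d) v)"
          "mact (S \<kappa>) x y (cmp G x w' y u d) v \<in> mob (S \<kappa>) y"
          using z(3)[of "cmp G x w' y u d" x y v] v cat_module.act_closed[OF S_cat[OF \<kappa>], of "cmp G x w' y u d" x y v]
          by (simp_all add: w_def)
        then show ?thesis by blast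
      qed
      then show ?case using act_lin(1)[OF hh step(4)] step(5) N.mv.subspace_add[OF sub N.mv.subspace_scale[OF sub]] by simp
    qed
    then show "n \<in> \<zeta>' y ` mob (S \<kappa>) y" using h(2) by simp
  qed
  obtain s0 where s0: "s0 \<in> mob (S \<mu>) y" "s0 \<noteq> 0" using \<mu> wsupp_iff by blast
  \<comment> \<open>The vector \<open>\<iota> y s0\<close> comes from \<open>S \<kappa>\<close>, so
    \<open>q \<circ> \<zeta>'\<close> is a non-zero map between the simple modules
    \<open>S \<kappa>\<close> and \<open>S \<mu>\<close>.\<close>
  have eqk: "\<mu> = \<kappa>" if xy: "iso_obj G x y"
  proof -
    obtain t where t: "t \<in> mob (S \<kappa>) y" "\<iota> y s0 = \<zeta>' y t" using top[OF xy] \<iota>N[OF s0(1)] by blast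
    have "q y (\<zeta>' y t) \<noteq> 0" using t(2) q\<iota>[OF s0(1)] s0(2) by simp
    then show ?thesis using schur_zero[OF \<kappa> \<mu>(1) mod_hom_comp[OF \<zeta>' qK] t(1)] by simp
  qed
  have wle: "weight_le r \<mu> \<kappa>"
  proof (cases "iso_obj G x y")
    case True then show ?thesis using eqk weight_le_refl by blast
  next
    case False
    then have "obj_class G x \<noteq> obj_class G y" using obj_class_eq_iff[OF linG] by blast
    then show ?thesis using leyx by (auto simp: weight_le_def weight_less_def sup\<mu> sup\<kappa> le_def)
  qed
  obtain \<tau> where \<tau>: "surj_hom KU (\<Delta> \<mu>) (S0 \<mu>) \<tau>" "\<forall>y. \<forall>s\<in>mob (S \<mu>) y. \<tau> y (\<eta> \<mu> y s) = s"
    using \<Delta>_tau[OF \<mu>(1)] by blast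
  obtain \<rho> where \<rho>: "mod_hom KU N (\<Delta> \<mu>) \<rho>" "\<forall>y. \<forall>v\<in>mob N y. \<tau> y (\<rho> y v) = q y v"
    using lift_propD[OF _ \<tau>(1) q] ul \<mu>(1) by (auto simp: u_lift_def)
  \<comment> \<open>Both sides are \<open>U\<close>-linear in \<open>e\<close>, so they are compared
    on the image of \<open>\<eta>\<close>. On the support of \<open>\<mu>\<close> nothing else of
    \<open>\<Delta> \<mu>\<close> is present, so the value of \<open>\<rho>\<close> is again of the
    form \<open>\<eta> \<mu> z t\<close>, and \<open>\<tau>\<close> determines
    \<open>t\<close>.\<close>
  have "\<rho> z (\<psi> z e) = e" if "e \<in> mob (\<Delta> \<mu>) z" for z e
  proof -
    note EU = G_to_U[OF \<Delta>_cat[of \<mu>]]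
    let ?A = "\<lambda>z. {e \<in> mob (\<Delta> \<mu>) z. \<rho> z (\<psi> z e) - e = 0}"
    have A: "submod KU (\<Delta> \<mu>) ?A"
      by (rule submod_kernel[OF EU EU mod_hom_minus[OF EU EU mod_hom_comp[OF hom_G_to_U[OF \<psi>] \<rho>(1)] mod_hom_id[OF EU]]])
    have "?A = mob (\<Delta> \<mu>)"
    proof (rule \<Delta>_U_gen[OF \<mu>(1) A])
      fix z s assume s: "s \<in> mob (S \<mu>) z"
      have \<eta>s: "\<eta> \<mu> z s \<in> mob (\<Delta> \<mu>) z"
        using mod_hom_closed[OF S0_D[OF \<mu>(1)] G_to_D[OF \<Delta>_cat] \<eta>_hom, of s z] s by simp
      have "\<rho> z (\<psi> z (\<eta> \<mu> z s)) = \<eta> \<mu> z s"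
      proof (cases "z \<in> wsupp \<mu>")
        case True
        have "\<rho> z (\<iota> z s) \<in> mob (\<Delta> \<mu>) z" using mod_hom_closed[OF G_to_U[OF N] EU \<rho>(1) \<iota>N[OF s]] .
        then obtain t where t: "t \<in> mob (S \<mu>) z" "\<rho> z (\<iota> z s) = \<eta> \<mu> z t"
          using \<Delta>_support(2)[OF \<mu>(1) \<mu>(2) _ True] by blast
        have "t = \<tau> z (\<eta> \<mu> z t)" using \<tau>(2) t(1) by simp
        also have "\<dots> = q z (\<iota> z s)" using t(2)[symmetric] \<rho>(2) \<iota>N[OF s] by simp
        finally have "t = q z (\<iota> z s)" .
        then show ?thesis using t(2) q\<iota>[OF s] \<psi>\<iota>[OF s] by simp
      next
        case False
        then have "s = 0" using S_zero[OF \<mu>(1) False s] by blast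
        then show ?thesis
          by (simp only: mod_hom_0[OF S0_D[OF \<mu>(1)] G_to_D[OF \<Delta>_cat] \<eta>_hom] mod_hom_0[OF \<Delta>_cat N \<psi>] mod_hom_0[OF G_to_U[OF N] EU \<rho>(1)])
      qed
      then show "\<eta> \<mu> z s \<in> ?A z" using \<eta>s by simp
    qed
    then have "?A z = mob (\<Delta> \<mu>) z" by (rule fun_cong)
    then have "e \<in> ?A z" using that by (simp only:)
    then show ?thesis by simp
  qed
  \<comment> \<open>Now \<open>q \<circ> \<zeta>'\<close> is injective on \<open>S \<kappa>\<close>
    and \<open>N\<close> at \<open>y\<close> is the image of \<open>\<zeta>'\<close>, so
    \<open>q\<close> is injective there and every vector \<open>n\<close> equals
    \<open>\<iota> (q n)\<close>. Transport by an isomorphism puts the generator \<open>w\<close>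
    into the image of \<open>\<psi>\<close>.\<close>
  moreover have "surj_hom G (\<Delta> \<mu>) N \<psi>" if e: "\<mu> = \<kappa>"
  proof -
    have xy: "iso_obj G x y" using sup\<mu> sup\<kappa> e obj_class_eq_iff[OF linG] by metis
    obtain t0 where t0: "t0 \<in> mob (S \<kappa>) y" "\<iota> y s0 = \<zeta>' y t0" using top[OF xy] \<iota>N[OF s0(1)] by blast
    have qz: "mod_hom K (S \<kappa>) (S \<kappa>) (\<lambda>z s. q z (\<zeta>' z s))" using mod_hom_comp[OF \<zeta>' qK] e by simp
    have qnz: "q y (\<zeta>' y t0) \<noteq> 0" using t0(2) q\<iota>[OF s0(1)] s0(2) by simp
    note inj = simple_hom_inj[OF S_simple[OF \<kappa>] S_cat[OF \<kappa>] qz t0(1) qnz]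
    have inN: "n \<in> \<psi> y ` mob (\<Delta> \<mu>) y" if n: "n \<in> mob N y" for n
    proof -
      have qn: "q y n \<in> mob (S \<mu>) y" using mod_hom_closed[OF G_to_K[OF N] S_cat[OF \<mu>(1)] qK n] .
      have d: "n - \<iota> y (q y n) \<in> mob N y" using N.mob_diff[OF n \<iota>N[OF qn]] .
      obtain t where t: "t \<in> mob (S \<kappa>) y" "n - \<iota> y (q y n) = \<zeta>' y t" using top[OF xy] d by blast
      have "q y (n - \<iota> y (q y n)) = 0"
        using mod_hom_diff[OF G_to_K[OF N] S_cat[OF \<mu>(1)] qK n \<iota>N[OF qn]] q\<iota>[OF qn] by simp
      then have "t = 0" using inj[OF t(1)] t(2) by simp
      then have "n = \<psi> y (\<eta> \<mu> y (q y n))" using t(2) z(6)[of y] \<psi>\<iota>[OF qn] by simp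
      moreover have "\<eta> \<mu> y (q y n) \<in> mob (\<Delta> \<mu>) y"
        using mod_hom_closed[OF S0_D[OF \<mu>(1)] G_to_D[OF \<Delta>_cat] \<eta>_hom, of "q y n" y] qn by simp
      ultimately show ?thesis by blast
    qed
    note im = submod_image[OF \<Delta>_cat N \<psi> submod_mob[OF \<Delta>_cat]]
    obtain m m' where m: "m \<in> H x y" "m' \<in> H y x" "cmp G x y x m' m = ident G x" by (rule iso_H[OF xy])
    have "mact N x y m w \<in> \<psi> y ` mob (\<Delta> \<mu>) y" using inN N.act_closed[OF H_Hom[OF m(1)] wN] by blast
    then have "mact N y x m' (mact N x y m w) \<in> \<psi> x ` mob (\<Delta> \<mu>) x"
      using submod_act[OF N im H_Hom[OF m(2)]] by blast
    then have wim: "w \<in> \<psi> x ` mob (\<Delta> \<mu>) x"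
      using N.act_comp[OF H_Hom[OF m(1)] H_Hom[OF m(2)] wN] m(3) N.act_ident[OF wN] by simp
    have "\<psi> z ` mob (\<Delta> \<mu>) z = mob N z" for z
    proof
      show "\<psi> z ` mob (\<Delta> \<mu>) z \<subseteq> mob N z" using mod_hom_closed[OF \<Delta>_cat N \<psi>] by blast
      show "mob N z \<subseteq> \<psi> z ` mob (\<Delta> \<mu>) z" using gen submod_act[OF N im _ wim] by blast
    qed
    then show ?thesis using \<psi> by (simp add: surj_hom_def)
  qed
  ultimately show ?thesis using \<mu>(1) wle \<psi> \<rho>(1) by blast
qed

end

section \<open>Standard filtrations and characters\<close>

lemma fin_dim_inj:
  fixes f :: "'v::ab_group_add \<Rightarrow> 'w::ab_group_add" and s :: "'k::field \<Rightarrow> _"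
  assumes s: "vector_space s" and t: "vector_space t" and V: "module.subspace s V"
    and f: "linear_map_on s t V f" and fd: "fin_dim t (f ` V)"
    and inj: "\<And>v. v \<in> V \<Longrightarrow> f v = 0 \<Longrightarrow> v = 0"
  shows "fin_dim s V"
proof -
  interpret s: vector_space s by (rule s)
  interpret t: vector_space t by (rule t)
  interpret p: vector_space_pair s t ..
  obtain g where g: "Vector_Spaces.linear s t g" "\<And>v. v \<in> V \<Longrightarrow> g v = f v"
    using linear_map_on_extend[OF s t V f] by blast
  interpret g: Vector_Spaces.linear s t g by (rule g(1))
  obtain B where B: "B \<subseteq> V" "s.independent B" "V \<subseteq> s.span B"
    using s.maximal_independent_subset[of V] by blast
  have spV: "s.span B \<subseteq> V" by (rule s.span_minimal[OF B(1) V])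
  have injB: "inj_on g (s.span B)"
    using g.inj_on_iff_eq_0[of "s.span B"] inj g(2) spV by auto
  have "t.independent (g ` B)"
    using p.linear_independent_injective_image[OF g(1) B(2) injB] .
  moreover have "g ` B \<subseteq> f ` V" using B(1) g(2) by force
  ultimately have "finite (g ` B)" using fin_dim_independent_le(1)[OF t fd] by blast
  moreover have "inj_on g B" using injB s.span_superset inj_on_subset by blast
  ultimately have "finite B" by (rule finite_imageD)
  then show ?thesis using B(3) by (auto simp: fin_dim_def)
qed

lemma sum_fibres:
  fixes f :: "'a \<Rightarrow> 'b::semiring_1"
  assumes "finite W" "\<mu> ` {..<n::nat} \<subseteq> W"
  shows "(\<Sum>i<n. f (\<mu> i)) = (\<Sum>a\<in>W. of_nat (card {i. i < n \<and> \<mu> i = a}) * f a)"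
proof -
  have "(\<Sum>i<n. f (\<mu> i)) = (\<Sum>a\<in>W. \<Sum>i\<in>{i\<in>{..<n}. \<mu> i = a}. f (\<mu> i))"
    by (rule sum.group[OF _ assms, symmetric]) simp
  also have "\<dots> = (\<Sum>a\<in>W. of_nat (card {i. i < n \<and> \<mu> i = a}) * f a)"
    by (rule sum.cong[OF refl]) (simp add: lessThan_def)
  finally show ?thesis .
qed

lemma subquot_iso_preimage:
  assumes N: "cat_module C N" and Q: "cat_module C Q" and \<pi>: "surj_hom C N Q \<pi>"
    and A: "submod C Q A" and B: "submod C Q B" and s: "subquot_iso C Q A B L"
  shows "subquot_iso C N (\<lambda>x. {v \<in> mob N x. \<pi> x v \<in> A x}) (\<lambda>x. {v \<in> mob N x. \<pi> x v \<in> B x}) L"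
proof -
  have \<pi>': "mod_hom C N Q \<pi>" and im: "\<pi> x ` mob N x = mob Q x" for x using \<pi> by (auto simp: surj_hom_def)
  obtain \<rho> where \<rho>: "surj_hom C (restr_mod Q B) L \<rho>" "\<And>x. A x = {v \<in> B x. \<rho> x v = 0}"
    using s by (auto simp: subquot_iso_def)
  let ?B = "\<lambda>x. {v \<in> mob N x. \<pi> x v \<in> B x}"
  have B': "submod C N ?B" by (rule submod_preimage[OF N Q \<pi>' B])
  have pB: "surj_hom C (restr_mod N ?B) (restr_mod Q B) \<pi>"
  proof -
    have "mod_hom C (restr_mod N ?B) Q \<pi>" by (rule mod_hom_restr_source[OF N B' \<pi>'])
    then have "mod_hom C (restr_mod N ?B) (restr_mod Q B) \<pi>" by (auto simp: mod_hom_def)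
    moreover have "\<pi> x ` ?B x = B x" for x
    proof
      show "\<pi> x ` ?B x \<subseteq> B x" by blast
      show "B x \<subseteq> \<pi> x ` ?B x"
      proof
        fix b assume b: "b \<in> B x"
        then have "b \<in> \<pi> x ` mob N x" using submod_le[OF Q B] im by blast
        then show "b \<in> \<pi> x ` ?B x" using b by blast
      qed
    qed
    ultimately show ?thesis by (simp add: surj_hom_def)
  qed
  show ?thesis unfolding subquot_iso_def
    using surj_hom_comp[OF pB \<rho>(1)] \<rho>(2) by (intro exI[of _ "\<lambda>x v. \<rho> x (\<pi> x v)"]) auto
qed

lemma bij_hom_of_injective:
  assumes M: "cat_module C M" and N: "cat_module C N" and \<psi>: "mod_hom C M N \<psi>"
    and inj: "\<And>x v. v \<in> mob M x \<Longrightarrow> \<psi> x v = 0 \<Longrightarrow> v = 0"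
  shows "\<exists>\<theta>. surj_hom C (restr_mod N (\<lambda>x. \<psi> x ` mob M x)) M \<theta> \<and>
    (\<forall>x. \<forall>v\<in>\<psi> x ` mob M x. \<theta> x v = 0 \<longrightarrow> v = 0)"
proof -
  let ?I = "\<lambda>x. \<psi> x ` mob M x"
  have I: "submod C N ?I" by (rule submod_image[OF M N \<psi> submod_mob[OF M]])
  note Ic = cat_module_restr[OF N I]
  have \<psi>I: "mod_hom C M (restr_mod N ?I) \<psi>" using \<psi> by (auto simp: mod_hom_def)
  have "inj_on (\<psi> x) (mob M x)" for x using mod_hom_inj_iff[OF M N \<psi>] inj by blast
  then have "bij_betw (\<psi> x) (mob M x) (mob (restr_mod N ?I) x)" for x by (simp add: bij_betw_def)
  then obtain \<theta> where \<theta>: "mod_hom C (restr_mod N ?I) M \<theta>" "\<forall>x. bij_betw (\<theta> x) (?I x) (mob M x)"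
    "\<forall>x. \<forall>v\<in>mob M x. \<theta> x (\<psi> x v) = v"
    using mod_hom_inverse[OF M Ic \<psi>I] by auto
  have "surj_hom C (restr_mod N ?I) M \<theta>" using \<theta>(1,2) by (simp add: surj_hom_def bij_betw_def)
  moreover have "v = 0" if v: "v \<in> ?I x" "\<theta> x v = 0" for x v
  proof -
    obtain u where "u \<in> mob M x" "v = \<psi> x u" using v(1) by blast
    then show ?thesis using \<theta>(3) v(2) mod_hom_0[OF M N \<psi>] by simp
  qed
  ultimately show ?thesis by blast
qed

section \<open>Standard filtrations and weight multiplicities\<close>

context tri
begin

text \<open>Only finitely many classes lie below the support of \<open>\<kappa>\<close>. The total
  dimension of a module on such a finite set of objects is the measure that makes the filtration
  terminate.\<close>

lemma lower_reps:
  assumes \<kappa>: "\<kappa> \<in> \<Lambda>"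
  shows "\<exists>Y. finite Y \<and> (\<forall>\<mu>\<in>\<Lambda>. weight_le r \<mu> \<kappa> \<longrightarrow> (\<exists>y\<in>Y. y \<in> wsupp \<mu>))"
proof -
  obtain x where x: "x \<in> wsupp \<kappa>" using wsupp_ex[OF \<kappa>] by blast
  have k: "wsupp \<kappa> = obj_class G x" by (rule wsupp_class[OF \<kappa> x])
  let ?L = "{X. (X, obj_class G x) \<in> r}"
  have fin: "finite ?L" using adm cls_in by (simp add: admissible_order_def)
  have "\<exists>y\<in>(\<lambda>X. SOME y. y \<in> X) ` ?L. y \<in> wsupp \<mu>" if \<mu>: "\<mu> \<in> \<Lambda>" "weight_le r \<mu> \<kappa>" for \<mu>
  proof -
    have "(wsupp \<mu>, obj_class G x) \<in> r"
      using \<mu>(2) le_refl[of x] k by (auto simp: weight_le_def weight_less_def le_def)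
    moreover have "(SOME y. y \<in> wsupp \<mu>) \<in> wsupp \<mu>" using wsupp_ex[OF \<mu>(1)] by (rule someI_ex)
    ultimately show ?thesis by blast
  qed
  then show ?thesis using fin by (intro exI[of _ "(\<lambda>X. SOME y. y \<in> X) ` ?L"]) auto
qed

text \<open>The filtration is built from the bottom: \<open>quotient_step\<close> embeds some
  \<open>\<Delta> \<mu>\<close> in \<open>N\<close>, and the induction continues with the cokernel.
  When \<open>\<mu> = \<kappa>\<close>, that step exhausts what is left, so in this construction
  \<open>\<Delta> \<kappa>\<close> can only be the top layer and is then a quotient of
  \<open>N\<close>.\<close>

lemma quotient_filtration:
  fixes N :: "('o, 'm, 'k, 'v::ab_group_add) cmod"
  assumes \<kappa>: "\<kappa> \<in> \<Lambda>" and Y: "finite Y" "\<And>\<mu>. \<mu> \<in> \<Lambda> \<Longrightarrow> weight_le r \<mu> \<kappa> \<Longrightarrow> \<exists>y\<in>Y. y \<in> wsupp \<mu>"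
    and "cat_module G N" "surj_hom G (Pt \<kappa>) N p0" "u_lift N"
  shows "\<exists>n F \<mu>. standard_filtration G U D S N n F \<mu> \<and> (\<forall>i<n. weight_le r (\<mu> i) \<kappa>) \<and>
    ((\<exists>i<n. \<mu> i = \<kappa>) \<longrightarrow> (\<exists>\<pi>. surj_hom G N (\<Delta> \<kappa>) \<pi>))"
  using assms(4-6)
proof (induction "\<Sum>y\<in>Y. vector_space.dim (mscale N) (mob N y)" arbitrary: N p0 rule: less_induct)
  case less
  note N = less.prems(1) and p0 = less.prems(2) and ul = less.prems(3)
  interpret N: cat_module G N by (rule N)
  show ?case
  proof (cases "mob N = zero_sub")
    case True
    have "standard_filtration G U D S N 0 (\<lambda>_. zero_sub) (\<lambda>_. \<kappa>)"
      using True submod_zero[OF N] by (simp add: standard_filtration_def)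
    then show ?thesis by (intro exI[of _ 0]) auto
  next
    case False
    obtain \<mu> \<psi> \<rho> where \<mu>: "\<mu> \<in> \<Lambda>" "weight_le r \<mu> \<kappa>" and \<psi>: "mod_hom G (\<Delta> \<mu>) N \<psi>"
      and \<rho>: "mod_hom KU N (\<Delta> \<mu>) \<rho>" and \<rho>\<psi>: "\<forall>y. \<forall>v\<in>mob (\<Delta> \<mu>) y. \<rho> y (\<psi> y v) = v"
      and top: "\<mu> = \<kappa> \<longrightarrow> surj_hom G (\<Delta> \<mu>) N \<psi>"
      using quotient_step[OF \<kappa> N p0 ul False] by blast
    note E = \<Delta>_cat[of \<mu>]
    have inj: "v = 0" if "v \<in> mob (\<Delta> \<mu>) y" "\<psi> y v = 0" for y v
      using \<rho>\<psi> that mod_hom_0[OF G_to_U[OF N] G_to_U[OF E] \<rho>, of y] by force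
    let ?I = "\<lambda>y. \<psi> y ` mob (\<Delta> \<mu>) y"
    have I: "submod G N ?I" by (rule submod_image[OF E N \<psi> submod_mob[OF E]])
    obtain Q :: "('o, 'm, 'k, 'v) cmod" and \<pi> where Q: "cat_module G Q" "surj_hom G N Q \<pi>"
      and k: "\<forall>x. \<forall>v\<in>mob N x. \<pi> x v = 0 \<longleftrightarrow> v \<in> ?I x"
      using quotient_exists[OF N I] by blast
    have \<pi>: "mod_hom G N Q \<pi>" and \<pi>im: "\<pi> x ` mob N x = mob Q x" for x using Q(2) by (auto simp: surj_hom_def)
    have p0': "surj_hom G (Pt \<kappa>) Q (\<lambda>x v. \<pi> x (p0 x v))" by (rule surj_hom_comp[OF p0 Q(2)])
    \<comment> \<open>The projection complementary to \<open>\<psi> \<circ> \<rho>\<close>. It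
      vanishes on the kernel of \<open>\<pi>\<close> and so induces a \<open>U\<close>-linear
      section of the map to the cokernel \<open>Q\<close>, whence \<open>Q\<close> inherits
      \<open>u_lift\<close>.\<close>
    let ?e = "\<lambda>x v. v - \<psi> x (\<rho> x v)"
    note NU = G_to_U[OF N]
    have eh: "mod_hom KU N N ?e"
      by (rule mod_hom_minus[OF NU NU mod_hom_id[OF NU] mod_hom_comp[OF \<rho> hom_G_to_U[OF \<psi>]]])
    have "?e x v = 0" if "v \<in> mob N x" "\<pi> x v = 0" for x v
      using k that \<rho>\<psi> by auto
    then obtain \<sigma> where \<sigma>: "mod_hom KU Q N \<sigma>" "\<forall>x. \<forall>v\<in>mob N x. \<sigma> x (\<pi> x v) = ?e x v"
      using hom_factor[OF NU G_to_U[OF Q(1)] NU surj_hom_G_to_U[OF Q(2)] eh] by blast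
    have \<rho>c: "\<rho> x v \<in> mob (\<Delta> \<mu>) x" if "v \<in> mob N x" for x v
      by (rule mod_hom_closed[OF NU G_to_U[OF E] \<rho> that])
    have \<psi>c: "\<psi> x v \<in> mob N x" if "v \<in> mob (\<Delta> \<mu>) x" for x v by (rule mod_hom_closed[OF E N \<psi> that])
    have "\<pi> x (\<sigma> x q) = q" if q: "q \<in> mob Q x" for x q
    proof -
      have "q \<in> \<pi> x ` mob N x" using q \<pi>im by simp
      then obtain v where v: "v \<in> mob N x" "q = \<pi> x v" by blast
      have "\<pi> x (\<psi> x (\<rho> x v)) = 0" using k \<psi>c \<rho>c v(1) by blast
      then show ?thesis using \<sigma>(2) v mod_hom_diff[OF N Q(1) \<pi> v(1) \<psi>c[OF \<rho>c[OF v(1)]]] by simp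
    qed
    then have ulQ: "u_lift Q" by (rule u_lift_retract[OF ul \<sigma>(1) hom_G_to_U[OF \<pi>]])
    have fdN: "fin_dim (mscale N) (mob N y)" for y
      using pointwise_finite_quotient[OF Pt_cat N Pt_fin(1)[OF \<kappa>] p0] by (simp add: pointwise_finite_def)
    interpret Q: cat_module G Q by (rule Q(1))
    have dimQ: "N.mv.dim (mob N y) = N.mv.dim {v \<in> mob N y. \<pi> y v = 0} + Q.mv.dim (mob Q y)" for y
      using dim_kernel_image[OF N.vector_space Q.vector_space N.subspace mod_hom_linear[OF N Q(1) \<pi>] fdN, of y] \<pi>im by simp
    obtain y where y: "y \<in> Y" "y \<in> wsupp \<mu>" using Y(2)[OF \<mu>] by blast
    \<comment> \<open>The object \<open>y\<close> lies in the support of \<open>\<mu>\<close>, where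
      the removed copy of \<open>\<Delta> \<mu>\<close> is non-zero; at the other objects of
      \<open>Y\<close> the dimension does not grow.\<close>
    have less_y: "Q.mv.dim (mob Q y) < N.mv.dim (mob N y)"
    proof -
      obtain s where s: "s \<in> mob (S \<mu>) y" "s \<noteq> 0" using y wsupp_iff[OF \<mu>(1)] by blast
      obtain \<tau> where \<tau>: "surj_hom KU (\<Delta> \<mu>) (S0 \<mu>) \<tau>" "\<forall>y. \<forall>s\<in>mob (S \<mu>) y. \<tau> y (\<eta> \<mu> y s) = s"
        using \<Delta>_tau[OF \<mu>(1)] by blast
      have \<tau>0: "\<tau> y 0 = 0" using mod_hom_0[OF G_to_U[OF E] S0_U[OF \<mu>(1)]] \<tau>(1) by (simp add: surj_hom_def)
      have \<eta>s: "\<eta> \<mu> y s \<in> mob (\<Delta> \<mu>) y"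
        using mod_hom_closed[OF S0_D[OF \<mu>(1)] G_to_D[OF E] \<eta>_hom, of s y] s by simp
      have "\<eta> \<mu> y s \<noteq> 0" using \<tau>(2) s \<tau>0 by metis
      then have nz: "\<psi> y (\<eta> \<mu> y s) \<noteq> 0" using inj[OF \<eta>s] by blast
      let ?Ker = "{v \<in> mob N y. \<pi> y v = 0}"
      have "\<psi> y (\<eta> \<mu> y s) \<in> ?Ker" using \<psi>c[OF \<eta>s] k \<eta>s by blast
      moreover have sub0: "N.mv.subspace {0}" by (rule N.mv.subspace_single_0)
      moreover have "0 \<in> ?Ker" using N.mob_0 mod_hom_0[OF N Q(1) \<pi>] by simp
      ultimately have "{0} \<subset> ?Ker" using nz by blast
      then have "N.mv.dim {0} < N.mv.dim ?Ker"
        by (intro fin_dim_dim_less[OF N.vector_space _ _ sub0]) (rule fin_dim_subset[OF fdN, of _ y], blast)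
      then show ?thesis using dimQ[of y] by linarith
    qed
    have "(\<Sum>y\<in>Y. Q.mv.dim (mob Q y)) < (\<Sum>y\<in>Y. N.mv.dim (mob N y))"
      by (rule sum_strict_mono_ex1[OF Y(1)]) (use dimQ less_y y(1) in \<open>auto simp: le_iff_add\<close>)
    from less.hyps[OF this Q(1) p0' ulQ] obtain n F \<mu>s where
      IH: "standard_filtration G U D S Q n F \<mu>s" "\<forall>i<n. weight_le r (\<mu>s i) \<kappa>"
      "(\<exists>i<n. \<mu>s i = \<kappa>) \<longrightarrow> (\<exists>\<pi>. surj_hom G Q (\<Delta> \<kappa>) \<pi>)" by blast
    \<comment> \<open>Preimages of the filtration of \<open>Q\<close>, shifted by one: index 0 is
      the zero submodule and index 1 the image of \<open>\<Delta> \<mu>\<close>.\<close>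
    let ?F = "\<lambda>i. case i of 0 \<Rightarrow> zero_sub | Suc j \<Rightarrow> (\<lambda>x. {v \<in> mob N x. \<pi> x v \<in> F j x})"
    let ?\<mu> = "\<lambda>i. case i of 0 \<Rightarrow> \<mu> | Suc j \<Rightarrow> \<mu>s j"
    have F: "F 0 = zero_sub" "F n = mob Q" "\<And>i. i \<le> n \<Longrightarrow> submod G Q (F i)"
      "\<And>i. i < n \<Longrightarrow> F i \<le> F (Suc i)" "\<And>i. i < n \<Longrightarrow> \<mu>s i \<in> \<Lambda>"
      "\<And>i. i < n \<Longrightarrow> subquot_iso G Q (F i) (F (Suc i)) (\<Delta> (\<mu>s i))"
      using IH(1) by (auto simp: standard_filtration_def \<Delta>_def)
    have F1: "(\<lambda>x. {v \<in> mob N x. \<pi> x v \<in> F 0 x}) = ?I"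
      unfolding F(1) using k \<psi>c by (auto simp: fun_eq_iff zero_sub_def)
    have first: "subquot_iso G N zero_sub ?I (\<Delta> \<mu>)"
    proof -
      obtain \<theta> where \<theta>: "surj_hom G (restr_mod N ?I) (\<Delta> \<mu>) \<theta>" "\<forall>x. \<forall>v\<in>?I x. \<theta> x v = 0 \<longrightarrow> v = 0"
        using bij_hom_of_injective[OF E N \<psi>] inj by blast
      have "\<theta> x 0 = 0" for x
        by (rule mod_hom_0[OF cat_module_restr[OF N I] E surj_hom_def[THEN iffD1, OF \<theta>(1), THEN conjunct1]])
      moreover have "0 \<in> ?I x" for x by (rule submod_0[OF N I])
      ultimately have "zero_sub x = {v \<in> ?I x. \<theta> x v = 0}" for x using \<theta>(2) by (auto simp: zero_sub_def)
      then show ?thesis using \<theta>(1) unfolding subquot_iso_def by blast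
    qed
    have "standard_filtration G U D S N (Suc n) ?F ?\<mu>"
      unfolding standard_filtration_def
    proof (intro conjI allI impI)
      show "?F (Suc n) = mob N" using F(2) mod_hom_closed[OF N Q(1) \<pi>] by (auto simp: fun_eq_iff)
      show "submod G N (?F i)" if "i \<le> Suc n" for i
        using that submod_zero[OF N] submod_preimage[OF N Q(1) \<pi> F(3)] by (cases i) auto
      show "?F i \<le> ?F (Suc i)" if "i < Suc n" for i
      proof (cases i)
        case 0
        then show ?thesis using F1 submod_0[OF N I] by (auto simp: le_fun_def zero_sub_def)
      next
        case (Suc j)
        then show ?thesis using F(4)[of j] that by (auto simp: le_fun_def)
      qed
      show "?\<mu> i \<in> \<Lambda>" if "i < Suc n" for i using that \<mu>(1) F(5) by (cases i) auto
      show "subquot_iso G N (?F i) (?F (Suc i)) (standard G D (S (?\<mu> i)))" if "i < Suc n" for i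
      proof (cases i)
        case 0
        then show ?thesis using first F1 by (simp add: \<Delta>_def)
      next
        case (Suc j)
        then have "j < n" using that by simp
        then show ?thesis
          using subquot_iso_preimage[OF N Q(1,2) F(3) F(3) F(6)[of j]] Suc by (simp add: \<Delta>_def)
      qed
    qed simp
    moreover have "weight_le r (?\<mu> i) \<kappa>" if "i < Suc n" for i using that \<mu>(2) IH(2) by (cases i) auto
    moreover have "\<exists>\<pi>. surj_hom G N (\<Delta> \<kappa>) \<pi>" if ex: "\<exists>i<Suc n. ?\<mu> i = \<kappa>"
    proof -
      obtain i where i: "i < Suc n" "?\<mu> i = \<kappa>" using ex by blast
      show ?thesis
      proof (cases i)
        case 0
        then have e: "\<mu> = \<kappa>" using i by simp
        then have "?I = mob N" using top by (auto simp: surj_hom_def)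
        moreover have "\<exists>\<theta>. surj_hom G (restr_mod N ?I) (\<Delta> \<mu>) \<theta>"
          using bij_hom_of_injective[OF E N \<psi>] inj by blast
        ultimately show ?thesis using e by simp
      next
        case (Suc j)
        then obtain \<pi>' where "surj_hom G Q (\<Delta> \<kappa>) \<pi>'" using IH(3) i by auto
        then show ?thesis using surj_hom_comp[OF Q(2)] by blast
      qed
    qed
    ultimately show ?thesis by blast
  qed
qed

text \<open>For pointwise finite modules this is \<open>weight_mult\<close> as a natural
  number.\<close>

definition wdim :: "('o, 'm, 'k) weight \<Rightarrow> ('o, 'm, 'k, 'v::ab_group_add) cmod \<Rightarrow> nat" where
  "wdim \<nu> N = vector_space.dim (hscale N) (hom_space K (S \<nu>) N)"

text \<open>Evaluation at one non-zero vector of the simple module \<open>S \<nu>\<close> embeds the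
  Hom space into a finite-dimensional space.\<close>

lemma hom_S_fin:
  fixes N :: "('o, 'm, 'k, 'v::ab_group_add) cmod"
  assumes \<nu>: "\<nu> \<in> \<Lambda>" and N: "cat_module K N" and fd: "pointwise_finite N"
  shows "fin_dim (hscale N) (hom_space K (S \<nu>) N)"
proof -
  interpret N: cat_module K N by (rule N)
  obtain x v where v: "v \<in> mob (S \<nu>) x" "v \<noteq> 0" using S_nonzero[OF \<nu>] by blast
  let ?ev = "\<lambda>\<phi> :: 'o \<Rightarrow> 'm \<Rightarrow> 'v. \<phi> x v"
  show ?thesis
  proof (rule fin_dim_inj[OF vector_space_hscale[OF N] N.vector_space subspace_hom_space[OF S_cat[OF \<nu>] N]])
    show "linear_map_on (hscale N) (mscale N) (hom_space K (S \<nu>) N) ?ev" by (simp add: linear_map_on_def)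
    have "?ev ` hom_space K (S \<nu>) N \<subseteq> mob N x"
      using mod_hom_closed[OF S_cat[OF \<nu>] N hom_space_mod_hom v(1)] by blast
    moreover have "fin_dim (mscale N) (mob N x)" using fd by (simp add: pointwise_finite_def)
    ultimately show "fin_dim (mscale N) (?ev ` hom_space K (S \<nu>) N)" using fin_dim_subset by blast
    fix \<phi> assume \<phi>: "\<phi> \<in> hom_space K (S \<nu>) N" "\<phi> x v = 0"
    have "\<phi> y w = 0" for y w
    proof (cases "w \<in> mob (S \<nu>) y")
      case True
      show ?thesis
      proof (rule ccontr)
        assume "\<phi> y w \<noteq> 0"
        from simple_hom_inj[OF S_simple[OF \<nu>] N hom_space_mod_hom[OF \<phi>(1)] True this v(1) \<phi>(2)] v(2)
        show False by blast
      qed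
    next
      case False
      then show ?thesis using \<phi>(1) by (simp add: hom_space_def)
    qed
    then show "\<phi> = 0" by (simp add: fun_eq_iff)
  qed
qed

lemma weight_mult_wdim:
  assumes "\<nu> \<in> \<Lambda>" "cat_module K N" "pointwise_finite N"
  shows "weight_mult G U D S \<nu> N = enat (wdim \<nu> N)"
  using weight_mult_eq[OF assms(1,2)] hom_S_fin[OF assms] by (simp add: hom_dim_def edim_def wdim_def)

text \<open>Projectivity of \<open>S \<nu>\<close> over \<open>K\<close> makes composition with the
  map from \<open>B\<close> to \<open>Q\<close> surjective on Hom spaces; its kernel is the Hom
  space into \<open>A\<close>, and rank-nullity applies.\<close>

lemma wdim_exact:
  fixes M :: "('o, 'm, 'k, 'v::ab_group_add) cmod" and Q :: "('o, 'm, 'k, 'w::ab_group_add) cmod"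
  assumes \<nu>: "\<nu> \<in> \<Lambda>" and M: "cat_module K M" and fd: "pointwise_finite M"
    and A: "submod K M A" and B: "submod K M B" and s: "subquot_iso K M A B Q" and Q: "cat_module K Q"
  shows "wdim \<nu> (restr_mod M B) = wdim \<nu> (restr_mod M A) + wdim \<nu> Q"
proof -
  note Sc = S_cat[OF \<nu>]
  interpret Q: cat_module K Q by (rule Q)
  obtain \<rho> where \<rho>: "surj_hom K (restr_mod M B) Q \<rho>" "\<And>x. A x = {v \<in> B x. \<rho> x v = 0}"
    using s by (auto simp: subquot_iso_def)
  have \<rho>': "mod_hom K (restr_mod M B) Q \<rho>" using \<rho>(1) by (simp add: surj_hom_def)
  note Bc = cat_module_restr[OF M B] and Ac = cat_module_restr[OF M A]
  have fdB: "pointwise_finite (restr_mod M B)"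
    using fd fin_dim_subset submod_le[OF M B] unfolding pointwise_finite_def by (metis restr_mod_sel(1,2) subsetI)
  let ?HB = "hom_space K (S \<nu>) (restr_mod M B)"
  let ?f = "\<lambda>\<phi>. hom_norm (S \<nu>) (\<lambda>x v. \<rho> x (\<phi> x v))"
  have \<phi>B: "\<phi> x v \<in> B x" if "\<phi> \<in> ?HB" "v \<in> mob (S \<nu>) x" for \<phi> x v
    using mod_hom_closed[OF Sc Bc hom_space_mod_hom[OF that(1)] that(2)] by simp
  have lin: "linear_map_on (hscale (restr_mod M B)) (hscale Q) ?HB ?f"
    unfolding linear_map_on_def
    using \<phi>B mod_hom_add[OF Bc Q \<rho>'] mod_hom_scale[OF Bc Q \<rho>']
    by (auto simp: hom_norm_def fun_eq_iff)
  have ker: "{\<phi> \<in> ?HB. ?f \<phi> = 0} = hom_space K (S \<nu>) (restr_mod M A)"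
  proof (intro set_eqI iffI)
    fix \<phi> assume "\<phi> \<in> {\<phi> \<in> ?HB. ?f \<phi> = 0}"
    then have \<phi>: "\<phi> \<in> ?HB" and z: "?f \<phi> = 0" by auto
    have "\<rho> x (\<phi> x v) = 0" if "v \<in> mob (S \<nu>) x" for x v
      using fun_cong[OF fun_cong[OF z, of x], of v] that by (simp add: hom_norm_def)
    then have "\<phi> x v \<in> A x" if "v \<in> mob (S \<nu>) x" for x v using that \<phi>B[OF \<phi> that] \<rho>(2) by blast
    then show "\<phi> \<in> hom_space K (S \<nu>) (restr_mod M A)" using \<phi> by (auto simp: hom_space_def mod_hom_def)
  next
    fix \<phi> assume \<phi>: "\<phi> \<in> hom_space K (S \<nu>) (restr_mod M A)"
    have \<phi>A: "\<phi> x v \<in> A x" if "v \<in> mob (S \<nu>) x" for x v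
      using mod_hom_closed[OF Sc Ac hom_space_mod_hom[OF \<phi>] that] by simp
    have AB: "A x \<subseteq> B x" for x using \<rho>(2) by blast
    have "mod_hom K (S \<nu>) (restr_mod M B) \<phi>"
      using hom_space_mod_hom[OF \<phi>] AB unfolding mod_hom_def restr_mod_sel by (meson subset_trans)
    then have "\<phi> \<in> ?HB" using \<phi> by (simp add: hom_space_def)
    moreover have "?f \<phi> = 0" using \<phi>A \<rho>(2) by (auto simp: fun_eq_iff hom_norm_def)
    ultimately show "\<phi> \<in> {\<phi> \<in> ?HB. ?f \<phi> = 0}" by blast
  qed
  have im: "?f ` ?HB = hom_space K (S \<nu>) Q"
  proof
    show "?f ` ?HB \<subseteq> hom_space K (S \<nu>) Q"
      using hom_norm_hom_space[OF Sc mod_hom_comp[OF hom_space_mod_hom \<rho>']] by blast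
    show "hom_space K (S \<nu>) Q \<subseteq> ?f ` ?HB"
    proof
      fix \<chi> assume \<chi>: "\<chi> \<in> hom_space K (S \<nu>) Q"
      obtain \<psi> where \<psi>: "mod_hom K (S \<nu>) (restr_mod M B) \<psi>" "\<forall>x. \<forall>v\<in>mob (S \<nu>) x. \<rho> x (\<psi> x v) = \<chi> x v"
        using lift_propD[OF S_lift[OF \<nu> Bc Q] \<rho>(1) hom_space_mod_hom[OF \<chi>]] by blast
      have "\<chi> = ?f (hom_norm (S \<nu>) \<psi>)"
        using \<psi>(2) \<chi> by (auto simp: fun_eq_iff hom_norm_def hom_space_def)
      then show "\<chi> \<in> ?f ` ?HB" using hom_norm_hom_space[OF Sc \<psi>(1)] by blast
    qed
  qed
  show ?thesis
    using dim_kernel_image[OF vector_space_hscale[OF Bc] vector_space_hscale[OF Q] subspace_hom_space[OF Sc Bc] lin hom_S_fin[OF \<nu> Bc fdB]]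
    unfolding ker im wdim_def by simp
qed

lemma wdim_filtration:
  fixes M :: "('o, 'm, 'k, 'v::ab_group_add) cmod"
  assumes \<nu>: "\<nu> \<in> \<Lambda>" and M: "cat_module G M" and fd: "pointwise_finite M"
    and F: "standard_filtration G U D S M n F \<mu>"
  shows "wdim \<nu> M = (\<Sum>i<n. wdim \<nu> (\<Delta> (\<mu> i)))"
proof -
  note MK = G_to_K[OF M]
  have f: "F 0 = zero_sub" "F n = mob M" "\<And>i. i \<le> n \<Longrightarrow> submod G M (F i)"
    "\<And>i. i < n \<Longrightarrow> subquot_iso G M (F i) (F (Suc i)) (\<Delta> (\<mu> i))"
    using F by (auto simp: standard_filtration_def \<Delta>_def)
  have "k \<le> n \<Longrightarrow> wdim \<nu> (restr_mod M (F k)) = (\<Sum>i<k. wdim \<nu> (\<Delta> (\<mu> i)))" for k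
  proof (induction k)
    case 0
    let ?Z = "restr_mod M zero_sub"
    interpret H: vector_space "hscale ?Z :: 'k \<Rightarrow> ('o \<Rightarrow> 'm \<Rightarrow> 'v) \<Rightarrow> _"
      by (rule vector_space_hscale[OF cat_module_restr[OF M submod_zero[OF M]]])
    have "hom_space K (S \<nu>) ?Z \<subseteq> {0}"
    proof
      fix \<phi> assume \<phi>: "\<phi> \<in> hom_space K (S \<nu>) ?Z"
      have "\<phi> x v = 0" for x v
        using \<phi> by (cases "v \<in> mob (S \<nu>) x") (auto simp: hom_space_def mod_hom_def zero_sub_def)
      then show "\<phi> \<in> {0}" by (simp add: fun_eq_iff)
    qed
    then have "hom_space K (S \<nu>) ?Z \<subseteq> H.span {}" by (simp only: H.span_empty)
    from H.dim_le_card[OF this finite.emptyI] show ?case by (simp add: f(1) wdim_def)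
  next
    case (Suc k)
    have sub: "submod K M (F k)" "submod K M (F (Suc k))"
      using f(3) Suc.prems by (auto intro: submod_subcat[OF _ wide_H])
    have "subquot_iso K M (F k) (F (Suc k)) (\<Delta> (\<mu> k))"
      using f(4)[of k] Suc.prems surj_hom_G_to_K unfolding subquot_iso_def by (meson Suc_le_eq)
    then show ?case using wdim_exact[OF \<nu> MK fd sub _ G_to_K[OF \<Delta>_cat]] Suc by simp
  qed
  from this[of n] show ?thesis by (simp add: f(2))
qed

lemma \<Delta>_surj_Pt: assumes \<mu>: "\<mu> \<in> \<Lambda>" shows "\<exists>\<psi>. surj_hom G (Pt \<mu>) (\<Delta> \<mu>) \<psi>"
proof -
  have "mod_hom K (S \<mu>) (\<Delta> \<mu>) (\<eta> \<mu>)" using mod_hom_comp[OF S_S0(1)[OF \<mu>] hom_D_to_K[OF \<eta>_hom]] .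
  then obtain \<psi> where \<psi>: "mod_hom G (Pt \<mu>) (\<Delta> \<mu>) \<psi>" "\<forall>y. \<forall>s\<in>mob (S \<mu>) y. \<psi> y (\<zeta> \<mu> y s) = \<eta> \<mu> y s"
    using Pt_ext[OF \<mu> \<Delta>_cat] by blast
  have "(\<lambda>y. \<psi> y ` mob (Pt \<mu>) y) = mob (\<Delta> \<mu>)"
  proof (rule \<Delta>_gen[OF submod_image[OF Pt_cat \<Delta>_cat \<psi>(1) submod_mob[OF Pt_cat]]])
    fix y s assume s: "s \<in> mob (S \<mu>) y"
    have "\<zeta> \<mu> y s \<in> mob (Pt \<mu>) y" by (rule mod_hom_closed[OF S_cat[OF \<mu>] G_to_K[OF Pt_cat] \<zeta>_hom s])
    moreover have "\<eta> \<mu> y s = \<psi> y (\<zeta> \<mu> y s)" using \<psi>(2) s by simp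
    ultimately show "\<eta> \<mu> y s \<in> \<psi> y ` mob (Pt \<mu>) y" by blast
  qed
  then have "\<psi> y ` mob (Pt \<mu>) y = mob (\<Delta> \<mu>) y" for y by (rule fun_cong)
  then show ?thesis using \<psi>(1) by (auto simp: surj_hom_def)
qed

lemma \<Delta>_fin: "\<mu> \<in> \<Lambda> \<Longrightarrow> pointwise_finite (\<Delta> \<mu>)"
  using \<Delta>_surj_Pt pointwise_finite_quotient[OF Pt_cat \<Delta>_cat Pt_fin(1)] by blast

text \<open>\<open>\<Delta> \<mu>\<close> vanishes off the classes above the support of
  \<open>\<mu>\<close>. If \<open>\<mu>\<close> and \<open>\<nu>\<close> have the same support, the
  order does not separate them; then \<open>\<tau>\<close> turns \<open>\<phi>\<close> into a
  non-zero map from \<open>S \<nu>\<close> to \<open>S \<mu>\<close>, and the weights are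
  equal.\<close>

lemma S_hom_\<Delta>:
  assumes \<mu>: "\<mu> \<in> \<Lambda>" and \<nu>: "\<nu> \<in> \<Lambda>" and \<phi>: "mod_hom K (S \<nu>) (\<Delta> \<mu>) \<phi>" and nz: "s \<in> mob (S \<nu>) y" "\<phi> y s \<noteq> 0"
  shows "weight_le r \<mu> \<nu>"
proof -
  obtain x where x: "x \<in> wsupp \<mu>" using wsupp_ex[OF \<mu>] by blast
  have \<phi>s: "\<phi> y s \<in> mob (\<Delta> \<mu>) y" by (rule mod_hom_closed[OF S_cat[OF \<nu>] G_to_K[OF \<Delta>_cat] \<phi> nz(1)])
  have xy: "le x y" by (rule \<Delta>_support(1)[OF \<mu> x \<phi>s nz(2)])
  have "s \<noteq> 0" using nz(2) mod_hom_0[OF S_cat[OF \<nu>] G_to_K[OF \<Delta>_cat] \<phi>] by auto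
  then have y: "y \<in> wsupp \<nu>" using wsupp_iff[OF \<nu>] nz(1) by blast
  have w: "wsupp \<mu> = obj_class G x" "wsupp \<nu> = obj_class G y" using wsupp_class \<mu> \<nu> x y by auto
  show ?thesis
  proof (cases "wsupp \<mu> = wsupp \<nu>")
    case True
    obtain t where t: "t \<in> mob (S \<mu>) y" "\<phi> y s = \<eta> \<mu> y t" using \<Delta>_support(2)[OF \<mu> x \<phi>s] y True by blast
    obtain \<tau> where \<tau>: "surj_hom KU (\<Delta> \<mu>) (S0 \<mu>) \<tau>" "\<forall>y. \<forall>s\<in>mob (S \<mu>) y. \<tau> y (\<eta> \<mu> y s) = s"
      using \<Delta>_tau[OF \<mu>] by blast
    have \<tau>K: "mod_hom K (\<Delta> \<mu>) (S \<mu>) \<tau>"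
      using mod_hom_comp[OF hom_U_to_K[OF surj_hom_def[THEN iffD1, OF \<tau>(1), THEN conjunct1]] S_S0(2)[OF \<mu>]] .
    have "t \<noteq> 0" using t(2) nz(2) mod_hom_0[OF S0_D[OF \<mu>] G_to_D[OF \<Delta>_cat] \<eta>_hom] by auto
    then have "\<tau> y (\<phi> y s) \<noteq> 0" using \<tau>(2) t by simp
    then have "\<nu> = \<mu>" using schur_zero[OF \<nu> \<mu> mod_hom_comp[OF \<phi> \<tau>K] nz(1)] by simp
    then show ?thesis using weight_le_refl by simp
  next
    case False
    then show ?thesis using xy w by (simp add: weight_le_def weight_less_def le_def)
  qed
qed

lemma wdim_nonzero:
  fixes N :: "('o, 'm, 'k, 'v::ab_group_add) cmod"
  assumes \<nu>: "\<nu> \<in> \<Lambda>" and N: "cat_module K N" and h: "wdim \<nu> N \<noteq> 0"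
  shows "\<exists>\<phi> y s. mod_hom K (S \<nu>) N \<phi> \<and> s \<in> mob (S \<nu>) y \<and> \<phi> y s \<noteq> 0"
proof (rule ccontr)
  assume n: "\<not> ?thesis"
  interpret H: vector_space "hscale N :: 'k \<Rightarrow> ('o \<Rightarrow> 'm \<Rightarrow> 'v) \<Rightarrow> _" by (rule vector_space_hscale[OF N])
  have "hom_space K (S \<nu>) N \<subseteq> {0}"
  proof
    fix \<phi> assume \<phi>: "\<phi> \<in> hom_space K (S \<nu>) N"
    have "\<phi> x v = 0" for x v
    proof (cases "v \<in> mob (S \<nu>) x")
      case True then show ?thesis using n hom_space_mod_hom[OF \<phi>] by blast
    next
      case False then show ?thesis using \<phi> by (simp add: hom_space_def)
    qed
    then show "\<phi> \<in> {0}" by (simp add: fun_eq_iff)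
  qed
  then have "H.dim (hom_space K (S \<nu>) N) \<le> card ({} :: ('o \<Rightarrow> 'm \<Rightarrow> 'v) set)"
    by (intro H.dim_le_card) auto
  then show False using h by (simp add: wdim_def)
qed

text \<open>Together with \<open>wdim_\<Delta>_self\<close> this is the unitriangularity of the
  characters of the standard modules.\<close>

lemma wdim_\<Delta>_le: "\<mu> \<in> \<Lambda> \<Longrightarrow> \<nu> \<in> \<Lambda> \<Longrightarrow> wdim \<nu> (\<Delta> \<mu>) \<noteq> 0 \<Longrightarrow> weight_le r \<mu> \<nu>"
  using wdim_nonzero[OF _ G_to_K[OF \<Delta>_cat]] S_hom_\<Delta> by blast

lemma wdim_one:
  fixes N :: "('o, 'm, 'k, 'v::ab_group_add) cmod"
  assumes \<nu>: "\<nu> \<in> \<Lambda>" and N: "cat_module K N" and \<phi>: "mod_hom K (S \<nu>) N \<phi>" and nz: "s \<in> mob (S \<nu>) y" "\<phi> y s \<noteq> 0"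
    and one: "\<And>\<chi>. mod_hom K (S \<nu>) N \<chi> \<Longrightarrow> \<exists>c. \<forall>x. \<forall>v\<in>mob (S \<nu>) x. \<chi> x v = mscale N c (\<phi> x v)"
  shows "wdim \<nu> N = 1"
proof -
  interpret N: cat_module K N by (rule N)
  interpret H: vector_space "hscale N :: 'k \<Rightarrow> ('o \<Rightarrow> 'm \<Rightarrow> 'v) \<Rightarrow> _" by (rule vector_space_hscale[OF N])
  let ?\<phi> = "hom_norm (S \<nu>) \<phi>"
  have m: "?\<phi> \<in> hom_space K (S \<nu>) N" by (rule hom_norm_hom_space[OF S_cat[OF \<nu>] \<phi>])
  have "?\<phi> y s \<noteq> 0" using nz by (simp add: hom_norm_def)
  then have n0: "?\<phi> \<noteq> 0" by (auto simp: fun_eq_iff)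
  have "hom_space K (S \<nu>) N \<subseteq> H.span {?\<phi>}"
  proof
    fix \<chi> assume \<chi>: "\<chi> \<in> hom_space K (S \<nu>) N"
    obtain c where c: "\<forall>x. \<forall>v\<in>mob (S \<nu>) x. \<chi> x v = mscale N c (\<phi> x v)" using one[OF hom_space_mod_hom[OF \<chi>]] by blast
    have "\<chi> = hscale N c ?\<phi>" using c \<chi> by (auto simp: fun_eq_iff hom_norm_def hom_space_def)
    then show "\<chi> \<in> H.span {?\<phi>}" using H.span_scale[OF H.span_base[of ?\<phi> "{?\<phi>}"]] by simp
  qed
  then have "H.dim (hom_space K (S \<nu>) N) = 1"
    using m n0 by (intro H.dim_unique[of "{?\<phi>}"]) auto
  then show ?thesis by (simp add: wdim_def)
qed

lemma \<eta>_K: assumes \<mu>: "\<mu> \<in> \<Lambda>" shows "mod_hom K (S \<mu>) (\<Delta> \<mu>) (\<eta> \<mu>)"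
  using mod_hom_comp[OF S_S0(1)[OF \<mu>] hom_D_to_K[OF \<eta>_hom]] .

text \<open>Following \<open>\<chi>\<close> by \<open>\<tau>\<close> gives a scalar endomorphism of
  \<open>S \<mu>\<close>, and on the support \<open>\<tau>\<close> is inverse to
  \<open>\<eta>\<close>.\<close>

lemma S_hom_\<Delta>_scalar:
  assumes \<mu>: "\<mu> \<in> \<Lambda>" and \<chi>: "mod_hom K (S \<mu>) (\<Delta> \<mu>) \<chi>"
  shows "\<exists>c. \<forall>x. \<forall>v\<in>mob (S \<mu>) x. \<chi> x v = mscale (\<Delta> \<mu>) c (\<eta> \<mu> x v)"
proof -
  obtain x s where s: "s \<in> mob (S \<mu>) x" "s \<noteq> 0" using S_nonzero[OF \<mu>] by blast
  have x: "x \<in> wsupp \<mu>" using s wsupp_iff[OF \<mu>] by blast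
  obtain \<tau> where \<tau>: "surj_hom KU (\<Delta> \<mu>) (S0 \<mu>) \<tau>" "\<forall>y. \<forall>s\<in>mob (S \<mu>) y. \<tau> y (\<eta> \<mu> y s) = s"
    using \<Delta>_tau[OF \<mu>] by blast
  have \<tau>K: "mod_hom K (\<Delta> \<mu>) (S \<mu>) \<tau>"
    using mod_hom_comp[OF hom_U_to_K[OF surj_hom_def[THEN iffD1, OF \<tau>(1), THEN conjunct1]] S_S0(2)[OF \<mu>]] .
  note EK = G_to_K[OF \<Delta>_cat[of \<mu>]]
  obtain c where c: "\<forall>x. \<forall>v\<in>mob (S \<mu>) x. \<tau> x (\<chi> x v) = mscale (S \<mu>) c v"
    using simple_endo_scalar[OF S_simple[OF \<mu>] S_fin[OF \<mu>] mod_hom_comp[OF \<chi> \<tau>K]] by blast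
  have "\<chi> y v = mscale (\<Delta> \<mu>) c (\<eta> \<mu> y v)" if v: "v \<in> mob (S \<mu>) y" for y v
  proof (cases "v = 0")
    case True
    interpret E: cat_module K "\<Delta> \<mu>" by (rule EK)
    show ?thesis using True mod_hom_0[OF S_cat[OF \<mu>] EK \<chi>] mod_hom_0[OF S_cat[OF \<mu>] EK \<eta>_K[OF \<mu>]] by simp
  next
    case False
    then have y: "y \<in> wsupp \<mu>" using v wsupp_iff[OF \<mu>] by blast
    obtain t where t: "t \<in> mob (S \<mu>) y" "\<chi> y v = \<eta> \<mu> y t"
      using \<Delta>_support(2)[OF \<mu> x mod_hom_closed[OF S_cat[OF \<mu>] EK \<chi> v] y] by blast
    have "t = mscale (S \<mu>) c v" using c v t \<tau>(2) by metis
    then show ?thesis using t(2) mod_hom_scale[OF S_cat[OF \<mu>] EK \<eta>_K[OF \<mu>] v] by simp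
  qed
  then show ?thesis by blast
qed

lemma \<eta>_inj:
  assumes \<mu>: "\<mu> \<in> \<Lambda>" and s: "s \<in> mob (S \<mu>) y" "s \<noteq> 0"
  shows "\<eta> \<mu> y s \<noteq> 0"
proof -
  obtain \<tau> where \<tau>: "surj_hom KU (\<Delta> \<mu>) (S0 \<mu>) \<tau>" "\<forall>y. \<forall>s\<in>mob (S \<mu>) y. \<tau> y (\<eta> \<mu> y s) = s"
    using \<Delta>_tau[OF \<mu>] by blast
  have "\<tau> y 0 = 0"
    by (rule mod_hom_0[OF G_to_U[OF \<Delta>_cat] S0_U[OF \<mu>] surj_hom_def[THEN iffD1, OF \<tau>(1), THEN conjunct1]])
  then show ?thesis using \<tau>(2) s by metis
qed

lemma wdim_\<Delta>_self: assumes \<mu>: "\<mu> \<in> \<Lambda>" shows "wdim \<mu> (\<Delta> \<mu>) = 1"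
proof -
  obtain x s where s: "s \<in> mob (S \<mu>) x" "s \<noteq> 0" using S_nonzero[OF \<mu>] by blast
  show ?thesis
    by (rule wdim_one[OF \<mu> G_to_K[OF \<Delta>_cat] \<eta>_K[OF \<mu>] s(1) \<eta>_inj[OF \<mu> s] S_hom_\<Delta>_scalar[OF \<mu>]])
qed

lemma weight_less_lc:
  assumes \<mu>: "\<mu> \<in> \<Lambda>" and \<nu>: "\<nu> \<in> \<Lambda>" and l: "weight_le r \<mu> \<nu>" "\<mu> \<noteq> \<nu>"
  shows "lc (wsupp \<mu>) < lc (wsupp \<nu>)"
proof -
  obtain x y where x: "x \<in> wsupp \<mu>" and y: "y \<in> wsupp \<nu>" using wsupp_ex \<mu> \<nu> by blast
  have w: "wsupp \<mu> = obj_class G x" "wsupp \<nu> = obj_class G y" using wsupp_class \<mu> \<nu> x y by auto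
  have "le x y" "\<not> iso_obj G x y"
    using l w obj_class_eq_iff[OF linG] by (auto simp: weight_le_def weight_less_def le_def)
  then show ?thesis using lc_less w by simp
qed

text \<open>Take \<open>\<nu>\<close> of least rank among the weights with non-zero coefficient. By
  unitriangularity the relation evaluated at \<open>\<nu>\<close> reduces to
  \<open>a \<nu> = 0\<close>.\<close>

lemma standard_characters_independent:
  fixes a :: "('o, 'm, 'k) weight \<Rightarrow> rat"
  assumes W: "finite W" "W \<subseteq> \<Lambda>" and z: "\<And>\<nu>. \<nu> \<in> \<Lambda> \<Longrightarrow> (\<Sum>\<mu>\<in>W. a \<mu> * of_nat (wdim \<nu> (\<Delta> \<mu>))) = 0"
    and w: "\<omega> \<in> W"
  shows "a \<omega> = 0"
proof (rule ccontr)
  assume n: "a \<omega> \<noteq> 0"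
  define \<nu> where "\<nu> = (ARG_MIN (\<lambda>\<mu>. lc (wsupp \<mu>)) \<mu>. \<mu> \<in> W \<and> a \<mu> \<noteq> 0)"
  have ex: "\<omega> \<in> W \<and> a \<omega> \<noteq> 0" using n w by simp
  have \<nu>: "\<nu> \<in> W \<and> a \<nu> \<noteq> 0"
    unfolding \<nu>_def by (rule arg_min_natI[of "\<lambda>\<mu>. \<mu> \<in> W \<and> a \<mu> \<noteq> 0", OF ex])
  have min: "lc (wsupp \<nu>) \<le> lc (wsupp \<mu>)" if "\<mu> \<in> W" "a \<mu> \<noteq> 0" for \<mu>
    unfolding \<nu>_def by (rule arg_min_nat_le[of "\<lambda>\<mu>. \<mu> \<in> W \<and> a \<mu> \<noteq> 0"]) (use that in simp)
  have \<nu>\<Lambda>: "\<nu> \<in> \<Lambda>" using \<nu> W by blast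
  have t: "a \<mu> * of_nat (wdim \<nu> (\<Delta> \<mu>)) = 0" if \<mu>: "\<mu> \<in> W - {\<nu>}" for \<mu>
  proof (rule ccontr)
    assume "a \<mu> * of_nat (wdim \<nu> (\<Delta> \<mu>)) \<noteq> 0"
    then have "a \<mu> \<noteq> 0" "wdim \<nu> (\<Delta> \<mu>) \<noteq> 0" by auto
    then show False using weight_less_lc[of \<mu> \<nu>] wdim_\<Delta>_le[of \<mu> \<nu>] min[of \<mu>] \<mu> W(2) \<nu>\<Lambda> by force
  qed
  have "(\<Sum>\<mu>\<in>W - {\<nu>}. a \<mu> * of_nat (wdim \<nu> (\<Delta> \<mu>))) = 0" by (rule sum.neutral) (use t in blast)
  then have "(\<Sum>\<mu>\<in>W. a \<mu> * of_nat (wdim \<nu> (\<Delta> \<mu>))) = a \<nu> * of_nat (wdim \<nu> (\<Delta> \<nu>))"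
    using sum.remove[OF W(1), of \<nu> "\<lambda>\<mu>. a \<mu> * of_nat (wdim \<nu> (\<Delta> \<mu>))"] \<nu> by simp
  then show False using z[OF \<nu>\<Lambda>] \<nu> wdim_\<Delta>_self[OF \<nu>\<Lambda>] by simp
qed

text \<open>Two filtrations compute the same character, so the difference of the counts is a linear
  relation between standard characters. This makes the description in \<open>standard_mult\<close>
  definite.\<close>

lemma filtration_count_unique:
  fixes M :: "('o, 'm, 'k, 'v::ab_group_add) cmod"
  assumes M: "cat_module G M" and fd: "pointwise_finite M"
    and F: "standard_filtration G U D S M n F \<mu>" and F': "standard_filtration G U D S M n' F' \<mu>'"
  shows "card {i. i < n \<and> \<mu> i = \<nu>} = card {i. i < n' \<and> \<mu>' i = \<nu>}"
proof -
  let ?W = "\<mu> ` {..<n} \<union> \<mu>' ` {..<n'}"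
  have W: "finite ?W" "?W \<subseteq> \<Lambda>" using F F' by (auto simp: standard_filtration_def)
  let ?c = "\<lambda>\<omega>. of_nat (card {i. i < n \<and> \<mu> i = \<omega>}) :: rat" and ?c' = "\<lambda>\<omega>. of_nat (card {i. i < n' \<and> \<mu>' i = \<omega>}) :: rat"
  have z: "(\<Sum>\<omega>\<in>?W. (?c \<omega> - ?c' \<omega>) * of_nat (wdim \<xi> (\<Delta> \<omega>))) = 0" if \<xi>: "\<xi> \<in> \<Lambda>" for \<xi>
  proof -
    have "(\<Sum>i<n. wdim \<xi> (\<Delta> (\<mu> i))) = (\<Sum>i<n'. wdim \<xi> (\<Delta> (\<mu>' i)))"
      using wdim_filtration[OF \<xi> M fd F] wdim_filtration[OF \<xi> M fd F'] by simp
    then have "(\<Sum>i<n. of_nat (wdim \<xi> (\<Delta> (\<mu> i))) :: rat) = (\<Sum>i<n'. of_nat (wdim \<xi> (\<Delta> (\<mu>' i))))"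
      by (metis of_nat_sum)
    moreover have "(\<Sum>i<n. of_nat (wdim \<xi> (\<Delta> (\<mu> i))) :: rat) = (\<Sum>\<omega>\<in>?W. ?c \<omega> * of_nat (wdim \<xi> (\<Delta> \<omega>)))"
      by (rule sum_fibres[OF W(1)]) blast
    moreover have "(\<Sum>i<n'. of_nat (wdim \<xi> (\<Delta> (\<mu>' i))) :: rat) = (\<Sum>\<omega>\<in>?W. ?c' \<omega> * of_nat (wdim \<xi> (\<Delta> \<omega>)))"
      by (rule sum_fibres[OF W(1)]) blast
    ultimately show ?thesis by (simp add: left_diff_distrib sum_subtractf)
  qed
  show ?thesis
  proof (cases "\<nu> \<in> ?W")
    case True
    have "?c \<nu> - ?c' \<nu> = 0" by (rule standard_characters_independent[OF W z True])
    then show ?thesis by simp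
  next
    case False
    then have e: "{i. i < n \<and> \<mu> i = \<nu>} = {}" "{i. i < n' \<and> \<mu>' i = \<nu>} = {}" by auto
    show ?thesis unfolding e ..
  qed
qed

lemma standard_mult_eq:
  fixes M :: "('o, 'm, 'k, 'v::ab_group_add) cmod"
  assumes M: "cat_module G M" and fd: "pointwise_finite M"
    and F: "standard_filtration G U D S M n F \<mu>"
  shows "standard_mult G U D S M \<nu> = card {i. i < n \<and> \<mu> i = \<nu>}"
  unfolding standard_mult_def
proof (rule the_equality)
  show "\<exists>n' F' \<mu>'. standard_filtration G U D S M n' F' \<mu>' \<and>
      card {i. i < n \<and> \<mu> i = \<nu>} = card {i. i < n' \<and> \<mu>' i = \<nu>}" using F by blast
  show "k = card {i. i < n \<and> \<mu> i = \<nu>}"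
    if k: "\<exists>n' F' \<mu>'. standard_filtration G U D S M n' F' \<mu>' \<and> k = card {i. i < n' \<and> \<mu>' i = \<nu>}" for k
  proof -
    obtain n' F' \<mu>' where *: "standard_filtration G U D S M n' F' \<mu>'" "k = card {i. i < n' \<and> \<mu>' i = \<nu>}" using k by blast
    show ?thesis using filtration_count_unique[OF M fd F *(1), of \<nu>] *(2) by simp
  qed
qed

end

section \<open>Indecomposable projective modules\<close>

text \<open>Numbers a basis by an initial segment of the naturals, to match the index set of the
  direct sum that decomposes \<open>Pt \<kappa>\<close>.\<close>

lemma indexed_basis:
  assumes s: "vector_space s" and V: "module.subspace s V" "fin_dim s V"
  shows "\<exists>b :: nat \<Rightarrow> _. (\<forall>i<vector_space.dim s V. b i \<in> V) \<and>
    (\<forall>v\<in>V. \<exists>c. v = (\<Sum>i<vector_space.dim s V. s (c i) (b i))) \<and>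
    (\<forall>c. (\<Sum>i<vector_space.dim s V. s (c i) (b i)) = 0 \<longrightarrow> (\<forall>i<vector_space.dim s V. c i = 0))"
proof -
  interpret s: vector_space s by (rule s)
  obtain B where B: "finite B" "B \<subseteq> V" "s.independent B" "V \<subseteq> s.span B" "card B = s.dim V"
    by (rule fin_dim_basis[OF s V(2)])
  obtain b where b: "bij_betw b {0..<card B} B" using ex_bij_betw_nat_finite[OF B(1)] by blast
  let ?n = "s.dim V"
  have b': "bij_betw b {..<?n} B" using b B(5) by (simp add: atLeast0LessThan)
  have re: "(\<Sum>i<?n. s (u (b i)) (b i)) = (\<Sum>v\<in>B. s (u v) v)" for u
    by (rule sum.reindex_bij_betw[OF b'])
  have "\<exists>c. v = (\<Sum>i<?n. s (c i) (b i))" if v: "v \<in> V" for v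
  proof -
    have "v \<in> range (\<lambda>u. \<Sum>v\<in>B. s (u v) v)" using v B(4) s.span_finite[OF B(1)] by blast
    then obtain u where "v = (\<Sum>v\<in>B. s (u v) v)" by blast
    then show ?thesis using re[of u] by (intro exI[of _ "\<lambda>i. u (b i)"]) simp
  qed
  moreover have "c i = 0" if c: "(\<Sum>i<?n. s (c i) (b i)) = 0" and i: "i < ?n" for c i
  proof -
    define u where "u v = c (inv_into {..<?n} b v)" for v
    have ub: "u (b i) = c i" if "i < ?n" for i
      using that b' by (simp add: u_def bij_betw_def inv_into_f_f)
    have "(\<Sum>v\<in>B. s (u v) v) = (\<Sum>i<?n. s (c i) (b i))"
      unfolding re[symmetric] by (rule sum.cong) (use ub in auto)
    then have "(\<Sum>v\<in>B. s (u v) v) = 0" using c by simp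
    moreover have "b i \<in> B" using b' i by (auto simp: bij_betw_def)
    ultimately have "u (b i) = 0" using s.independentD[OF B(3) B(1) subset_refl] by blast
    then show ?thesis using ub[OF i] by simp
  qed
  moreover have "b i \<in> V" if "i < ?n" for i using b' B(2) that by (auto simp: bij_betw_def)
  ultimately show ?thesis by blast
qed

lemma split_internal_sum:
  assumes M: "cat_module C M" and Q: "cat_module C Q" and f: "mod_hom C M Q f" and \<sigma>: "mod_hom C Q M \<sigma>"
    and e: "\<And>x v. v \<in> mob Q x \<Longrightarrow> f x (\<sigma> x v) = v"
  shows "internal_sum C M (\<lambda>x. \<sigma> x ` mob Q x) (\<lambda>x. {v \<in> mob M x. f x v = 0})"
  unfolding internal_sum_def
proof (intro conjI allI)
  interpret M: cat_module C M by (rule M)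
  show "submod C M (\<lambda>x. \<sigma> x ` mob Q x)" by (rule submod_image[OF Q M \<sigma> submod_mob[OF Q]])
  show "submod C M (\<lambda>x. {v \<in> mob M x. f x v = 0})" by (rule submod_kernel[OF M Q f])
  fix x
  have \<sigma>c: "\<sigma> x v \<in> mob M x" if "v \<in> mob Q x" for v by (rule mod_hom_closed[OF Q M \<sigma> that])
  have z: "\<sigma> x 0 = 0" "f x 0 = 0" using mod_hom_0[OF Q M \<sigma>] mod_hom_0[OF M Q f] by auto
  show "\<sigma> x ` mob Q x \<inter> {v \<in> mob M x. f x v = 0} = {0}"
  proof
    show "\<sigma> x ` mob Q x \<inter> {v \<in> mob M x. f x v = 0} \<subseteq> {0}" using e z by auto
    have "0 \<in> \<sigma> x ` mob Q x" using cat_module.mob_0[OF Q, of x] z(1) by (metis imageI)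
    then show "{0} \<subseteq> \<sigma> x ` mob Q x \<inter> {v \<in> mob M x. f x v = 0}" using z M.mob_0 by simp
  qed
  show "{a + b | a b. a \<in> \<sigma> x ` mob Q x \<and> b \<in> {v \<in> mob M x. f x v = 0}} = mob M x"
  proof
    show "{a + b | a b. a \<in> \<sigma> x ` mob Q x \<and> b \<in> {v \<in> mob M x. f x v = 0}} \<subseteq> mob M x"
      using \<sigma>c M.mob_add by auto
    show "mob M x \<subseteq> {a + b | a b. a \<in> \<sigma> x ` mob Q x \<and> b \<in> {v \<in> mob M x. f x v = 0}}"
    proof
      fix v assume v: "v \<in> mob M x"
      have fv: "f x v \<in> mob Q x" by (rule mod_hom_closed[OF M Q f v])
      have "f x (v - \<sigma> x (f x v)) = 0" using mod_hom_diff[OF M Q f v \<sigma>c[OF fv]] e[OF fv] by simp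
      then have "v - \<sigma> x (f x v) \<in> {v \<in> mob M x. f x v = 0}" using M.mob_diff[OF v \<sigma>c[OF fv]] by simp
      moreover have "v = \<sigma> x (f x v) + (v - \<sigma> x (f x v))" by simp
      ultimately show "v \<in> {a + b | a b. a \<in> \<sigma> x ` mob Q x \<and> b \<in> {v \<in> mob M x. f x v = 0}}" using fv by blast
    qed
  qed
qed

lemma fin_genE:
  assumes "fin_gen C M"
  shows "\<exists>X. finite X \<and> (\<forall>p\<in>X. snd p \<in> mob M (fst p)) \<and>
    (\<forall>N. submod C M N \<and> (\<forall>p\<in>X. snd p \<in> N (fst p)) \<longrightarrow> N = mob M)"
  using assms by (simp only: fin_gen_def case_prod_unfold)

lemma fin_genI:
  assumes "finite X" "\<And>p. p \<in> X \<Longrightarrow> snd p \<in> mob M (fst p)"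
    and "\<And>N. submod C M N \<Longrightarrow> (\<And>p. p \<in> X \<Longrightarrow> snd p \<in> N (fst p)) \<Longrightarrow> N = mob M"
  shows "fin_gen C M"
  unfolding fin_gen_def case_prod_unfold
proof (intro exI conjI allI impI ballI)
  show "finite X" by (rule assms(1))
  show "p \<in> X \<Longrightarrow> snd p \<in> mob M (fst p)" for p by (rule assms(2))
  show "N = mob M" if "submod C M N \<and> (\<forall>p\<in>X. snd p \<in> N (fst p))" for N
    by (rule assms(3)) (use that in auto)
qed

lemma fin_gen_dir_sum:
  fixes N :: "'i \<Rightarrow> ('o, 'm::ab_group_add, 'k::field, 'v::ab_group_add) cmod"
  assumes ex: "\<exists>s :: 'k \<Rightarrow> 'v \<Rightarrow> 'v. vector_space s" and N: "\<And>i. i \<in> I \<Longrightarrow> cat_module C (N i)"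
    and fin: "finite I" and fg: "\<And>i. i \<in> I \<Longrightarrow> fin_gen C (N i)"
  shows "fin_gen C (dir_sum I N)"
proof -
  have S: "cat_module C (dir_sum I N)" by (rule cat_module_dir_sum[OF ex N])
  let ?Q = "\<lambda>i X. finite X \<and> (\<forall>p\<in>X. snd p \<in> mob (N i) (fst p)) \<and>
    (\<forall>A. submod C (N i) A \<and> (\<forall>p\<in>X. snd p \<in> A (fst p)) \<longrightarrow> A = mob (N i))"
  define X where "X i = (SOME X. ?Q i X)" for i
  have XQ: "?Q i (X i)" if i: "i \<in> I" for i
    unfolding X_def by (rule someI_ex[where P = "?Q i"]) (rule fin_genE[OF fg[OF i]])
  have X: "finite (X i)" "p \<in> X i \<Longrightarrow> snd p \<in> mob (N i) (fst p)"
    "submod C (N i) A \<Longrightarrow> \<forall>p\<in>X i. snd p \<in> A (fst p) \<Longrightarrow> A = mob (N i)" if i: "i \<in> I" for i p A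
    using XQ[OF i] by auto
  have inj: "mod_hom C (N i) (dir_sum I N) (\<lambda>x. sgl i)" if "i \<in> I" for i
    by (rule dir_sum_inj[OF ex N]) (use that in auto)
  show ?thesis
  proof (rule fin_genI)
    let ?Y = "\<Union>i\<in>I. (\<lambda>p. (fst p, sgl i (snd p))) ` X i"
    show "finite ?Y" using fin X(1) by blast
    show "snd p \<in> mob (dir_sum I N) (fst p)" if p: "p \<in> ?Y" for p
    proof -
      obtain i q where "i \<in> I" "q \<in> X i" "p = (fst q, sgl i (snd q))" using p by blast
      then show ?thesis using mod_hom_closed[OF N S inj X(2)] by auto
    qed
    fix A assume A: "submod C (dir_sum I N) A" and Y: "\<And>p. p \<in> ?Y \<Longrightarrow> snd p \<in> A (fst p)"
    have sg: "sgl i v \<in> A x" if i: "i \<in> I" and v: "v \<in> mob (N i) x" for i v x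
    proof -
      have "(\<lambda>x. {v \<in> mob (N i) x. sgl i v \<in> A x}) = mob (N i)"
      proof (rule X(3)[OF i submod_preimage[OF N[OF i] S inj[OF i] A]], rule ballI)
        fix p assume p: "p \<in> X i"
        have "(fst p, sgl i (snd p)) \<in> ?Y" using i p by blast
        from Y[OF this] show "snd p \<in> {v \<in> mob (N i) (fst p). sgl i v \<in> A (fst p)}" using X(2)[OF i p] by simp
      qed
      then have "{v \<in> mob (N i) x. sgl i v \<in> A x} = mob (N i) x" by (rule fun_cong)
      then show ?thesis using v by blast
    qed
    have "h \<in> A x" if h: "h \<in> mob (dir_sum I N) x" for h x
    proof -
      have "sgl i (h i) \<in> A x" if "i \<in> {i. h i \<noteq> 0}" for i
        using that h sg[of i "h i" x] by (auto simp: dir_sum_sel)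
      then have "(\<Sum>i | h i \<noteq> 0. sgl i (h i)) \<in> A x" by (rule submod_sum[OF S A])
      moreover have "h = (\<Sum>i | h i \<noteq> 0. sgl i (h i))" by (rule dir_sum_decompose[OF ex N h])
      ultimately show ?thesis by simp
    qed
    then show "A = mob (dir_sum I N)" using submod_le[OF S A] by (intro ext) blast
  qed
qed

lemma quotient_of_dir_sum:
  fixes N :: "'i \<Rightarrow> ('o, 'm::ab_group_add, 'k::field, 'v::ab_group_add) cmod"
    and M :: "('o, 'm, 'k, 'w::ab_group_add) cmod"
  assumes ex: "\<exists>s :: 'k \<Rightarrow> 'v \<Rightarrow> 'v. vector_space s" and N: "\<And>i. i \<in> I \<Longrightarrow> cat_module C (N i)"
    and M: "cat_module C M" and \<phi>: "\<And>i. i \<in> I \<Longrightarrow> mod_hom C (N i) M (\<phi> i)"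
    and gen: "\<And>A. submod C M A \<Longrightarrow> (\<And>i x v. i \<in> I \<Longrightarrow> v \<in> mob (N i) x \<Longrightarrow> \<phi> i x v \<in> A x) \<Longrightarrow> A = mob M"
  shows "is_quotient_of C (dir_sum I N) M"
proof -
  have S: "cat_module C (dir_sum I N)" by (rule cat_module_dir_sum[OF ex N])
  have inj: "mod_hom C (N i) (dir_sum I N) (\<lambda>x. sgl i)" if "i \<in> I" for i
    by (rule dir_sum_inj[OF ex N]) (use that in auto)
  have "\<exists>\<psi>. mod_hom C (dir_sum I N) M \<psi> \<and> (\<forall>i\<in>I. \<forall>x. \<forall>v\<in>mob (N i) x. \<psi> x (sgl i v) = \<phi> i x v)"
    by (rule dir_sum_out[OF ex N M \<phi>])
  then obtain \<psi> where \<psi>: "mod_hom C (dir_sum I N) M \<psi>" "\<forall>i\<in>I. \<forall>x. \<forall>v\<in>mob (N i) x. \<psi> x (sgl i v) = \<phi> i x v"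
    by blast
  have "(\<lambda>x. \<psi> x ` mob (dir_sum I N) x) = mob M"
  proof (rule gen[OF submod_image[OF S M \<psi>(1) submod_mob[OF S]]])
    fix i x v assume i: "i \<in> I" and v: "v \<in> mob (N i) x"
    have "sgl i v \<in> mob (dir_sum I N) x"
      by (rule mod_hom_closed[OF N[OF i] S inj[OF i] v])
    moreover have "\<phi> i x v = \<psi> x (sgl i v)" using \<psi>(2) i v by simp
    ultimately show "\<phi> i x v \<in> \<psi> x ` mob (dir_sum I N) x" by blast
  qed
  then have "\<psi> x ` mob (dir_sum I N) x = mob M x" for x by (rule fun_cong)
  then show ?thesis using \<psi>(1) by (auto simp: is_quotient_of_def surj_hom_def)
qed

section \<open>The modules \<open>P \<mu>\<close> and \<open>L \<mu>\<close>\<close>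

locale tri_proj = tri G U D r S
  for G :: "('o, 'm::ab_group_add, 'k::alg_closed_field) lincat" and U D :: "'o \<Rightarrow> 'o \<Rightarrow> 'm set"
    and r :: "('o set \<times> 'o set) set" and S :: "('o, 'm, 'k) weight \<Rightarrow> ('o, 'm, 'k, 'm) cmod" +
  fixes L :: "('o, 'm, 'k) weight \<Rightarrow> ('o, 'm, 'k, 'l::ab_group_add) cmod"
    and P :: "('o, 'm, 'k) weight \<Rightarrow> ('o, 'm, 'k, 'p::ab_group_add) cmod"
  assumes L_of: "\<mu> \<in> \<Lambda> \<Longrightarrow> is_simple_of_weight G U D S \<mu> (L \<mu>)"
    and P_of: "\<mu> \<in> \<Lambda> \<Longrightarrow> is_projective_of_weight G U D S \<mu> (P \<mu>)"
begin

lemma P_indec: "\<mu> \<in> \<Lambda> \<Longrightarrow> indecomposable G (P \<mu>)"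
  using P_of by (simp add: is_projective_of_weight_def)

lemma P_cat: "\<mu> \<in> \<Lambda> \<Longrightarrow> cat_module G (P \<mu>)"
  using P_indec by (simp add: indecomposable_def)

lemma P_nonzero: "\<mu> \<in> \<Lambda> \<Longrightarrow> mob (P \<mu>) \<noteq> zero_sub"
  using P_indec by (simp add: indecomposable_def)

lemma P_retract: "\<mu> \<in> \<Lambda> \<Longrightarrow>
    \<exists>i p. mod_hom G (P \<mu>) (Pt \<mu>) i \<and> mod_hom G (Pt \<mu>) (P \<mu>) p \<and> (\<forall>x. \<forall>v\<in>mob (P \<mu>) x. p x (i x v) = v)"
  using summand_retract[OF Pt_cat P_cat] P_of unfolding is_projective_of_weight_def Pt_def by blast

lemma P_surj_Pt: assumes \<mu>: "\<mu> \<in> \<Lambda>" shows "\<exists>p. surj_hom G (Pt \<mu>) (P \<mu>) p"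
proof -
  obtain i p where "mod_hom G (P \<mu>) (Pt \<mu>) i" "mod_hom G (Pt \<mu>) (P \<mu>) p" "\<forall>x. \<forall>v\<in>mob (P \<mu>) x. p x (i x v) = v"
    using P_retract[OF \<mu>] by blast
  then show ?thesis using retract_surj[OF P_cat[OF \<mu>] Pt_cat] by blast
qed

lemma P_fin: assumes \<mu>: "\<mu> \<in> \<Lambda>" shows "pointwise_finite (P \<mu>)" "fin_gen G (P \<mu>)"
  using P_surj_Pt[OF \<mu>] pointwise_finite_quotient[OF Pt_cat P_cat[OF \<mu>] Pt_fin(1)[OF \<mu>]]
    fin_gen_quotient[OF Pt_cat P_cat[OF \<mu>] Pt_fin(2)[OF \<mu>]] by blast+

lemma P_lift:
  fixes A :: "('o, 'm, 'k, 'v::ab_group_add) cmod" and B :: "('o, 'm, 'k, 'w::ab_group_add) cmod"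
  assumes \<mu>: "\<mu> \<in> \<Lambda>" and A: "cat_module G A" and B: "cat_module G B"
  shows "lift_prop G (P \<mu>) A B"
  using P_retract[OF \<mu>] lift_prop_retract[OF Pt_lift[OF \<mu> A B]] by blast

lemma P_u_lift: assumes \<mu>: "\<mu> \<in> \<Lambda>" shows "u_lift (P \<mu>)"
proof -
  obtain i p where i: "mod_hom G (P \<mu>) (Pt \<mu>) i" "mod_hom G (Pt \<mu>) (P \<mu>) p" "\<forall>x. \<forall>v\<in>mob (P \<mu>) x. p x (i x v) = v"
    using P_retract[OF \<mu>] by blast
  show ?thesis
    by (rule u_lift_retract[OF Pt_u_lift[OF \<mu>] hom_G_to_U[OF i(1)] hom_G_to_U[OF i(2)]]) (use i(3) in blast)
qed

text \<open>By definition \<open>\<Delta> \<mu>\<close> occurs once in \<open>P \<mu>\<close>, so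
  the last clause of \<open>quotient_filtration\<close> applies and yields the surjection onto
  it.\<close>

lemma P_filtration:
  assumes \<mu>: "\<mu> \<in> \<Lambda>"
  shows "\<exists>n F \<omega>. standard_filtration G U D S (P \<mu>) n F \<omega> \<and> (\<forall>i<n. \<omega> i \<in> \<Lambda> \<and> weight_le r (\<omega> i) \<mu>) \<and>
    card {i. i < n \<and> \<omega> i = \<mu>} = 1"
    and "\<exists>\<delta>. surj_hom G (P \<mu>) (\<Delta> \<mu>) \<delta>"
proof -
  obtain Y where Y: "finite Y" "\<And>\<nu>. \<nu> \<in> \<Lambda> \<Longrightarrow> weight_le r \<nu> \<mu> \<Longrightarrow> \<exists>y\<in>Y. y \<in> wsupp \<nu>"
    using lower_reps[OF \<mu>] by blast
  obtain p where p: "surj_hom G (Pt \<mu>) (P \<mu>) p" using P_surj_Pt[OF \<mu>] by blast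
  obtain n F \<omega> where F: "standard_filtration G U D S (P \<mu>) n F \<omega>" "\<forall>i<n. weight_le r (\<omega> i) \<mu>"
    "(\<exists>i<n. \<omega> i = \<mu>) \<longrightarrow> (\<exists>\<pi>. surj_hom G (P \<mu>) (\<Delta> \<mu>) \<pi>)"
    using quotient_filtration[OF \<mu> Y P_cat[OF \<mu>] p P_u_lift[OF \<mu>]] by blast
  have c: "card {i. i < n \<and> \<omega> i = \<mu>} = 1"
    using standard_mult_eq[OF P_cat[OF \<mu>] P_fin(1)[OF \<mu>] F(1), of \<mu>] P_of[OF \<mu>]
    by (simp add: is_projective_of_weight_def)
  have "{i. i < n \<and> \<omega> i = \<mu>} \<noteq> {}"
  proof
    assume "{i. i < n \<and> \<omega> i = \<mu>} = {}"
    then have "card {i. i < n \<and> \<omega> i = \<mu>} = 0" by (simp only: card.empty)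
    then show False using c by simp
  qed
  then show "\<exists>\<delta>. surj_hom G (P \<mu>) (\<Delta> \<mu>) \<delta>" using F(3) by blast
  have "\<forall>i<n. \<omega> i \<in> \<Lambda>" using F(1) by (simp add: standard_filtration_def)
  then show "\<exists>n F \<omega>. standard_filtration G U D S (P \<mu>) n F \<omega> \<and> (\<forall>i<n. \<omega> i \<in> \<Lambda> \<and> weight_le r (\<omega> i) \<mu>) \<and>
      card {i. i < n \<and> \<omega> i = \<mu>} = 1" using F(1,2) c by blast
qed

lemma L_simple: "\<mu> \<in> \<Lambda> \<Longrightarrow> simple_mod G (L \<mu>)"
  using L_of by (simp add: is_simple_of_weight_def)

lemmas L_cat = simple_cat_module[OF L_simple]

lemma L_surj: "\<mu> \<in> \<Lambda> \<Longrightarrow> \<exists>l. surj_hom G (\<Delta> \<mu>) (L \<mu>) l"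
  using L_of by (simp add: is_simple_of_weight_def is_quotient_of_def \<Delta>_def)

lemma L_fin: "\<mu> \<in> \<Lambda> \<Longrightarrow> pointwise_finite (L \<mu>)"
  using L_surj pointwise_finite_quotient[OF \<Delta>_cat L_cat \<Delta>_fin] by blast

definition \<pi> where "\<pi> \<mu> = (SOME \<pi>. surj_hom G (P \<mu>) (L \<mu>) \<pi>)"

lemma \<pi>_surj: assumes \<mu>: "\<mu> \<in> \<Lambda>" shows "surj_hom G (P \<mu>) (L \<mu>) (\<pi> \<mu>)"
proof -
  have "\<exists>\<pi>. surj_hom G (P \<mu>) (L \<mu>) \<pi>" using surj_hom_comp P_filtration(2)[OF \<mu>] L_surj[OF \<mu>] by blast
  then show ?thesis unfolding \<pi>_def by (rule someI_ex)
qed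

lemma \<pi>_hom: "\<mu> \<in> \<Lambda> \<Longrightarrow> mod_hom G (P \<mu>) (L \<mu>) (\<pi> \<mu>)" using \<pi>_surj by (simp add: surj_hom_def)

lemma surj_nonzero:
  assumes L: "simple_mod C L'" and s: "surj_hom C M L' p"
  shows "\<exists>x. \<exists>v\<in>mob M x. p x v \<noteq> 0"
proof -
  obtain x l where l: "l \<in> mob L' x" "l \<noteq> 0" using simple_nonzero[OF L] mob_nonzero_iff[OF simple_cat_module[OF L]] by blast
  have "l \<in> p x ` mob M x" using s l(1) by (simp add: surj_hom_def)
  then show ?thesis using l(2) by blast
qed

lemma cover_simple:
  fixes T :: "('o, 'm, 'k, 'v::ab_group_add) cmod"
  assumes \<mu>: "\<mu> \<in> \<Lambda>" and T: "simple_mod G T" and p: "surj_hom G (P \<mu>) T p"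
    and N: "submod G (P \<mu>) N" "N \<noteq> mob (P \<mu>)" "v \<in> N x"
  shows "p x v = 0"
  by (rule indecomposable_cover[OF P_indec[OF \<mu>] P_fin(1)[OF \<mu>] T p P_lift[OF \<mu> cat_module_restr[OF P_cat[OF \<mu>]] simple_cat_module[OF T]] N])

text \<open>The kernel of \<open>\<chi>\<close> is a proper submodule, so the cover
  \<open>\<pi> \<mu>\<close> vanishes on it and factors through \<open>T\<close>.\<close>

lemma cover_factor:
  fixes T :: "('o, 'm, 'k, 'v::ab_group_add) cmod"
  assumes \<mu>: "\<mu> \<in> \<Lambda>" and T: "simple_mod G T" and \<chi>: "mod_hom G (P \<mu>) T \<chi>" and nz: "v \<in> mob (P \<mu>) x" "\<chi> x v \<noteq> 0"
  shows "\<exists>\<theta>. surj_hom G T (L \<mu>) \<theta> \<and> (\<forall>x. \<forall>v\<in>mob (P \<mu>) x. \<theta> x (\<chi> x v) = \<pi> \<mu> x v)"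
proof -
  note Pc = P_cat[OF \<mu>] and Tc = simple_cat_module[OF T]
  have \<chi>s: "surj_hom G (P \<mu>) T \<chi>" by (rule simple_hom_surj[OF T Pc \<chi> nz])
  have "(\<lambda>x. {v \<in> mob (P \<mu>) x. \<chi> x v = 0}) \<noteq> mob (P \<mu>)"
    using nz by (metis (mono_tags, lifting) mem_Collect_eq)
  note c = cover_simple[OF \<mu> L_simple[OF \<mu>] \<pi>_surj[OF \<mu>] submod_kernel[OF Pc Tc \<chi>] this]
  obtain \<theta> where \<theta>: "mod_hom G T (L \<mu>) \<theta>" "\<forall>x. \<forall>v\<in>mob (P \<mu>) x. \<theta> x (\<chi> x v) = \<pi> \<mu> x v"
    using hom_factor[OF Pc Tc L_cat[OF \<mu>] \<chi>s \<pi>_hom[OF \<mu>]] c by blast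
  obtain y u where u: "u \<in> mob (P \<mu>) y" "\<pi> \<mu> y u \<noteq> 0" using surj_nonzero[OF L_simple[OF \<mu>] \<pi>_surj[OF \<mu>]] by blast
  have "surj_hom G T (L \<mu>) \<theta>"
    by (rule simple_hom_surj[OF L_simple[OF \<mu>] Tc \<theta>(1) mod_hom_closed[OF Pc Tc \<chi> u(1)]]) (use \<theta>(2) u in simp)
  then show ?thesis using \<theta>(2) by blast
qed

text \<open>A non-zero \<open>\<chi>\<close> satisfies
  \<open>\<theta> \<circ> \<chi> = \<pi> \<mu>\<close> for an endomorphism \<open>\<theta>\<close>
  of \<open>L \<mu>\<close>. This \<open>\<theta>\<close> is a scalar by Schur's lemma, and
  invertible since \<open>\<pi> \<mu>\<close> is not zero.\<close>

lemma hom_P_L_scalar: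
  assumes \<mu>: "\<mu> \<in> \<Lambda>" and \<chi>: "mod_hom G (P \<mu>) (L \<mu>) \<chi>"
  shows "\<exists>c. \<forall>x. \<forall>v\<in>mob (P \<mu>) x. \<chi> x v = mscale (L \<mu>) c (\<pi> \<mu> x v)"
proof (cases "\<exists>x. \<exists>v\<in>mob (P \<mu>) x. \<chi> x v \<noteq> 0")
  case False
  interpret L: cat_module G "L \<mu>" by (rule L_cat[OF \<mu>])
  show ?thesis using False by (intro exI[of _ 0]) simp
next
  case True
  interpret L: cat_module G "L \<mu>" by (rule L_cat[OF \<mu>])
  obtain x v where nz: "v \<in> mob (P \<mu>) x" "\<chi> x v \<noteq> 0" using True by blast
  obtain \<theta> where \<theta>: "surj_hom G (L \<mu>) (L \<mu>) \<theta>" "\<forall>x. \<forall>v\<in>mob (P \<mu>) x. \<theta> x (\<chi> x v) = \<pi> \<mu> x v"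
    using cover_factor[OF \<mu> L_simple[OF \<mu>] \<chi> nz] by blast
  obtain c where c: "\<forall>x. \<forall>v\<in>mob (L \<mu>) x. \<theta> x v = mscale (L \<mu>) c v"
    using simple_endo_scalar[OF L_simple[OF \<mu>] L_fin[OF \<mu>] surj_hom_def[THEN iffD1, OF \<theta>(1), THEN conjunct1]] by blast
  obtain y u where u: "u \<in> mob (P \<mu>) y" "\<pi> \<mu> y u \<noteq> 0" using surj_nonzero[OF L_simple[OF \<mu>] \<pi>_surj[OF \<mu>]] by blast
  have e: "mscale (L \<mu>) c (\<chi> x v) = \<pi> \<mu> x v" if "v \<in> mob (P \<mu>) x" for x v
    using \<theta>(2)[rule_format, OF that] c[rule_format, OF mod_hom_closed[OF P_cat[OF \<mu>] L_cat[OF \<mu>] \<chi> that]] by simp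
  have "c \<noteq> 0" using e[OF u(1)] u(2) by auto
  then have "\<chi> x v = mscale (L \<mu>) (inverse c) (\<pi> \<mu> x v)" if "v \<in> mob (P \<mu>) x" for x v
    using e[OF that, symmetric] by simp
  then show ?thesis by blast
qed

definition \<gamma> where "\<gamma> \<mu> = (SOME l. surj_hom G (\<Delta> \<mu>) (L \<mu>) l)"

lemma \<gamma>_surj: "\<mu> \<in> \<Lambda> \<Longrightarrow> surj_hom G (\<Delta> \<mu>) (L \<mu>) (\<gamma> \<mu>)"
  unfolding \<gamma>_def using L_surj by (rule someI_ex)

lemma \<gamma>_hom: "\<mu> \<in> \<Lambda> \<Longrightarrow> mod_hom G (\<Delta> \<mu>) (L \<mu>) (\<gamma> \<mu>)" using \<gamma>_surj by (simp add: surj_hom_def)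

lemma \<gamma>\<eta>_hom: "\<mu> \<in> \<Lambda> \<Longrightarrow> mod_hom K (S \<mu>) (L \<mu>) (\<lambda>x s. \<gamma> \<mu> x (\<eta> \<mu> x s))"
  by (rule mod_hom_comp[OF \<eta>_K hom_G_to_K[OF \<gamma>_hom]])

lemma \<gamma>\<eta>_nonzero: assumes \<mu>: "\<mu> \<in> \<Lambda>" shows "\<exists>x. \<exists>s\<in>mob (S \<mu>) x. \<gamma> \<mu> x (\<eta> \<mu> x s) \<noteq> 0"
proof (rule ccontr)
  assume n: "\<not> ?thesis"
  have "(\<lambda>x. {v \<in> mob (\<Delta> \<mu>) x. \<gamma> \<mu> x v = 0}) = mob (\<Delta> \<mu>)"
  proof (rule \<Delta>_gen[OF submod_kernel[OF \<Delta>_cat L_cat[OF \<mu>] \<gamma>_hom[OF \<mu>]]])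
    fix y s assume s: "s \<in> mob (S \<mu>) y"
    show "\<eta> \<mu> y s \<in> {v \<in> mob (\<Delta> \<mu>) y. \<gamma> \<mu> y v = 0}"
      using n s mod_hom_closed[OF S_cat[OF \<mu>] G_to_K[OF \<Delta>_cat] \<eta>_K[OF \<mu>] s] by blast
  qed
  then have "{v \<in> mob (\<Delta> \<mu>) x. \<gamma> \<mu> x v = 0} = mob (\<Delta> \<mu>) x" for x by (rule fun_cong)
  then show False using surj_nonzero[OF L_simple[OF \<mu>] \<gamma>_surj[OF \<mu>]] by blast
qed

lemma L_support:
  assumes \<mu>: "\<mu> \<in> \<Lambda>" and x: "x \<in> wsupp \<mu>"
  shows "v \<in> mob (L \<mu>) z \<Longrightarrow> v \<noteq> 0 \<Longrightarrow> le x z"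
    and "v \<in> mob (L \<mu>) z \<Longrightarrow> z \<in> wsupp \<mu> \<Longrightarrow> \<exists>s\<in>mob (S \<mu>) z. v = \<gamma> \<mu> z (\<eta> \<mu> z s)"
proof -
  have ex: "\<exists>e\<in>mob (\<Delta> \<mu>) z. v = \<gamma> \<mu> z e" if "v \<in> mob (L \<mu>) z"
  proof -
    have "v \<in> \<gamma> \<mu> z ` mob (\<Delta> \<mu>) z" using \<gamma>_surj[OF \<mu>] that by (simp add: surj_hom_def)
    then show ?thesis by blast
  qed
  show "le x z" if v: "v \<in> mob (L \<mu>) z" "v \<noteq> 0"
  proof -
    obtain e where e: "e \<in> mob (\<Delta> \<mu>) z" "v = \<gamma> \<mu> z e" using ex[OF v(1)] by blast
    then have "e \<noteq> 0" using v(2) mod_hom_0[OF \<Delta>_cat L_cat[OF \<mu>] \<gamma>_hom[OF \<mu>]] by auto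
    then show ?thesis using \<Delta>_support(1)[OF \<mu> x e(1)] by blast
  qed
  show "\<exists>s\<in>mob (S \<mu>) z. v = \<gamma> \<mu> z (\<eta> \<mu> z s)" if v: "v \<in> mob (L \<mu>) z" "z \<in> wsupp \<mu>"
  proof -
    obtain e where e: "e \<in> mob (\<Delta> \<mu>) z" "v = \<gamma> \<mu> z e" using ex[OF v(1)] by blast
    then show ?thesis using \<Delta>_support(2)[OF \<mu> x e(1) v(2)] by blast
  qed
qed

text \<open>The module \<open>L \<mu>\<close> remembers its weight: the support of
  \<open>\<mu>\<close> is the least class where it is non-zero, and there it is a copy of
  \<open>S \<mu>\<close>. Both data are compared through \<open>\<theta>\<close>.\<close>

lemma L_hom_eq:
  assumes \<mu>: "\<mu> \<in> \<Lambda>" and \<nu>: "\<nu> \<in> \<Lambda>" and \<theta>: "mod_hom G (L \<nu>) (L \<mu>) \<theta>" and nz: "v0 \<in> mob (L \<nu>) x0" "\<theta> x0 v0 \<noteq> 0"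
  shows "\<nu> = \<mu>"
proof -
  note inj = simple_hom_inj[OF L_simple[OF \<nu>] L_cat[OF \<mu>] \<theta> nz]
  have \<theta>s: "surj_hom G (L \<nu>) (L \<mu>) \<theta>" by (rule simple_hom_surj[OF L_simple[OF \<mu>] L_cat[OF \<nu>] \<theta> nz])
  let ?f = "\<lambda>x s. \<theta> x (\<gamma> \<nu> x (\<eta> \<nu> x s))" and ?g = "\<lambda>x s. \<gamma> \<mu> x (\<eta> \<mu> x s)"
  have f: "mod_hom K (S \<nu>) (L \<mu>) ?f" by (rule mod_hom_comp[OF \<gamma>\<eta>_hom[OF \<nu>] hom_G_to_K[OF \<theta>]])
  note g = \<gamma>\<eta>_hom[OF \<mu>]
  obtain x s where s: "s \<in> mob (S \<nu>) x" "\<gamma> \<nu> x (\<eta> \<nu> x s) \<noteq> 0" using \<gamma>\<eta>_nonzero[OF \<nu>] by blast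
  obtain y t where t: "t \<in> mob (S \<mu>) y" "?g y t \<noteq> 0" using \<gamma>\<eta>_nonzero[OF \<mu>] by blast
  note LK = G_to_K[OF L_cat[OF \<mu>]] and LK' = G_to_K[OF L_cat[OF \<nu>]]
  have sc: "\<gamma> \<nu> x (\<eta> \<nu> x s) \<in> mob (L \<nu>) x" by (rule mod_hom_closed[OF S_cat[OF \<nu>] LK' \<gamma>\<eta>_hom[OF \<nu>] s(1)])
  have fs: "?f x s \<noteq> 0" using inj[OF sc] s(2) by blast
  have "s \<noteq> 0" using s(2) mod_hom_0[OF S_cat[OF \<nu>] LK' \<gamma>\<eta>_hom[OF \<nu>]] by auto
  then have x: "x \<in> wsupp \<nu>" using wsupp_iff[OF \<nu>] s(1) by blast
  have "t \<noteq> 0" using t(2) mod_hom_0[OF S_cat[OF \<mu>] LK g] by auto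
  then have y: "y \<in> wsupp \<mu>" using wsupp_iff[OF \<mu>] t(1) by blast
  have yx: "le y x"
    by (rule L_support(1)[OF \<mu> y mod_hom_closed[OF S_cat[OF \<nu>] LK f s(1)] fs])
  have xy: "le x y"
  proof -
    have "?g y t \<in> \<theta> y ` mob (L \<nu>) y" using \<theta>s mod_hom_closed[OF S_cat[OF \<mu>] LK g t(1)] by (simp add: surj_hom_def)
    then obtain w where w: "w \<in> mob (L \<nu>) y" "?g y t = \<theta> y w" by blast
    then have "w \<noteq> 0" using t(2) mod_hom_0[OF L_cat[OF \<nu>] L_cat[OF \<mu>] \<theta>] by auto
    then show ?thesis by (rule L_support(1)[OF \<nu> x w(1)])
  qed
  have w: "wsupp \<nu> = wsupp \<mu>"
    using le_antisym[OF xy yx] wsupp_class[OF \<nu> x] wsupp_class[OF \<mu> y] obj_class_eq_iff[OF linG] by blast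
  have ginj: "v = 0" if "v \<in> mob (S \<mu>) z" "?g z v = 0" for v z
    using simple_hom_inj[OF S_simple[OF \<mu>] LK g t that] .
  have "\<exists>\<theta>'. surj_hom K (restr_mod (L \<mu>) (\<lambda>x. ?g x ` mob (S \<mu>) x)) (S \<mu>) \<theta>' \<and>
      (\<forall>x. \<forall>v\<in>?g x ` mob (S \<mu>) x. \<theta>' x v = 0 \<longrightarrow> v = 0)"
    using bij_hom_of_injective[OF S_cat[OF \<mu>] LK g] ginj by blast
  then obtain \<theta>' where \<theta>': "surj_hom K (restr_mod (L \<mu>) (\<lambda>x. ?g x ` mob (S \<mu>) x)) (S \<mu>) \<theta>'"
    "\<forall>x. \<forall>v\<in>?g x ` mob (S \<mu>) x. \<theta>' x v = 0 \<longrightarrow> v = 0" by blast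
  have fg: "?f z u \<in> ?g z ` mob (S \<mu>) z" if u: "u \<in> mob (S \<nu>) z" for z u
  proof (cases "z \<in> wsupp \<nu>")
    case True
    then have "z \<in> wsupp \<mu>" using w by simp
    then show ?thesis using L_support(2)[OF \<mu> y mod_hom_closed[OF S_cat[OF \<nu>] LK f u]] by blast
  next
    case False
    then have "u = 0" using S_zero[OF \<nu> False u] by blast
    then have "?f z u = ?g z 0" using mod_hom_0[OF S_cat[OF \<nu>] LK f] mod_hom_0[OF S_cat[OF \<mu>] LK g] by simp
    then show ?thesis using cat_module.mob_0[OF S_cat[OF \<mu>]] by blast
  qed
  have f': "mod_hom K (S \<nu>) (restr_mod (L \<mu>) (\<lambda>x. ?g x ` mob (S \<mu>) x)) ?f"
    using f fg by (simp add: mod_hom_def image_subset_iff)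
  have "mod_hom K (S \<nu>) (S \<mu>) (\<lambda>x v. \<theta>' x (?f x v))"
    by (rule mod_hom_comp[OF f' surj_hom_def[THEN iffD1, OF \<theta>'(1), THEN conjunct1]])
  moreover have "\<theta>' x (?f x s) \<noteq> 0" using \<theta>'(2) fg[OF s(1)] fs by blast
  ultimately show ?thesis using schur_zero[OF \<nu> \<mu> _ s(1)] by blast
qed

lemma hom_P_L_zero:
  assumes \<mu>: "\<mu> \<in> \<Lambda>" and \<nu>: "\<nu> \<in> \<Lambda>" and \<chi>: "mod_hom G (P \<mu>) (L \<nu>) \<chi>" and ne: "\<mu> \<noteq> \<nu>" and v: "v \<in> mob (P \<mu>) x"
  shows "\<chi> x v = 0"
proof (rule ccontr)
  assume nz: "\<chi> x v \<noteq> 0"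
  obtain \<theta> where \<theta>: "surj_hom G (L \<nu>) (L \<mu>) \<theta>"
    using cover_factor[OF \<mu> L_simple[OF \<nu>] \<chi> v nz] by blast
  obtain y u where u: "u \<in> mob (L \<nu>) y" "\<theta> y u \<noteq> 0" using surj_nonzero[OF L_simple[OF \<mu>] \<theta>] by blast
  have "\<nu> = \<mu>" by (rule L_hom_eq[OF \<mu> \<nu> surj_hom_def[THEN iffD1, OF \<theta>, THEN conjunct1] u])
  then show False using ne by simp
qed

lemma S_hom_L_lift:
  assumes \<mu>: "\<mu> \<in> \<Lambda>" and \<kappa>: "\<kappa> \<in> \<Lambda>" and \<phi>: "mod_hom K (S \<kappa>) (L \<mu>) \<phi>"
  shows "\<exists>\<psi>. mod_hom K (S \<kappa>) (\<Delta> \<mu>) \<psi> \<and> (\<forall>x. \<forall>s\<in>mob (S \<kappa>) x. \<gamma> \<mu> x (\<psi> x s) = \<phi> x s)"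
  using lift_propD[OF S_lift[OF \<kappa> G_to_K[OF \<Delta>_cat] G_to_K[OF L_cat[OF \<mu>]]] surj_hom_G_to_K[OF \<gamma>_surj[OF \<mu>]] \<phi>] .

lemma wdim_L_le:
  assumes \<mu>: "\<mu> \<in> \<Lambda>" and \<kappa>: "\<kappa> \<in> \<Lambda>" and h: "wdim \<kappa> (L \<mu>) \<noteq> 0"
  shows "weight_le r \<mu> \<kappa>"
proof -
  obtain \<phi> y s where \<phi>: "mod_hom K (S \<kappa>) (L \<mu>) \<phi>" "s \<in> mob (S \<kappa>) y" "\<phi> y s \<noteq> 0"
    using wdim_nonzero[OF \<kappa> G_to_K[OF L_cat[OF \<mu>]] h] by blast
  obtain \<psi> where \<psi>: "mod_hom K (S \<kappa>) (\<Delta> \<mu>) \<psi>" "\<forall>x. \<forall>s\<in>mob (S \<kappa>) x. \<gamma> \<mu> x (\<psi> x s) = \<phi> x s"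
    using S_hom_L_lift[OF \<mu> \<kappa> \<phi>(1)] by blast
  have "\<psi> y s \<noteq> 0" using \<psi>(2) \<phi>(2,3) mod_hom_0[OF \<Delta>_cat L_cat[OF \<mu>] \<gamma>_hom[OF \<mu>]] by metis
  then show ?thesis using S_hom_\<Delta>[OF \<mu> \<kappa> \<psi>(1) \<phi>(2)] by blast
qed

lemma wdim_L_self: assumes \<kappa>: "\<kappa> \<in> \<Lambda>" shows "wdim \<kappa> (L \<kappa>) = 1"
proof -
  obtain x s where s: "s \<in> mob (S \<kappa>) x" "\<gamma> \<kappa> x (\<eta> \<kappa> x s) \<noteq> 0" using \<gamma>\<eta>_nonzero[OF \<kappa>] by blast
  show ?thesis
  proof (rule wdim_one[OF \<kappa> G_to_K[OF L_cat[OF \<kappa>]] \<gamma>\<eta>_hom[OF \<kappa>] s])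
    fix \<chi> assume \<chi>: "mod_hom K (S \<kappa>) (L \<kappa>) \<chi>"
    obtain \<psi> where \<psi>: "mod_hom K (S \<kappa>) (\<Delta> \<kappa>) \<psi>" "\<forall>x. \<forall>s\<in>mob (S \<kappa>) x. \<gamma> \<kappa> x (\<psi> x s) = \<chi> x s"
      using S_hom_L_lift[OF \<kappa> \<kappa> \<chi>] by blast
    obtain c where c: "\<forall>x. \<forall>v\<in>mob (S \<kappa>) x. \<psi> x v = mscale (\<Delta> \<kappa>) c (\<eta> \<kappa> x v)"
      using S_hom_\<Delta>_scalar[OF \<kappa> \<psi>(1)] by blast
    have "\<chi> x v = mscale (L \<kappa>) c (\<gamma> \<kappa> x (\<eta> \<kappa> x v))" if v: "v \<in> mob (S \<kappa>) x" for x v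
    proof -
      have "\<eta> \<kappa> x v \<in> mob (\<Delta> \<kappa>) x" by (rule mod_hom_closed[OF S_cat[OF \<kappa>] G_to_K[OF \<Delta>_cat] \<eta>_K[OF \<kappa>] v])
      from mod_hom_scale[OF \<Delta>_cat L_cat[OF \<kappa>] \<gamma>_hom[OF \<kappa>] this, of c] show ?thesis using \<psi>(2) c v by metis
    qed
    then show "\<exists>c. \<forall>x. \<forall>v\<in>mob (S \<kappa>) x. \<chi> x v = mscale (L \<kappa>) c (\<gamma> \<kappa> x (\<eta> \<kappa> x v))" by blast
  qed
qed

text \<open>At a minimal class of the support of \<open>T\<close>, \<open>step_min\<close> gives a
  non-zero map from some \<open>\<Delta> \<mu>\<close> to \<open>T\<close>; precede it by the
  surjection from \<open>P \<mu>\<close>.\<close>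

lemma simple_weight:
  fixes T :: "('o, 'm, 'k, 'v::ab_group_add) cmod"
  assumes T: "simple_mod G T"
  shows "\<exists>\<mu>\<in>\<Lambda>. \<exists>\<chi> x v. mod_hom G (P \<mu>) T \<chi> \<and> v \<in> mob (P \<mu>) x \<and> \<chi> x v \<noteq> 0"
proof -
  note Tc = simple_cat_module[OF T]
  obtain x0 v0 where "v0 \<in> mob T x0" "v0 \<noteq> 0" using simple_nonzero[OF T] mob_nonzero_iff[OF Tc] by blast
  from minimal_support[OF this] obtain x v where v: "v \<in> mob T x" "v \<noteq> 0"
    and min: "\<forall>y. \<forall>w\<in>mob T y. w \<noteq> 0 \<longrightarrow> le y x \<longrightarrow> iso_obj G y x" by blast
  have "surj_hom G (rep G x) T (\<lambda>y f. mact T x y f v)"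
    by (rule simple_hom_surj[OF T cat_module_rep[OF linG] yoneda_hom[OF linG Tc v(1)], of "ident G x" x])
      (use ident_closed cat_module.act_ident[OF Tc v(1)] v(2) in simp_all)
  then have fd: "fin_dim (mscale T) (mob T x)"
    using pointwise_finite_quotient[OF cat_module_rep[OF linG] Tc] T0 by (simp add: pointwise_finite_def)
  have min': "iso_obj G y x" if "w \<in> mob T y" "w \<noteq> 0" "le y x" for y w using min that by blast
  have sm: "\<exists>\<mu>\<in>\<Lambda>. \<exists>q \<iota> \<psi>. x \<in> wsupp \<mu> \<and> mod_hom KU T (S0 \<mu>) q \<and> mod_hom G (\<Delta> \<mu>) T \<psi> \<and>
    (\<forall>y. \<forall>s\<in>mob (S \<mu>) y. \<psi> y (\<eta> \<mu> y s) = \<iota> y s \<and> q y (\<iota> y s) = s)"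
    by (rule step_min[OF Tc fd v min'])
  obtain \<mu> q \<iota> \<psi> where \<mu>: "\<mu> \<in> \<Lambda>" and q: "mod_hom KU T (S0 \<mu>) q" and \<psi>: "mod_hom G (\<Delta> \<mu>) T \<psi>"
    and e: "\<forall>y. \<forall>s\<in>mob (S \<mu>) y. \<psi> y (\<eta> \<mu> y s) = \<iota> y s \<and> q y (\<iota> y s) = s"
    using sm by blast
  obtain \<delta> where \<delta>: "surj_hom G (P \<mu>) (\<Delta> \<mu>) \<delta>" using P_filtration(2)[OF \<mu>] by blast
  obtain y s where s: "s \<in> mob (S \<mu>) y" "s \<noteq> 0" using S_nonzero[OF \<mu>] by blast
  have q0: "q y 0 = 0" by (rule mod_hom_0[OF G_to_U[OF Tc] S0_U[OF \<mu>] q])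
  have "\<psi> y (\<eta> \<mu> y s) \<noteq> 0"
  proof
    assume "\<psi> y (\<eta> \<mu> y s) = 0"
    moreover have "\<psi> y (\<eta> \<mu> y s) = \<iota> y s" "q y (\<iota> y s) = s" using e s(1) by blast+
    ultimately show False using q0 s(2) by simp
  qed
  moreover have "\<eta> \<mu> y s \<in> \<delta> y ` mob (P \<mu>) y"
    using \<delta> mod_hom_closed[OF S_cat[OF \<mu>] G_to_K[OF \<Delta>_cat] \<eta>_K[OF \<mu>] s(1)] by (simp add: surj_hom_def)
  then obtain p where "p \<in> mob (P \<mu>) y" "\<eta> \<mu> y s = \<delta> y p" by blast
  moreover have "mod_hom G (P \<mu>) T (\<lambda>x v. \<psi> x (\<delta> x v))"
    by (rule mod_hom_comp[OF surj_hom_def[THEN iffD1, OF \<delta>, THEN conjunct1] \<psi>])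
  ultimately show ?thesis using \<mu> by metis
qed

text \<open>Proper submodules of finitely generated modules are detected by maps to the modules
  \<open>L \<mu>\<close>. In the decomposition of \<open>Pt \<kappa>\<close> this tests both
  surjectivity and the vanishing of the kernel.\<close>

lemma hom_to_L:
  fixes M :: "('o, 'm, 'k, 'v::ab_group_add) cmod"
  assumes M: "cat_module G M" and fg: "fin_gen G M" and N: "submod G M N" "N \<noteq> mob M"
  shows "\<exists>\<mu>\<in>\<Lambda>. \<exists>\<chi>. surj_hom G M (L \<mu>) \<chi> \<and> (\<forall>x. \<forall>v\<in>N x. \<chi> x v = 0)"
proof -
  obtain Q :: "('o, 'm, 'k, 'v) cmod" and q where Q: "simple_mod G Q" "surj_hom G M Q q" "\<forall>x. \<forall>v\<in>N x. q x v = 0"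
    using fin_gen_simple_quotient[OF M fg N] by blast
  obtain \<mu> \<chi> x v where \<mu>: "\<mu> \<in> \<Lambda>" and \<chi>: "mod_hom G (P \<mu>) Q \<chi>" "v \<in> mob (P \<mu>) x" "\<chi> x v \<noteq> 0"
    using simple_weight[OF Q(1)] by blast
  obtain \<theta> where \<theta>: "surj_hom G Q (L \<mu>) \<theta>" using cover_factor[OF \<mu> Q(1) \<chi>] by blast
  have "\<theta> x 0 = 0" for x
    by (rule mod_hom_0[OF simple_cat_module[OF Q(1)] L_cat[OF \<mu>] surj_hom_def[THEN iffD1, OF \<theta>, THEN conjunct1]])
  then show ?thesis using surj_hom_comp[OF Q(2) \<theta>] Q(3) \<mu> by (intro bexI[of _ \<mu>] exI conjI) auto
qed

lemma ex_vs: "\<kappa> \<in> \<Lambda> \<Longrightarrow> \<exists>s :: 'k \<Rightarrow> 'p \<Rightarrow> 'p. vector_space s"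
  using cat_module.vector_space[OF P_cat] by blast

lemma P_standard:
  assumes \<kappa>: "\<kappa> \<in> \<Lambda>"
  shows "semistandard G U D S (P \<kappa>)" "standard_mult G U D S (P \<kappa>) \<kappa> = 1"
    "\<mu> \<in> \<Lambda> \<Longrightarrow> standard_mult G U D S (P \<kappa>) \<mu> \<noteq> 0 \<Longrightarrow> weight_le r \<mu> \<kappa>"
proof -
  obtain n F \<omega> where F: "standard_filtration G U D S (P \<kappa>) n F \<omega>" "\<forall>i<n. \<omega> i \<in> \<Lambda> \<and> weight_le r (\<omega> i) \<kappa>"
    using P_filtration(1)[OF \<kappa>] by blast
  show "semistandard G U D S (P \<kappa>)" using F(1) P_cat[OF \<kappa>] by (auto simp: semistandard_def)
  show "standard_mult G U D S (P \<kappa>) \<kappa> = 1" using P_of[OF \<kappa>] by (simp add: is_projective_of_weight_def)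
  assume "standard_mult G U D S (P \<kappa>) \<mu> \<noteq> 0"
  then have "card {i. i < n \<and> \<omega> i = \<mu>} \<noteq> 0" using standard_mult_eq[OF P_cat[OF \<kappa>] P_fin(1)[OF \<kappa>] F(1)] by simp
  then have "{i. i < n \<and> \<omega> i = \<mu>} \<noteq> {}" using card.empty by metis
  then show "weight_le r \<mu> \<kappa>" using F(2) by blast
qed

lemma P_projective_cover:
  assumes \<kappa>: "\<kappa> \<in> \<Lambda>"
  shows "projective_cover G (P \<kappa>) (\<Delta> \<kappa>)" "projective_cover G (P \<kappa>) (L \<kappa>)"
proof -
  note Pc = P_cat[OF \<kappa>]
  have proj: "projective G (P \<kappa>)" unfolding projective_iff_lift_prop using Pc P_lift[OF \<kappa>] by blast
  have cov: "N = mob (P \<kappa>)" if p: "surj_hom G (P \<kappa>) (L \<kappa>) p" and N: "submod G (P \<kappa>) N" and im: "\<And>x. p x ` N x = mob (L \<kappa>) x" for p N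
  proof (rule ccontr)
    assume "N \<noteq> mob (P \<kappa>)"
    then have z: "p x v = 0" if "v \<in> N x" for x v using cover_simple[OF \<kappa> L_simple[OF \<kappa>] p N _ that] by blast
    obtain x l where l: "l \<in> mob (L \<kappa>) x" "l \<noteq> 0"
      using simple_nonzero[OF L_simple[OF \<kappa>]] mob_nonzero_iff[OF L_cat[OF \<kappa>]] by blast
    then show False using z im[of x] by auto
  qed
  show "projective_cover G (P \<kappa>) (L \<kappa>)"
    unfolding projective_cover_def using proj \<pi>_surj[OF \<kappa>] cov[OF \<pi>_surj[OF \<kappa>]] by blast
  obtain \<delta> where \<delta>: "surj_hom G (P \<kappa>) (\<Delta> \<kappa>) \<delta>" using P_filtration(2)[OF \<kappa>] by blast
  have "N = mob (P \<kappa>)" if N: "submod G (P \<kappa>) N" and im: "\<forall>x. \<delta> x ` N x = mob (\<Delta> \<kappa>) x" for N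
  \<comment> \<open>A submodule that maps onto \<open>\<Delta> \<kappa>\<close> also maps onto
    \<open>L \<kappa>\<close>, so the case of the simple quotient applies.\<close>
  proof (rule cov[OF surj_hom_comp[OF \<delta> \<gamma>_surj[OF \<kappa>]] N])
    fix x
    have "(\<lambda>v. \<gamma> \<kappa> x (\<delta> x v)) ` N x = \<gamma> \<kappa> x ` (\<delta> x ` N x)" by (simp only: image_image)
    also have "\<dots> = mob (L \<kappa>) x" using im \<gamma>_surj[OF \<kappa>] by (simp add: surj_hom_def)
    finally show "(\<lambda>v. \<gamma> \<kappa> x (\<delta> x v)) ` N x = mob (L \<kappa>) x" .
  qed
  then show "projective_cover G (P \<kappa>) (\<Delta> \<kappa>)" unfolding projective_cover_def using proj \<delta> by blast
qed

lemma P_hom_dim: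
  fixes M :: "('o, 'm, 'k, 'v::ab_group_add) cmod"
  assumes \<kappa>: "\<kappa> \<in> \<Lambda>" and M: "cat_module G M"
  shows "hom_dim G (P \<kappa>) M = multiplicity_mod G M (L \<kappa>)"
proof (rule hom_dim_eq_multiplicity[OF P_cat[OF \<kappa>] M L_simple[OF \<kappa>] \<pi>_surj[OF \<kappa>]])
  show "\<pi> \<kappa> x v = 0" if "submod G (P \<kappa>) N" "N \<noteq> mob (P \<kappa>)" "v \<in> N x" for N x v
    by (rule cover_simple[OF \<kappa> L_simple[OF \<kappa>] \<pi>_surj[OF \<kappa>] that])
  show "\<exists>c. \<forall>x. \<forall>v\<in>mob (P \<kappa>) x. \<chi> x v = mscale (L \<kappa>) c (\<pi> \<kappa> x v)" if "mod_hom G (P \<kappa>) (L \<kappa>) \<chi>" for \<chi>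
    by (rule hom_P_L_scalar[OF \<kappa> that])
  show "\<exists>\<psi>. mod_hom G (P \<kappa>) (restr_mod M B) \<psi> \<and> (\<forall>x. \<forall>v\<in>mob (P \<kappa>) x. \<rho> x (\<psi> x v) = \<pi> \<kappa> x v)"
    if "submod G M B" "surj_hom G (restr_mod M B) (L \<kappa>) \<rho>" for B \<rho>
    by (rule lift_propD[OF P_lift[OF \<kappa> cat_module_restr[OF M that(1)] L_cat[OF \<kappa>]] that(2) \<pi>_hom[OF \<kappa>]])
qed

end

lemma sum_fun_eval: "(\<Sum>i\<in>I. f i) x = (\<Sum>i\<in>I. f i x)"
  for f :: "'i \<Rightarrow> 'x \<Rightarrow> 'a::comm_monoid_add"
  by (induction I rule: infinite_finite_induct) auto

section \<open>Generation by the modules \<open>P \<mu>\<close>, indecomposable projectives, and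
  characters\<close>

context tri_proj
begin

text \<open>\<open>M\<close> may fail to be finitely generated, but the submodule generated by
  \<open>v\<close> is cyclic. The trace of the family \<open>P\<close> in it is everything, since
  every simple module receives a non-zero map from some \<open>P \<mu>\<close>.\<close>

lemma P_generate:
  fixes M :: "('o, 'm, 'k, 'v::ab_group_add) cmod"
  assumes M: "cat_module G M" and v: "v \<in> mob M x"
  shows "\<exists>(n::nat) w \<phi> s. (\<forall>j<n. w j \<in> \<Lambda> \<and> mod_hom G (P (w j)) M (\<phi> j) \<and> s j \<in> mob (P (w j)) x) \<and>
    v = (\<Sum>j<n. \<phi> j x (s j))"
proof -
  let ?y = "\<lambda>y f. mact M x y f v"
  let ?N = "\<lambda>y. ?y y ` mob (rep G x) y"
  note R = cat_module_rep[OF linG, of x]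
  have y: "mod_hom G (rep G x) M ?y" by (rule yoneda_hom[OF linG M v])
  have N: "submod G M ?N" by (rule submod_image[OF R M y submod_mob[OF R]])
  note Nc = cat_module_restr[OF M N]
  have le: "?N z \<subseteq> mob M z" for z using submod_le[OF M N] by blast
  have "mod_hom G (rep G x) (restr_mod M ?N) ?y" unfolding mod_hom_restr_target[OF le] using y by blast
  then have "surj_hom G (rep G x) (restr_mod M ?N) ?y" by (simp add: surj_hom_def)
  then have fg: "fin_gen G (restr_mod M ?N)" by (rule fin_gen_quotient[OF R Nc fin_gen_rep[OF linG]])
  have "trace_sub G P \<Lambda> (restr_mod M ?N) = mob (restr_mod M ?N)"
  proof (rule trace_sub_full[OF Nc fg P_cat])
    fix Q :: "('o, 'm, 'k, 'v) cmod" assume Q: "simple_mod G Q"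
    obtain \<mu> \<chi> x v where \<mu>: "\<mu> \<in> \<Lambda>" and \<chi>: "mod_hom G (P \<mu>) Q \<chi>" "v \<in> mob (P \<mu>) x" "\<chi> x v \<noteq> 0"
      using simple_weight[OF Q] by blast
    show "\<exists>w\<in>\<Lambda>. \<exists>\<phi> x. \<exists>s\<in>mob (P w) x. lift_prop G (P w) (restr_mod M ?N) Q \<and> mod_hom G (P w) Q \<phi> \<and> \<phi> x s \<noteq> 0"
      using \<mu> \<chi> P_lift[OF \<mu> Nc simple_cat_module[OF Q]] by blast
  qed
  then have "trace_sub G P \<Lambda> (restr_mod M ?N) x = ?N x" by (simp only: restr_mod_sel)
  moreover have "v \<in> ?N x" using cat_module.act_ident[OF M v] ident_closed[of x] by (metis imageI rep_sel(2))
  ultimately have t: "v \<in> trace_sub G P \<Lambda> (restr_mod M ?N) x" by blast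
  have "\<exists>(n::nat) w \<phi> s. (\<forall>j<n. w j \<in> \<Lambda> \<and> mod_hom G (P (w j)) (restr_mod M ?N) (\<phi> j) \<and> s j \<in> mob (P (w j)) x) \<and>
      v = (\<Sum>j<n. \<phi> j x (s j))"
    by (rule trace_sub_sum[OF Nc P_cat t])
  then show ?thesis unfolding mod_hom_restr_target[OF le] by blast
qed

text \<open>For each vector \<open>v\<close> at \<open>x\<close> a finite list of maps from modules
  \<open>P \<mu>\<close> is chosen whose images at \<open>x\<close> together produce
  \<open>v\<close>; the triple \<open>(x, v, j)\<close> points to entry \<open>j\<close> of that
  list. Finiteness of each list is what gives finite sums for finitely generated modules.\<close>

lemma P_cover_index:
  fixes M :: "('o, 'm, 'k, 'v::ab_group_add) cmod"
  assumes M: "cat_module G M"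
  shows "\<exists>(I :: ('o \<times> 'v \<times> nat) set) \<mu> \<phi>. (\<forall>i\<in>I. \<mu> i \<in> \<Lambda> \<and> mod_hom G (P (\<mu> i)) M (\<phi> i)) \<and>
    (\<forall>x v. finite {j. (x, v, j) \<in> I}) \<and>
    (\<forall>x. \<forall>v\<in>mob M x. \<forall>A. submod G M A \<longrightarrow>
      (\<forall>j. (x, v, j) \<in> I \<longrightarrow> (\<forall>u\<in>mob (P (\<mu> (x, v, j))) x. \<phi> (x, v, j) x u \<in> A x)) \<longrightarrow> v \<in> A x)"
proof -
  \<comment> \<open>The tuple \<open>t\<close> packs length, weights, maps and vectors of such a
    list, so that a single choice function suffices.\<close>
  let ?Q = "\<lambda>p t. (\<forall>j<(fst t :: nat). fst (snd t) j \<in> \<Lambda> \<and> mod_hom G (P (fst (snd t) j)) M (fst (snd (snd t)) j) \<and>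
      snd (snd (snd t)) j \<in> mob (P (fst (snd t) j)) (fst p)) \<and>
    snd p = (\<Sum>j<fst t. fst (snd (snd t)) j (fst p) (snd (snd (snd t)) j))"
  have "\<exists>t. snd p \<in> mob M (fst p) \<longrightarrow> ?Q p t" for p :: "'o \<times> 'v"
  proof (cases "snd p \<in> mob M (fst p)")
    case True
    obtain n w \<phi> s where "(\<forall>j<n. w j \<in> \<Lambda> \<and> mod_hom G (P (w j)) M (\<phi> j) \<and> s j \<in> mob (P (w j)) (fst p)) \<and>
      snd p = (\<Sum>j<(n::nat). \<phi> j (fst p) (s j))" using P_generate[OF M True] by blast
    then have q: "?Q p (n, w, \<phi>, s)" by simp
    show ?thesis by (intro exI[of _ "(n, w, \<phi>, s)"] impI q)
  qed simp
  then obtain T where T: "\<And>p. snd p \<in> mob M (fst p) \<Longrightarrow> ?Q p (T p)" using choice[of "\<lambda>p t. snd p \<in> mob M (fst p) \<longrightarrow> ?Q p t"] by blast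
  define I where "I = {i. fst (snd i) \<in> mob M (fst i) \<and> snd (snd i) < fst (T (fst i, fst (snd i)))}"
  define \<mu> where "\<mu> i = fst (snd (T (fst i, fst (snd i)))) (snd (snd i))" for i
  define \<phi> where "\<phi> i = fst (snd (snd (T (fst i, fst (snd i))))) (snd (snd i))" for i
  have 1: "\<mu> i \<in> \<Lambda> \<and> mod_hom G (P (\<mu> i)) M (\<phi> i)" if "i \<in> I" for i
    using T[of "(fst i, fst (snd i))"] that by (simp add: I_def \<mu>_def \<phi>_def)
  have 2: "finite {j. (x, v, j) \<in> I}" for x v
    by (rule finite_subset[of _ "{..<fst (T (x, v))}"]) (auto simp: I_def)
  have 3: "v \<in> A x" if v: "v \<in> mob M x" and A: "submod G M A"
    and g: "\<forall>j. (x, v, j) \<in> I \<longrightarrow> (\<forall>u\<in>mob (P (\<mu> (x, v, j))) x. \<phi> (x, v, j) x u \<in> A x)" for x v A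
  proof -
    let ?t = "T (x, v)"
    have t: "snd (snd (snd ?t)) j \<in> mob (P (\<mu> (x, v, j))) x" "(x, v, j) \<in> I" if "j < fst ?t" for j
      using T[of "(x, v)"] v that by (simp_all add: \<mu>_def I_def)
    have e: "v = (\<Sum>j<fst ?t. \<phi> (x, v, j) x (snd (snd (snd ?t)) j))"
      using T[of "(x, v)"] v by (simp add: \<phi>_def)
    have "(\<Sum>j<fst ?t. \<phi> (x, v, j) x (snd (snd (snd ?t)) j)) \<in> A x"
      by (rule submod_sum[OF M A]) (use t g in auto)
    then show ?thesis using e by metis
  qed
  show ?thesis using 1 2 3 by (intro exI[of _ I] exI[of _ \<mu>] exI[of _ \<phi>]) blast
qed

lemma quotient_of_P:
  fixes M :: "('o, 'm, 'k, 'v::ab_group_add) cmod"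
  assumes \<kappa>: "\<kappa> \<in> \<Lambda>" and M: "cat_module G M"
  shows "\<exists>(I :: ('o \<times> 'v \<times> nat) set) \<mu>. \<mu> ` I \<subseteq> \<Lambda> \<and> is_quotient_of G (dir_sum I (\<lambda>i. P (\<mu> i))) M"
    and "fin_gen G M \<Longrightarrow> \<exists>(n :: nat) \<mu>. \<mu> ` {..<n} \<subseteq> \<Lambda> \<and> is_quotient_of G (dir_sum {..<n} (\<lambda>i. P (\<mu> i))) M"
proof -
  obtain I :: "('o \<times> 'v \<times> nat) set" and \<mu> \<phi> where I: "\<forall>i\<in>I. \<mu> i \<in> \<Lambda> \<and> mod_hom G (P (\<mu> i)) M (\<phi> i)"
    and fin: "\<forall>x v. finite {j. (x, v, j) \<in> I}"
    and g: "\<forall>x. \<forall>v\<in>mob M x. \<forall>A. submod G M A \<longrightarrow>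
      (\<forall>j. (x, v, j) \<in> I \<longrightarrow> (\<forall>u\<in>mob (P (\<mu> (x, v, j))) x. \<phi> (x, v, j) x u \<in> A x)) \<longrightarrow> v \<in> A x"
    using P_cover_index[OF M] by blast
  have Ic: "cat_module G (P (\<mu> i))" and Ih: "mod_hom G (P (\<mu> i)) M (\<phi> i)" if "i \<in> I" for i
    using I P_cat that by blast+
  have "is_quotient_of G (dir_sum I (\<lambda>i. P (\<mu> i))) M"
  proof (rule quotient_of_dir_sum[where N = "\<lambda>i. P (\<mu> i)" and \<phi> = \<phi>, OF ex_vs[OF \<kappa>] Ic M Ih])
    fix A assume A: "submod G M A" and im: "\<And>i x v. i \<in> I \<Longrightarrow> v \<in> mob (P (\<mu> i)) x \<Longrightarrow> \<phi> i x v \<in> A x"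
    have "v \<in> A x" if "v \<in> mob M x" for v x
      using g[rule_format, OF that A] im by blast
    then show "A = mob M" using submod_le[OF M A] by (intro ext) blast
  qed
  then show "\<exists>(I :: ('o \<times> 'v \<times> nat) set) \<mu>. \<mu> ` I \<subseteq> \<Lambda> \<and> is_quotient_of G (dir_sum I (\<lambda>i. P (\<mu> i))) M"
    using I by blast
  assume "fin_gen G M"
  then obtain X where X': "finite X \<and> (\<forall>p\<in>X. snd p \<in> mob M (fst p)) \<and>
    (\<forall>N. submod G M N \<and> (\<forall>p\<in>X. snd p \<in> N (fst p)) \<longrightarrow> N = mob M)" by (elim exE[OF fin_genE])
  note X = X'[THEN conjunct1] X'[THEN conjunct2, THEN conjunct1] X'[THEN conjunct2, THEN conjunct2]
  \<comment> \<open>The entries that belong to the finitely many generators.\<close>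
  define J where "J = (\<Union>p\<in>X. (\<lambda>j. (fst p, snd p, j)) ` {j. (fst p, snd p, j) \<in> I})"
  have "finite J" unfolding J_def using X(1) fin by blast
  then obtain b where b: "bij_betw b {0..<card J} J" using ex_bij_betw_nat_finite by blast
  then have b': "b ` {..<card J} = J" by (simp add: bij_betw_def atLeast0LessThan)
  have JI: "J \<subseteq> I" by (auto simp: J_def)
  have bI: "b i \<in> I" if "i \<in> {..<card J}" for i using b' JI that by blast
  have "is_quotient_of G (dir_sum {..<card J} (\<lambda>i. P (\<mu> (b i)))) M"
  proof (rule quotient_of_dir_sum[where N = "\<lambda>i. P (\<mu> (b i))" and \<phi> = "\<lambda>i. \<phi> (b i)", OF ex_vs[OF \<kappa>] Ic[OF bI] M Ih[OF bI]])
    fix A assume A: "submod G M A" and im: "\<And>i x v. i \<in> {..<card J} \<Longrightarrow> v \<in> mob (P (\<mu> (b i))) x \<Longrightarrow> \<phi> (b i) x v \<in> A x"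
    have im': "\<phi> i x v \<in> A x" if i: "i \<in> J" and v: "v \<in> mob (P (\<mu> i)) x" for i x v
    proof -
      obtain m where "m \<in> {..<card J}" "i = b m" using b' i by blast
      then show ?thesis using im v by blast
    qed
    have "snd p \<in> A (fst p)" if p: "p \<in> X" for p
    proof -
      have J: "(fst p, snd p, j) \<in> J" if "(fst p, snd p, j) \<in> I" for j unfolding J_def using p that by blast
      show ?thesis by (rule g[rule_format, OF X(2)[rule_format, OF p] A]) (rule im'[OF J])
    qed
    then show "A = mob M" using X(3) A by blast
  qed
  moreover have "(\<lambda>i. \<mu> (b i)) ` {..<card J} \<subseteq> \<Lambda>" using bI I by blast
  ultimately show "\<exists>(n :: nat) \<mu>. \<mu> ` {..<n} \<subseteq> \<Lambda> \<and> is_quotient_of G (dir_sum {..<n} (\<lambda>i. P (\<mu> i))) M"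
    by (intro exI[of _ "card J"] exI[of _ "\<lambda>i. \<mu> (b i)"] conjI)
qed

text \<open>A surjection from \<open>M\<close> to some \<open>L \<mu>\<close> lifts to a map
  \<open>f\<close> from \<open>M\<close> to \<open>P \<mu>\<close>, whose image is not in the kernel
  of the cover and so is everything. Projectivity of \<open>P \<mu>\<close> splits \<open>f\<close>,
  and indecomposability of \<open>M\<close> leaves no kernel.\<close>

lemma indecomposable_projective_P:
  fixes M :: "('o, 'm, 'k, 'v::ab_group_add) cmod"
  assumes fg: "fin_gen G M" and ind: "indecomposable G M" and pr: "projective G M"
  shows "\<exists>\<mu>\<in>\<Lambda>. isomorphic G M (P \<mu>)"
proof -
  have M: "cat_module G M" and nz: "zero_sub \<noteq> mob M" using ind by (auto simp: indecomposable_def)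
  obtain \<mu> \<chi> where \<mu>: "\<mu> \<in> \<Lambda>" and \<chi>: "surj_hom G M (L \<mu>) \<chi>" using hom_to_L[OF M fg submod_zero[OF M] nz] by blast
  note Pc = P_cat[OF \<mu>] and \<chi>h = surj_hom_def[THEN iffD1, OF \<chi>, THEN conjunct1]
  obtain f where f: "mod_hom G M (P \<mu>) f" "\<forall>x. \<forall>v\<in>mob M x. \<pi> \<mu> x (f x v) = \<chi> x v"
    using lift_propD[OF projective_lift_prop[OF linG pr Pc L_cat[OF \<mu>]] \<pi>_surj[OF \<mu>] \<chi>h] by blast
  have "(\<lambda>x. f x ` mob M x) = mob (P \<mu>)"
  proof (rule ccontr)
    assume n: "(\<lambda>x. f x ` mob M x) \<noteq> mob (P \<mu>)"
    obtain x v where v: "v \<in> mob M x" "\<chi> x v \<noteq> 0" using surj_nonzero[OF L_simple[OF \<mu>] \<chi>] by blast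
    have "\<pi> \<mu> x (f x v) = 0"
      by (rule cover_simple[OF \<mu> L_simple[OF \<mu>] \<pi>_surj[OF \<mu>] submod_image[OF M Pc f(1) submod_mob[OF M]] n]) (use v in blast)
    then show False using f(2) v by simp
  qed
  then have im: "f x ` mob M x = mob (P \<mu>) x" for x by (rule fun_cong)
  then have fs: "surj_hom G M (P \<mu>) f" using f(1) by (simp add: surj_hom_def)
  obtain \<sigma> where \<sigma>: "mod_hom G (P \<mu>) M \<sigma>" "\<forall>x. \<forall>v\<in>mob (P \<mu>) x. f x (\<sigma> x v) = v"
    using lift_propD[OF P_lift[OF \<mu> M Pc] fs mod_hom_id[OF Pc]] by blast
  have s: "internal_sum G M (\<lambda>x. \<sigma> x ` mob (P \<mu>) x) (\<lambda>x. {v \<in> mob M x. f x v = 0})"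
    by (rule split_internal_sum[OF M Pc f(1) \<sigma>(1)]) (use \<sigma>(2) in blast)
  have "(\<lambda>x. \<sigma> x ` mob (P \<mu>) x) \<noteq> zero_sub"
  proof
    assume z: "(\<lambda>x. \<sigma> x ` mob (P \<mu>) x) = zero_sub"
    obtain x v where v: "v \<in> mob (P \<mu>) x" "v \<noteq> 0" using P_nonzero[OF \<mu>] mob_nonzero_iff[OF Pc] by blast
    have "\<sigma> x ` mob (P \<mu>) x = {0}" using fun_cong[OF z, of x] by (simp add: zero_sub_def)
    then have "\<sigma> x v = 0" using v(1) by blast
    then have "f x 0 = v" using \<sigma>(2) v(1) by metis
    then show False using mod_hom_0[OF M Pc f(1)] v(2) by metis
  qed
  then have k: "(\<lambda>x. {v \<in> mob M x. f x v = 0}) = zero_sub" using ind s by (auto simp: indecomposable_def)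
  have "v = 0" if "v \<in> mob M x" "f x v = 0" for x v
  proof -
    have "{v \<in> mob M x. f x v = 0} = {0}" using fun_cong[OF k, of x] by (simp add: zero_sub_def)
    then show ?thesis using that by blast
  qed
  then have "inj_on (f x) (mob M x)" for x using mod_hom_inj_iff[OF M Pc f(1)] by blast
  then have "isomorphic G M (P \<mu>)" unfolding isomorphic_def using f(1) im by (intro exI[of _ f]) (simp add: bij_betw_def)
  then show ?thesis using \<mu> by blast
qed

lemma wdim_P:
  assumes \<mu>: "\<mu> \<in> \<Lambda>"
  shows "\<exists>V. finite V \<and> V = {\<omega> \<in> \<Lambda>. standard_mult G U D S (P \<mu>) \<omega> \<noteq> 0} \<and>
    (\<forall>\<nu>\<in>\<Lambda>. wdim \<nu> (P \<mu>) = (\<Sum>\<omega>\<in>V. standard_mult G U D S (P \<mu>) \<omega> * wdim \<nu> (\<Delta> \<omega>)))"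
proof -
  obtain n F \<omega> where F: "standard_filtration G U D S (P \<mu>) n F \<omega>" "\<forall>i<n. \<omega> i \<in> \<Lambda> \<and> weight_le r (\<omega> i) \<mu>"
    using P_filtration(1)[OF \<mu>] by blast
  have k: "standard_mult G U D S (P \<mu>) \<alpha> = card {i. i < n \<and> \<omega> i = \<alpha>}" for \<alpha>
    by (rule standard_mult_eq[OF P_cat[OF \<mu>] P_fin(1)[OF \<mu>] F(1)])
  have "card {i. i < n \<and> \<omega> i = \<alpha>} \<noteq> 0 \<longleftrightarrow> \<alpha> \<in> \<omega> ` {..<n}" for \<alpha>
    by (auto simp: card_eq_0_iff)
  then have V: "\<omega> ` {..<n} = {\<alpha> \<in> \<Lambda>. standard_mult G U D S (P \<mu>) \<alpha> \<noteq> 0}" unfolding k using F(2) by auto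
  have "wdim \<nu> (P \<mu>) = (\<Sum>\<alpha>\<in>\<omega> ` {..<n}. standard_mult G U D S (P \<mu>) \<alpha> * wdim \<nu> (\<Delta> \<alpha>))" if \<nu>: "\<nu> \<in> \<Lambda>" for \<nu>
  proof -
    have "wdim \<nu> (P \<mu>) = (\<Sum>i<n. wdim \<nu> (\<Delta> (\<omega> i)))" by (rule wdim_filtration[OF \<nu> P_cat[OF \<mu>] P_fin(1)[OF \<mu>] F(1)])
    also have "\<dots> = (\<Sum>\<alpha>\<in>\<omega> ` {..<n}. of_nat (card {i. i < n \<and> \<omega> i = \<alpha>}) * wdim \<nu> (\<Delta> \<alpha>))"
      by (rule sum_fibres) auto
    finally show ?thesis by (simp add: k)
  qed
  then have "\<forall>\<nu>\<in>\<Lambda>. wdim \<nu> (P \<mu>) = (\<Sum>\<omega>\<in>\<omega> ` {..<n}. standard_mult G U D S (P \<mu>) \<omega> * wdim \<nu> (\<Delta> \<omega>))" by blast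
  then show ?thesis by (intro exI[of _ "\<omega> ` {..<n}"] conjI finite_imageI finite_lessThan V)
qed

text \<open>Rewrite the relation in terms of standard characters, whose coefficients must all
  vanish. At a weight \<open>\<mu>\<close> of highest rank among those with
  \<open>c \<mu> \<noteq> 0\<close> the coefficient is \<open>c \<mu>\<close> itself, as
  \<open>\<Delta> \<mu>\<close> occurs in another \<open>P \<nu>\<close> only when
  \<open>\<mu> < \<nu>\<close>.\<close>

lemma projective_characters_independent:
  fixes c :: "('o, 'm, 'k) weight \<Rightarrow> rat"
  assumes T: "finite T" "T \<subseteq> \<Lambda>" and z: "\<And>\<nu>. \<nu> \<in> \<Lambda> \<Longrightarrow> (\<Sum>\<mu>\<in>T. c \<mu> * of_nat (wdim \<nu> (P \<mu>))) = 0"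
    and t: "\<tau> \<in> T"
  shows "c \<tau> = 0"
proof (rule ccontr)
  assume c\<tau>: "c \<tau> \<noteq> 0"
  let ?k = "\<lambda>\<mu>. standard_mult G U D S (P \<mu>)"
  let ?V = "\<lambda>\<mu>. {\<omega> \<in> \<Lambda>. ?k \<mu> \<omega> \<noteq> 0}"
  define W where "W = (\<Union>\<mu>\<in>T. ?V \<mu>)"
  define a where "a \<omega> = (\<Sum>\<mu>\<in>T. c \<mu> * of_nat (?k \<mu> \<omega>))" for \<omega>
  have fV: "finite (?V \<mu>)" if "\<mu> \<in> T" for \<mu>
  proof -
    have "\<mu> \<in> \<Lambda>" using that T(2) by blast
    from wdim_P[OF this] show ?thesis by (elim exE conjE) (simp only:)
  qed
  have W: "finite W" "W \<subseteq> \<Lambda>" unfolding W_def using T(1) fV by auto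
  have hW: "wdim \<nu> (P \<mu>) = (\<Sum>\<omega>\<in>W. ?k \<mu> \<omega> * wdim \<nu> (\<Delta> \<omega>))" if \<mu>: "\<mu> \<in> T" and \<nu>: "\<nu> \<in> \<Lambda>" for \<mu> \<nu>
  proof -
    have "\<mu> \<in> \<Lambda>" using \<mu> T(2) by blast
    then have "wdim \<nu> (P \<mu>) = (\<Sum>\<omega>\<in>?V \<mu>. ?k \<mu> \<omega> * wdim \<nu> (\<Delta> \<omega>))" using wdim_P \<nu> by blast
    also have "\<dots> = (\<Sum>\<omega>\<in>W. ?k \<mu> \<omega> * wdim \<nu> (\<Delta> \<omega>))"
      by (rule sum.mono_neutral_left) (use W \<mu> in \<open>auto simp: W_def\<close>)
    finally show ?thesis .
  qed
  have aW: "a \<omega> = 0" if "\<omega> \<in> W" for \<omega>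
  proof (rule standard_characters_independent[where a = a, OF W _ that])
    fix \<nu> assume \<nu>: "\<nu> \<in> \<Lambda>"
    have "(\<Sum>\<omega>\<in>W. a \<omega> * of_nat (wdim \<nu> (\<Delta> \<omega>))) = (\<Sum>\<mu>\<in>T. \<Sum>\<omega>\<in>W. c \<mu> * of_nat (?k \<mu> \<omega>) * of_nat (wdim \<nu> (\<Delta> \<omega>)))"
      unfolding a_def sum_distrib_right by (rule sum.swap)
    also have "\<dots> = (\<Sum>\<mu>\<in>T. c \<mu> * of_nat (wdim \<nu> (P \<mu>)))"
      by (rule sum.cong) (simp_all add: hW \<nu> sum_distrib_left mult.assoc)
    also have "\<dots> = 0" by (rule z[OF \<nu>])
    finally show "(\<Sum>\<omega>\<in>W. a \<omega> * of_nat (wdim \<nu> (\<Delta> \<omega>))) = 0" .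
  qed
  have "\<exists>\<mu>. (\<mu> \<in> T \<and> c \<mu> \<noteq> 0) \<and> (\<forall>\<nu>. \<nu> \<in> T \<and> c \<nu> \<noteq> 0 \<longrightarrow> lc (wsupp \<nu>) \<le> lc (wsupp \<mu>))"
  proof (rule Lattices_Big.ex_has_greatest_nat[where P = "\<lambda>\<mu>. \<mu> \<in> T \<and> c \<mu> \<noteq> 0" and f = "\<lambda>\<mu>. lc (wsupp \<mu>)"])
    show "\<tau> \<in> T \<and> c \<tau> \<noteq> 0" using t c\<tau> by blast
    \<comment> \<open>The sum of all ranks over the finite set \<open>T\<close> serves as a crude
      bound for the maximum.\<close>
    show "\<forall>\<nu>. \<nu> \<in> T \<and> c \<nu> \<noteq> 0 \<longrightarrow> lc (wsupp \<nu>) < Suc (\<Sum>\<mu>\<in>T. lc (wsupp \<mu>))"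
      using member_le_sum[OF _ _ T(1), of _ "\<lambda>\<mu>. lc (wsupp \<mu>)"] by (auto simp: less_Suc_eq_le)
  qed
  then obtain \<mu> where \<mu>: "\<mu> \<in> T" "c \<mu> \<noteq> 0" and mx: "\<And>\<nu>. \<nu> \<in> T \<Longrightarrow> c \<nu> \<noteq> 0 \<Longrightarrow> lc (wsupp \<nu>) \<le> lc (wsupp \<mu>)" by blast
  have \<mu>\<Lambda>: "\<mu> \<in> \<Lambda>" using \<mu> T by blast
  have z': "c \<nu> * of_nat (?k \<nu> \<mu>) = 0" if \<nu>: "\<nu> \<in> T - {\<mu>}" for \<nu>
  proof (rule ccontr)
    assume nz: "c \<nu> * of_nat (?k \<nu> \<mu>) \<noteq> 0"
    have \<nu>\<Lambda>: "\<nu> \<in> \<Lambda>" using \<nu> T by blast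
    have "weight_le r \<mu> \<nu>" using P_standard(3)[OF \<nu>\<Lambda> \<mu>\<Lambda>] nz by auto
    then have "lc (wsupp \<mu>) < lc (wsupp \<nu>)" using weight_less_lc[OF \<mu>\<Lambda> \<nu>\<Lambda>] \<nu> by blast
    then show False using mx[of \<nu>] \<nu> nz by auto
  qed
  have "a \<mu> = c \<mu> * of_nat (?k \<mu> \<mu>) + (\<Sum>\<nu>\<in>T - {\<mu>}. c \<nu> * of_nat (?k \<nu> \<mu>))"
    unfolding a_def by (rule sum.remove[OF T(1) \<mu>(1)])
  also have "(\<Sum>\<nu>\<in>T - {\<mu>}. c \<nu> * of_nat (?k \<nu> \<mu>)) = 0" by (intro sum.neutral ballI z')
  also have "c \<mu> * of_nat (?k \<mu> \<mu>) + 0 = c \<mu>" using P_standard(2)[OF \<mu>\<Lambda>] by simp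
  finally have "a \<mu> = c \<mu>" .
  moreover have "\<mu> \<in> W" unfolding W_def by (rule UN_I[OF \<mu>(1)]) (simp add: \<mu>\<Lambda> P_standard(2)[OF \<mu>\<Lambda>])
  ultimately show False using aW \<mu>(2) by simp
qed

lemma formal_character_P: "\<mu> \<in> \<Lambda> \<Longrightarrow> \<nu> \<in> \<Lambda> \<Longrightarrow> formal_character G U D S (P \<mu>) \<nu> = of_nat (wdim \<nu> (P \<mu>))"
  using weight_mult_wdim[OF _ G_to_K[OF P_cat] P_fin(1)] by (simp add: formal_character_def)

text \<open>Linear dependence is a property of sets, so independence of the family consists of
  injectivity together with independence of the image.\<close>

lemma P_characters:
  shows "inj_on (\<lambda>\<mu>. formal_character G U D S (P \<mu>)) \<Lambda>"
    and "\<not> module.dependent fscale ((\<lambda>\<mu>. formal_character G U D S (P \<mu>)) ` \<Lambda>)"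
proof -
  let ?f = "\<lambda>\<mu>. formal_character G U D S (P \<mu>)"
  interpret F: vector_space "fscale :: rat \<Rightarrow> (('o, 'm, 'k) weight \<Rightarrow> rat) \<Rightarrow> _" by (rule vector_space_fscale)
  show inj: "inj_on ?f \<Lambda>"
  proof (rule inj_onI, rule ccontr)
    fix \<mu> \<nu> assume \<mu>: "\<mu> \<in> \<Lambda>" and \<nu>: "\<nu> \<in> \<Lambda>" and e: "?f \<mu> = ?f \<nu>" and ne: "\<mu> \<noteq> \<nu>"
    \<comment> \<open>Equal characters amount to a relation with coefficients 1 and -1; the odd
      shape is the coefficient function evaluated at \<open>\<mu>\<close>.\<close>
    have "(if \<mu> = \<mu> then 1 else - 1 :: rat) = 0"
    proof (rule projective_characters_independent[where T = "{\<mu>, \<nu>}" and c = "\<lambda>\<tau>. if \<tau> = \<mu> then 1 else - 1"])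
      show "(\<Sum>\<tau>\<in>{\<mu>, \<nu>}. (if \<tau> = \<mu> then 1 else - 1) * of_nat (wdim \<omega> (P \<tau>))) = (0::rat)" if \<omega>: "\<omega> \<in> \<Lambda>" for \<omega>
        using ne fun_cong[OF e, of \<omega>] formal_character_P[OF \<mu> \<omega>] formal_character_P[OF \<nu> \<omega>] by auto
    qed (use \<mu> \<nu> in auto)
    then show False by simp
  qed
  show "\<not> F.dependent (?f ` \<Lambda>)"
  proof
    assume "F.dependent (?f ` \<Lambda>)"
    then obtain B u w where B: "finite B" "B \<subseteq> ?f ` \<Lambda>" and s: "(\<Sum>v\<in>B. fscale (u v) v) = 0" and w: "w \<in> B" "u w \<noteq> 0"
      unfolding F.dependent_explicit by blast
    obtain T where T: "T \<subseteq> \<Lambda>" "finite T" "B = ?f ` T" using finite_subset_image[OF B] by blast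
    obtain \<tau> where \<tau>: "\<tau> \<in> T" "w = ?f \<tau>" using w(1) T(3) by blast
    have "u (?f \<tau>) = 0"
    proof (rule projective_characters_independent[where T = T and c = "\<lambda>\<tau>. u (?f \<tau>)", OF T(2,1) _ \<tau>(1)])
      fix \<nu> assume \<nu>: "\<nu> \<in> \<Lambda>"
      have "(\<Sum>\<mu>\<in>T. u (?f \<mu>) * of_nat (wdim \<nu> (P \<mu>))) = (\<Sum>\<mu>\<in>T. fscale (u (?f \<mu>)) (?f \<mu>) \<nu>)"
        by (rule sum.cong) (use T(1) in \<open>auto simp: fscale_def formal_character_P \<nu>\<close>)
      also have "\<dots> = (\<Sum>\<mu>\<in>T. fscale (u (?f \<mu>)) (?f \<mu>)) \<nu>" by (rule sum_fun_eval[symmetric])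
      also have "(\<Sum>\<mu>\<in>T. fscale (u (?f \<mu>)) (?f \<mu>)) = (\<Sum>v\<in>B. fscale (u v) v)"
        unfolding T(3) by (rule sum.reindex_cong[OF inj_on_subset[OF inj T(1)] refl refl, symmetric])
      finally show "(\<Sum>\<mu>\<in>T. u (?f \<mu>) * of_nat (wdim \<nu> (P \<mu>))) = 0" using s by simp
    qed
    then show False using w(2) \<tau>(2) by simp
  qed
qed

end

lemma internal_sum_sym: "internal_sum C M A B \<Longrightarrow> internal_sum C M B A"
  for M :: "('o, 'm, 'k::field, 'v::ab_group_add) cmod"
proof -
  assume s: "internal_sum C M A B"
  have "{b + a | b a. b \<in> B x \<and> a \<in> A x} = {a + b | a b. a \<in> A x \<and> b \<in> B x}" for x
  proof (intro set_eqI iffI)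
    show "v \<in> {a + b | a b. a \<in> A x \<and> b \<in> B x}" if v: "v \<in> {b + a | b a. b \<in> B x \<and> a \<in> A x}" for v
    proof -
      obtain a b where "a \<in> A x" "b \<in> B x" "v = b + a" using v by blast
      then have "v = a + b" "a \<in> A x" "b \<in> B x" by (simp_all add: add.commute)
      then show ?thesis by blast
    qed
    show "v \<in> {b + a | b a. b \<in> B x \<and> a \<in> A x}" if v: "v \<in> {a + b | a b. a \<in> A x \<and> b \<in> B x}" for v
    proof -
      obtain a b where "a \<in> A x" "b \<in> B x" "v = a + b" using v by blast
      then have "v = b + a" "a \<in> A x" "b \<in> B x" by (simp_all add: add.commute)
      then show ?thesis by blast
    qed
  qed
  then show ?thesis using s by (simp add: internal_sum_def Int_commute)
qed

section \<open>Decomposition of the induced projective modules\<close>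

context tri_proj
begin

text \<open>By adjunction \<open>Hom(Pt \<kappa>, L \<mu>)\<close> is the Hom space over
  \<open>K\<close> from \<open>S \<kappa>\<close> to \<open>L \<mu>\<close>, of dimension
  \<open>wdim \<kappa> (L \<mu>)\<close>. The maps \<open>\<psi> i\<close> are lifts of a basis
  through the cover \<open>\<pi> \<mu>\<close>.\<close>

lemma Pt_hom_basis:
  assumes \<kappa>: "\<kappa> \<in> \<Lambda>" and \<mu>: "\<mu> \<in> \<Lambda>"
  shows "\<exists>\<psi> :: nat \<Rightarrow> _. (\<forall>i<wdim \<kappa> (L \<mu>). mod_hom G (Pt \<kappa>) (P \<mu>) (\<psi> i)) \<and>
    (\<forall>\<phi>. mod_hom G (Pt \<kappa>) (L \<mu>) \<phi> \<longrightarrow>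
      (\<exists>c. \<forall>x. \<forall>v\<in>mob (Pt \<kappa>) x. \<phi> x v = (\<Sum>i<wdim \<kappa> (L \<mu>). mscale (L \<mu>) (c i) (\<pi> \<mu> x (\<psi> i x v))))) \<and>
    (\<forall>c. (\<forall>x. \<forall>v\<in>mob (Pt \<kappa>) x. (\<Sum>i<wdim \<kappa> (L \<mu>). mscale (L \<mu>) (c i) (\<pi> \<mu> x (\<psi> i x v))) = 0) \<longrightarrow>
      (\<forall>i<wdim \<kappa> (L \<mu>). c i = 0))"
proof -
  note Lc = L_cat[OF \<mu>] and Sc = S_cat[OF \<kappa>]
  note LK = G_to_K[OF Lc]
  interpret L: cat_module G "L \<mu>" by (rule Lc)
  let ?n = "wdim \<kappa> (L \<mu>)"
  have "\<exists>b :: nat \<Rightarrow> _. (\<forall>i<?n. b i \<in> hom_space K (S \<kappa>) (L \<mu>)) \<and>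
      (\<forall>v\<in>hom_space K (S \<kappa>) (L \<mu>). \<exists>c. v = (\<Sum>i<?n. hscale (L \<mu>) (c i) (b i))) \<and>
      (\<forall>c. (\<Sum>i<?n. hscale (L \<mu>) (c i) (b i)) = 0 \<longrightarrow> (\<forall>i<?n. c i = 0))"
    unfolding wdim_def
    by (rule indexed_basis[OF vector_space_hscale[OF Lc] subspace_hom_space[OF Sc LK] hom_S_fin[OF \<kappa> LK L_fin[OF \<mu>]]])
  then obtain b :: "nat \<Rightarrow> _" where b: "\<forall>i<?n. b i \<in> hom_space K (S \<kappa>) (L \<mu>)"
    and sp: "\<forall>v\<in>hom_space K (S \<kappa>) (L \<mu>). \<exists>c. v = (\<Sum>i<?n. hscale (L \<mu>) (c i) (b i))"
    and ind: "\<forall>c. (\<Sum>i<?n. hscale (L \<mu>) (c i) (b i)) = 0 \<longrightarrow> (\<forall>i<?n. c i = 0)"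
    by (elim exE conjE)
  have ex: "\<exists>\<psi>. mod_hom G (Pt \<kappa>) (P \<mu>) \<psi> \<and> (\<forall>y. \<forall>s\<in>mob (S \<kappa>) y. \<pi> \<mu> y (\<psi> y (\<zeta> \<kappa> y s)) = b i y s)" if i: "i < ?n" for i
  proof -
    have bh: "mod_hom K (S \<kappa>) (L \<mu>) (b i)" by (rule hom_space_mod_hom) (use b i in blast)
    obtain e where e: "mod_hom G (Pt \<kappa>) (L \<mu>) e" "\<forall>y. \<forall>s\<in>mob (S \<kappa>) y. e y (\<zeta> \<kappa> y s) = b i y s"
      using Pt_ext[OF \<kappa> Lc bh] by blast
    obtain \<psi> where \<psi>: "mod_hom G (Pt \<kappa>) (P \<mu>) \<psi>" "\<forall>x. \<forall>v\<in>mob (Pt \<kappa>) x. \<pi> \<mu> x (\<psi> x v) = e x v"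
      using lift_propD[OF Pt_lift[OF \<kappa> P_cat[OF \<mu>] Lc] \<pi>_surj[OF \<mu>] e(1)] by blast
    have "\<pi> \<mu> y (\<psi> y (\<zeta> \<kappa> y s)) = b i y s" if s: "s \<in> mob (S \<kappa>) y" for y s
    proof -
      have "\<zeta> \<kappa> y s \<in> mob (Pt \<kappa>) y" by (rule mod_hom_closed[OF Sc G_to_K[OF Pt_cat] \<zeta>_hom s])
      then show ?thesis using \<psi>(2) e(2) s by metis
    qed
    then show ?thesis using \<psi>(1) by blast
  qed
  define \<psi> where "\<psi> i = (SOME \<psi>. mod_hom G (Pt \<kappa>) (P \<mu>) \<psi> \<and> (\<forall>y. \<forall>s\<in>mob (S \<kappa>) y. \<pi> \<mu> y (\<psi> y (\<zeta> \<kappa> y s)) = b i y s))" for i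
  have \<psi>: "mod_hom G (Pt \<kappa>) (P \<mu>) (\<psi> i)" "\<forall>y. \<forall>s\<in>mob (S \<kappa>) y. \<pi> \<mu> y (\<psi> i y (\<zeta> \<kappa> y s)) = b i y s" if i: "i < ?n" for i
    using someI_ex[OF ex[OF i], folded \<psi>_def] by (rule conjunct1, rule conjunct2)
  have lc_hom: "mod_hom G (Pt \<kappa>) (L \<mu>) (\<lambda>x v. \<Sum>i<?n. mscale (L \<mu>) (c i) (\<pi> \<mu> x (\<psi> i x v)))" for c
    by (rule mod_hom_setsum[OF Lc Pt_cat])
      (use mod_hom_smult[OF Lc Pt_cat mod_hom_comp[OF \<psi>(1) \<pi>_hom[OF \<mu>]]] in auto)
  have lc_eval: "(\<Sum>i<?n. mscale (L \<mu>) (c i) (\<pi> \<mu> y (\<psi> i y (\<zeta> \<kappa> y s)))) = (\<Sum>i<?n. hscale (L \<mu>) (c i) (b i)) y s"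
    if s: "s \<in> mob (S \<kappa>) y" for c y s
    unfolding sum_fun_eval by (rule sum.cong) (use \<psi>(2) s in auto)
  have span: "\<exists>c. \<forall>x. \<forall>v\<in>mob (Pt \<kappa>) x. \<phi> x v = (\<Sum>i<?n. mscale (L \<mu>) (c i) (\<pi> \<mu> x (\<psi> i x v)))"
    if \<phi>: "mod_hom G (Pt \<kappa>) (L \<mu>) \<phi>" for \<phi>
  proof -
    have "mod_hom K (S \<kappa>) (L \<mu>) (\<lambda>y s. \<phi> y (\<zeta> \<kappa> y s))" by (rule mod_hom_comp[OF \<zeta>_hom hom_G_to_K[OF \<phi>]])
    then have "hom_norm (S \<kappa>) (\<lambda>y s. \<phi> y (\<zeta> \<kappa> y s)) \<in> hom_space K (S \<kappa>) (L \<mu>)" by (rule hom_norm_hom_space[OF Sc])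
    then obtain c where c: "hom_norm (S \<kappa>) (\<lambda>y s. \<phi> y (\<zeta> \<kappa> y s)) = (\<Sum>i<?n. hscale (L \<mu>) (c i) (b i))" using sp by blast
    have "\<phi> x v = (\<Sum>i<?n. mscale (L \<mu>) (c i) (\<pi> \<mu> x (\<psi> i x v)))" if v: "v \<in> mob (Pt \<kappa>) x" for x v
    proof (rule Pt_hom_eq[OF Lc \<phi> lc_hom _ v])
      fix y s assume s: "s \<in> mob (S \<kappa>) y"
      have "\<phi> y (\<zeta> \<kappa> y s) = hom_norm (S \<kappa>) (\<lambda>y s. \<phi> y (\<zeta> \<kappa> y s)) y s" using s by (simp add: hom_norm_def)
      also have "\<dots> = (\<Sum>i<?n. hscale (L \<mu>) (c i) (b i)) y s" by (simp only: c)
      also have "\<dots> = (\<Sum>i<?n. mscale (L \<mu>) (c i) (\<pi> \<mu> y (\<psi> i y (\<zeta> \<kappa> y s))))" by (rule lc_eval[OF s, symmetric])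
      finally show "\<phi> y (\<zeta> \<kappa> y s) = (\<Sum>i<?n. mscale (L \<mu>) (c i) (\<pi> \<mu> y (\<psi> i y (\<zeta> \<kappa> y s))))" .
    qed
    then show ?thesis by blast
  qed
  have indep: "\<forall>i<?n. c i = 0"
    if z: "\<forall>x. \<forall>v\<in>mob (Pt \<kappa>) x. (\<Sum>i<?n. mscale (L \<mu>) (c i) (\<pi> \<mu> x (\<psi> i x v))) = 0" for c
  proof -
    have "(\<Sum>i<?n. hscale (L \<mu>) (c i) (b i)) y s = 0" for y s
    proof (cases "s \<in> mob (S \<kappa>) y")
      case True
      have m: "\<zeta> \<kappa> y s \<in> mob (Pt \<kappa>) y" by (rule mod_hom_closed[OF Sc G_to_K[OF Pt_cat] \<zeta>_hom True])
      show ?thesis by (rule trans[OF lc_eval[OF True, symmetric] z[rule_format, OF m]])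
    next
      case False
      have "b i y s = 0" if "i < ?n" for i using b that False by (simp add: hom_space_def)
      then show ?thesis unfolding sum_fun_eval by (intro sum.neutral ballI) simp
    qed
    then have "(\<Sum>i<?n. hscale (L \<mu>) (c i) (b i)) = 0" by (intro ext) (simp only: zero_fun_def)
    then show ?thesis by (rule ind[THEN spec, THEN mp])
  qed
  show ?thesis using \<psi>(1) span indep by (intro exI[of _ \<psi>] conjI allI impI) auto
qed

lemma weight_mult_L: "\<mu> \<in> \<Lambda> \<Longrightarrow> \<kappa> \<in> \<Lambda> \<Longrightarrow> weight_mult G U D S \<kappa> (L \<mu>) = enat (wdim \<kappa> (L \<mu>))"
  by (rule weight_mult_wdim[OF _ G_to_K[OF L_cat] L_fin])

lemma finite_lower_weights: assumes \<kappa>: "\<kappa> \<in> \<Lambda>" shows "finite {\<mu> \<in> \<Lambda>. weight_le r \<mu> \<kappa>}"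
proof -
  obtain Y where Y: "finite Y" "\<forall>\<mu>\<in>\<Lambda>. weight_le r \<mu> \<kappa> \<longrightarrow> (\<exists>y\<in>Y. y \<in> wsupp \<mu>)" using lower_reps[OF \<kappa>] by blast
  have "finite (\<Union>y\<in>Y. {\<mu> \<in> \<Lambda>. y \<in> wsupp \<mu>})" using Y(1) finite_weights_at by blast
  then show ?thesis by (rule finite_subset[rotated]) (use Y(2) in blast)
qed

lemma Pt_decomposition:
  assumes \<kappa>: "\<kappa> \<in> \<Lambda>"
  shows "isomorphic G (Pt \<kappa>)
    (dir_sum {(\<mu>, i :: nat). \<mu> \<in> \<Lambda> \<and> weight_le r \<mu> \<kappa> \<and> enat i < weight_mult G U D S \<kappa> (L \<mu>)} (\<lambda>(\<mu>, i). P \<mu>))"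
proof -
  define I where "I = {p. fst p \<in> \<Lambda> \<and> weight_le r (fst p) \<kappa> \<and> snd p < wdim \<kappa> (L (fst p))}"
  let ?N = "\<lambda>p :: (('o, 'm, 'k) weight \<times> nat). P (fst p)"
  have Ieq: "{(\<mu>, i :: nat). \<mu> \<in> \<Lambda> \<and> weight_le r \<mu> \<kappa> \<and> enat i < weight_mult G U D S \<kappa> (L \<mu>)} = I"
    using weight_mult_L[OF _ \<kappa>] by (auto simp: I_def)
  have Neq: "(\<lambda>(\<mu>, i). P \<mu>) = ?N" by auto
  have "I \<subseteq> Sigma {\<mu> \<in> \<Lambda>. weight_le r \<mu> \<kappa>} (\<lambda>\<mu>. {..<wdim \<kappa> (L \<mu>)})" by (auto simp: I_def)
  then have fin: "finite I" by (rule finite_subset) (intro finite_SigmaI finite_lower_weights[OF \<kappa>] finite_lessThan)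
  have NI: "cat_module G (?N p)" if "p \<in> I" for p using that P_cat by (simp add: I_def)
  note ex = ex_vs[OF \<kappa>]
  let ?R = "dir_sum I ?N"
  have R: "cat_module G ?R" by (rule cat_module_dir_sum[OF ex NI])
  have inj: "mod_hom G (?N p) ?R (\<lambda>x. sgl p)" if "p \<in> I" for p
    by (rule dir_sum_inj[where N = ?N, OF ex NI]) (use that in auto)
  have Rfg: "fin_gen G ?R"
    by (rule fin_gen_dir_sum[where N = ?N, OF ex NI fin]) (use P_fin(2) in \<open>auto simp: I_def\<close>)
  let ?B = "\<lambda>\<mu> \<psi>. (\<forall>i<wdim \<kappa> (L \<mu>). mod_hom G (Pt \<kappa>) (P \<mu>) (\<psi> i)) \<and>
    (\<forall>\<phi>. mod_hom G (Pt \<kappa>) (L \<mu>) \<phi> \<longrightarrow>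
      (\<exists>c. \<forall>x. \<forall>v\<in>mob (Pt \<kappa>) x. \<phi> x v = (\<Sum>i<wdim \<kappa> (L \<mu>). mscale (L \<mu>) (c i) (\<pi> \<mu> x (\<psi> i x v))))) \<and>
    (\<forall>c. (\<forall>x. \<forall>v\<in>mob (Pt \<kappa>) x. (\<Sum>i<wdim \<kappa> (L \<mu>). mscale (L \<mu>) (c i) (\<pi> \<mu> x (\<psi> i x v))) = 0) \<longrightarrow>
      (\<forall>i<wdim \<kappa> (L \<mu>). c i = 0))"
  define \<psi> where "\<psi> \<mu> = (SOME \<psi>. ?B \<mu> \<psi>)" for \<mu>
  have B: "?B \<mu> (\<psi> \<mu>)" if \<mu>: "\<mu> \<in> \<Lambda>" for \<mu>
    unfolding \<psi>_def by (rule someI_ex[where P = "?B \<mu>"]) (rule Pt_hom_basis[OF \<kappa> \<mu>])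
  note B1 = B[THEN conjunct1, rule_format] and B2 = B[THEN conjunct2, THEN conjunct1, THEN spec, THEN mp]
    and B3 = B[THEN conjunct2, THEN conjunct2, THEN spec, THEN mp]
  have \<psi>I: "mod_hom G (Pt \<kappa>) (?N p) (\<psi> (fst p) (snd p))" if "p \<in> I" for p
    by (rule B1) (use that in \<open>auto simp: I_def\<close>)
  define \<Psi> where "\<Psi> x v = (\<lambda>p. if p \<in> I then \<psi> (fst p) (snd p) x v else 0)" for x v
  have \<Psi>: "mod_hom G (Pt \<kappa>) ?R \<Psi>"
    unfolding \<Psi>_def by (rule dir_sum_in[where N = ?N and \<psi> = "\<lambda>p. \<psi> (fst p) (snd p)", OF ex NI fin Pt_cat \<psi>I])
  have le: "weight_le r \<mu> \<kappa>" if "\<mu> \<in> \<Lambda>" "i < wdim \<kappa> (L \<mu>)" for \<mu> i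
    by (rule wdim_L_le[OF that(1) \<kappa>]) (use that in simp)
  have memI: "(\<mu>, i) \<in> I" if "\<mu> \<in> \<Lambda>" "i < wdim \<kappa> (L \<mu>)" for \<mu> i using le[OF that] that by (simp add: I_def)
  \<comment> \<open>Only the summands indexed by the given \<open>\<mu>\<close> contribute, and on
    each of them a map to \<open>L \<mu>\<close> is a multiple of
    \<open>\<pi> \<mu>\<close>.\<close>
  have homR: "\<exists>d. \<forall>x. \<forall>h\<in>mob ?R x. \<chi> x h = (\<Sum>i<wdim \<kappa> (L \<mu>). mscale (L \<mu>) (d i) (\<pi> \<mu> x (h (\<mu>, i))))"
    if \<mu>: "\<mu> \<in> \<Lambda>" and \<chi>: "mod_hom G ?R (L \<mu>) \<chi>" for \<mu> \<chi>
  proof -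
    have \<chi>p: "mod_hom G (?N p) (L \<mu>) (\<lambda>x v. \<chi> x (sgl p v))" if "p \<in> I" for p
      by (rule mod_hom_comp[OF inj[OF that] \<chi>])
    have "\<exists>c. \<forall>x. \<forall>v\<in>mob (P \<mu>) x. \<chi> x (sgl (\<mu>, i) v) = mscale (L \<mu>) c (\<pi> \<mu> x v)" if "i < wdim \<kappa> (L \<mu>)" for i
      using hom_P_L_scalar[OF \<mu> \<chi>p[OF memI[OF \<mu> that], unfolded fst_conv]] .
    then obtain d where d: "\<And>i x v. i < wdim \<kappa> (L \<mu>) \<Longrightarrow> v \<in> mob (P \<mu>) x \<Longrightarrow> \<chi> x (sgl (\<mu>, i) v) = mscale (L \<mu>) (d i) (\<pi> \<mu> x v)"
      by metis
    have "\<chi> x h = (\<Sum>i<wdim \<kappa> (L \<mu>). mscale (L \<mu>) (d i) (\<pi> \<mu> x (h (\<mu>, i))))" if h: "h \<in> mob ?R x" for x h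
    proof -
      have hp: "h p \<in> mob (?N p) x" if "p \<in> I" for p using h that by (simp add: dir_sum_sel)
      have sp: "sgl p (h p) \<in> mob ?R x" if "p \<in> I" for p by (rule mod_hom_closed[OF NI[OF that] R inj[OF that] hp[OF that]])
      have "h = (\<Sum>p | h p \<noteq> 0. sgl p (h p))" by (rule dir_sum_decompose[where N = ?N, OF ex NI h])
      also have "\<dots> = (\<Sum>p\<in>I. sgl p (h p))"
        by (rule sum.mono_neutral_left) (use fin h in \<open>auto simp: dir_sum_sel sgl_def fun_eq_iff\<close>)
      finally have "\<chi> x h = \<chi> x (\<Sum>p\<in>I. sgl p (h p))" by simp
      also have "\<dots> = (\<Sum>p\<in>I. \<chi> x (sgl p (h p)))" by (rule mod_hom_sum[OF R L_cat[OF \<mu>] \<chi> sp])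
      also have "\<dots> = (\<Sum>p\<in>Pair \<mu> ` {..<wdim \<kappa> (L \<mu>)}. \<chi> x (sgl p (h p)))"
      proof (rule sum.mono_neutral_right[OF fin])
        show "Pair \<mu> ` {..<wdim \<kappa> (L \<mu>)} \<subseteq> I" using memI[OF \<mu>] by auto
        show "\<forall>p\<in>I - Pair \<mu> ` {..<wdim \<kappa> (L \<mu>)}. \<chi> x (sgl p (h p)) = 0"
        proof
          fix p assume p: "p \<in> I - Pair \<mu> ` {..<wdim \<kappa> (L \<mu>)}"
          then have pI: "p \<in> I" and pL: "fst p \<in> \<Lambda>" by (auto simp: I_def)
          have "fst p \<noteq> \<mu>"
          proof
            assume "fst p = \<mu>"
            then have "p = (\<mu>, snd p)" "snd p < wdim \<kappa> (L \<mu>)" using pI by (auto simp: I_def)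
            then show False using p by blast
          qed
          from hom_P_L_zero[OF pL \<mu> \<chi>p[OF pI] this hp[OF pI]] show "\<chi> x (sgl p (h p)) = 0" .
        qed
      qed
      also have "\<dots> = (\<Sum>i<wdim \<kappa> (L \<mu>). \<chi> x (sgl (\<mu>, i) (h (\<mu>, i))))"
        by (rule sum.reindex_cong[OF _ refl refl]) (simp add: inj_on_def)
      also have "\<dots> = (\<Sum>i<wdim \<kappa> (L \<mu>). mscale (L \<mu>) (d i) (\<pi> \<mu> x (h (\<mu>, i))))"
        by (rule sum.cong) (use d hp[OF memI[OF \<mu>]] in auto)
      finally show ?thesis .
    qed
    then show ?thesis by blast
  qed
  \<comment> \<open>A map \<open>\<chi>\<close> onto some \<open>L \<mu>\<close> that kills the
    image gives a relation between the maps \<open>\<pi> \<mu> \<circ> \<psi> \<mu> i\<close>. These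
    are independent, so the coefficients vanish, and with them \<open>\<chi>\<close>.\<close>
  have surj: "(\<lambda>x. \<Psi> x ` mob (Pt \<kappa>) x) = mob ?R"
  proof (rule ccontr)
    assume ne: "(\<lambda>x. \<Psi> x ` mob (Pt \<kappa>) x) \<noteq> mob ?R"
    obtain \<mu> \<chi> where \<mu>: "\<mu> \<in> \<Lambda>" and \<chi>: "surj_hom G ?R (L \<mu>) \<chi>" and z: "\<forall>x. \<forall>h\<in>\<Psi> x ` mob (Pt \<kappa>) x. \<chi> x h = 0"
      using hom_to_L[OF R Rfg submod_image[OF Pt_cat R \<Psi> submod_mob[OF Pt_cat]] ne] by blast
    obtain d where d: "\<forall>x. \<forall>h\<in>mob ?R x. \<chi> x h = (\<Sum>i<wdim \<kappa> (L \<mu>). mscale (L \<mu>) (d i) (\<pi> \<mu> x (h (\<mu>, i))))"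
      using homR[OF \<mu> surj_hom_def[THEN iffD1, OF \<chi>, THEN conjunct1]] by blast
    have "(\<Sum>i<wdim \<kappa> (L \<mu>). mscale (L \<mu>) (d i) (\<pi> \<mu> x (\<psi> \<mu> i x v))) = 0" if v: "v \<in> mob (Pt \<kappa>) x" for x v
    proof -
      have "(\<Sum>i<wdim \<kappa> (L \<mu>). mscale (L \<mu>) (d i) (\<pi> \<mu> x (\<psi> \<mu> i x v))) =
          (\<Sum>i<wdim \<kappa> (L \<mu>). mscale (L \<mu>) (d i) (\<pi> \<mu> x (\<Psi> x v (\<mu>, i))))"
        by (rule sum.cong) (use memI[OF \<mu>] in \<open>auto simp: \<Psi>_def\<close>)
      also have "\<dots> = \<chi> x (\<Psi> x v)" using d mod_hom_closed[OF Pt_cat R \<Psi> v] by simp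
      also have "\<dots> = 0" using z v by blast
      finally show ?thesis .
    qed
    then have d0: "\<forall>i<wdim \<kappa> (L \<mu>). d i = 0" by (intro B3[OF \<mu>]) blast
    interpret L: cat_module G "L \<mu>" by (rule L_cat[OF \<mu>])
    obtain x h where h: "h \<in> mob ?R x" "\<chi> x h \<noteq> 0" using surj_nonzero[OF L_simple[OF \<mu>] \<chi>] by blast
    have "\<chi> x h = (\<Sum>i<wdim \<kappa> (L \<mu>). mscale (L \<mu>) (d i) (\<pi> \<mu> x (h (\<mu>, i))))" using d h(1) by blast
    also have "\<dots> = 0" by (intro sum.neutral ballI) (simp add: d0)
    finally show False using h(2) by simp
  qed
  then have im: "\<Psi> x ` mob (Pt \<kappa>) x = mob ?R x" for x by (rule fun_cong)
  then have \<Psi>s: "surj_hom G (Pt \<kappa>) ?R \<Psi>" using \<Psi> by (simp only: surj_hom_def simp_thms)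
  have "lift_prop G ?R (Pt \<kappa>) ?R"
    by (rule lift_prop_dir_sum[where N = ?N, OF ex NI Pt_cat R]) (use P_lift[OF _ Pt_cat R] in \<open>auto simp: I_def\<close>)
  from lift_propD[OF this \<Psi>s mod_hom_id[OF R]]
  obtain \<sigma> where \<sigma>: "mod_hom G ?R (Pt \<kappa>) \<sigma>" "\<forall>x. \<forall>h\<in>mob ?R x. \<Psi> x (\<sigma> x h) = h" by blast
  \<comment> \<open>By the splitting the kernel is a direct summand. It is thus a quotient of
    \<open>Pt \<kappa>\<close>, hence finitely generated, and maps out of it extend to
    \<open>Pt \<kappa>\<close> through \<open>q\<close>.\<close>
  let ?K = "\<lambda>x. {v \<in> mob (Pt \<kappa>) x. \<Psi> x v = 0}"
  have s: "internal_sum G (Pt \<kappa>) ?K (\<lambda>x. \<sigma> x ` mob ?R x)"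
    by (rule internal_sum_sym, rule split_internal_sum[OF Pt_cat R \<Psi> \<sigma>(1)]) (use \<sigma>(2) in blast)
  obtain q where q: "mod_hom G (Pt \<kappa>) (restr_mod (Pt \<kappa>) ?K) q" "\<forall>x. \<forall>v\<in>?K x. q x v = v"
    using internal_sum_projection[OF Pt_cat s] by blast
  have Ks: "submod G (Pt \<kappa>) ?K" by (rule submod_kernel[OF Pt_cat R \<Psi>])
  note Kc = cat_module_restr[OF Pt_cat Ks]
  have "q x ` mob (Pt \<kappa>) x = ?K x" for x
  proof
    show "q x ` mob (Pt \<kappa>) x \<subseteq> ?K x" using mod_hom_closed[OF Pt_cat Kc q(1)] by auto
    show "?K x \<subseteq> q x ` mob (Pt \<kappa>) x"
    proof
      fix v assume v: "v \<in> ?K x"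
      then have "q x v = v" "v \<in> mob (Pt \<kappa>) x" using q(2) by blast+
      then show "v \<in> q x ` mob (Pt \<kappa>) x" by (metis imageI)
    qed
  qed
  then have qs: "surj_hom G (Pt \<kappa>) (restr_mod (Pt \<kappa>) ?K) q" using q(1) by (simp add: surj_hom_def)
  have Kfg: "fin_gen G (restr_mod (Pt \<kappa>) ?K)" by (rule fin_gen_quotient[OF Pt_cat Kc Pt_fin(2)[OF \<kappa>] qs])
  \<comment> \<open>A map from the kernel onto \<open>L \<mu>\<close>, once extended, is a
    combination of the maps \<open>\<pi> \<mu> \<circ> \<psi> \<mu> i\<close>, all of which vanish
    where \<open>\<Psi>\<close> does.\<close>
  have "zero_sub = mob (restr_mod (Pt \<kappa>) ?K)"
  proof (rule ccontr)
    assume ne: "zero_sub \<noteq> mob (restr_mod (Pt \<kappa>) ?K)"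
    obtain \<mu> \<chi> where \<mu>: "\<mu> \<in> \<Lambda>" and \<chi>: "surj_hom G (restr_mod (Pt \<kappa>) ?K) (L \<mu>) \<chi>"
      using hom_to_L[OF Kc Kfg submod_zero[OF Kc] ne] by blast
    have "mod_hom G (Pt \<kappa>) (L \<mu>) (\<lambda>x v. \<chi> x (q x v))"
      by (rule mod_hom_comp[OF q(1) surj_hom_def[THEN iffD1, OF \<chi>, THEN conjunct1]])
    from B2[OF \<mu> this] obtain c where
      c: "\<forall>x. \<forall>v\<in>mob (Pt \<kappa>) x. \<chi> x (q x v) = (\<Sum>i<wdim \<kappa> (L \<mu>). mscale (L \<mu>) (c i) (\<pi> \<mu> x (\<psi> \<mu> i x v)))" by blast
    obtain x v where v: "v \<in> mob (restr_mod (Pt \<kappa>) ?K) x" "\<chi> x v \<noteq> 0" using surj_nonzero[OF L_simple[OF \<mu>] \<chi>] by blast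
    then have vK: "v \<in> ?K x" by simp
    then have vP: "v \<in> mob (Pt \<kappa>) x" "\<Psi> x v = 0" and qv: "q x v = v" using q(2) by blast+
    interpret L: cat_module G "L \<mu>" by (rule L_cat[OF \<mu>])
    have "\<psi> \<mu> i x v = 0" if "i < wdim \<kappa> (L \<mu>)" for i
      using fun_cong[OF vP(2), of "(\<mu>, i)"] memI[OF \<mu> that] by (simp add: \<Psi>_def)
    then have s0: "(\<Sum>i<wdim \<kappa> (L \<mu>). mscale (L \<mu>) (c i) (\<pi> \<mu> x (\<psi> \<mu> i x v))) = 0"
      by (intro sum.neutral ballI) (simp add: mod_hom_0[OF P_cat[OF \<mu>] L_cat[OF \<mu>] \<pi>_hom[OF \<mu>]])
    have "\<chi> x (q x v) = 0" unfolding c[rule_format, OF vP(1)] by (rule s0)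
    then have "\<chi> x v = 0" by (simp only: qv)
    then show False using v(2) by blast
  qed
  then have "zero_sub = ?K" by (simp only: restr_mod_sel)
  then have "zero_sub x = ?K x" for x by (rule fun_cong)
  then have "v = 0" if "v \<in> mob (Pt \<kappa>) x" "\<Psi> x v = 0" for x v using that by (auto simp: zero_sub_def)
  then have "inj_on (\<Psi> x) (mob (Pt \<kappa>) x)" for x using mod_hom_inj_iff[OF Pt_cat R \<Psi>] by blast
  then have "isomorphic G (Pt \<kappa>) ?R"
    unfolding isomorphic_def using \<Psi> im by (intro exI[of _ \<Psi>] conjI allI bij_betw_imageI) auto
  then show ?thesis unfolding Ieq Neq .
qed

end

theorem proposition4p28:
  fixes G :: "('o, 'm::ab_group_add, 'k::alg_closed_field) lincat"
    and U D :: "'o \<Rightarrow> 'o \<Rightarrow> 'm set"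
    and r :: "('o set \<times> 'o set) set"
    and S :: "('o, 'm, 'k) weight \<Rightarrow> ('o, 'm, 'k, 'm) cmod"
    and L :: "('o, 'm, 'k) weight \<Rightarrow> ('o, 'm, 'k, 'l::ab_group_add) cmod"
    and P :: "('o, 'm, 'k) weight \<Rightarrow> ('o, 'm, 'k, 'p::ab_group_add) cmod"
    and \<kappa> :: "('o, 'm, 'k) weight"
  assumes "triangular_category G U D"
    and "admissible_order G U D r"
    and "\<And>\<mu>. \<mu> \<in> weights G U D \<Longrightarrow> S \<mu> \<in> \<mu>"
    and "\<And>\<mu>. \<mu> \<in> weights G U D \<Longrightarrow> is_simple_of_weight G U D S \<mu> (L \<mu>)"
    and "\<And>\<mu>. \<mu> \<in> weights G U D \<Longrightarrow> is_projective_of_weight G U D S \<mu> (P \<mu>)"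
    and "\<kappa> \<in> weights G U D"
  shows
    \<comment> \<open>(a)\<close>
    "(semistandard G U D S (P \<kappa>) \<and>
      standard_mult G U D S (P \<kappa>) \<kappa> = 1 \<and>
      (\<forall>\<mu>\<in>weights G U D. standard_mult G U D S (P \<kappa>) \<mu> \<noteq> 0 \<longrightarrow> weight_le r \<mu> \<kappa>))
    \<and> \<comment> \<open>(b)\<close>
     (projective_cover G (P \<kappa>) (standard G D (S \<kappa>)) \<and>
      projective_cover G (P \<kappa>) (L \<kappa>))
    \<and> \<comment> \<open>(c)\<close>
     (\<forall>M :: ('o, 'm, 'k, 'v::ab_group_add) cmod. cat_module G M \<longrightarrow>
        hom_dim G (P \<kappa>) M = multiplicity_mod G M (L \<kappa>))
    \<and> \<comment> \<open>(d)\<close>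
     ((\<forall>\<mu>\<in>weights G U D. pointwise_finite (P \<mu>)) \<and>
      inj_on (\<lambda>\<mu>. formal_character G U D S (P \<mu>)) (weights G U D) \<and>
      \<not> module.dependent fscale ((\<lambda>\<mu>. formal_character G U D S (P \<mu>)) ` weights G U D))
    \<and> \<comment> \<open>(e)\<close>
     (isomorphic G (big_projective G U D (S \<kappa>))
        (dir_sum {(\<mu>, i :: nat). \<mu> \<in> weights G U D \<and> weight_le r \<mu> \<kappa> \<and>
                    enat i < weight_mult G U D S \<kappa> (L \<mu>)}
           (\<lambda>(\<mu>, i). P \<mu>)) \<and>
      weight_mult G U D S \<kappa> (L \<kappa>) = 1)
    \<and> \<comment> \<open>(f)\<close>
     (\<forall>M :: ('o, 'm, 'k, 'v) cmod. cat_module G M \<longrightarrow>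
        (\<exists>(I :: ('o \<times> 'v \<times> nat) set) \<mu>. \<mu> ` I \<subseteq> weights G U D \<and>
           is_quotient_of G (dir_sum I (\<lambda>i. P (\<mu> i))) M) \<and>
        (fin_gen G M \<longrightarrow>
           (\<exists>(n :: nat) \<mu>. \<mu> ` {..<n} \<subseteq> weights G U D \<and>
              is_quotient_of G (dir_sum {..<n} (\<lambda>i. P (\<mu> i))) M)))
    \<and> \<comment> \<open>(g)\<close>
     (\<forall>M :: ('o, 'm, 'k, 'v) cmod.
        fin_gen G M \<and> indecomposable G M \<and> projective G M \<longrightarrow>
        (\<exists>\<mu>\<in>weights G U D. isomorphic G M (P \<mu>)))"
proof -
  interpret tri_proj G U D r S L P
    by (intro tri_proj.intro tri.intro tri_axioms.intro tri_proj_axioms.intro assms(1-5))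
  note \<kappa> = assms(6)
  show ?thesis
  proof (intro conjI ballI allI impI)
    show "weight_mult G U D S \<kappa> (L \<kappa>) = 1"
      by (simp add: weight_mult_L[OF \<kappa> \<kappa>] wdim_L_self[OF \<kappa>] one_enat_def)
    show "\<exists>\<mu>\<in>weights G U D. isomorphic G M (P \<mu>)"
      if "fin_gen G M \<and> indecomposable G M \<and> projective G M" for M :: "('o, 'm, 'k, 'v) cmod"
      using indecomposable_projective_P that by blast
  qed (use P_standard[OF \<kappa>] P_projective_cover[OF \<kappa>, unfolded \<Delta>_def] P_hom_dim[OF \<kappa>] P_fin(1) P_characters
      Pt_decomposition[OF \<kappa>, unfolded Pt_def] quotient_of_P[OF \<kappa>] in blast)+
qed

end
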